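(* Let $\mathbb K$ be a commutative unital ring with an exhaustive, complete, decreasing filtration, and let $\mathcal A,\mathcal B$ be (c-unital) curved filtered $\mathbb K$-linear $A_\infty$ categories. If $G:\mathcal A\to\mathcal B$ is a curved filtered quasi-equivalence, then $G^{\mathsf{bc}}$ defines an uncurved $A_\infty$ functor $\mathcal A^{\mathsf{bc}}\to\mathcal B^{\mathsf{bc}}$ (in particular, the image of a c-unital bounding cochain under $G^{\mathsf{bc}}$ is c-unital). Furthermore, this functor is a quasi-equivalence.
   Context: Filtrations $F_{\ge\bullet}$ are indexed by $\mathbb Z$, decreasing, exhaustive and complete. A *curved filtered $\mathbb K$-linear $A_\infty$ category* has $\mathbb Z/2$-graded filtered $\mathbb K$-modules $hom(A,B)$ with $F_{\ge\lambda_1}\mathbb K\cdot F_{\ge\lambda_2}hom\subset F_{\ge\lambda_1+\lambda_2}hom$, and $\mathbb K$-linear operations $\mu^k:hom(A_0,A_1)\otimes\cdots\otimes hom(A_{k-1},A_k)\to hom(A_0,A_k)$, $k\ge0$, of degree $2-k$, with $\mu^k(F_{\ge\lambda_1},\dots,F_{\ge\lambda_k})\subset F_{\ge\lambda_1+\dots+\lambda_k}$ and $\mu^0\in F_{\ge1}$, satisfying the curved $A_\infty$ equations. A curved filtered $A_\infty$ algebra is the one-object case. The associated graded $\mathrm{Gr}_*\mathcal A$ is an uncurved $\mathbb Z/2\oplus\mathbb Z$-graded $\mathrm{Gr}_*\mathbb K$-linear $A_\infty$ category ($\mu^k$ of degree $(2-k,0)$). $\mathcal A$ is *c-unital* if $\mathrm{Gr}_*\mathcal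 A$ is cohomologically unital (c-unital); all curved filtered $A_\infty$ categories are assumed c-unital. A *Maurer–Cartan element* (bounding cochain) of a curved filtered $A_\infty$ algebra $A$ is $a\in F_{\ge1}A$ of degree $1$ with $\sum_{k\ge0}\mu^k(a,\dots,a)=0$. It deforms $A$ to an uncurved $A_\infty$ algebra $A^a=(A,\mu_a^* )$, with $\mu_a^k(c_1,\dots,c_k)=\sum_{i_0,\dots,i_k\ge0}\mu(a^{\otimes i_0},c_1,a^{\otimes i_1},\dots,c_k,a^{\otimes i_k})$. It is *c-unital* if $A^a$ is c-unital and there is a cocycle $e^a\in F_{\ge0}A^a$ representing the c-unit whose class in $\mathrm{Gr}_0A$ represents the c-unit of $\mathrm{Gr}_*A$. $\mathcal A^{\mathsf{bc}}$ is the uncurved $A_\infty$ category whose objects are pairs $(A,a)$ with $A\in\mathrm{ob}\,\mathcal A$ and $a\in hom^1(A,A)$ a c-unital Maurer–Cartan element, with $hom((A,a),(B,b))=hom_{\mathcal A}(A,B)$ and, for morphisms $c_j$ from $(A_{j-1},a_{j-1})$ to $(A_j,a_j)$, $\mu^k(c_1,\dots,c_k)=\sum\mu_{\mathcal A}(a_0^{\otimes i_0},c_1,a_1^{\otimes i_1},\dots,c_k,a_k^{\otimes i_k})$. A *curved filtered $A_\infty$ functor* $G$ is a curved $A_\infty$ functor respecting the filtrations, with curvature $G^0\in F_{\ge1}$, such that the uncurved functor $\mathrm{Gr}_*G$ is c-unital. It is a *curved filtered quasi-equivalence* if $\mathrm{Gr}_*G$ is a quasi-equivalence of $\mathbb Z/2\oplus\mathbb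 Z$-graded $A_\infty$ categories, i.e. induces an equivalence of $\mathbb Z/2\oplus\mathbb Z$-graded cohomological categories (isomorphisms between objects being of degree $(0,0)$). An uncurved $\mathbb{Z}/2$-graded $A_\infty$ functor is a *quasi-equivalence* if it induces an equivalence of cohomological categories. $G^{\mathsf{bc}}$ is the (a priori not necessarily c-unital) $A_\infty$ functor given on objects by $(A,a)\mapsto(GA,\sum_{k\ge0}G^k(a,\dots,a))$ and on morphisms by $(G^{\mathsf{bc}})^k(c_1,\dots,c_k)=\sum G(a_0^{\otimes i_0},c_1,\dots,c_k,a_k^{\otimes i_k})$, with target the not-necessarily-c-unital category of all bounding cochains on $\mathcal B$. *)

theory Defs
  imports Complex_Main "HOL-Algebra.Coset" "HOL-Library.Z2" "HOL-Library.Product_Plus"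
begin

section \<open>Gradings\<close>

text \<open>
  An abelian group of degrees with a parity and a distinguished degree of the differential.
  The two instances used are \<open>bit\<close> (that is, \<open>\<int>/2\<close>) and \<open>bit \<times> int\<close> (that is, \<open>\<int>/2 \<oplus> \<int>\<close>, where
  the integer is the level of an associated graded piece and the differential has degree \<open>(1,0)\<close>).
\<close>

class grading = ab_group_add +
  fixes deg1 :: 'a
    and parity :: "'a \<Rightarrow> bit"
  assumes parity_add: "parity (a + b) = parity a + parity b"
    and parity_deg1: "parity deg1 = 1"

instantiation bit :: grading
begin
definition "deg1 = (1::bit)"
definition "parity = (\<lambda>d::bit. d)"
instance by standard (simp_all add: deg1_bit_def parity_bit_def)
end

instantiation prod :: (grading, ab_group_add) grading
begin
definition "deg1 = (deg1, 0)"
definition "parity = (\<lambda>d. parity (fst d))"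
instance by standard (simp_all add: deg1_prod_def parity_prod_def parity_add parity_deg1)
end


section \<open>Composable chains of homogeneous morphisms\<close>

text \<open>
  Graded modules are families of modules indexed by the degree.
  A chain \<open>c\<^sub>1 \<in> hom(A\<^sub>0,A\<^sub>1), \<dots>, c\<^sub>k \<in> hom(A\<^sub>k\<^sub>-\<^sub>1,A\<^sub>k)\<close> of homogeneous morphisms of degrees
  \<open>d\<^sub>1, \<dots>, d\<^sub>k\<close> is given by its source \<open>A\<^sub>0\<close> together with the list
  \<open>[(d\<^sub>1, c\<^sub>1, A\<^sub>1), \<dots>, (d\<^sub>k, c\<^sub>k, A\<^sub>k)]\<close>. In particular the empty list at \<open>A\<^sub>0\<close> is the argument of the
  curvature term of \<open>A\<^sub>0\<close>.
\<close>

type_synonym ('o, 'g, 'x) chain = "('g \<times> 'x \<times> 'o) list"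

fun tgt :: "'o \<Rightarrow> ('o, 'g, 'x) chain \<Rightarrow> 'o" where
  "tgt X [] = X"
| "tgt X ((d, c, Y) # cs) = tgt Y cs"

fun is_chain :: "'o set \<Rightarrow> ('o \<Rightarrow> 'o \<Rightarrow> 'g \<Rightarrow> 'x set) \<Rightarrow> 'o \<Rightarrow> ('o, 'g, 'x) chain \<Rightarrow> bool" where
  "is_chain Ob H X [] \<longleftrightarrow> X \<in> Ob"
| "is_chain Ob H X ((d, c, Y) # cs) \<longleftrightarrow> X \<in> Ob \<and> c \<in> H X Y d \<and> is_chain Ob H Y cs"

text \<open>The degree of the value of a \<open>k\<close>-ary operation of degree \<open>n - k\<close>.\<close>

definition deg_out :: "int \<Rightarrow> ('o, bit, 'x) chain \<Rightarrow> bit" where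
  "deg_out n cs = sum_list (map fst cs) + of_int (n - int (length cs))"

text \<open>
  The sign \<open>(-1)\<close> to the sum of the reduced degrees \<open>|c\<^sub>j| - 1\<close> of the chain that an operation has to
  move past.
\<close>

definition koszul :: "('o, bit, 'x) chain \<Rightarrow> 'm::ab_group_add \<Rightarrow> 'm" where
  "koszul cs x = (if sum_list (map (\<lambda>(d, c, Y). d - 1) cs) = 0 then x else - x)"

definition multilinear ::
    "('k \<Rightarrow> 'm \<Rightarrow> 'm) \<Rightarrow> ('k \<Rightarrow> 'n \<Rightarrow> 'n) \<Rightarrow> 'o set \<Rightarrow> ('o \<Rightarrow> 'o \<Rightarrow> 'g \<Rightarrow> 'm::plus set)
      \<Rightarrow> ('o \<Rightarrow> ('o, 'g, 'm) chain \<Rightarrow> 'n::plus) \<Rightarrow> bool" where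
  "multilinear scale scale' Ob H f \<longleftrightarrow>
     (\<forall>X p d c c' Y r k.
        is_chain Ob H X (p @ (d, c, Y) # r) \<longrightarrow> is_chain Ob H X (p @ (d, c', Y) # r) \<longrightarrow>
          f X (p @ (d, c + c', Y) # r) = f X (p @ (d, c, Y) # r) + f X (p @ (d, c', Y) # r) \<and>
          f X (p @ (d, scale k c, Y) # r) = scale' k (f X (p @ (d, c, Y) # r)))"

text \<open>Chains of morphisms with a filtration level attached to each degree.\<close>

definition forget_level :: "('o, bit \<times> int, 'x) chain \<Rightarrow> ('o, bit, 'x) chain" where
  "forget_level = map (\<lambda>((d, l), c, Y). (d, c, Y))"

definition level :: "('o, bit \<times> int, 'x) chain \<Rightarrow> int" where
  "level cs = sum_list (map (\<lambda>((d, l), c, Y). l) cs)"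


section \<open>Complete filtrations\<close>

text \<open>The last two conditions say that \<open>M \<rightarrow> lim M / F\<^sub>l\<close> is injective and surjective.\<close>

definition complete_filtration :: "'m::ab_group_add set \<Rightarrow> (int \<Rightarrow> 'm set) \<Rightarrow> bool" where
  "complete_filtration M F \<longleftrightarrow>
     (\<forall>l. 0 \<in> F l \<and> (\<forall>x\<in>F l. \<forall>y\<in>F l. x - y \<in> F l)) \<and>
     (\<forall>l l'. l \<le> l' \<longrightarrow> F l' \<subseteq> F l) \<and>
     (\<Union>l. F l) = M \<and>
     (\<Inter>l. F l) = {0} \<and>
     (\<forall>x. (\<forall>l. x l \<in> M \<and> x (l + 1) - x l \<in> F l) \<longrightarrow> (\<exists>y\<in>M. \<forall>l. y - x l \<in> F l))"

text \<open>Unconditional convergence in the topology defined by the filtration.\<close>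

definition filt_has_sum ::
    "(int \<Rightarrow> 'm::ab_group_add set) \<Rightarrow> ('i \<Rightarrow> 'm) \<Rightarrow> 'i set \<Rightarrow> 'm \<Rightarrow> bool" where
  "filt_has_sum F f I s \<longleftrightarrow>
     (\<forall>l. \<exists>J0. finite J0 \<and> J0 \<subseteq> I \<and> (\<forall>J. finite J \<and> J0 \<subseteq> J \<and> J \<subseteq> I \<longrightarrow> s - sum f J \<in> F l))"

definition filt_sum :: "(int \<Rightarrow> 'm::ab_group_add set) \<Rightarrow> ('i \<Rightarrow> 'm) \<Rightarrow> 'i set \<Rightarrow> 'm" where
  "filt_sum F f I = (THE s. filt_has_sum F f I s)"

locale filtered_ring =
  fixes FK :: "int \<Rightarrow> 'k::comm_ring_1 set"
  assumes FK_complete: "complete_filtration UNIV FK"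
    and FK_one: "1 \<in> FK 0"
    and FK_mult: "r \<in> FK l \<Longrightarrow> s \<in> FK l' \<Longrightarrow> r * s \<in> FK (l + l')"


section \<open>Linear \<open>A\<^sub>\<infinity>\<close> categories\<close>

text \<open>
  All morphism modules are submodules of one ambient module (for instance the direct sum of all of
  them), and \<open>mu X [(d\<^sub>1, c\<^sub>1, X\<^sub>1), \<dots>]\<close> is \<open>\<mu>\<^sup>k(c\<^sub>1, \<dots>, c\<^sub>k)\<close>.
\<close>

record ('o, 'm) ainf =
  obj :: "'o set"
  mor :: "'o \<Rightarrow> 'o \<Rightarrow> bit \<Rightarrow> 'm set"
  mu :: "'o \<Rightarrow> ('o, bit, 'm) chain \<Rightarrow> 'm"

record ('o, 'm) filt_ainf = "('o, 'm) ainf" +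
  fil :: "'o \<Rightarrow> 'o \<Rightarrow> bit \<Rightarrow> int \<Rightarrow> 'm set"

text \<open>
  The signs in the \<open>A\<^sub>\<infinity>\<close> equations are those belonging to the order of composition
  \<open>hom(A\<^sub>0,A\<^sub>1) \<otimes> \<dots> \<otimes> hom(A\<^sub>k\<^sub>-\<^sub>1,A\<^sub>k) \<rightarrow> hom(A\<^sub>0,A\<^sub>k)\<close>:
  \<open>\<Sum> (-1)\<^bsup>|c\<^sub>1|' + \<dots> + |c\<^sub>i|'\<^esup> \<mu>(c\<^sub>1, \<dots>, c\<^sub>i, \<mu>(c\<^sub>i\<^sub>+\<^sub>1, \<dots>, c\<^sub>i\<^sub>+\<^sub>j), \<dots>, c\<^sub>k) = 0\<close> with \<open>|c|' = |c| - 1\<close>.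
  The inner \<open>\<mu>\<close> may have no arguments, so the curvature is included.
\<close>

locale curved_ainf_category = module scale
  for scale :: "'k::comm_ring_1 \<Rightarrow> 'm::ab_group_add \<Rightarrow> 'm" +
  fixes A :: "('o, 'm, 'z) ainf_scheme"
  assumes mor_submodule: "X \<in> obj A \<Longrightarrow> Y \<in> obj A \<Longrightarrow> module.subspace scale (mor A X Y d)"
    and mu_degree: "is_chain (obj A) (mor A) X cs \<Longrightarrow> mu A X cs \<in> mor A X (tgt X cs) (deg_out 2 cs)"
    and mu_multilinear: "multilinear scale scale (obj A) (mor A) (mu A)"
    and mu_ainf: "is_chain (obj A) (mor A) X cs \<Longrightarrow>
      (\<Sum>(p, q, r)\<in>{(p, q, r). p @ q @ r = cs}.
         koszul p (mu A X (p @ (deg_out 2 q, mu A (tgt X p) q, tgt (tgt X p) q) # r))) = 0"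

locale uncurved_ainf_category = curved_ainf_category scale A
  for scale :: "'k::comm_ring_1 \<Rightarrow> 'm::ab_group_add \<Rightarrow> 'm" and A :: "('o, 'm, 'z) ainf_scheme" +
  assumes mu_uncurved: "X \<in> obj A \<Longrightarrow> mu A X [] = 0"

locale curved_filtered_ainf_category = filtered_ring FK + curved_ainf_category scale A
  for FK :: "int \<Rightarrow> 'k::comm_ring_1 set"
    and scale :: "'k \<Rightarrow> 'm::ab_group_add \<Rightarrow> 'm"
    and A :: "('o, 'm, 'z) filt_ainf_scheme" +
  assumes fil_complete:
      "X \<in> obj A \<Longrightarrow> Y \<in> obj A \<Longrightarrow> complete_filtration (mor A X Y d) (fil A X Y d)"
    and fil_scale: "X \<in> obj A \<Longrightarrow> Y \<in> obj A \<Longrightarrow> k \<in> FK l \<Longrightarrow> c \<in> fil A X Y d l' \<Longrightarrow>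
      scale k c \<in> fil A X Y d (l + l')"
    and mu_filtered: "is_chain (obj A) (\<lambda>X Y (d, l). fil A X Y d l) X ls \<Longrightarrow>
      mu A X (forget_level ls) \<in> fil A X (tgt X ls) (deg_out 2 (forget_level ls)) (level ls)"
    and curvature_filtered: "X \<in> obj A \<Longrightarrow> mu A X [] \<in> fil A X X 0 1"


section \<open>Cohomological categories\<close>

text \<open>
  Graded categories, possibly without units: \<open>chom C X Y d\<close> are the morphisms of degree \<open>d\<close>, and
  \<open>ccomp C X Y Z d d' f g\<close> is the composite of \<open>f : X \<rightarrow> Y\<close> of degree \<open>d\<close> followed by \<open>g : Y \<rightarrow> Z\<close> of
  degree \<open>d'\<close>.
\<close>

record ('o, 'g, 'h) gcat =
  cobj :: "'o set"
  chom :: "'o \<Rightarrow> 'o \<Rightarrow> 'g \<Rightarrow> 'h set"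
  ccomp :: "'o \<Rightarrow> 'o \<Rightarrow> 'o \<Rightarrow> 'g \<Rightarrow> 'g \<Rightarrow> 'h \<Rightarrow> 'h \<Rightarrow> 'h"

definition is_unit_at :: "('o, 'g::ab_group_add, 'h) gcat \<Rightarrow> 'o \<Rightarrow> 'h \<Rightarrow> bool" where
  "is_unit_at C X e \<longleftrightarrow> e \<in> chom C X X 0 \<and>
     (\<forall>Y\<in>cobj C. \<forall>d. (\<forall>f\<in>chom C X Y d. ccomp C X X Y 0 d e f = f) \<and>
                     (\<forall>f\<in>chom C Y X d. ccomp C Y X X d 0 f e = f))"

definition isomorphic_in :: "('o, 'g::ab_group_add, 'h) gcat \<Rightarrow> 'o \<Rightarrow> 'o \<Rightarrow> bool" where
  "isomorphic_in C X Y \<longleftrightarrow>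
     (\<exists>f\<in>chom C X Y 0. \<exists>g\<in>chom C Y X 0.
        is_unit_at C X (ccomp C X Y X 0 0 f g) \<and> is_unit_at C Y (ccomp C Y X Y 0 0 g f))"

definition graded_functor ::
    "('o, 'g::ab_group_add, 'h) gcat \<Rightarrow> ('p, 'g, 'i) gcat
      \<Rightarrow> ('o \<Rightarrow> 'p) \<Rightarrow> ('o \<Rightarrow> 'o \<Rightarrow> 'g \<Rightarrow> 'h \<Rightarrow> 'i) \<Rightarrow> bool" where
  "graded_functor C D P \<Phi> \<longleftrightarrow>
     (\<forall>X\<in>cobj C. P X \<in> cobj D) \<and>
     (\<forall>X\<in>cobj C. \<forall>Y\<in>cobj C. \<forall>d. \<forall>f\<in>chom C X Y d. \<Phi> X Y d f \<in> chom D (P X) (P Y) d) \<and>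
     (\<forall>X\<in>cobj C. \<forall>Y\<in>cobj C. \<forall>Z\<in>cobj C. \<forall>d d'. \<forall>f\<in>chom C X Y d. \<forall>g\<in>chom C Y Z d'.
        \<Phi> X Z (d + d') (ccomp C X Y Z d d' f g) =
        ccomp D (P X) (P Y) (P Z) d d' (\<Phi> X Y d f) (\<Phi> Y Z d' g)) \<and>
     (\<forall>X\<in>cobj C. \<forall>e. is_unit_at C X e \<longrightarrow> is_unit_at D (P X) (\<Phi> X X 0 e))"

definition graded_equivalence ::
    "('o, 'g::ab_group_add, 'h) gcat \<Rightarrow> ('p, 'g, 'i) gcat
      \<Rightarrow> ('o \<Rightarrow> 'p) \<Rightarrow> ('o \<Rightarrow> 'o \<Rightarrow> 'g \<Rightarrow> 'h \<Rightarrow> 'i) \<Rightarrow> bool" where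
  "graded_equivalence C D P \<Phi> \<longleftrightarrow>
     graded_functor C D P \<Phi> \<and>
     (\<forall>X\<in>cobj C. \<forall>Y\<in>cobj C. \<forall>d. bij_betw (\<Phi> X Y d) (chom C X Y d) (chom D (P X) (P Y) d)) \<and>
     (\<forall>Y\<in>cobj D. \<exists>X\<in>cobj C. isomorphic_in D (P X) Y)"

text \<open>
  Graded \<open>A\<^sub>\<infinity>\<close> structures on arbitrary abelian groups, which therefore also accommodate quotients.
  The abelian groups are HOL-Algebra groups, written multiplicatively.
\<close>

record ('o, 'g, 'x) graded_ainf =
  gobj :: "'o set"
  gmor :: "'o \<Rightarrow> 'o \<Rightarrow> 'g \<Rightarrow> 'x monoid"
  gmu :: "'o \<Rightarrow> ('o, 'g, 'x) chain \<Rightarrow> 'x"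

text \<open>
  The operations \<open>F\<^sup>k\<close> of a functor take chains as arguments, just as the \<open>\<mu>\<^sup>k\<close> do.
\<close>

record ('o, 'g, 'x, 'p, 'y) ainf_functor =
  fobj :: "'o \<Rightarrow> 'p"
  fmor :: "'o \<Rightarrow> ('o, 'g, 'x) chain \<Rightarrow> 'y"

definition cocycles :: "('o, 'g::grading, 'x) graded_ainf \<Rightarrow> 'o \<Rightarrow> 'o \<Rightarrow> 'g \<Rightarrow> 'x set" where
  "cocycles A X Y d = kernel (gmor A X Y d) (gmor A X Y (d + deg1)) (\<lambda>x. gmu A X [(d, x, Y)])"

definition coboundaries :: "('o, 'g::grading, 'x) graded_ainf \<Rightarrow> 'o \<Rightarrow> 'o \<Rightarrow> 'g \<Rightarrow> 'x set" where
  "coboundaries A X Y d = (\<lambda>x. gmu A X [(d - deg1, x, Y)]) ` carrier (gmor A X Y (d - deg1))"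

definition coh_class ::
    "('o, 'g::grading, 'x) graded_ainf \<Rightarrow> 'o \<Rightarrow> 'o \<Rightarrow> 'g \<Rightarrow> 'x \<Rightarrow> 'x set" where
  "coh_class A X Y d x = coboundaries A X Y d #>\<^bsub>gmor A X Y d\<^esub> x"

text \<open>
  The product on cohomology is \<open>[x][y] = (-1)\<^bsup>|x|\<^esup> [\<mu>\<^sup>2(x,y)]\<close>; with the sign convention for the \<open>A\<^sub>\<infinity>\<close>
  equations chosen above this is what makes it associative.
\<close>

definition coh :: "('o, 'g::grading, 'x) graded_ainf \<Rightarrow> ('o, 'g, 'x set) gcat" where
  "coh A = \<lparr>
     cobj = gobj A,
     chom = (\<lambda>X Y d.
       carrier ((gmor A X Y d)\<lparr>carrier := cocycles A X Y d\<rparr> Mod coboundaries A X Y d)),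
     ccomp = (\<lambda>X Y Z d d' f g.
       let m = gmu A X [(d, (SOME x. x \<in> f), Y), (d', (SOME y. y \<in> g), Z)]
       in coh_class A X Z (d + d')
            (if parity d = 0 then m else inv\<^bsub>gmor A X Z (d + d')\<^esub> m)) \<rparr>"

definition coh_functor ::
    "('p, 'g::grading, 'y) graded_ainf \<Rightarrow> ('o, 'g, 'x, 'p, 'y) ainf_functor
      \<Rightarrow> 'o \<Rightarrow> 'o \<Rightarrow> 'g \<Rightarrow> 'x set \<Rightarrow> 'y set" where
  "coh_functor B F X Y d f =
     coh_class B (fobj F X) (fobj F Y) d (fmor F X [(d, (SOME x. x \<in> f), Y)])"

definition c_unital :: "('o, 'g::grading, 'x) graded_ainf \<Rightarrow> bool" where
  "c_unital A \<longleftrightarrow> (\<forall>X\<in>gobj A. \<exists>e. is_unit_at (coh A) X e)"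

definition c_unital_functor ::
    "('o, 'g::grading, 'x) graded_ainf \<Rightarrow> ('p, 'g, 'y) graded_ainf
      \<Rightarrow> ('o, 'g, 'x, 'p, 'y) ainf_functor \<Rightarrow> bool" where
  "c_unital_functor A B F \<longleftrightarrow>
     (\<forall>X\<in>gobj A. \<forall>e. is_unit_at (coh A) X e \<longrightarrow>
        is_unit_at (coh B) (fobj F X) (coh_functor B F X X 0 e))"

definition quasi_equivalence ::
    "('o, 'g::grading, 'x) graded_ainf \<Rightarrow> ('p, 'g, 'y) graded_ainf
      \<Rightarrow> ('o, 'g, 'x, 'p, 'y) ainf_functor \<Rightarrow> bool" where
  "quasi_equivalence A B F \<longleftrightarrow>
     c_unital A \<and> c_unital B \<and> graded_equivalence (coh A) (coh B) (fobj F) (coh_functor B F)"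

text \<open>A linear \<open>A\<^sub>\<infinity>\<close> category, viewed as a graded \<open>A\<^sub>\<infinity>\<close> structure on its additive groups of morphisms.\<close>

definition additive :: "'m::ab_group_add set \<Rightarrow> 'm monoid" where
  "additive S = \<lparr>carrier = S, mult = (+), one = 0\<rparr>"

definition graded :: "('o, 'm::ab_group_add, 'z) ainf_scheme \<Rightarrow> ('o, bit, 'm) graded_ainf" where
  "graded A = \<lparr>gobj = obj A, gmor = (\<lambda>X Y d. additive (mor A X Y d)), gmu = mu A\<rparr>"


section \<open>The associated graded\<close>

text \<open>
  The piece of degree \<open>(d, l)\<close> of the associated graded is the quotient of \<open>F\<^sub>l\<close> by \<open>F\<^sub>l\<^sub>+\<^sub>1\<close> in \<open>hom\<^sup>d\<close>.
  Operations are evaluated on representatives.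
\<close>

definition gr_class ::
    "('o, 'm::ab_group_add, 'z) filt_ainf_scheme \<Rightarrow> 'o \<Rightarrow> 'o \<Rightarrow> bit \<Rightarrow> int \<Rightarrow> 'm \<Rightarrow> 'm set" where
  "gr_class A X Y d l x = fil A X Y d (l + 1) #>\<^bsub>additive (fil A X Y d l)\<^esub> x"

definition representatives :: "('o, 'g, 'm set) chain \<Rightarrow> ('o, 'g, 'm) chain" where
  "representatives = map (\<lambda>(d, c, Y). (d, (SOME x. x \<in> c), Y))"

definition Gr ::
    "('o, 'm::ab_group_add, 'z) filt_ainf_scheme \<Rightarrow> ('o, bit \<times> int, 'm set) graded_ainf" where
  "Gr A = \<lparr>
     gobj = obj A,
     gmor = (\<lambda>X Y (d, l). additive (fil A X Y d l) Mod fil A X Y d (l + 1)),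
     gmu = (\<lambda>X cs. let xs = forget_level (representatives cs)
       in gr_class A X (tgt X cs) (deg_out 2 xs) (level cs) (mu A X xs)) \<rparr>"

definition Gr_functor ::
    "('p, 'n::ab_group_add, 'z) filt_ainf_scheme \<Rightarrow> ('o, bit, 'm, 'p, 'n) ainf_functor
      \<Rightarrow> ('o, bit \<times> int, 'm set, 'p, 'n set) ainf_functor" where
  "Gr_functor B G = \<lparr>
     fobj = fobj G,
     fmor = (\<lambda>X cs. let xs = forget_level (representatives cs)
       in gr_class B (fobj G X) (fobj G (tgt X cs)) (deg_out 1 xs) (level cs) (fmor G X xs)) \<rparr>"


section \<open>\<open>A\<^sub>\<infinity>\<close> functors\<close>

text \<open>
  For a decomposition \<open>bs\<close> of a chain into consecutive blocks, the chain of the \<open>G(b)\<close> for \<open>b\<close> in \<open>bs\<close>.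
  For curved functors the blocks may be empty, and an empty block contributes the curvature of \<open>G\<close>.
\<close>

fun apply_blocks ::
    "('o, bit, 'm, 'p, 'n) ainf_functor \<Rightarrow> 'o \<Rightarrow> ('o, bit, 'm) chain list \<Rightarrow> ('p, bit, 'n) chain" where
  "apply_blocks G X [] = []"
| "apply_blocks G X (b # bs) =
     (deg_out 1 b, fmor G X b, fobj G (tgt X b)) # apply_blocks G (tgt X b) bs"

text \<open>
  The functor equations are
  \<open>\<Sum> \<mu>(G(c\<^sub>1, \<dots>), \<dots>, G(\<dots>, c\<^sub>k)) = \<Sum> (-1)\<^bsup>|c\<^sub>1|' + \<dots> + |c\<^sub>i|'\<^esup> G(c\<^sub>1, \<dots>, c\<^sub>i, \<mu>(c\<^sub>i\<^sub>+\<^sub>1, \<dots>), \<dots>, c\<^sub>k)\<close>.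
  If empty blocks are allowed, then the left-hand side is an infinite sum.
\<close>

locale uncurved_ainf_functor =
  dom: uncurved_ainf_category scale A + cod: uncurved_ainf_category scale' B
  for scale :: "'k::comm_ring_1 \<Rightarrow> 'm::ab_group_add \<Rightarrow> 'm" and A :: "('o, 'm, 'z) ainf_scheme"
    and scale' :: "'k \<Rightarrow> 'n::ab_group_add \<Rightarrow> 'n" and B :: "('p, 'n, 'y) ainf_scheme" +
  fixes F :: "('o, bit, 'm, 'p, 'n) ainf_functor"
  assumes fobj: "X \<in> obj A \<Longrightarrow> fobj F X \<in> obj B"
    and fmor_degree: "is_chain (obj A) (mor A) X cs \<Longrightarrow>
      fmor F X cs \<in> mor B (fobj F X) (fobj F (tgt X cs)) (deg_out 1 cs)"
    and fmor_multilinear: "multilinear scale scale' (obj A) (mor A) (fmor F)"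
    and fmor_uncurved: "X \<in> obj A \<Longrightarrow> fmor F X [] = 0"
    and fmor_ainf: "is_chain (obj A) (mor A) X cs \<Longrightarrow>
      (\<Sum>bs\<in>{bs. concat bs = cs \<and> [] \<notin> set bs}. mu B (fobj F X) (apply_blocks F X bs)) =
      (\<Sum>(p, q, r)\<in>{(p, q, r). p @ q @ r = cs}.
         koszul p (fmor F X (p @ (deg_out 2 q, mu A (tgt X p) q, tgt (tgt X p) q) # r)))"

locale curved_filtered_ainf_functor =
  dom: curved_filtered_ainf_category FK scale A + cod: curved_filtered_ainf_category FK scale' B
  for FK :: "int \<Rightarrow> 'k::comm_ring_1 set"
    and scale :: "'k \<Rightarrow> 'm::ab_group_add \<Rightarrow> 'm" and A :: "('o, 'm, 'z) filt_ainf_scheme"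
    and scale' :: "'k \<Rightarrow> 'n::ab_group_add \<Rightarrow> 'n" and B :: "('p, 'n, 'y) filt_ainf_scheme" +
  fixes G :: "('o, bit, 'm, 'p, 'n) ainf_functor"
  assumes fobj: "X \<in> obj A \<Longrightarrow> fobj G X \<in> obj B"
    and fmor_degree: "is_chain (obj A) (mor A) X cs \<Longrightarrow>
      fmor G X cs \<in> mor B (fobj G X) (fobj G (tgt X cs)) (deg_out 1 cs)"
    and fmor_multilinear: "multilinear scale scale' (obj A) (mor A) (fmor G)"
    and fmor_filtered: "is_chain (obj A) (\<lambda>X Y (d, l). fil A X Y d l) X ls \<Longrightarrow>
      fmor G X (forget_level ls) \<in>
        fil B (fobj G X) (fobj G (tgt X ls)) (deg_out 1 (forget_level ls)) (level ls)"
    and curvature_filtered: "X \<in> obj A \<Longrightarrow> fmor G X [] \<in> fil B (fobj G X) (fobj G X) 1 1"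
    and fmor_ainf: "is_chain (obj A) (mor A) X cs \<Longrightarrow>
      filt_has_sum (fil B (fobj G X) (fobj G (tgt X cs)) (deg_out 2 cs))
        (\<lambda>bs. mu B (fobj G X) (apply_blocks G X bs)) {bs. concat bs = cs}
        (\<Sum>(p, q, r)\<in>{(p, q, r). p @ q @ r = cs}.
           koszul p (fmor G X (p @ (deg_out 2 q, mu A (tgt X p) q, tgt (tgt X p) q) # r)))"
    and Gr_c_unital: "c_unital_functor (Gr A) (Gr B) (Gr_functor B G)"

locale curved_filtered_quasi_equivalence = curved_filtered_ainf_functor +
  assumes Gr_quasi_equivalence: "quasi_equivalence (Gr A) (Gr B) (Gr_functor B G)"


section \<open>Bounding cochains\<close>

definition maurer_cartan ::
    "('o, 'm::ab_group_add, 'z) filt_ainf_scheme \<Rightarrow> 'o \<Rightarrow> 'm \<Rightarrow> bool" where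
  "maurer_cartan A X a \<longleftrightarrow> X \<in> obj A \<and> a \<in> fil A X X 1 1 \<and>
     filt_has_sum (fil A X X 0) (\<lambda>k. mu A X (replicate k (1, a, X))) UNIV 0"

text \<open>
  \<open>insert_mc (A\<^sub>0, a\<^sub>0) [i\<^sub>0, \<dots>, i\<^sub>k] [c\<^sub>1, \<dots>, c\<^sub>k]\<close> is the chain
  \<open>a\<^sub>0\<^bsup>\<otimes>i\<^sub>0\<^esup>, c\<^sub>1, a\<^sub>1\<^bsup>\<otimes>i\<^sub>1\<^esup>, \<dots>, c\<^sub>k, a\<^sub>k\<^bsup>\<otimes>i\<^sub>k\<^esup>\<close>; the list of exponents has to be one longer than the chain.
\<close>

fun insert_mc ::
    "'o \<times> 'm \<Rightarrow> nat list \<Rightarrow> ('o \<times> 'm, bit, 'm) chain \<Rightarrow> ('o, bit, 'm) chain" where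
  "insert_mc (X, a) (i # is) [] = replicate i (1, a, X)"
| "insert_mc (X, a) (i # is) ((d, c, Y, b) # cs) =
     replicate i (1, a, X) @ (d, c, Y) # insert_mc (Y, b) is cs"
| "insert_mc (X, a) [] cs = []"

text \<open>The (not necessarily c-unital) \<open>A\<^sub>\<infinity>\<close> category of all bounding cochains.\<close>

definition bc_all ::
    "('o, 'm::ab_group_add, 'z) filt_ainf_scheme \<Rightarrow> ('o \<times> 'm, 'm) ainf" where
  "bc_all A = \<lparr>
     obj = {(X, a). maurer_cartan A X a},
     mor = (\<lambda>U V. mor A (fst U) (fst V)),
     mu = (\<lambda>U cs. filt_sum (fil A (fst U) (fst (tgt U cs)) (deg_out 2 cs))
            (\<lambda>is. mu A (fst U) (insert_mc U is cs)) {is. length is = Suc (length cs)}) \<rparr>"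

text \<open>The \<open>A\<^sub>\<infinity>\<close> algebra of endomorphisms of \<open>X\<close>, and its deformation by \<open>a\<close>.\<close>

definition endo :: "('o, 'm, 'z) filt_ainf_scheme \<Rightarrow> 'o \<Rightarrow> ('o, 'm, 'z) filt_ainf_scheme" where
  "endo A X = A\<lparr>obj := {X}\<rparr>"

definition deformed ::
    "('o, 'm::ab_group_add, 'z) filt_ainf_scheme \<Rightarrow> 'o \<Rightarrow> 'm \<Rightarrow> ('o \<times> 'm, 'm) ainf" where
  "deformed A X a = (bc_all A)\<lparr>obj := {(X, a)}\<rparr>"

definition c_unital_maurer_cartan ::
    "('o, 'm::ab_group_add, 'z) filt_ainf_scheme \<Rightarrow> 'o \<Rightarrow> 'm \<Rightarrow> bool" where
  "c_unital_maurer_cartan A X a \<longleftrightarrow>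
     maurer_cartan A X a \<and>
     c_unital (graded (deformed A X a)) \<and>
     (\<exists>e\<in>fil A X X 0 0.
        e \<in> cocycles (graded (deformed A X a)) (X, a) (X, a) 0 \<and>
        is_unit_at (coh (graded (deformed A X a))) (X, a)
          (coh_class (graded (deformed A X a)) (X, a) (X, a) 0 e) \<and>
        gr_class A X X 0 0 e \<in> cocycles (Gr (endo A X)) X X (0, 0) \<and>
        is_unit_at (coh (Gr (endo A X))) X
          (coh_class (Gr (endo A X)) X X (0, 0) (gr_class A X X 0 0 e)))"

definition bc ::
    "('o, 'm::ab_group_add, 'z) filt_ainf_scheme \<Rightarrow> ('o \<times> 'm, 'm) ainf" where
  "bc A = (bc_all A)\<lparr>obj := {(X, a). c_unital_maurer_cartan A X a}\<rparr>"

text \<open>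
  The formula for the operations of the functor on bounding cochains only applies to \<open>k \<ge> 1\<close>: for
  \<open>k = 0\<close> it would return the Maurer-Cartan element of the image object, whereas the functor is
  uncurved.
\<close>

definition push_mc ::
    "('p, 'n::ab_group_add, 'z) filt_ainf_scheme \<Rightarrow> ('o, bit, 'm, 'p, 'n) ainf_functor
      \<Rightarrow> 'o \<Rightarrow> 'm \<Rightarrow> 'n" where
  "push_mc B G X a =
     filt_sum (fil B (fobj G X) (fobj G X) 1) (\<lambda>k. fmor G X (replicate k (1, a, X))) UNIV"

definition bc_functor ::
    "('p, 'n::ab_group_add, 'z) filt_ainf_scheme \<Rightarrow> ('o, bit, 'm, 'p, 'n) ainf_functor
      \<Rightarrow> ('o \<times> 'm, bit, 'm, 'p \<times> 'n, 'n) ainf_functor" where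
  "bc_functor B G = \<lparr>
     fobj = (\<lambda>(X, a). (fobj G X, push_mc B G X a)),
     fmor = (\<lambda>U cs. if cs = [] then 0
       else filt_sum (fil B (fobj G (fst U)) (fobj G (fst (tgt U cs))) (deg_out 1 cs))
              (\<lambda>is. fmor G (fst U) (insert_mc U is cs)) {is. length is = Suc (length cs)}) \<rparr>"

end

(*
  Each pair (X, a) with a in F_1 hom(X, X) of degree 1 is an object of a curved filtered category "twist A",
  whose operations insert a between the inputs; the bounding cochains are its objects without curvature.
  Inserting a raises the filtration, so twisting changes neither the associated graded nor the leading terms
  of G, and statements about bounding cochains are reduced to the associated graded by successive
  approximation, which converges by completeness.

  Full faithfulness: the mapping cone of the chain map (G^bc)^1 is acyclic on the associated graded, hence acyclic.

  Essential surjectivity: for a bounding cochain (Y, b) of B choose X and an isomorphism f0 from G X to Y in the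
  associated graded. The Maurer-Cartan equation for an unknown a on X and the closedness of an unknown
  f = f0 + ... from G^bc (X, a) to (Y, b) are solved together: at each step the defect is a cocycle in the cone
  of x -> G^1(x) f0, which is acyclic on the associated graded. Composition with the closed f is bijective on
  cohomology, because its leading term is invertible.

  Units: a bounding cochain is c-unital as soon as it has a closed e that is idempotent up to homotopy and
  whose leading term is a unit: right and left multiplication by e are idempotent and injective on cohomology,
  hence the identity. Such an e is transported along G^bc in both directions and obtained along f by solving
  e f = f.
*)
theory Submission
  imports Defs
begin

section \<open>Unconditional sums in complete filtered groups\<close>

text \<open>Over a general ring nothing need split, so no homotopies or minimal models are
  constructed. Statements are phrased as exactness of a mapping cone, which survives perturbations
  of higher level and can be solved level by level. The filtrations may be unbounded in both
  directions, so an approximation starts at a level where the data happen to lie, and each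
  correction has to lie in the level of the current defect: a correction of worse level would
  destroy convergence. Hence exactness always comes with control of levels. A second obstacle is
  that the untwisted \<open>del\<close> squares to zero only modulo the next level, so that the cone
  of an untwisted map is a complex only after passing to the associated graded. Exactness is proved
  there, where the hypothesis on \<open>G\<close> applies, and is transferred to the twisted maps,
  which are chain maps between genuine complexes. Finally, a unit is tested against all morphisms,
  and those of the target need not come from the source. The description of units by closed
  idempotents avoids this test on the twisted side, which is what lets them move along the
  functor.\<close>

lemma filt_has_sumE:
  assumes "filt_has_sum F f I s"
  obtains J0 where "finite J0" "J0 \<subseteq> I"
    "\<forall>J. finite J \<longrightarrow> J0 \<subseteq> J \<longrightarrow> J \<subseteq> I \<longrightarrow> s - sum f J \<in> F l"
proof -
  have "\<exists>J0. finite J0 \<and> J0 \<subseteq> I \<and> (\<forall>J. finite J \<and> J0 \<subseteq> J \<and> J \<subseteq> I \<longrightarrow> s - sum f J \<in> F l)"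
    using assms unfolding filt_has_sum_def by (rule spec)
  then show thesis unfolding imp_conjL by (elim exE conjE) (rule that)
qed

lemma filt_has_sum_cong:
  assumes "\<And>i. i \<in> I \<Longrightarrow> f i = g i"
  shows "filt_has_sum F f I s \<longleftrightarrow> filt_has_sum F g I s"
proof -
  have "sum f J = sum g J" if "J \<subseteq> I" for J
    using that assms by (intro sum.cong) auto
  then show ?thesis unfolding filt_has_sum_def by auto
qed

lemma filt_has_sum_reindex:
  assumes "bij_betw h I I'"
  shows "filt_has_sum F (\<lambda>i. f (h i)) I s \<longleftrightarrow> filt_has_sum F f I' s"
proof -
  have imp: "filt_has_sum F f I' s" if hs: "filt_has_sum F (\<lambda>i. f (h i)) I s" and bij: "bij_betw h I I'"
    for f :: "'x \<Rightarrow> 'c::ab_group_add" and h :: "'y \<Rightarrow> 'x" and I I' and F :: "int \<Rightarrow> 'c set" and s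
    unfolding filt_has_sum_def
  proof
    fix l
    obtain J0 where J0: "finite J0" "J0 \<subseteq> I"
      "\<forall>J. finite J \<longrightarrow> J0 \<subseteq> J \<longrightarrow> J \<subseteq> I \<longrightarrow> s - sum (\<lambda>i. f (h i)) J \<in> F l"
      using hs by (rule filt_has_sumE[where l = l])
    have "s - sum f J \<in> F l" if J: "finite J" "h ` J0 \<subseteq> J" "J \<subseteq> I'" for J
    proof -
      let ?K = "{i\<in>I. h i \<in> J}"
      have inj: "inj_on h ?K" using bij by (auto simp: bij_betw_def inj_on_def)
      have im: "h ` ?K = J" using bij J(3) by (auto simp: bij_betw_def)
      have fin: "finite ?K" using finite_imageD[of h ?K] inj im J(1) by simp
      have "J0 \<subseteq> ?K" using J0(2) J(2) by auto
      then have "s - sum (\<lambda>i. f (h i)) ?K \<in> F l" using J0(3)[rule_format, of ?K] fin by auto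
      moreover have "sum f J = sum (\<lambda>i. f (h i)) ?K"
        using sum.reindex[OF inj, of f] im by simp
      ultimately show ?thesis by simp
    qed
    moreover have "finite (h ` J0)" "h ` J0 \<subseteq> I'" using J0 bij by (auto simp: bij_betw_def)
    ultimately show "\<exists>J0. finite J0 \<and> J0 \<subseteq> I' \<and>
      (\<forall>J. finite J \<and> J0 \<subseteq> J \<and> J \<subseteq> I' \<longrightarrow> s - sum f J \<in> F l)" by blast
  qed
  show ?thesis
  proof
    assume "filt_has_sum F f I' s"
    moreover have "filt_has_sum F f I' s \<longleftrightarrow> filt_has_sum F (\<lambda>i. f (h (inv_into I h i))) I' s"
      using assms by (intro filt_has_sum_cong) (auto simp: bij_betw_def f_inv_into_f)
    ultimately show "filt_has_sum F (\<lambda>i. f (h i)) I s"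
      using imp[of F "\<lambda>i. f (h i)" "inv_into I h" I' s I] bij_betw_inv_into[OF assms] by simp
  qed (rule imp[OF _ assms])
qed

text \<open>Convergence to zero along the cofinite filter. In a complete filtered group this already
  gives summability, because finite sums of terms in \<open>F l\<close> stay in
  \<open>F l\<close>.\<close>

definition null_family :: "(int \<Rightarrow> 'a set) \<Rightarrow> ('i \<Rightarrow> 'a) \<Rightarrow> 'i set \<Rightarrow> bool" where
  "null_family F f I \<longleftrightarrow> (\<forall>l. finite {i\<in>I. f i \<notin> F l})"

lemma null_family_subset: "null_family F f I \<Longrightarrow> J \<subseteq> I \<Longrightarrow> null_family F f J"
  unfolding null_family_def by (blast intro: finite_subset[of "{i\<in>J. f i \<notin> F l}" "{i\<in>I. f i \<notin> F l}" for l])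

text \<open>The source of the null families below: the weight counts inserted elements of level 1,
  so it bounds the gain in level from below, and only finitely many insertions have bounded
  weight.\<close>

lemma null_family_weight:
  assumes "\<And>n. finite {i\<in>I. w i \<le> (n::nat)}"
    and "\<And>i. i \<in> I \<Longrightarrow> f i \<in> F (l0 + int (w i))" and "\<And>l l'. l \<le> l' \<Longrightarrow> F l' \<subseteq> F l"
  shows "null_family F f I"
  unfolding null_family_def
proof
  fix l
  have "{i\<in>I. f i \<notin> F l} \<subseteq> {i\<in>I. w i \<le> nat (l - l0)}"
  proof safe
    fix i assume i: "i \<in> I" "f i \<notin> F l"
    then have "\<not> l \<le> l0 + int (w i)" using assms(2,3) by blast
    then show "w i \<le> nat (l - l0)" by simp
  qed
  then show "finite {i\<in>I. f i \<notin> F l}" using assms(1) finite_subset by blast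
qed

locale complete_group =
  fixes M :: "'a::ab_group_add set" and F :: "int \<Rightarrow> 'a set"
  assumes complete: "complete_filtration M F"
begin

lemma zero_F [simp]: "0 \<in> F l" and diff_F: "x \<in> F l \<Longrightarrow> y \<in> F l \<Longrightarrow> x - y \<in> F l"
  and F_antimono: "l \<le> l' \<Longrightarrow> F l' \<subseteq> F l"
  and Union_F: "(\<Union>l. F l) = M" and Inter_F: "(\<Inter>l. F l) = {0}"
  using complete unfolding complete_filtration_def by auto

lemma F_mono: "x \<in> F l' \<Longrightarrow> l \<le> l' \<Longrightarrow> x \<in> F l" using F_antimono by blast
lemma uminus_F: "x \<in> F l \<Longrightarrow> - x \<in> F l" using diff_F[of 0 l x] by simp
lemma uminus_F_iff [simp]: "- x \<in> F l \<longleftrightarrow> x \<in> F l" using uminus_F[of x l] uminus_F[of "- x" l] by auto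
lemma add_F: "x \<in> F l \<Longrightarrow> y \<in> F l \<Longrightarrow> x + y \<in> F l" using diff_F[of x l "- y"] uminus_F by simp
lemma sum_F: "(\<And>i. i \<in> J \<Longrightarrow> f i \<in> F l) \<Longrightarrow> sum f J \<in> F l"
  by (induction J rule: infinite_finite_induct) (auto intro: add_F)
lemma F_sub_M: "x \<in> F l \<Longrightarrow> x \<in> M" using Union_F by auto
lemma F_exhaust: assumes "x \<in> M" obtains l where "x \<in> F l" using assms Union_F by auto
lemma F_separated: "(\<And>l. x \<in> F l) \<Longrightarrow> x = 0" using Inter_F by auto
lemma zero_M: "0 \<in> M" using zero_F F_sub_M by blast
lemma diff_M: assumes "x \<in> M" "y \<in> M" shows "x - y \<in> M"
proof -
  obtain l l' where "x \<in> F l" "y \<in> F l'" using assms F_exhaust by metis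
  then have "x \<in> F (min l l')" "y \<in> F (min l l')" by (auto intro: F_mono)
  then show ?thesis using diff_F F_sub_M by blast
qed
lemma uminus_M: "x \<in> M \<Longrightarrow> - x \<in> M" using diff_M[of 0 x] zero_M by simp
lemma add_M: "x \<in> M \<Longrightarrow> y \<in> M \<Longrightarrow> x + y \<in> M" using diff_M[of x "- y"] uminus_M by simp

lemma F_limit:
  assumes "\<And>l. x l \<in> M" "\<And>l. x (l + 1) - x l \<in> F l"
  shows "\<exists>y\<in>M. \<forall>l. y - x l \<in> F l"
proof -
  have "(\<forall>l. x l \<in> M \<and> x (l + 1) - x l \<in> F l) \<longrightarrow> (\<exists>y\<in>M. \<forall>l. y - x l \<in> F l)"
    using complete unfolding complete_filtration_def by (elim conjE allE[of _ x])
  then show ?thesis using assms by auto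
qed

lemma filt_has_sum_unique:
  assumes "filt_has_sum F f I s" "filt_has_sum F f I t" shows "s = t"
proof -
  have "s - t \<in> F l" for l
  proof -
    obtain J1 where J1: "finite J1" "J1 \<subseteq> I"
      "\<forall>J. finite J \<longrightarrow> J1 \<subseteq> J \<longrightarrow> J \<subseteq> I \<longrightarrow> s - sum f J \<in> F l"
      using assms(1) by (rule filt_has_sumE[where l = l])
    obtain J2 where J2: "finite J2" "J2 \<subseteq> I"
      "\<forall>J. finite J \<longrightarrow> J2 \<subseteq> J \<longrightarrow> J \<subseteq> I \<longrightarrow> t - sum f J \<in> F l"
      using assms(2) by (rule filt_has_sumE[where l = l])
    have "s - sum f (J1 \<union> J2) \<in> F l" "t - sum f (J1 \<union> J2) \<in> F l"
      using J1(3)[rule_format, of "J1 \<union> J2"] J2(3)[rule_format, of "J1 \<union> J2"] J1 J2 by auto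
    from diff_F[OF this] show ?thesis by simp
  qed
  from F_separated[OF this] show ?thesis by simp
qed

lemma filt_sum_eqI: "filt_has_sum F f I s \<Longrightarrow> filt_sum F f I = s"
  unfolding filt_sum_def by (rule the_equality) (auto intro: filt_has_sum_unique)

text \<open>Adding further terms of \<open>F l\<close> to a finite partial sum does not move it
  modulo \<open>F l\<close>. With a single term in \<open>J\<close> this extracts the leading term
  of an infinite sum.\<close>

lemma filt_has_sum_approx:
  assumes "filt_has_sum F f I s" "finite J" "J \<subseteq> I" "\<And>i. i \<in> I - J \<Longrightarrow> f i \<in> F l"
  shows "s - sum f J \<in> F l"
proof -
  obtain J0 where J0: "finite J0" "J0 \<subseteq> I" "\<forall>J. finite J \<longrightarrow> J0 \<subseteq> J \<longrightarrow> J \<subseteq> I \<longrightarrow> s - sum f J \<in> F l"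
    using assms(1) by (rule filt_has_sumE[where l = l])
  have "sum f (J \<union> J0) = sum f J + sum f (J0 - J)"
    using assms(2) J0(1) sum.union_disjoint[of J "J0 - J" f] by (simp add: Diff_disjoint)
  moreover have "s - sum f (J \<union> J0) \<in> F l" using J0 assms by auto
  moreover have "sum f (J0 - J) \<in> F l" using assms(4) J0(2) by (intro sum_F) auto
  ultimately show ?thesis using add_F[of "s - sum f (J \<union> J0)" l "sum f (J0 - J)"] by simp
qed

lemma filt_has_sum_in:
  "filt_has_sum F f I s \<Longrightarrow> (\<And>i. i \<in> I \<Longrightarrow> f i \<in> F l) \<Longrightarrow> s \<in> F l"
  using filt_has_sum_approx[of f I s "{}" l] by simp

lemma filt_has_sum_finite: "finite I \<Longrightarrow> filt_has_sum F f I (sum f I)"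
  unfolding filt_has_sum_def by (intro allI exI[of _ I]) (auto dest: subset_antisym)

lemma filt_has_sum_add:
  assumes "filt_has_sum F f I s" "filt_has_sum F g I t"
  shows "filt_has_sum F (\<lambda>i. f i + g i) I (s + t)"
  unfolding filt_has_sum_def
proof
  fix l
  obtain J1 where J1: "finite J1" "J1 \<subseteq> I"
    and 1: "\<forall>J. finite J \<longrightarrow> J1 \<subseteq> J \<longrightarrow> J \<subseteq> I \<longrightarrow> s - sum f J \<in> F l"
    using assms(1) by (rule filt_has_sumE[where l = l])
  obtain J2 where J2: "finite J2" "J2 \<subseteq> I"
    and 2: "\<forall>J. finite J \<longrightarrow> J2 \<subseteq> J \<longrightarrow> J \<subseteq> I \<longrightarrow> t - sum g J \<in> F l"
    using assms(2) by (rule filt_has_sumE[where l = l])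
  note J = J1 J2
  have "s + t - (\<Sum>i\<in>J. f i + g i) \<in> F l" if "finite J" "J1 \<union> J2 \<subseteq> J" "J \<subseteq> I" for J
    using add_F[OF 1[rule_format, of J] 2[rule_format, of J]] that by (simp add: sum.distrib algebra_simps)
  then show "\<exists>J0. finite J0 \<and> J0 \<subseteq> I \<and>
      (\<forall>J. finite J \<and> J0 \<subseteq> J \<and> J \<subseteq> I \<longrightarrow> s + t - (\<Sum>i\<in>J. f i + g i) \<in> F l)"
    using J by (intro exI[of _ "J1 \<union> J2"]) auto
qed

lemma filt_has_sum_zero: "filt_has_sum F (\<lambda>_. 0) I 0"
  unfolding filt_has_sum_def by (intro allI exI[of _ "{}"]) simp

lemma filt_has_sum_uminus:
  assumes "filt_has_sum F f I s" shows "filt_has_sum F (\<lambda>i. - f i) I (- s)"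
proof -
  have "- s - (\<Sum>i\<in>J. - f i) = - (s - sum f J)" for J by (simp add: sum_negf)
  then show ?thesis using assms unfolding filt_has_sum_def by (simp only: uminus_F_iff) simp
qed

lemma filt_has_sum_diff:
  "filt_has_sum F f I s \<Longrightarrow> filt_has_sum F g I t \<Longrightarrow> filt_has_sum F (\<lambda>i. f i - g i) I (s - t)"
  using filt_has_sum_add[of f I s "\<lambda>i. - g i" "- t"] filt_has_sum_uminus[of g I t] by simp

text \<open>The terms outside \<open>F l\<close> form a finite set \<open>E l\<close>. The sums over
  \<open>E l\<close> are a Cauchy sequence, because the terms that are new in
  \<open>E (l + 1)\<close> lie in \<open>F l\<close>, and completeness supplies the limit.\<close>

lemma null_family_has_sum:
  assumes null: "null_family F f I" and M: "\<And>i. i \<in> I \<Longrightarrow> f i \<in> M"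
  shows "\<exists>s\<in>M. filt_has_sum F f I s"
proof -
  define E where "E l = {i\<in>I. f i \<notin> F l}" for l
  have fin: "finite (E l)" for l using null unfolding null_family_def E_def by simp
  have mono: "E l \<subseteq> E (l + 1)" for l unfolding E_def using F_mono[of _ "l + 1" l] by auto
  have M': "sum f J \<in> M" if "J \<subseteq> I" for J
    using that by (induction J rule: infinite_finite_induct) (auto intro: add_M M zero_M)
  have "sum f (E (l + 1)) - sum f (E l) \<in> F l" for l
  proof -
    have "sum f (E (l + 1)) - sum f (E l) = sum f (E (l + 1) - E l)"
      using sum_diff[OF fin mono] by metis
    also have "\<dots> \<in> F l" by (rule sum_F) (auto simp: E_def)
    finally show ?thesis .
  qed
  moreover have "sum f (E l) \<in> M" for l by (rule M') (auto simp: E_def)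
  ultimately have "\<exists>s\<in>M. \<forall>l. s - sum f (E l) \<in> F l" by (intro F_limit)
  then obtain s where s: "s \<in> M" "\<And>l. s - sum f (E l) \<in> F l" by blast
  have "filt_has_sum F f I s" unfolding filt_has_sum_def
  proof
    fix l
    have "s - sum f J \<in> F l" if J: "finite J" "E l \<subseteq> J" "J \<subseteq> I" for J
    proof -
      have "sum f J = sum f (E l) + sum f (J - E l)"
        using sum.subset_diff[OF J(2,1), of f] by (simp add: add.commute)
      moreover have "sum f (J - E l) \<in> F l" using J(3) by (intro sum_F) (auto simp: E_def)
      ultimately show ?thesis using diff_F[OF s(2)[of l], of "sum f (J - E l)"] by (simp add: algebra_simps)
    qed
    then show "\<exists>J0. finite J0 \<and> J0 \<subseteq> I \<and> (\<forall>J. finite J \<and> J0 \<subseteq> J \<and> J \<subseteq> I \<longrightarrow> s - sum f J \<in> F l)"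
      using fin[of l] by (intro exI[of _ "E l"]) (auto simp: E_def)
  qed
  then show ?thesis using s(1) by blast
qed

text \<open>The total sum is known to exist, so only finitely many inner sums have to be
  approximated at a time and no uniformity in \<open>i\<close> enters.\<close>

lemma filt_has_sum_Sigma:
  assumes tot: "filt_has_sum F f (Sigma I K) s"
    and inner: "\<And>i. i \<in> I \<Longrightarrow> filt_has_sum F (\<lambda>k. f (i, k)) (K i) (g i)"
  shows "filt_has_sum F g I s"
  unfolding filt_has_sum_def
proof
  fix l
  obtain J0 where J0: "finite J0" "J0 \<subseteq> Sigma I K"
    "\<forall>J. finite J \<longrightarrow> J0 \<subseteq> J \<longrightarrow> J \<subseteq> Sigma I K \<longrightarrow> s - sum f J \<in> F l"
    using tot by (rule filt_has_sumE[where l = l])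
  have "\<forall>i\<in>I. \<exists>Q. finite Q \<and> Q \<subseteq> K i \<and> (\<forall>J. finite J \<and> Q \<subseteq> J \<and> J \<subseteq> K i \<longrightarrow>
      g i - (\<Sum>k\<in>J. f (i, k)) \<in> F l)" (is "\<forall>i\<in>I. \<exists>Q. ?P i Q")
    using inner unfolding filt_has_sum_def by (intro ballI) (rule spec)
  from bchoice[OF this] obtain Q where "\<forall>i\<in>I. ?P i (Q i)" by (rule exE)
  then have Q: "\<And>i. i \<in> I \<Longrightarrow> finite (Q i)" "\<And>i. i \<in> I \<Longrightarrow> Q i \<subseteq> K i"
    "\<And>i J. i \<in> I \<Longrightarrow> finite J \<and> Q i \<subseteq> J \<and> J \<subseteq> K i \<Longrightarrow> g i - (\<Sum>k\<in>J. f (i, k)) \<in> F l"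
    by (simp_all only: Ball_def)
  have "s - sum g J \<in> F l" if J: "finite J" "fst ` J0 \<subseteq> J" "J \<subseteq> I" for J
  proof -
    \<comment> \<open>Over each \<open>i\<close> the finite set contains both the part of
      \<open>J0\<close> over \<open>i\<close> and a set \<open>Q i\<close> that computes the inner
      sum modulo \<open>F l\<close>.\<close>
    define R where "R i = Q i \<union> {k. (i, k) \<in> J0}" for i
    have finR: "finite (R i)" if "i \<in> J" for i
    proof -
      have "{k. (i, k) \<in> J0} \<subseteq> snd ` J0" by force
      then show ?thesis unfolding R_def using Q(1) J(3) J0(1) that finite_subset by blast
    qed
    have RK: "R i \<subseteq> K i" if "i \<in> J" for i using Q(2) J0(2) J(3) that unfolding R_def by auto
    have sub: "J0 \<subseteq> Sigma J R" using J(2) by (force simp: R_def)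
    have "s - sum f (Sigma J R) \<in> F l"
    proof (rule J0(3)[rule_format])
      show "finite (Sigma J R)" using J(1) finR by (rule finite_SigmaI)
      show "Sigma J R \<subseteq> Sigma I K" using J(3) RK by blast
    qed (rule sub)
    moreover have "sum f (Sigma J R) = (\<Sum>i\<in>J. \<Sum>k\<in>R i. f (i, k))"
      using sum.Sigma[of J R "\<lambda>i k. f (i, k)"] J(1) finR by simp
    moreover have "sum g J - (\<Sum>i\<in>J. \<Sum>k\<in>R i. f (i, k)) \<in> F l"
    proof -
      have "g i - (\<Sum>k\<in>R i. f (i, k)) \<in> F l" if "i \<in> J" for i
        using Q(3)[of i "R i"] that finR RK J(3) by (auto simp: R_def)
      then have "(\<Sum>i\<in>J. g i - (\<Sum>k\<in>R i. f (i, k))) \<in> F l" by (rule sum_F)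
      then show ?thesis by (simp add: sum_subtractf)
    qed
    ultimately show ?thesis using diff_F by fastforce
  qed
  then show "\<exists>J0. finite J0 \<and> J0 \<subseteq> I \<and> (\<forall>J. finite J \<and> J0 \<subseteq> J \<and> J \<subseteq> I \<longrightarrow> s - sum g J \<in> F l)"
    using J0 by (intro exI[of _ "fst ` J0"]) auto
qed

lemma filt_has_sum_partition:
  assumes s: "filt_has_sum F f J s" and img: "\<And>j. j \<in> J \<Longrightarrow> p j \<in> I"
    and inner: "\<And>i. i \<in> I \<Longrightarrow> filt_has_sum F f {j\<in>J. p j = i} (g i)"
  shows "filt_has_sum F g I s"
proof -
  have "bij_betw (\<lambda>j. (p j, j)) J (Sigma I (\<lambda>i. {j\<in>J. p j = i}))"
    using img by (auto simp: bij_betw_def inj_on_def)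
  from filt_has_sum_reindex[OF this, of F "\<lambda>(i, j). f j" s] s
  have "filt_has_sum F (\<lambda>(i, j). f j) (Sigma I (\<lambda>i. {j\<in>J. p j = i})) s" by simp
  from filt_has_sum_Sigma[OF this] inner show "filt_has_sum F g I s" by simp
qed

text \<open>Interchange of summations: a null family grouped by the fibres of two different maps has
  the same total. The two sides of a twisted equation are compared in this way.\<close>

lemma filt_has_sum_fibres:
  assumes null: "null_family F f J" and M: "\<And>j. j \<in> J \<Longrightarrow> f j \<in> M"
    and img: "\<And>j. j \<in> J \<Longrightarrow> p j \<in> I"
    and inner: "\<And>i. i \<in> I \<Longrightarrow> filt_has_sum F f {j\<in>J. p j = i} (g i)"
  shows "filt_has_sum F g I (filt_sum F f J)" "filt_has_sum F f J (filt_sum F f J)"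
proof -
  obtain s where s: "filt_has_sum F f J s" using null_family_has_sum[OF null M] by blast
  then show "filt_has_sum F f J (filt_sum F f J)" using filt_sum_eqI by metis
  from filt_has_sum_partition[OF s img inner] have "filt_has_sum F g I s" .
  then show "filt_has_sum F g I (filt_sum F f J)" using s filt_sum_eqI by metis
qed

lemma filt_has_sum_fibres_eq:
  assumes "null_family F f J" "\<And>j. j \<in> J \<Longrightarrow> f j \<in> M" "\<And>j. j \<in> J \<Longrightarrow> p j \<in> I"
    and "\<And>i. i \<in> I \<Longrightarrow> filt_has_sum F f {j\<in>J. p j = i} (g i)"
    and "filt_has_sum F g I s"
  shows "filt_has_sum F f J s"
  using filt_has_sum_fibres[OF assms(1-4)] filt_has_sum_unique[OF _ assms(5)] by auto

end

lemma filt_has_sum_map: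
  assumes "complete_group M F" "filt_has_sum F f I s" "\<And>i. i \<in> I \<Longrightarrow> f i \<in> M" "s \<in> M"
    and add: "\<And>x y. x \<in> M \<Longrightarrow> y \<in> M \<Longrightarrow> h (x + y) = h x + h y"
    and cont: "\<And>l. \<exists>l'. \<forall>x\<in>F l'. h x \<in> F' l"
  shows "filt_has_sum F' (\<lambda>i. h (f i)) I (h s)"
  unfolding filt_has_sum_def
proof
  interpret complete_group M F by fact
  fix l
  obtain l' where l': "\<And>x. x \<in> F l' \<Longrightarrow> h x \<in> F' l" using cont by blast
  obtain J0 where J0: "finite J0" "J0 \<subseteq> I" "\<forall>J. finite J \<longrightarrow> J0 \<subseteq> J \<longrightarrow> J \<subseteq> I \<longrightarrow> s - sum f J \<in> F l'"
    using assms(2) by (rule filt_has_sumE[where l = l'])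
  have h0: "h 0 = 0" using add[of 0 0] zero_M by simp
  have hm: "h (x - y) = h x - h y" if "x \<in> M" "y \<in> M" for x y
    using add[of "x - y" y] that diff_M by (simp add: algebra_simps)
  have sM: "sum f J \<in> M \<and> h (sum f J) = (\<Sum>i\<in>J. h (f i))" if "J \<subseteq> I" for J
    using that by (induction J rule: infinite_finite_induct) (auto simp: add assms(3) h0 zero_M intro: add_M)
  have "h s - (\<Sum>i\<in>J. h (f i)) \<in> F' l" if "finite J" "J0 \<subseteq> J" "J \<subseteq> I" for J
    using l'[OF J0(3)[rule_format, OF that]] hm[OF assms(4), of "sum f J"] sM[OF that(3)] by simp
  then show "\<exists>J0. finite J0 \<and> J0 \<subseteq> I \<and> (\<forall>J. finite J \<and> J0 \<subseteq> J \<and> J \<subseteq> I \<longrightarrow> h s - (\<Sum>i\<in>J. h (f i)) \<in> F' l)"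
    using J0 by blast
qed

section \<open>Chains\<close>

text \<open>Sums of degrees are kept as sums, so that \<open>add_ac\<close> and
  \<open>algebra_simps\<close> can normalise them.\<close>

declare add_bit_eq_xor [simp del] mult_bit_eq_and [simp del]

lemma bit_add_self [simp]: "(a::bit) + a = 0" "(a::bit) + (a + b) = b"
  by (cases a; cases b; simp)+

lemma tgt_append [simp]: "tgt X (p @ r) = tgt (tgt X p) r"
  by (induction X p rule: tgt.induct) auto

lemma is_chain_source: "is_chain Ob H X cs \<Longrightarrow> X \<in> Ob"
  by (cases "(Ob, H, X, cs)" rule: is_chain.cases) auto

lemma is_chain_append: "is_chain Ob H X (p @ r) \<longleftrightarrow> is_chain Ob H X p \<and> is_chain Ob H (tgt X p) r"
  by (induction Ob H X p rule: is_chain.induct) (auto dest: is_chain_source)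

lemma is_chain_tgt: "is_chain Ob H X cs \<Longrightarrow> tgt X cs \<in> Ob"
  by (induction Ob H X cs rule: is_chain.induct) auto

lemma is_chain_mono:
  "is_chain Ob H X cs \<Longrightarrow> Ob \<subseteq> Ob' \<Longrightarrow> is_chain Ob' H X cs"
  by (induction Ob H X cs rule: is_chain.induct) auto

text \<open>Koszul signs and output degrees depend on a chain only through its total reduced degree.\<close>

definition red_deg :: "('o, bit, 'x) chain \<Rightarrow> bit" where
  "red_deg cs = sum_list (map (\<lambda>(d, c, Y). d - 1) cs)"

lemma red_deg_simps [simp]:
  "red_deg [] = 0" "red_deg ((d, c, Y) # cs) = d + 1 + red_deg cs"
  "red_deg (p @ r) = red_deg p + red_deg r"
  by (auto simp: red_deg_def)

lemma koszul_red_deg: "koszul cs x = (if red_deg cs = 0 then x else - x)"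
  unfolding koszul_def red_deg_def ..

lemma deg_out_red_deg: "deg_out n cs = of_int n + red_deg cs"
proof (induction cs)
  case (Cons x cs)
  obtain d c Y where x: "x = (d, c, Y)" by (cases x)
  show ?case using Cons unfolding x deg_out_def by (simp add: algebra_simps)
qed (simp add: deg_out_def)

section \<open>Marked lists: insertions into a chain\<close>

text \<open>A list of exponents cannot be cut at an arbitrary place of the expanded chain, a list
  with marks can. Splittings and block decompositions of expanded chains thereby become those of
  marked lists.\<close>

fun unmark :: "'a option list \<Rightarrow> 'a list" where
  "unmark [] = []"
| "unmark (None # ms) = unmark ms"
| "unmark (Some x # ms) = x # unmark ms"

definition nones :: "'a option list \<Rightarrow> nat" where
  "nones ms = length (filter (\<lambda>x. x = None) ms)"

lemma nones_simps [simp]: "nones [] = 0" "nones (None # ms) = Suc (nones ms)"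
  "nones (Some x # ms) = nones ms" "nones (p @ r) = nones p + nones r"
  by (auto simp: nones_def)

lemma unmark_append [simp]: "unmark (p @ r) = unmark p @ unmark r"
  by (induction p rule: unmark.induct) auto

lemma length_marked: "length ms = nones ms + length (unmark ms)"
  by (induction ms rule: unmark.induct) auto

lemma set_marked: "set ms \<subseteq> insert None (Some ` set (unmark ms))"
  by (induction ms rule: unmark.induct) auto

lemma finite_marked: "finite {ms. unmark ms = cs \<and> nones ms \<le> n}"
proof (rule finite_subset)
  show "{ms. unmark ms = cs \<and> nones ms \<le> n} \<subseteq>
      {ms. set ms \<subseteq> insert None (Some ` set cs) \<and> length ms \<le> n + length cs}"
  proof safe
    fix ms assume "nones ms \<le> n"
    then show "length ms \<le> n + length (unmark ms)" using length_marked[of ms] by simp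
  qed (use set_marked in blast)
qed (intro finite_lists_length_le, simp)

text \<open>Equally many unmarked entries precede the distinguished \<open>Some x\<close> on both
  sides, so the two occurrences are at the same place.\<close>

lemma marked_eq_cancel:
  "P @ Some x # R = P' @ Some x # R' \<Longrightarrow> unmark P = unmark P' \<Longrightarrow> P = P' \<and> R = R'"
proof (induction P P' rule: list_induct2')
  case 1 then show ?case by simp
next
  case (2 y P)
  then show ?case by (cases y) simp_all
next
  case (3 y P)
  then show ?case by (cases y) simp_all
next
  case (4 y P z P')
  from 4(2) have e: "y = z" "P @ Some x # R = P' @ Some x # R'" by simp_all
  from 4(3) have "unmark P = unmark P'" unfolding e by (cases z) simp_all
  from 4(1)[OF e(2) this] e(1) show ?case by simp
qed

text \<open>Insertions before and after a fixed entry are independent, which turns a twisted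
  operation with a distinguished slot into a sum over pairs.\<close>

lemma bij_betw_unmark_split:
  "bij_betw (\<lambda>(P, R). P @ Some x # R) ({P. unmark P = p} \<times> {R. unmark R = r})
     {ms. unmark ms = p @ x # r}"
proof -
  have ex: "\<exists>P R. ms = P @ Some x # R \<and> unmark P = p \<and> unmark R = r" if "unmark ms = p @ x # r" for ms p
    using that
  proof (induction ms arbitrary: p rule: unmark.induct)
    case (2 ms)
    then obtain P R where "ms = P @ Some x # R" "unmark P = p" "unmark R = r" by auto
    then show ?case by - (rule exI[of _ "None # P"], rule exI[of _ R], auto)
  next
    case (3 y ms)
    show ?case
    proof (cases p)
      case Nil
      with 3 show ?thesis by - (rule exI[of _ "[]"], rule exI[of _ ms], auto)
    next
      case (Cons a p')
      with 3 obtain P R where "ms = P @ Some x # R" "unmark P = p'" "unmark R = r" by auto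
      with 3 Cons show ?thesis by - (rule exI[of _ "Some y # P"], rule exI[of _ R], auto)
    qed
  qed simp
  show ?thesis unfolding bij_betw_def
  proof (intro conjI)
    show "inj_on (\<lambda>(P, R). P @ Some x # R) ({P. unmark P = p} \<times> {R. unmark R = r})"
      by (intro inj_onI) (auto dest: marked_eq_cancel)
  qed (use ex in force)
qed

fun mark_exponents :: "'a list \<Rightarrow> nat list \<Rightarrow> 'a option list" where
  "mark_exponents [] (i # is) = replicate i None"
| "mark_exponents (c # cs) (i # is) = replicate i None @ Some c # mark_exponents cs is"
| "mark_exponents cs [] = []"

lemma unmark_replicate [simp]: "unmark (replicate i None) = []"
  by (induction i) auto

lemma unmark_Nil_iff: "unmark ms = [] \<longleftrightarrow> ms = replicate (length ms) None"
  by (induction ms rule: unmark.induct) auto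

lemma replicate_None_Some_cancel:
  "replicate i None @ Some c # xs = replicate j None @ Some c # ys \<longleftrightarrow> i = j \<and> xs = ys"
proof (induction i arbitrary: j)
  case 0 then show ?case by (cases j) auto
next
  case (Suc i) then show ?case by (cases j) auto
qed

text \<open>Passes from lists of exponents, which index the sums in \<open>bc_all\<close> and
  \<open>bc_functor\<close>, to marked lists.\<close>

lemma bij_betw_mark_exponents:
  "bij_betw (mark_exponents cs) {is. length is = Suc (length cs)} {ms. unmark ms = cs}"
proof -
  have un: "unmark (mark_exponents cs is) = cs" if "length is = Suc (length cs)" for "is"
    using that by (induction cs "is" rule: mark_exponents.induct) auto
  have inj: "is = js" if "mark_exponents cs is = mark_exponents cs js" "length is = Suc (length cs)"
    "length js = Suc (length cs)" for "is" js
    using that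
  proof (induction cs "is" arbitrary: js rule: mark_exponents.induct)
    case (1 i "is")
    then obtain j where "js = [j]" by (cases js) auto
    with 1 show ?case by (auto dest: arg_cong[of _ _ length])
  next
    case (2 c cs i "is")
    then obtain j js' where "js = j # js'" by (cases js) auto
    with 2 show ?case by (simp add: replicate_None_Some_cancel)
  qed auto
  have sur: "\<exists>is. length is = Suc (length cs) \<and> mark_exponents cs is = ms" if "unmark ms = cs" for ms cs
    using that
  proof (induction cs arbitrary: ms)
    case Nil
    then have "mark_exponents [] [length ms] = ms" using unmark_Nil_iff[of ms] by simp
    then show ?case by (intro exI[of _ "[length ms]"]) simp
  next
    case (Cons c cs)
    then have "ms \<in> (\<lambda>(P, R). P @ Some c # R) ` ({P. unmark P = []} \<times> {R. unmark R = cs})"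
      using bij_betw_imp_surj_on[OF bij_betw_unmark_split[of c "[]" cs]] by auto
    then obtain P R where PR: "ms = P @ Some c # R" "unmark P = []" "unmark R = cs" by auto
    obtain "is" where "length is = Suc (length cs)" "mark_exponents cs is = R" using Cons.IH PR by blast
    moreover have "replicate (length P) None = P" using PR(2) unmark_Nil_iff by metis
    ultimately show ?case using PR by (intro exI[of _ "length P # is"]) simp
  qed
  have "{ms. unmark ms = cs} \<subseteq> mark_exponents cs ` {is. length is = Suc (length cs)}"
  proof
    fix ms assume "ms \<in> {ms. unmark ms = cs}"
    from sur[OF this[unfolded mem_Collect_eq]]
    show "ms \<in> mark_exponents cs ` {is. length is = Suc (length cs)}" by auto
  qed
  moreover have "inj_on (mark_exponents cs) {is. length is = Suc (length cs)}"
    by (rule inj_onI, rule inj) simp_all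
  moreover have "mark_exponents cs ` {is. length is = Suc (length cs)} \<subseteq> {ms. unmark ms = cs}"
    using un by auto
  ultimately show ?thesis unfolding bij_betw_def by auto
qed

text \<open>In a marked chain the entries \<open>None\<close> stand for the deformation parameter of the current object.\<close>

fun realize :: "'o \<times> 'm \<Rightarrow> (bit \<times> 'm \<times> 'o \<times> 'm) option list \<Rightarrow> ('o, bit, 'm) chain" where
  "realize U [] = []"
| "realize U (None # ms) = (1, snd U, fst U) # realize U ms"
| "realize U (Some (d, c, V) # ms) = (d, c, fst V) # realize V ms"

lemma realize_append [simp]: "realize U (P @ R) = realize U P @ realize (tgt U (unmark P)) R"
  by (induction U P rule: realize.induct) auto

lemma length_realize [simp]: "length (realize U ms) = length ms"
  by (induction U ms rule: realize.induct) auto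

lemma tgt_realize [simp]: "tgt (fst U) (realize U ms) = fst (tgt U (unmark ms))"
  by (induction U ms rule: realize.induct) auto

lemma red_deg_realize [simp]: "red_deg (realize U ms) = red_deg (unmark ms)"
  by (induction U ms rule: realize.induct) auto

lemma insert_mc_realize:
  "length is = Suc (length cs) \<Longrightarrow> insert_mc U is cs = realize U (mark_exponents cs is)"
proof (induction U "is" cs rule: insert_mc.induct)
  case (1 X a i "is")
  have "realize (X, a) (replicate i None) = replicate i (1, a, X)" by (induction i) auto
  with 1 show ?case by simp
next
  case (2 X a i "is" d c Y b cs)
  have "realize (X, a) (replicate i None) = replicate i (1, a, X)" by (induction i) auto
  with 2 show ?case by simp
qed auto

text \<open>\<open>realize\<close> preserves lengths, so a splitting of the expanded chain is cut
  out by the same positions of the marked list, also inside a run of inserted elements.\<close>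

lemma bij_betw_realize_splits:
  "bij_betw (\<lambda>(P, Q, R). (realize U P, realize (tgt U (unmark P)) Q, realize (tgt U (unmark (P @ Q))) R))
     {(P, Q, R). P @ Q @ R = ms} {(p, q, r). p @ q @ r = realize U ms}" (is "bij_betw ?h ?A ?B")
proof -
  have "inj_on ?h ?A" by (auto simp: inj_on_def dest!: arg_cong[of "realize _ _" _ length])
  moreover have "?h ` ?A \<subseteq> ?B" by auto
  moreover have "?B \<subseteq> ?h ` ?A"
  proof safe
    fix p q r assume pqr: "p @ q @ r = realize U ms"
    define P where "P = take (length p) ms"
    define Q where "Q = take (length q) (drop (length p) ms)"
    define R where "R = drop (length p + length q) ms"
    have ms: "ms = P @ Q @ R" unfolding P_def Q_def R_def by (metis append_take_drop_id drop_drop add.commute)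
    have "length ms = length p + length q + length r" using arg_cong[OF pqr, of length] by simp
    then have len: "length P = length p" "length Q = length q" unfolding P_def Q_def by auto
    have "p @ q @ r = realize U P @ realize (tgt U (unmark P)) Q @ realize (tgt U (unmark (P @ Q))) R"
      using pqr ms by simp
    then have "(p, q, r) = ?h (P, Q, R)" using len by (simp add: append_eq_append_conv)
    then show "(p, q, r) \<in> ?h ` ?A" using ms by blast
  qed
  ultimately show ?thesis unfolding bij_betw_def by blast
qed

lemma finite_splits: "finite {(p, q, r). p @ q @ r = cs}"
proof (rule finite_subset)
  show "{(p, q, r). p @ q @ r = cs} \<subseteq>
    (\<lambda>(i, j). (take i cs, take j (drop i cs), drop j (drop i cs))) ` ({..length cs} \<times> {..length cs})"
  proof safe
    fix p q r :: "'a list"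
    show "(p, q, r) \<in> (\<lambda>(i, j). (take i (p @ q @ r), take j (drop i (p @ q @ r)), drop j (drop i (p @ q @ r))))
       ` ({..length (p @ q @ r)} \<times> {..length (p @ q @ r)})"
      by (intro image_eqI[of _ _ "(length p, length q)"]) auto
  qed
qed simp

section \<open>Filtration levels of chains\<close>

text \<open>An element has no preferred level, so only a lower bound \<open>l\<close> for the total
  level is kept and the levels of the entries are quantified away. The axioms carry these levels as
  data instead.\<close>

fun filt_chain :: "('o, 'm, 'z) filt_ainf_scheme \<Rightarrow> 'o \<Rightarrow> ('o, bit, 'm) chain \<Rightarrow> int \<Rightarrow> bool" where
  "filt_chain A X [] l \<longleftrightarrow> X \<in> obj A \<and> l \<le> 0"
| "filt_chain A X ((d, c, Y) # cs) l \<longleftrightarrow>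
     X \<in> obj A \<and> (\<exists>l1. c \<in> fil A X Y d l1 \<and> filt_chain A Y cs (l - l1))"

lemma filt_chain_mono: "filt_chain A X cs l \<Longrightarrow> l' \<le> l \<Longrightarrow> filt_chain A X cs l'"
proof (induction A X cs l arbitrary: l' rule: filt_chain.induct)
  case (2 A X d c Y cs l)
  then obtain l1 where "c \<in> fil A X Y d l1" "filt_chain A Y cs (l - l1)" by auto
  moreover have "filt_chain A Y cs (l' - l1)" using 2(1)[of l1 "l' - l1"] 2(3) calculation by simp
  ultimately show ?case using 2 by auto
qed auto

lemma filt_chain_source: "filt_chain A X cs l \<Longrightarrow> X \<in> obj A"
  by (cases "(A, X, cs, l)" rule: filt_chain.cases) auto

lemma filt_chain_tgt: "filt_chain A X cs l \<Longrightarrow> tgt X cs \<in> obj A"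
  by (induction A X cs l rule: filt_chain.induct) auto

lemma filt_chain_append:
  "filt_chain A X p l \<Longrightarrow> filt_chain A (tgt X p) r l' \<Longrightarrow> filt_chain A X (p @ r) (l + l')"
proof (induction A X p l rule: filt_chain.induct)
  case (1 A X l)
  then show ?case using filt_chain_mono[of A X r l' "l + l'"] by simp
next
  case (2 A X d c Y cs l)
  then obtain l1 where l1: "c \<in> fil A X Y d l1" "filt_chain A Y cs (l - l1)" by auto
  then have "filt_chain A Y (cs @ r) (l - l1 + l')" using 2 by auto
  then have "filt_chain A Y (cs @ r) (l + l' - l1)" by (simp add: algebra_simps)
  then show ?case using l1 2 by auto
qed

text \<open>The slack of the bound is pushed into the right-hand part, so that the two bounds add up
  to exactly \<open>l\<close>.\<close>

lemma filt_chain_appendE: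
  assumes "filt_chain A X (p @ r) l"
  obtains l1 l2 where "filt_chain A X p l1" "filt_chain A (tgt X p) r l2" "l = l1 + l2"
proof -
  have "\<exists>l1 l2. filt_chain A X p l1 \<and> filt_chain A (tgt X p) r l2 \<and> l = l1 + l2"
    using assms
  proof (induction p arbitrary: X l)
    case Nil
    then show ?case by (intro exI[of _ 0] exI[of _ l]) (auto dest: filt_chain_source)
  next
    case (Cons x p)
    obtain d c Y where x: "x = (d, c, Y)" by (cases x)
    with Cons.prems obtain m where m: "X \<in> obj A" "c \<in> fil A X Y d m" "filt_chain A Y (p @ r) (l - m)" by auto
    from Cons.IH[OF m(3)] obtain l1 l2 where "filt_chain A Y p l1" "filt_chain A (tgt Y p) r l2" "l - m = l1 + l2"
      by blast
    then show ?case using m x by (intro exI[of _ "m + l1"] exI[of _ l2]) auto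
  qed
  then show thesis using that by blast
qed

lemma filt_chain_single: "X \<in> obj A \<Longrightarrow> Y \<in> obj A \<Longrightarrow> c \<in> fil A X Y d l \<Longrightarrow> filt_chain A X [(d, c, Y)] l"
  by auto

lemma filt_chain_level:
  assumes "filt_chain A X cs l"
  obtains ls where "is_chain (obj A) (\<lambda>X Y (d, l). fil A X Y d l) X ls" "forget_level ls = cs"
    "l \<le> level ls" "tgt X ls = tgt X cs"
proof -
  have "\<exists>ls. is_chain (obj A) (\<lambda>X Y (d, l). fil A X Y d l) X ls \<and> forget_level ls = cs \<and>
    l \<le> level ls \<and> tgt X ls = tgt X cs"
    using assms
  proof (induction A X cs l rule: filt_chain.induct)
    case (1 A X l)
    then show ?case by (intro exI[of _ "[]"]) (auto simp: forget_level_def level_def)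
  next
    case (2 A X d c Y cs l)
    then obtain l1 where l1: "c \<in> fil A X Y d l1" "filt_chain A Y cs (l - l1)" by auto
    from 2(1)[OF l1(2)] obtain ls where "is_chain (obj A) (\<lambda>X Y (d, l). fil A X Y d l) Y ls"
      "forget_level ls = cs" "l - l1 \<le> level ls" "tgt Y ls = tgt Y cs" by blast
    then show ?case using 2(2) l1(1)
      by (intro exI[of _ "((d, l1), c, Y) # ls"]) (auto simp: forget_level_def level_def)
  qed
  then show thesis using that by blast
qed

text \<open>The formula for the operations of \<open>bc_all\<close> does not mention its set of
  objects, so it makes sense for every pair with \<open>a\<close> of level 1. The curvature of
  \<open>(X, a)\<close> is then the defect of \<open>a\<close> in the Maurer-Cartan
  equation.\<close>

definition twist :: "('o, 'm::ab_group_add, 'z) filt_ainf_scheme \<Rightarrow> ('o \<times> 'm, 'm) filt_ainf" where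
  "twist A = \<lparr>obj = {(X, a). X \<in> obj A \<and> a \<in> fil A X X 1 1}, mor = (\<lambda>U V. mor A (fst U) (fst V)),
     mu = mu (bc_all A), fil = (\<lambda>U V. fil A (fst U) (fst V))\<rparr>"

lemma twist_simps [simp]:
  "obj (twist A) = {(X, a). X \<in> obj A \<and> a \<in> fil A X X 1 1}"
  "mor (twist A) = (\<lambda>U V. mor A (fst U) (fst V))" "mu (twist A) = mu (bc_all A)"
  "fil (twist A) = (\<lambda>U V. fil A (fst U) (fst V))"
  by (auto simp: twist_def)

text \<open>Inserted elements lie in level 1, so each mark raises the bound by one. This is what
  makes the sums over insertions converge.\<close>

lemma filt_chain_realize:
  "filt_chain (twist A) U (unmark ms) l \<Longrightarrow> filt_chain A (fst U) (realize U ms) (l + int (nones ms))"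
proof (induction U ms arbitrary: l rule: realize.induct)
  case (2 U ms)
  have "U \<in> obj (twist A)" using 2(2) filt_chain_source by fastforce
  moreover have "filt_chain A (fst U) (realize U ms) (l + int (nones ms))" using 2 by simp
  ultimately show ?case by (auto intro!: exI[of _ 1])
next
  case (3 U d c V ms)
  then obtain l1 where "c \<in> fil A (fst U) (fst V) d l1" "filt_chain (twist A) V (unmark ms) (l - l1)" by auto
  moreover from 3(1)[OF this(2)] have "filt_chain A (fst V) (realize V ms) (l + int (nones ms) - l1)"
    by (simp add: algebra_simps)
  ultimately show ?case using 3(2) by auto
qed auto

section \<open>Twisting filtered operations\<close>

text \<open>Exhaustiveness gives each of the finitely many entries some level, and these add
  up.\<close>

lemma is_chain_iff_filt_chain_complete:
  assumes compl: "\<And>X Y d. X \<in> obj A \<Longrightarrow> Y \<in> obj A \<Longrightarrow> complete_group (mor A X Y d) (fil A X Y d)"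
  shows "is_chain (obj A) (mor A) X cs \<longleftrightarrow> (\<exists>l. filt_chain A X cs l)"
proof
  assume "is_chain (obj A) (mor A) X cs"
  then show "\<exists>l. filt_chain A X cs l"
  proof (induction cs arbitrary: X)
    case Nil then show ?case by (auto intro: exI[of _ 0])
  next
    case (Cons x cs)
    obtain d c Y where x: "x = (d, c, Y)" by (cases x)
    with Cons.prems have h: "X \<in> obj A" "c \<in> mor A X Y d" "is_chain (obj A) (mor A) Y cs" by auto
    from is_chain_source[OF h(3)] h obtain l1 where l1: "c \<in> fil A X Y d l1"
      using complete_group.F_exhaust[OF compl] by metis
    obtain l2 where "filt_chain A Y cs l2" using Cons.IH h by blast
    then show ?case using x h l1 by (intro exI[of _ "l1 + l2"]) auto
  qed
next
  assume "\<exists>l. filt_chain A X cs l"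
  then obtain l where "filt_chain A X cs l" by blast
  then show "is_chain (obj A) (mor A) X cs"
  proof (induction cs arbitrary: X l)
    case (Cons x cs)
    obtain d c Y where x: "x = (d, c, Y)" by (cases x)
    with Cons show ?case by (auto intro: complete_group.F_sub_M[OF compl] dest: filt_chain_source)
  qed auto
qed

lemma filt_chain_of_level:
  assumes "is_chain (obj A) (\<lambda>X Y (d, l). fil A X Y d l) X ls"
  shows "filt_chain A X (forget_level ls) (level ls)" "tgt X (forget_level ls) = tgt X ls"
  using assms
proof (induction ls arbitrary: X)
  case Nil
  { case 1 then show ?case by (simp add: forget_level_def level_def) }
  { case 2 then show ?case by (simp add: forget_level_def level_def) }
next
  case (Cons x ls)
  obtain d l c Y where x: "x = ((d, l), c, Y)" by (metis prod.collapse)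
  { case 1 then show ?case using Cons.IH(1)[of Y] x
      by (auto simp: forget_level_def level_def intro!: exI[of _ l]) }
  { case 2 then show ?case using Cons.IH(2)[of Y] x by (auto simp: forget_level_def level_def) }
qed

context curved_filtered_ainf_category
begin

lemma complete_group_fil: "X \<in> obj A \<Longrightarrow> Y \<in> obj A \<Longrightarrow> complete_group (mor A X Y d) (fil A X Y d)"
  using fil_complete by (simp add: complete_group_def)

lemma fil_sub_mor: "X \<in> obj A \<Longrightarrow> Y \<in> obj A \<Longrightarrow> c \<in> fil A X Y d l \<Longrightarrow> c \<in> mor A X Y d"
  using complete_group.F_sub_M[OF complete_group_fil] .

lemma is_chain_iff_filt_chain: "is_chain (obj A) (mor A) X cs \<longleftrightarrow> (\<exists>l. filt_chain A X cs l)"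
  by (rule is_chain_iff_filt_chain_complete) (rule complete_group_fil)

lemma filt_chain_is_chain: "filt_chain A X cs l \<Longrightarrow> is_chain (obj A) (mor A) X cs"
  using is_chain_iff_filt_chain by blast

end

text \<open>Common setting for the operations of a category (\<open>n = 2\<close>) and the
  components of a functor (\<open>n = 1\<close>). The target groups are indexed by objects of the
  source, so that for a functor they are the morphisms from \<open>G X\<close> to
  \<open>G Y\<close>.\<close>

locale filtered_op =
  src: curved_filtered_ainf_category FK scale A + tm: module scale'
  for FK :: "int \<Rightarrow> 'k::comm_ring_1 set" and scale :: "'k \<Rightarrow> 'm::ab_group_add \<Rightarrow> 'm"
    and A :: "('o, 'm, 'z) filt_ainf_scheme" and scale' :: "'k \<Rightarrow> 'n::ab_group_add \<Rightarrow> 'n" +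
  fixes TM :: "'o \<Rightarrow> 'o \<Rightarrow> bit \<Rightarrow> 'n set" and T :: "'o \<Rightarrow> 'o \<Rightarrow> bit \<Rightarrow> int \<Rightarrow> 'n set"
    and op :: "'o \<Rightarrow> ('o, bit, 'm) chain \<Rightarrow> 'n" and n :: int
  assumes T_complete: "X \<in> obj A \<Longrightarrow> Y \<in> obj A \<Longrightarrow> complete_group (TM X Y d) (T X Y d)"
    and T_scale: "X \<in> obj A \<Longrightarrow> Y \<in> obj A \<Longrightarrow> k \<in> FK l \<Longrightarrow> c \<in> T X Y d l' \<Longrightarrow>
      scale' k c \<in> T X Y d (l + l')"
    and op_multilinear: "multilinear scale scale' (obj A) (mor A) op"
    and op_filtered: "is_chain (obj A) (\<lambda>X Y (d, l). fil A X Y d l) X ls \<Longrightarrow>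
      op X (forget_level ls) \<in> T X (tgt X ls) (deg_out n (forget_level ls)) (level ls)"
    and op_curvature: "X \<in> obj A \<Longrightarrow> op X [] \<in> T X X (of_int n) 1"
begin

lemma op_filt_chain: assumes "filt_chain A X cs l" shows "op X cs \<in> T X (tgt X cs) (deg_out n cs) l"
proof -
  obtain ls where ls: "is_chain (obj A) (\<lambda>X Y (d, l). fil A X Y d l) X ls" "forget_level ls = cs"
    "l \<le> level ls" "tgt X ls = tgt X cs"
    using filt_chain_level[OF assms] by metis
  have "op X cs \<in> T X (tgt X cs) (deg_out n cs) (level ls)" using op_filtered[OF ls(1)] ls by simp
  then show ?thesis
    using complete_group.F_mono[OF T_complete] ls(3) filt_chain_source[OF assms] filt_chain_tgt[OF assms] by metis
qed

lemma op_mor: "is_chain (obj A) (mor A) X cs \<Longrightarrow> op X cs \<in> TM X (tgt X cs) (deg_out n cs)"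
  using op_filt_chain complete_group.F_sub_M[OF T_complete] is_chain_source is_chain_tgt
  unfolding src.is_chain_iff_filt_chain by (metis filt_chain_source filt_chain_tgt)

lemma op_add:
  "is_chain (obj A) (mor A) X (p @ (d, c, Y) # r) \<Longrightarrow> is_chain (obj A) (mor A) X (p @ (d, c', Y) # r) \<Longrightarrow>
    op X (p @ (d, c + c', Y) # r) = op X (p @ (d, c, Y) # r) + op X (p @ (d, c', Y) # r)"
  using op_multilinear unfolding multilinear_def by meson

lemma op_scale:
  "is_chain (obj A) (mor A) X (p @ (d, c, Y) # r) \<Longrightarrow>
    op X (p @ (d, scale k c, Y) # r) = scale' k (op X (p @ (d, c, Y) # r))"
  using op_multilinear unfolding multilinear_def by meson

text \<open>By exhaustiveness the fixed entries have levels \<open>lp\<close> and \<open>lr\<close>,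
  so the output level follows that of the slot up to a constant shift. \<open>c0\<close> only serves
  to write the output degree, which depends on \<open>d\<close> alone.\<close>

lemma op_slot_continuous:
  assumes p: "is_chain (obj A) (mor A) X p" and r: "is_chain (obj A) (mor A) Y r"
  shows "\<exists>l'. \<forall>c\<in>fil A (tgt X p) Y d l'. op X (p @ (d, c, Y) # r) \<in> T X (tgt Y r) (deg_out n (p @ (d, c0, Y) # r)) l"
proof -
  obtain lp lr where l: "filt_chain A X p lp" "filt_chain A Y r lr"
    using p r unfolding src.is_chain_iff_filt_chain by blast
  have "op X (p @ (d, c, Y) # r) \<in> T X (tgt Y r) (deg_out n (p @ (d, c0, Y) # r)) l"
    if "c \<in> fil A (tgt X p) Y d (l - lp - lr)" for c
  proof -
    have "filt_chain A (tgt X p) ((d, c, Y) # r) (l - lp)"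
      using l that filt_chain_tgt[OF l(1)] by (auto intro!: exI[of _ "l - lp - lr"])
    from filt_chain_append[OF l(1) this] have "filt_chain A X (p @ (d, c, Y) # r) l" by simp
    from op_filt_chain[OF this] show ?thesis by (simp add: deg_out_red_deg)
  qed
  then show ?thesis by blast
qed

lemma op_slot_sum:
  assumes p: "is_chain (obj A) (mor A) X p" and r: "is_chain (obj A) (mor A) Y r"
    and f: "\<And>i. i \<in> I \<Longrightarrow> f i \<in> mor A (tgt X p) Y d" "s \<in> mor A (tgt X p) Y d"
    and sum: "filt_has_sum (fil A (tgt X p) Y d) f I s"
  shows "filt_has_sum (T X (tgt Y r) (deg_out n (p @ (d, c0, Y) # r)))
    (\<lambda>i. op X (p @ (d, f i, Y) # r)) I (op X (p @ (d, s, Y) # r))"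
proof (rule filt_has_sum_map[where h = "\<lambda>c. op X (p @ (d, c, Y) # r)", OF _ sum f])
  show "complete_group (mor A (tgt X p) Y d) (fil A (tgt X p) Y d)"
    using src.complete_group_fil is_chain_tgt[OF p] is_chain_source[OF r] by blast
  show "op X (p @ (d, x + y, Y) # r) = op X (p @ (d, x, Y) # r) + op X (p @ (d, y, Y) # r)"
    if "x \<in> mor A (tgt X p) Y d" "y \<in> mor A (tgt X p) Y d" for x y
    using that p r by (intro op_add) (auto simp: is_chain_append intro: is_chain_tgt)
qed (use op_slot_continuous[OF p r] in blast)+

text \<open>Specialises to the operations of \<open>bc_all\<close>, to \<open>push_mc\<close> on the
  empty chain, and to the components of \<open>bc_functor\<close> on nonempty ones.\<close>

definition twist_op :: "'o \<times> 'm \<Rightarrow> ('o \<times> 'm, bit, 'm) chain \<Rightarrow> 'n" where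
  "twist_op U cs = filt_sum (T (fst U) (fst (tgt U cs)) (deg_out n cs))
     (\<lambda>is. op (fst U) (insert_mc U is cs)) {is. length is = Suc (length cs)}"

lemma op_realize:
  assumes "filt_chain (twist A) U (unmark ms) l"
  shows "op (fst U) (realize U ms) \<in> T (fst U) (fst (tgt U (unmark ms))) (deg_out n (unmark ms)) (l + int (nones ms))"
  using op_filt_chain[OF filt_chain_realize[OF assms]] by (simp add: deg_out_red_deg)

lemma T_twist_complete:
  assumes "filt_chain (twist A) U cs l"
  shows "complete_group (TM (fst U) (fst (tgt U cs)) d) (T (fst U) (fst (tgt U cs)) d)"
  using filt_chain_source[OF assms] filt_chain_tgt[OF assms] by (intro T_complete) auto

lemma null_family_realize:
  assumes "filt_chain (twist A) U cs l"
  shows "null_family (T (fst U) (fst (tgt U cs)) (deg_out n cs)) (\<lambda>ms. op (fst U) (realize U ms)) {ms. unmark ms = cs}"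
proof (rule null_family_weight[where w = nones])
  show "finite {i \<in> {ms. unmark ms = cs}. nones i \<le> N}" for N using finite_marked[of cs N] by simp
  show "op (fst U) (realize U ms) \<in> T (fst U) (fst (tgt U cs)) (deg_out n cs) (l + int (nones ms))"
    if "ms \<in> {ms. unmark ms = cs}" for ms
    using op_realize[of U ms l] that assms by simp
qed (rule complete_group.F_antimono[OF T_twist_complete[OF assms]])

lemma twist_op_sum:
  assumes "filt_chain (twist A) U cs l"
  shows "filt_has_sum (T (fst U) (fst (tgt U cs)) (deg_out n cs)) (\<lambda>ms. op (fst U) (realize U ms))
    {ms. unmark ms = cs} (twist_op U cs)"
proof -
  interpret c: complete_group "TM (fst U) (fst (tgt U cs)) (deg_out n cs)" "T (fst U) (fst (tgt U cs)) (deg_out n cs)"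
    by (rule T_twist_complete[OF assms])
  have "op (fst U) (realize U ms) \<in> TM (fst U) (fst (tgt U cs)) (deg_out n cs)" if "unmark ms = cs" for ms
    using op_realize[of U ms l] assms that c.F_sub_M by blast
  then obtain s where s: "filt_has_sum (T (fst U) (fst (tgt U cs)) (deg_out n cs)) (\<lambda>ms. op (fst U) (realize U ms))
    {ms. unmark ms = cs} s"
    using c.null_family_has_sum[OF null_family_realize[OF assms]] by blast
  moreover have "filt_has_sum (T (fst U) (fst (tgt U cs)) (deg_out n cs))
      (\<lambda>is. op (fst U) (insert_mc U is cs)) {is. length is = Suc (length cs)} s"
    using filt_has_sum_reindex[OF bij_betw_mark_exponents[of cs], of _ "\<lambda>ms. op (fst U) (realize U ms)"] s
    by (subst filt_has_sum_cong[where g = "\<lambda>is. op (fst U) (realize U (mark_exponents cs is))"])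
      (auto simp: insert_mc_realize)
  ultimately show ?thesis unfolding twist_op_def by (simp only: c.filt_sum_eqI)
qed

lemma twist_op_filt_chain:
  assumes "filt_chain (twist A) U cs l"
  shows "twist_op U cs \<in> T (fst U) (fst (tgt U cs)) (deg_out n cs) l"
proof -
  interpret c: complete_group "TM (fst U) (fst (tgt U cs)) (deg_out n cs)" "T (fst U) (fst (tgt U cs)) (deg_out n cs)"
    by (rule T_twist_complete[OF assms])
  have "op (fst U) (realize U ms) \<in> T (fst U) (fst (tgt U cs)) (deg_out n cs) l" if "unmark ms = cs" for ms
    using op_realize[of U ms l] assms that c.F_mono[of _ "l + int (nones ms)" l] by simp
  then show ?thesis using c.filt_has_sum_in[OF twist_op_sum[OF assms]] by simp
qed

lemma realize_map_Some: "realize U (map Some cs) = map (\<lambda>(d, c, V). (d, c, fst V)) cs"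
proof (induction cs arbitrary: U)
  case (Cons x cs) then show ?case by (cases x) auto
qed auto

lemma unmark_map_Some: "unmark (map Some cs) = cs" by (induction cs) auto

lemma nones_0_imp: "nones ms = 0 \<Longrightarrow> ms = map Some (unmark ms)"
  by (induction ms rule: unmark.induct) auto

text \<open>Hence twisted and untwisted operations have the same associated graded.\<close>

lemma twist_op_approx:
  assumes "filt_chain (twist A) U cs l"
  shows "twist_op U cs - op (fst U) (map (\<lambda>(d, c, V). (d, c, fst V)) cs)
    \<in> T (fst U) (fst (tgt U cs)) (deg_out n cs) (l + 1)"
proof -
  interpret c: complete_group "TM (fst U) (fst (tgt U cs)) (deg_out n cs)" "T (fst U) (fst (tgt U cs)) (deg_out n cs)"
    by (rule T_twist_complete[OF assms])
  have "op (fst U) (realize U ms) \<in> T (fst U) (fst (tgt U cs)) (deg_out n cs) (l + 1)"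
    if "ms \<in> {ms. unmark ms = cs} - {map Some cs}" for ms
  proof -
    have "nones ms \<noteq> 0" using that nones_0_imp[of ms] by auto
    then show ?thesis using op_realize[of U ms l] assms that c.F_mono[of _ "l + int (nones ms)" "l + 1"] by simp
  qed
  from c.filt_has_sum_approx[OF twist_op_sum[OF assms], of "{map Some cs}" "l + 1", OF _ _ this]
  show ?thesis by (simp add: unmark_map_Some realize_map_Some)
qed

text \<open>The term without insertions is the curvature of \<open>op\<close>, which has level 1;
  every other term contains an inserted element.\<close>

lemma twist_op_curvature:
  assumes "U \<in> obj (twist A)" shows "twist_op U [] \<in> T (fst U) (fst U) (of_int n) 1"
proof -
  have U: "filt_chain (twist A) U [] 0" using assms by simp
  interpret c: complete_group "TM (fst U) (fst U) (of_int n)" "T (fst U) (fst U) (of_int n)"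
    using T_twist_complete[OF U] by simp
  have "op (fst U) (realize U ms) \<in> T (fst U) (fst U) (of_int n) 1" if "unmark ms = []" for ms
  proof (cases "ms = []")
    case True
    then show ?thesis using op_curvature assms by auto
  next
    case False
    then have "1 \<le> nones ms" using that length_marked[of ms] by (cases ms) auto
    then show ?thesis using op_realize[of U ms 0] that U c.F_mono[of _ "int (nones ms)" 1]
      by (simp add: deg_out_red_deg)
  qed
  note level = this
  have "filt_has_sum (T (fst U) (fst U) (of_int n)) (\<lambda>ms. op (fst U) (realize U ms))
      {ms. unmark ms = []} (twist_op U [])"
    using twist_op_sum[OF U] by (simp add: deg_out_red_deg)
  from c.filt_has_sum_in[OF this] show ?thesis using level by simp
qed

lemma twist_op_slot_sum:
  assumes "filt_chain (twist A) U (p @ (d, c, V) # r) l"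
  shows "filt_has_sum (T (fst U) (fst (tgt V r)) (deg_out n (p @ (d, c, V) # r)))
    (\<lambda>(P, R). op (fst U) (realize U P @ (d, c, fst V) # realize V R))
    ({P. unmark P = p} \<times> {R. unmark R = r}) (twist_op U (p @ (d, c, V) # r))"
proof -
  have eq: "op (fst U) (realize U ((\<lambda>(P, R). P @ Some (d, c, V) # R) j)) =
    (\<lambda>(P, R). op (fst U) (realize U P @ (d, c, fst V) # realize V R)) j" for j
    by (cases j) simp
  from twist_op_sum[OF assms]
  have "filt_has_sum (T (fst U) (fst (tgt V r)) (deg_out n (p @ (d, c, V) # r)))
      (\<lambda>ms. op (fst U) (realize U ms)) {ms. unmark ms = p @ (d, c, V) # r} (twist_op U (p @ (d, c, V) # r))"
    by simp
  then show ?thesis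
    unfolding filt_has_sum_reindex[OF bij_betw_unmark_split[of "(d, c, V)" p r], symmetric] eq .
qed

end

lemma (in complete_group) koszul_F [simp]: "koszul cs x \<in> F l \<longleftrightarrow> x \<in> F l"
  by (simp add: koszul_red_deg)

lemma (in complete_group) filt_has_sum_koszul:
  "filt_has_sum F f I s \<Longrightarrow> filt_has_sum F (\<lambda>i. koszul cs (f i)) I (koszul cs s)"
  using filt_has_sum_uminus[of f I s] by (simp add: koszul_red_deg)

lemma koszul_realize [simp]: "koszul (realize U ms) x = koszul (unmark ms) x"
  by (simp add: koszul_red_deg)

context curved_filtered_ainf_category
begin

lemma filtered_op_mu: "filtered_op FK scale A scale (mor A) (fil A) (mu A) 2"
  by unfold_locales (use fil_complete fil_scale mu_multilinear mu_filtered curvature_filtered in auto)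

sublocale mu: filtered_op FK scale A scale "mor A" "fil A" "mu A" 2
  by (rule filtered_op_mu)

lemma mu_twist: "mu (bc_all A) = mu.twist_op"
  by (intro ext) (simp add: bc_all_def mu.twist_op_def)

end

context filtered_op
begin

text \<open>Both sides regroup one family, indexed by marked lists \<open>P\<close>,
  \<open>Q\<close>, \<open>R\<close>: an inner operation on the expansion of \<open>Q\<close>,
  placed between the expansions of \<open>P\<close> and \<open>R\<close>. Grouping by
  \<open>P @ Q @ R\<close> gives untwisted expressions, grouping by the unmarked lists gives twisted
  operations inside twisted ones; a \<open>Q\<close> made of marks only contributes to the curvature
  of the twisted object. No equation for \<open>op\<close> itself enters, so the lemma serves
  categories and functors alike.\<close>

lemma twist_op_compose:
  assumes cs: "filt_chain (twist A) U cs l"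
  shows "filt_has_sum (T (fst U) (fst (tgt U cs)) (deg_out (n + 1) cs))
    (\<lambda>ms. \<Sum>(p, q, r)\<in>{(p, q, r). p @ q @ r = realize U ms}.
       koszul p (op (fst U) (p @ (deg_out 2 q, mu A (tgt (fst U) p) q, tgt (tgt (fst U) p) q) # r)))
    {ms. unmark ms = cs}
    (\<Sum>(p, q, r)\<in>{(p, q, r). p @ q @ r = cs}.
       koszul p (twist_op U (p @ (deg_out 2 q, mu (bc_all A) (tgt U p) q, tgt (tgt U p) q) # r)))"
    (is "filt_has_sum ?E ?g _ (sum ?h ?S)")
proof -
  let ?M = "TM (fst U) (fst (tgt U cs)) (deg_out (n + 1) cs)"
  interpret c: complete_group ?M ?E by (rule T_twist_complete[OF cs])
  define f where "f = (\<lambda>(P, Q, R). koszul (realize U P) (op (fst U) (realize U P @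
    (deg_out 2 (realize (tgt U (unmark P)) Q), mu A (fst (tgt U (unmark P))) (realize (tgt U (unmark P)) Q),
      fst (tgt U (unmark (P @ Q)))) # realize (tgt U (unmark (P @ Q))) R)))"
  let ?J = "{(P, Q, R). unmark (P @ Q @ R) = cs}"
  have level: "f (P, Q, R) \<in> ?E (l + int (nones (P @ Q @ R)))" if J: "unmark (P @ Q @ R) = cs" for P Q R
  proof -
    let ?V = "tgt U (unmark P)" and ?W = "tgt U (unmark (P @ Q))"
    obtain lP lQ lR where lv: "filt_chain (twist A) U (unmark P) lP" "filt_chain (twist A) ?V (unmark Q) lQ"
      "filt_chain (twist A) ?W (unmark R) lR" "l = lP + (lQ + lR)"
      using cs J by (auto elim!: filt_chain_appendE simp flip: J)
    have "mu A (fst ?V) (realize ?V Q) \<in> fil A (fst ?V) (fst ?W) (deg_out 2 (unmark Q)) (lQ + int (nones Q))"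
      using src.mu.op_realize[OF lv(2)] by simp
    then have "filt_chain A (fst ?V) ((deg_out 2 (realize ?V Q), mu A (fst ?V) (realize ?V Q), fst ?W) #
        realize ?W R) (lQ + int (nones Q) + (lR + int (nones R)))"
      using filt_chain_realize[OF lv(3)] filt_chain_source[OF filt_chain_realize[OF lv(2)]]
      by (auto simp: deg_out_red_deg intro!: exI[of _ "lQ + int (nones Q)"])
    then have "filt_chain A (fst U) (realize U P @ (deg_out 2 (realize ?V Q), mu A (fst ?V) (realize ?V Q), fst ?W) #
        realize ?W R) (lP + int (nones P) + (lQ + int (nones Q) + (lR + int (nones R))))"
      using filt_chain_append[OF filt_chain_realize[OF lv(1)]] by simp
    from op_filt_chain[OF this] have "op (fst U) (realize U P @ (deg_out 2 (realize ?V Q),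
        mu A (fst ?V) (realize ?V Q), fst ?W) # realize ?W R) \<in> ?E (l + int (nones (P @ Q @ R)))"
      using lv(4) J[symmetric] by (simp add: deg_out_red_deg algebra_simps)
    then show ?thesis unfolding f_def prod.case c.koszul_F .
  qed
  have null: "null_family ?E f ?J"
  proof (rule null_family_weight[where w = "\<lambda>(P, Q, R). nones (P @ Q @ R)"])
    fix N
    have "{i \<in> ?J. (\<lambda>(P, Q, R). nones (P @ Q @ R)) i \<le> N} \<subseteq>
      (\<Union>ms\<in>{ms. unmark ms = cs \<and> nones ms \<le> N}. {(P, Q, R). P @ Q @ R = ms})" by auto
    moreover have "finite \<dots>" using finite_marked[of cs N] finite_splits by (intro finite_UN_I) auto
    ultimately show "finite {i \<in> ?J. (\<lambda>(P, Q, R). nones (P @ Q @ R)) i \<le> N}" by (rule finite_subset)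
  next
    fix i assume "i \<in> ?J"
    then show "f i \<in> ?E (l + int ((\<lambda>(P, Q, R). nones (P @ Q @ R)) i))" using level by auto
  qed (rule c.F_antimono)
  have M: "f i \<in> ?M" if "i \<in> ?J" for i using that level c.F_sub_M by blast
  have "filt_has_sum ?E ?g {ms. unmark ms = cs} (filt_sum ?E f ?J)"
  proof (rule c.filt_has_sum_fibres(1)[OF null M, where p = "\<lambda>(P, Q, R). P @ Q @ R"])
    fix ms assume ms: "ms \<in> {ms. unmark ms = cs}"
    have J: "{j \<in> ?J. (\<lambda>(P, Q, R). P @ Q @ R) j = ms} = {(P, Q, R). P @ Q @ R = ms}" using ms by auto
    have "sum f {(P, Q, R). P @ Q @ R = ms} = ?g ms"
      by (subst sum.reindex_bij_betw[OF bij_betw_realize_splits, symmetric])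
        (auto simp: f_def intro!: sum.cong)
    then show "filt_has_sum ?E f {j \<in> ?J. (\<lambda>(P, Q, R). P @ Q @ R) j = ms} (?g ms)"
      unfolding J using c.filt_has_sum_finite[OF finite_splits[of ms], of f] by simp
  qed auto
  moreover have "filt_has_sum ?E ?h ?S (filt_sum ?E f ?J)"
  proof (rule c.filt_has_sum_fibres(1)[OF null M, where p = "\<lambda>(P, Q, R). (unmark P, unmark Q, unmark R)"])
    fix s assume s: "s \<in> ?S"
    obtain p q r where pqr: "s = (p, q, r)" by (cases s)
    with s have cs_eq: "cs = p @ q @ r" by auto
    let ?V = "tgt U p" and ?W = "tgt U (p @ q)"
    obtain lp lq lr where lv: "filt_chain (twist A) U p lp" "filt_chain (twist A) ?V q lq"
      "filt_chain (twist A) ?W r lr"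
      using cs unfolding cs_eq by (auto elim!: filt_chain_appendE)
    let ?K = "{j \<in> ?J. (\<lambda>(P, Q, R). (unmark P, unmark Q, unmark R)) j = s}"
    have K: "?K = {(P, Q, R). unmark P = p \<and> unmark Q = q \<and> unmark R = r}" using cs_eq pqr by auto
    let ?x = "mu (bc_all A) ?V q"
    have x: "?x \<in> fil A (fst ?V) (fst ?W) (deg_out 2 q) lq"
      using src.mu.twist_op_filt_chain[OF lv(2)] by (simp add: src.mu_twist)
    have ch: "filt_chain (twist A) U (p @ (deg_out 2 q, ?x, ?W) # r) (lp + (lq + lr))"
      using lv filt_chain_source[OF lv(2)] x
      by (intro filt_chain_append[OF lv(1)]) (auto intro!: exI[of _ lq])
    have E: "T (fst U) (fst (tgt ?W r)) (deg_out n (p @ (deg_out 2 q, ?x, ?W) # r)) = ?E"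
      by (simp add: cs_eq deg_out_red_deg add_ac)
    \<comment> \<open>For fixed unmarked lists the sum is taken over \<open>Q\<close> first, inside
      one slot by continuity, and then over the pairs \<open>(P, R)\<close>.\<close>
    show "filt_has_sum ?E f ?K (?h s)"
    proof (rule c.filt_has_sum_fibres_eq[where p = "\<lambda>(P, Q, R). (P, R)" and
          I = "{P. unmark P = p} \<times> {R. unmark R = r}"])
      show "null_family ?E f ?K" by (rule null_family_subset[OF null]) auto
      show "f j \<in> ?M" if "j \<in> ?K" for j using that M by auto
      show "(case j of (P, Q, R) \<Rightarrow> (P, R)) \<in> {P. unmark P = p} \<times> {R. unmark R = r}" if "j \<in> ?K" for j
        using that unfolding K by auto
      have "filt_has_sum ?E (\<lambda>j. koszul p ((\<lambda>(P, R). op (fst U) (realize U P @ (deg_out 2 q, ?x, fst ?W) # realize ?W R)) j))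
        ({P. unmark P = p} \<times> {R. unmark R = r}) (koszul p (twist_op U (p @ (deg_out 2 q, ?x, ?W) # r)))"
        using c.filt_has_sum_koszul[OF twist_op_slot_sum[OF ch, unfolded E], of p] .
      then show "filt_has_sum ?E (\<lambda>j. koszul p ((\<lambda>(P, R). op (fst U) (realize U P @ (deg_out 2 q, ?x, fst ?W) # realize ?W R)) j))
        ({P. unmark P = p} \<times> {R. unmark R = r}) (?h s)"
        unfolding pqr by simp
    next
      fix j assume j: "j \<in> {P. unmark P = p} \<times> {R. unmark R = r}"
      then obtain P R where PR: "j = (P, R)" "unmark P = p" "unmark R = r" by auto
      have bij: "bij_betw (\<lambda>Q. (P, Q, R)) {Q. unmark Q = q} {i \<in> ?K. (\<lambda>(P, Q, R). (P, R)) i = j}"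
        unfolding K using PR by (auto simp: bij_betw_def inj_on_def)
      have chP: "is_chain (obj A) (mor A) (fst U) (realize U P)"
        using filt_chain_realize[of A U P lp] lv(1) PR(2) src.filt_chain_is_chain by blast
      have chR: "is_chain (obj A) (mor A) (fst ?W) (realize ?W R)"
        using filt_chain_realize[of A ?W R lr] lv(3) PR(3) src.filt_chain_is_chain by blast
      have V: "tgt (fst U) (realize U P) = fst ?V" using PR by simp
      have W: "tgt (fst ?W) (realize ?W R) = fst (tgt U cs)" using PR cs_eq by simp
      have o: "fst ?V \<in> obj A" "fst ?W \<in> obj A"
        using filt_chain_source[OF lv(2)] filt_chain_source[OF lv(3)] by auto
      have sum: "filt_has_sum (fil A (fst ?V) (fst ?W) (deg_out 2 q)) (\<lambda>Q. mu A (fst ?V) (realize ?V Q))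
          {Q. unmark Q = q} ?x"
        using src.mu.twist_op_sum[OF lv(2)] by (simp add: src.mu_twist)
      have mem: "mu A (fst ?V) (realize ?V Q) \<in> mor A (fst ?V) (fst ?W) (deg_out 2 q)" if "Q \<in> {Q. unmark Q = q}" for Q
        using src.mu.op_realize[of ?V Q lq] lv(2) that src.fil_sub_mor[OF o] by simp
      have E': "T (fst U) (tgt (fst ?W) (realize ?W R))
        (deg_out n (realize U P @ (deg_out 2 q, ?x, fst ?W) # realize ?W R)) = ?E"
        using PR by (simp add: cs_eq deg_out_red_deg add_ac)
      have "filt_has_sum ?E (\<lambda>Q. op (fst U) (realize U P @ (deg_out 2 q, mu A (fst ?V) (realize ?V Q), fst ?W) # realize ?W R))
        {Q. unmark Q = q} (op (fst U) (realize U P @ (deg_out 2 q, ?x, fst ?W) # realize ?W R))"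
        using op_slot_sum[OF chP chR, unfolded V, OF mem src.fil_sub_mor[OF o x] sum, of ?x]
        unfolding E' .
      then have "filt_has_sum ?E (\<lambda>Q. koszul p (op (fst U) (realize U P @ (deg_out 2 q, mu A (fst ?V) (realize ?V Q), fst ?W) # realize ?W R)))
        {Q. unmark Q = q} (koszul p (op (fst U) (realize U P @ (deg_out 2 q, ?x, fst ?W) # realize ?W R)))"
        by (rule c.filt_has_sum_koszul)
      then have "filt_has_sum ?E (\<lambda>Q. f (P, Q, R)) {Q. unmark Q = q}
        (koszul p (op (fst U) (realize U P @ (deg_out 2 q, ?x, fst ?W) # realize ?W R)))"
        by (rule filt_has_sum_cong[THEN iffD1, rotated]) (simp add: f_def PR deg_out_red_deg)
      then show "filt_has_sum ?E f {i \<in> ?K. (\<lambda>(P, Q, R). (P, R)) i = j}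
        (koszul p ((\<lambda>(P, R). op (fst U) (realize U P @ (deg_out 2 q, ?x, fst ?W) # realize ?W R)) j))"
        using filt_has_sum_reindex[OF bij, of ?E f] PR(1) by simp
    qed
  qed auto
  then have "filt_sum ?E f ?J = sum ?h ?S"
    using c.filt_has_sum_finite[OF finite_splits[of cs], of ?h] c.filt_has_sum_unique by blast
  ultimately show ?thesis by simp
qed

end

section \<open>The twisted category\<close>

lemma multilinearI:
  assumes "\<And>X p d c c' Y r. is_chain Ob H X (p @ (d, c, Y) # r) \<Longrightarrow> is_chain Ob H X (p @ (d, c', Y) # r) \<Longrightarrow>
      f X (p @ (d, c + c', Y) # r) = f X (p @ (d, c, Y) # r) + f X (p @ (d, c', Y) # r)"
    and "\<And>X p d c Y r k. is_chain Ob H X (p @ (d, c, Y) # r) \<Longrightarrow>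
      f X (p @ (d, scale k c, Y) # r) = scale' k (f X (p @ (d, c, Y) # r))"
  shows "multilinear scale scale' Ob H f"
  using assms unfolding multilinear_def by blast

lemma (in curved_filtered_ainf_category) twist_chain:
  "is_chain (obj (twist A)) (mor (twist A)) U cs \<longleftrightarrow> (\<exists>l. filt_chain (twist A) U cs l)"
  by (rule is_chain_iff_filt_chain_complete) (auto intro: complete_group_fil)

context filtered_op
begin

lemma twist_op_add:
  assumes "is_chain (obj (twist A)) (mor (twist A)) U (p @ (d, c, V) # r)"
    and "is_chain (obj (twist A)) (mor (twist A)) U (p @ (d, c', V) # r)"
  shows "twist_op U (p @ (d, c + c', V) # r) = twist_op U (p @ (d, c, V) # r) + twist_op U (p @ (d, c', V) # r)"
proof -
  have o: "fst (tgt U p) \<in> obj A" "fst V \<in> obj A"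
    using assms by (auto simp: is_chain_append dest: is_chain_source)
  have "c + c' \<in> mor A (fst (tgt U p)) (fst V) d"
    using assms by (intro complete_group.add_M[OF src.complete_group_fil[OF o]]) (auto simp: is_chain_append)
  then have "is_chain (obj (twist A)) (mor (twist A)) U (p @ (d, c + c', V) # r)"
    using assms by (simp add: is_chain_append)
  then obtain l1 l2 l3 where l: "filt_chain (twist A) U (p @ (d, c, V) # r) l1"
    "filt_chain (twist A) U (p @ (d, c', V) # r) l2" "filt_chain (twist A) U (p @ (d, c + c', V) # r) l3"
    using assms unfolding src.twist_chain by blast
  let ?T = "T (fst U) (fst (tgt V r)) (deg_out n (p @ (d, c, V) # r))"
  have deg: "deg_out n (p @ (d, c', V) # r) = deg_out n (p @ (d, c, V) # r)"
    "deg_out n (p @ (d, c + c', V) # r) = deg_out n (p @ (d, c, V) # r)" by (simp_all add: deg_out_red_deg)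
  interpret c: complete_group "TM (fst U) (fst (tgt V r)) (deg_out n (p @ (d, c, V) # r))" ?T
    using T_twist_complete[OF l(1)] by simp
  have "(\<lambda>(P, R). op (fst U) (realize U P @ (d, c + c', fst V) # realize V R)) j =
      (\<lambda>(P, R). op (fst U) (realize U P @ (d, c, fst V) # realize V R)) j +
      (\<lambda>(P, R). op (fst U) (realize U P @ (d, c', fst V) # realize V R)) j"
    if mem: "j \<in> {P. unmark P = p} \<times> {R. unmark R = r}" for j
  proof -
    obtain P R where j: "j = (P, R)" "unmark P = p" "unmark R = r" using mem by (cases j) auto
    have "is_chain (obj A) (mor A) (fst U) (realize U P @ (d, c, fst V) # realize V R)"
      "is_chain (obj A) (mor A) (fst U) (realize U P @ (d, c', fst V) # realize V R)"
      using src.filt_chain_is_chain[OF filt_chain_realize[of A U "P @ Some (d, c, V) # R" l1]]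
        src.filt_chain_is_chain[OF filt_chain_realize[of A U "P @ Some (d, c', V) # R" l2]] l j by auto
    from op_add[OF this] show ?thesis using j by simp
  qed
  then have "filt_has_sum ?T (\<lambda>(P, R). op (fst U) (realize U P @ (d, c + c', fst V) # realize V R))
    ({P. unmark P = p} \<times> {R. unmark R = r}) (twist_op U (p @ (d, c, V) # r) + twist_op U (p @ (d, c', V) # r))"
    using c.filt_has_sum_add[OF twist_op_slot_sum[OF l(1)] twist_op_slot_sum[OF l(2), unfolded deg]]
    by (subst filt_has_sum_cong) auto
  from c.filt_has_sum_unique[OF twist_op_slot_sum[OF l(3), unfolded deg] this] show ?thesis .
qed

lemma twist_op_scale:
  assumes "is_chain (obj (twist A)) (mor (twist A)) U (p @ (d, c, V) # r)"
  shows "twist_op U (p @ (d, scale k c, V) # r) = scale' k (twist_op U (p @ (d, c, V) # r))"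
proof -
  have o: "fst (tgt U p) \<in> obj A" "fst V \<in> obj A"
    using assms by (auto simp: is_chain_append dest: is_chain_source)
  have "scale k c \<in> mor A (fst (tgt U p)) (fst V) d"
    using assms by (intro module.subspace_scale[OF src.module_axioms src.mor_submodule[OF o]])
      (auto simp: is_chain_append)
  then have "is_chain (obj (twist A)) (mor (twist A)) U (p @ (d, scale k c, V) # r)"
    using assms by (simp add: is_chain_append)
  then obtain l1 l3 where l: "filt_chain (twist A) U (p @ (d, c, V) # r) l1"
    "filt_chain (twist A) U (p @ (d, scale k c, V) # r) l3"
    using assms unfolding src.twist_chain by blast
  let ?T = "T (fst U) (fst (tgt V r)) (deg_out n (p @ (d, c, V) # r))"
  have deg: "deg_out n (p @ (d, scale k c, V) # r) = deg_out n (p @ (d, c, V) # r)"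
    by (simp add: deg_out_red_deg)
  let ?M = "TM (fst U) (fst (tgt V r)) (deg_out n (p @ (d, c, V) # r))"
  interpret c: complete_group ?M ?T
    using T_twist_complete[OF l(1)] by simp
  have o': "fst U \<in> obj A" "fst (tgt V r) \<in> obj A"
    using filt_chain_source[OF l(1)] filt_chain_tgt[OF l(1)] by auto
  \<comment> \<open>Exhaustiveness of the filtration of the ring gives \<open>k\<close> a level,
    which makes multiplication by \<open>k\<close> continuous.\<close>
  obtain lk where lk: "k \<in> FK lk"
    using complete_group.F_exhaust[of UNIV FK k] src.FK_complete unfolding complete_group_def by blast
  let ?f = "\<lambda>c. \<lambda>(P, R). op (fst U) (realize U P @ (d, c, fst V) # realize V R)"
  let ?I = "{P. unmark P = p} \<times> {R. unmark R = r}"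
  have chain: "is_chain (obj A) (mor A) (fst U) (realize U P @ (d, c, fst V) # realize V R)"
    if "unmark P = p" "unmark R = r" for P R
    using src.filt_chain_is_chain[OF filt_chain_realize[of A U "P @ Some (d, c, V) # R" l1]] l that by auto
  have "filt_has_sum ?T (\<lambda>j. scale' k (?f c j)) ?I (scale' k (twist_op U (p @ (d, c, V) # r)))"
  proof (rule filt_has_sum_map[OF c.complete_group_axioms twist_op_slot_sum[OF l(1)]])
    show "?f c j \<in> ?M" if mem: "j \<in> ?I" for j
    proof -
      obtain P R where j: "j = (P, R)" "unmark P = p" "unmark R = r" using mem by (cases j) auto
      from op_mor[OF chain[OF j(2,3)]] show ?thesis using j by (simp add: deg_out_red_deg)
    qed
    show "twist_op U (p @ (d, c, V) # r) \<in> ?M"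
      using c.F_sub_M twist_op_filt_chain[OF l(1)] by simp
    show "\<exists>l'. \<forall>x\<in>?T l'. scale' k x \<in> ?T l" for l
      using T_scale[OF o' lk, of _ _ "l - lk"] by (intro exI[of _ "l - lk"]) auto
  qed (rule tm.scale_right_distrib)
  moreover have "scale' k (?f c j) = ?f (scale k c) j" if mem: "j \<in> ?I" for j
  proof -
    obtain P R where j: "j = (P, R)" "unmark P = p" "unmark R = r" using mem by (cases j) auto
    show ?thesis using op_scale[OF chain[OF j(2,3)]] j by simp
  qed
  ultimately have "filt_has_sum ?T (?f (scale k c)) ?I (scale' k (twist_op U (p @ (d, c, V) # r)))"
    using filt_has_sum_cong[of ?I "\<lambda>j. scale' k (?f c j)" "?f (scale k c)"] by blast
  from c.filt_has_sum_unique[OF twist_op_slot_sum[OF l(2), unfolded deg] this] show ?thesis .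
qed

lemma twist_op_multilinear: "multilinear scale scale' (obj (twist A)) (mor (twist A)) twist_op"
  using twist_op_add twist_op_scale by (intro multilinearI) blast+

end

text \<open>The twisted equation is \<open>twist_op_compose\<close> for \<open>mu\<close> itself:
  every inner sum is an untwisted equation, hence zero, and limits are unique.\<close>

lemma (in curved_filtered_ainf_category) twist_category:
  "curved_filtered_ainf_category FK scale (twist A)"
proof (unfold_locales, goal_cases)
  case (1 U V d) then show ?case using mor_submodule by auto
next
  case (2 U cs)
  then obtain l where l: "filt_chain (twist A) U cs l" unfolding twist_chain by blast
  show ?case
    using mu.twist_op_filt_chain[OF l] complete_group.F_sub_M[OF mu.T_twist_complete[OF l]] by (simp add: mu_twist)
next
  case 3 then show ?case using mu.twist_op_multilinear by (simp add: mu_twist)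
next
  case (4 U cs)
  then obtain l where l: "filt_chain (twist A) U cs l" unfolding twist_chain by blast
  interpret c: complete_group "mor A (fst U) (fst (tgt U cs)) (deg_out (2 + 1) cs)" "fil A (fst U) (fst (tgt U cs)) (deg_out (2 + 1) cs)"
    by (rule mu.T_twist_complete[OF l])
  have "(\<Sum>(p, q, r)\<in>{(p, q, r). p @ q @ r = realize U ms}.
       koszul p (mu A (fst U) (p @ (deg_out 2 q, mu A (tgt (fst U) p) q, tgt (tgt (fst U) p) q) # r))) = 0"
    if "ms \<in> {ms. unmark ms = cs}" for ms
    using filt_chain_realize[of A U ms l] l that by (intro mu_ainf filt_chain_is_chain) auto
  then have "filt_has_sum (fil A (fst U) (fst (tgt U cs)) (deg_out (2 + 1) cs)) (\<lambda>ms. 0) {ms. unmark ms = cs}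
     (\<Sum>(p, q, r)\<in>{(p, q, r). p @ q @ r = cs}.
       koszul p (mu.twist_op U (p @ (deg_out 2 q, mu (bc_all A) (tgt U p) q, tgt (tgt U p) q) # r)))"
    using mu.twist_op_compose[OF l] by (subst (asm) filt_has_sum_cong) auto
  moreover have "filt_has_sum (fil A (fst U) (fst (tgt U cs)) (deg_out (2 + 1) cs)) (\<lambda>ms. 0) {ms. unmark ms = cs} 0"
    by (rule c.filt_has_sum_zero)
  ultimately show ?case using c.filt_has_sum_unique by (simp add: mu_twist)
next
  case (5 U V d) then show ?case using fil_complete by auto
next
  case (6 U V k l c d l') then show ?case using fil_scale by auto
next
  case (7 U ls)
  then show ?case using mu.twist_op_filt_chain[OF filt_chain_of_level(1)[OF 7]] filt_chain_of_level(2)[OF 7]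
    by (simp add: mu_twist)
next
  case (8 U) then show ?case using mu.twist_op_curvature[of U] by (simp add: mu_twist)
qed

section \<open>Twisting a functor\<close>

lemma tgt_apply_blocks [simp]: "tgt (fobj H X) (apply_blocks H X bs) = fobj H (tgt X (concat bs))"
  by (induction H X bs rule: apply_blocks.induct) auto

lemma red_deg_apply_blocks [simp]: "red_deg (apply_blocks H X bs) = red_deg (concat bs)"
  by (induction H X bs rule: apply_blocks.induct) (auto simp: deg_out_red_deg)

fun realize_blocks ::
    "'o \<times> 'm \<Rightarrow> (bit \<times> 'm \<times> 'o \<times> 'm) option list list \<Rightarrow> ('o, bit, 'm) chain list" where
  "realize_blocks U [] = []"
| "realize_blocks U (b # BS) = realize U b # realize_blocks (tgt U (unmark b)) BS"

lemma concat_realize_blocks [simp]: "concat (realize_blocks U BS) = realize U (concat BS)"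
  by (induction U BS rule: realize_blocks.induct) auto

lemma unmark_concat [simp]: "unmark (concat BS) = concat (map unmark BS)"
  by (induction BS) auto

text \<open>Each block keeps its length under \<open>realize\<close>, so blocks of the expanded
  chain, empty ones included, correspond to blocks of the marked list.\<close>

lemma bij_betw_realize_blocks:
  "bij_betw (realize_blocks U) {BS. concat BS = ms} {bs. concat bs = realize U ms}"
proof -
  have inj: "BS = BS'" if "concat BS = concat BS'" "realize_blocks U BS = realize_blocks U BS'" for BS BS' U
    using that
  proof (induction BS arbitrary: U BS')
    case Nil then show ?case by (cases BS') auto
  next
    case (Cons b BS)
    from Cons.prems obtain b' BS'' where B: "BS' = b' # BS''" by (cases BS') auto
    from Cons.prems B have "realize U b = realize U b'" by simp
    from arg_cong[OF this, of length] have "length b = length b'" by simp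
    moreover have "b @ concat BS = b' @ concat BS''" using Cons.prems B by simp
    ultimately have b: "b = b'" "concat BS = concat BS''" by (simp_all add: append_eq_append_conv)
    with Cons.prems B Cons.IH[of BS'' "tgt U (unmark b)"] show ?case by simp
  qed
  have sur: "\<exists>BS. concat BS = ms \<and> realize_blocks U BS = bs" if "concat bs = realize U ms" for bs ms U
    using that
  proof (induction bs arbitrary: U ms)
    case Nil
    then have "ms = []" using length_realize[of U ms] by simp
    then show ?case by (intro exI[of _ "[]"]) simp
  next
    case (Cons b bs)
    define m m' where "m = take (length b) ms" and "m' = drop (length b) ms"
    have ms: "ms = m @ m'" by (simp add: m_def m'_def)
    have "length (concat (b # bs)) = length ms" unfolding Cons.prems by simp
    then have "length m = length b" unfolding m_def by simp
    moreover have "b @ concat bs = realize U m @ realize (tgt U (unmark m)) m'" using Cons.prems ms by simp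
    ultimately have b: "b = realize U m" "concat bs = realize (tgt U (unmark m)) m'"
      by (simp_all add: append_eq_append_conv)
    from Cons.IH[OF b(2)] obtain BS where "concat BS = m'" "realize_blocks (tgt U (unmark m)) BS = bs" by blast
    then show ?case using b(1) ms by (intro exI[of _ "m # BS"]) simp
  qed
  have "inj_on (realize_blocks U) {BS. concat BS = ms}" by (rule inj_onI, rule inj[of _ _ U]) simp_all
  moreover have "realize_blocks U ` {BS. concat BS = ms} \<subseteq> {bs. concat bs = realize U ms}" by auto
  moreover have "{bs. concat bs = realize U ms} \<subseteq> realize_blocks U ` {BS. concat BS = ms}"
  proof
    fix bs assume "bs \<in> {bs. concat bs = realize U ms}"
    then have "\<exists>BS. concat BS = ms \<and> realize_blocks U BS = bs" by (intro sur) simp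
    then show "bs \<in> realize_blocks U ` {BS. concat BS = ms}" by auto
  qed
  ultimately show ?thesis unfolding bij_betw_def by blast
qed

text \<open>Infinitely many decompositions of a chain differ only by empty blocks. Each of these
  contributes curvature of level 1, so their number measures the gain in level.\<close>

definition empties :: "'a list list \<Rightarrow> nat" where
  "empties bs = length (filter (\<lambda>b. b = []) bs)"

lemma empties_simps [simp]: "empties [] = 0" "empties (b # bs) = (if b = [] then 1 else 0) + empties bs"
  by (auto simp: empties_def)

lemma length_blocks: "length bs \<le> empties bs + length (concat bs)"
proof (induction bs)
  case (Cons b bs) then show ?case by (cases b) auto
qed auto

lemma finite_blocks: "finite {bs. concat bs = xs \<and> empties bs \<le> N}"
proof (rule finite_subset)
  let ?B = "{b. set b \<subseteq> set xs \<and> length b \<le> length xs}"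
  show "{bs. concat bs = xs \<and> empties bs \<le> N} \<subseteq> {bs. set bs \<subseteq> ?B \<and> length bs \<le> N + length xs}"
  proof safe
    fix bs :: "'a list list" assume N: "empties bs \<le> N"
    show "length bs \<le> N + length (concat bs)" using length_blocks[of bs] N by simp
    fix b assume b: "b \<in> set bs"
    show "x \<in> set (concat bs)" if "x \<in> set b" for x using b that by auto
    show "length b \<le> length (concat bs)" using b by (simp add: length_concat member_le_sum_list)
  qed
  show "finite {bs. set bs \<subseteq> ?B \<and> length bs \<le> N + length xs}"
    by (intro finite_lists_length_le) simp
qed

text \<open>Lower bound for the gain in level: one for each inserted element and one for the
  curvature at each empty block.\<close>

definition block_weight :: "'a option list list \<Rightarrow> nat" where
  "block_weight BS = nones (concat BS) + empties BS"

lemma finite_block_weight: "finite {BS. concat (map unmark BS) = cs \<and> block_weight BS \<le> N}"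
proof (rule finite_subset)
  show "{BS. concat (map unmark BS) = cs \<and> block_weight BS \<le> N} \<subseteq>
    (\<Union>ms\<in>{ms. unmark ms = cs \<and> nones ms \<le> N}. {BS. concat BS = ms \<and> empties BS \<le> N})"
    by (auto simp: block_weight_def)
qed (intro finite_UN_I finite_marked finite_blocks)

lemma filt_chain_apply_blocks:
  assumes val: "\<And>U b l. filt_chain A U b l \<Longrightarrow>
      fmor H U b \<in> fil B (fobj H U) (fobj H (tgt U b)) (deg_out 1 b) l"
    and ob: "\<And>U. U \<in> obj A \<Longrightarrow> fobj H U \<in> obj B"
    and "filt_chain A U (concat bs) l"
  shows "filt_chain B (fobj H U) (apply_blocks H U bs) l"
  using assms(3)
proof (induction bs arbitrary: U l)
  case (Cons b bs)
  then obtain l1 l2 where l: "filt_chain A U b l1" "filt_chain A (tgt U b) (concat bs) l2" "l = l1 + l2"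
    by (auto elim: filt_chain_appendE)
  show ?case using val[OF l(1)] Cons.IH[OF l(2)] l(3) ob filt_chain_source[OF l(1)]
    by (auto intro!: exI[of _ l1])
qed (use ob in auto)

text \<open>Under a functor an empty block contributes its curvature, which plays the role of the deformation
  parameter on the target side; hence \<open>None\<close>.\<close>

fun mark_blocks :: "('o, bit, 'm, 'p, 'n) ainf_functor \<Rightarrow> 'o \<Rightarrow> ('o, bit, 'm) chain list \<Rightarrow>
    (bit \<times> 'n \<times> 'p) option list" where
  "mark_blocks H X [] = []"
| "mark_blocks H X (b # bs) =
    (if b = [] then None else Some (deg_out 1 b, fmor H X b, fobj H (tgt X b))) # mark_blocks H (tgt X b) bs"

text \<open>With the nonempty blocks fixed, the empty ones may stand anywhere, just as inserted
  elements may in the image chain. Summing over them therefore amounts to twisting in the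
  target.\<close>

lemma bij_betw_mark_blocks:
  assumes "[] \<notin> set bs'"
  shows "bij_betw (mark_blocks H X) {bs. filter (\<lambda>b. b \<noteq> []) bs = bs'} {ms. unmark ms = apply_blocks H X bs'}"
proof -
  have un: "unmark (mark_blocks H X bs) = apply_blocks H X (filter (\<lambda>b. b \<noteq> []) bs)" for bs
    by (induction H X bs rule: mark_blocks.induct) auto
  have inj: "bs = cs" if "filter (\<lambda>b. b \<noteq> []) bs = filter (\<lambda>b. b \<noteq> []) cs"
    "mark_blocks H X bs = mark_blocks H X cs" for bs cs X
    using that
  proof (induction bs arbitrary: X cs)
    case Nil then show ?case by (cases cs) auto
  next
    case (Cons b bs)
    from Cons.prems(2) obtain c cs' where c: "cs = c # cs'" by (cases cs) auto
    have bc: "b = [] \<longleftrightarrow> c = []" using Cons.prems(2) c by (auto split: if_splits)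
    with Cons.prems(1) c have "b = c" "filter (\<lambda>b. b \<noteq> []) bs = filter (\<lambda>b. b \<noteq> []) cs'"
      by (auto split: if_splits)
    with Cons.prems(2) c Cons.IH[of cs' "tgt X b"] show ?case by simp
  qed
  have sur: "\<exists>bs. filter (\<lambda>b. b \<noteq> []) bs = bs' \<and> mark_blocks H X bs = ms"
    if "unmark ms = apply_blocks H X bs'" "[] \<notin> set bs'" for ms bs' X
    using that
  proof (induction ms arbitrary: X bs')
    case Nil
    then show ?case by (cases bs') (auto intro!: exI[of _ "[]"])
  next
    case (Cons m ms)
    show ?case
    proof (cases m)
      case None
      then have "unmark ms = apply_blocks H X bs'" using Cons.prems by simp
      from Cons.IH[OF this Cons.prems(2)] obtain bs where
        "filter (\<lambda>b. b \<noteq> []) bs = bs'" "mark_blocks H X bs = ms" by blast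
      then show ?thesis using None by (intro exI[of _ "[] # bs"]) simp
    next
      case (Some x)
      then obtain b bs'' where b: "bs' = b # bs''" using Cons.prems by (cases bs') auto
      then have "unmark ms = apply_blocks H (tgt X b) bs''" "[] \<notin> set bs''" using Some Cons.prems by auto
      from Cons.IH[OF this] obtain bs where
        "filter (\<lambda>b. b \<noteq> []) bs = bs''" "mark_blocks H (tgt X b) bs = ms" by blast
      then show ?thesis using Some b Cons.prems by (intro exI[of _ "b # bs"]) auto
    qed
  qed
  have "inj_on (mark_blocks H X) {bs. filter (\<lambda>b. b \<noteq> []) bs = bs'}"
    by (rule inj_onI, rule inj[of _ _ X]) simp_all
  moreover have "mark_blocks H X ` {bs. filter (\<lambda>b. b \<noteq> []) bs = bs'} \<subseteq> {ms. unmark ms = apply_blocks H X bs'}"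
    using un by auto
  moreover have "{ms. unmark ms = apply_blocks H X bs'} \<subseteq> mark_blocks H X ` {bs. filter (\<lambda>b. b \<noteq> []) bs = bs'}"
  proof
    fix ms assume "ms \<in> {ms. unmark ms = apply_blocks H X bs'}"
    then have "\<exists>bs. filter (\<lambda>b. b \<noteq> []) bs = bs' \<and> mark_blocks H X bs = ms"
      using assms by (intro sur) simp_all
    then show "ms \<in> mark_blocks H X ` {bs. filter (\<lambda>b. b \<noteq> []) bs = bs'}" by auto
  qed
  ultimately show ?thesis unfolding bij_betw_def by blast
qed

lemma concat_filter_nonempty [simp]: "concat (filter (\<lambda>b. b \<noteq> []) bs) = concat bs"
  by (induction bs) auto

section \<open>Functor equations on twisted objects\<close>

context curved_filtered_ainf_functor
begin

lemma filtered_op_fmor: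
  "filtered_op FK scale A scale' (\<lambda>X Y. mor B (fobj G X) (fobj G Y)) (\<lambda>X Y. fil B (fobj G X) (fobj G Y)) (fmor G) 1"
  by unfold_locales
    (use fobj cod.fil_complete cod.fil_scale fmor_multilinear fmor_filtered curvature_filtered in auto)

sublocale op: filtered_op FK scale A scale' "\<lambda>X Y. mor B (fobj G X) (fobj G Y)"
    "\<lambda>X Y. fil B (fobj G X) (fobj G Y)" "fmor G" 1
  by (rule filtered_op_fmor)

lemma push_mc_twist: "push_mc B G X a = op.twist_op (X, a) []"
proof -
  have bij: "bij_betw (\<lambda>k. [k]) UNIV {is. length is = Suc (length [])}"
    by (auto simp: bij_betw_def inj_on_def length_Suc_conv)
  have "filt_has_sum F (\<lambda>k. fmor G X (replicate k (1, a, X))) UNIV =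
      filt_has_sum F (\<lambda>is. fmor G X (insert_mc (X, a) is [])) {is. length is = Suc (length [])}" for F
    using filt_has_sum_reindex[OF bij, of F "\<lambda>is. fmor G X (insert_mc (X, a) is [])"] by (intro ext) simp
  then show ?thesis
    unfolding push_mc_def op.twist_op_def filt_sum_def by (simp add: deg_out_red_deg)
qed

lemma fmor_bc_functor: "fmor (bc_functor B G) U cs = (if cs = [] then 0 else op.twist_op U cs)"
  by (simp add: bc_functor_def op.twist_op_def)

lemma fobj_bc_functor: "fobj (bc_functor B G) U = (fobj G (fst U), op.twist_op U [])"
  by (cases U) (simp add: bc_functor_def push_mc_twist)

lemma fobj_bc_twist: "U \<in> obj (twist A) \<Longrightarrow> fobj (bc_functor B G) U \<in> obj (twist B)"
  using op.twist_op_curvature[of U] fobj by (auto simp: fobj_bc_functor)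

lemma fmor_bc_filt_chain:
  assumes "filt_chain (twist A) U cs l"
  shows "fmor (bc_functor B G) U cs \<in>
    fil (twist B) (fobj (bc_functor B G) U) (fobj (bc_functor B G) (tgt U cs)) (deg_out 1 cs) l"
  using op.twist_op_filt_chain[OF assms] complete_group.zero_F[OF op.T_twist_complete[OF assms]]
  by (cases "cs = []") (simp_all add: fmor_bc_functor fobj_bc_functor)

text \<open>The functor on twisted objects before its curvature is absorbed into the target.\<close>

definition "twistG = \<lparr>fobj = \<lambda>U. fobj G (fst U), fmor = op.twist_op\<rparr>"

lemma twistG_simps [simp]: "fobj twistG U = fobj G (fst U)" "fmor twistG = op.twist_op"
  by (simp_all add: twistG_def)

lemma apply_realize_blocks_level:
  assumes "filt_chain (twist A) U (concat (map unmark BS)) l"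
  shows "filt_chain B (fobj G (fst U)) (apply_blocks G (fst U) (realize_blocks U BS)) (l + int (block_weight BS))"
  using assms
proof (induction BS arbitrary: U l)
  case Nil then show ?case using fobj by (auto simp: block_weight_def)
next
  case (Cons b BS)
  let ?V = "tgt U (unmark b)"
  obtain l1 l2 where l: "filt_chain (twist A) U (unmark b) l1"
    "filt_chain (twist A) ?V (concat (map unmark BS)) l2" "l = l1 + l2"
    using Cons.prems by (auto elim: filt_chain_appendE)
  have o: "fst U \<in> obj A" "fst ?V \<in> obj A" using filt_chain_source[OF l(1)] filt_chain_source[OF l(2)] by auto
  \<comment> \<open>An empty block gains 1 from the curvature of \<open>G\<close>, whereas a
    nonempty one gains its number of marks, even if it consists of marks only.\<close>
  let ?w = "(if b = [] then 1 else int (nones b))"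
  have "fmor G (fst U) (realize U b) \<in> fil B (fobj G (fst U)) (fobj G (fst ?V)) (deg_out 1 (realize U b)) (l1 + ?w)"
  proof (cases "b = []")
    case True
    then have "l1 \<le> 0" using l(1) by simp
    then show ?thesis
      using True complete_group.F_mono[OF op.T_complete[OF o(1,1)] curvature_filtered[OF o(1)], of "l1 + 1"]
      by (simp add: deg_out_red_deg)
  next
    case False
    then show ?thesis using op.op_realize[OF l(1)] by (simp add: deg_out_red_deg)
  qed
  then show ?case using Cons.IH[OF l(2)] l(3) fobj o
    by (auto simp: block_weight_def algebra_simps intro!: exI[of _ "l1 + ?w"])
qed

lemma filt_chain_twistG:
  "filt_chain (twist A) U (concat bs) l \<Longrightarrow> filt_chain B (fobj G (fst U)) (apply_blocks twistG U bs) l"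
  using filt_chain_apply_blocks[of "twist A" twistG B U bs l] op.twist_op_filt_chain fobj by auto

text \<open>Expands an operation all of whose later arguments are infinite sums, one slot at a time
  from the left: \<open>p\<close> grows by the single terms already chosen, and continuity in the
  current slot sums over them afterwards.\<close>

lemma expand_blocks:
  assumes "filt_chain (twist A) U (concat bs) l" "filt_chain B X p l'" "tgt X p = fobj G (fst U)"
  shows "filt_has_sum (fil B X (fobj G (fst (tgt U (concat bs)))) (deg_out 2 (p @ apply_blocks twistG U bs)))
    (\<lambda>BS. mu B X (p @ apply_blocks G (fst U) (realize_blocks U BS))) {BS. map unmark BS = bs}
    (mu B X (p @ apply_blocks twistG U bs))"
  using assms
proof (induction bs arbitrary: U p l l')
  case Nil
  have o: "X \<in> obj B" "fobj G (fst U) \<in> obj B"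
    using filt_chain_source[OF Nil(2)] filt_chain_tgt[OF Nil(2)] Nil(3) by auto
  show ?case
    using complete_group.filt_has_sum_finite[OF cod.complete_group_fil[OF o], of "{[]}"
      _ "\<lambda>BS. mu B X (p @ apply_blocks G (fst U) (realize_blocks U BS))"] by simp
next
  case (Cons b bs)
  let ?V = "tgt U b"
  let ?f = "\<lambda>BS. mu B X (p @ apply_blocks G (fst U) (realize_blocks U BS))"
  let ?W = "fst (tgt U (concat (b # bs)))"
  let ?E = "fil B X (fobj G ?W) (deg_out 2 (p @ apply_blocks twistG U (b # bs)))"
  let ?M = "mor B X (fobj G ?W) (deg_out 2 (p @ apply_blocks twistG U (b # bs)))"
  let ?J = "{BS. map unmark BS = b # bs}"
  obtain l1 l2 where l: "filt_chain (twist A) U b l1" "filt_chain (twist A) ?V (concat bs) l2"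
    using Cons.prems(1) by (auto elim: filt_chain_appendE)
  have oA: "fst U \<in> obj A" "fst ?V \<in> obj A" "?W \<in> obj A"
    using filt_chain_source[OF l(1)] filt_chain_source[OF l(2)] filt_chain_tgt[OF l(2)] by auto
  have oX: "X \<in> obj B" using filt_chain_source[OF Cons.prems(2)] .
  interpret c: complete_group ?M ?E by (rule cod.complete_group_fil[OF oX fobj[OF oA(3)]])
  have level: "?f BS \<in> ?E (l' + l + int (block_weight BS))" if BS: "BS \<in> ?J" for BS
  proof -
    have cBS: "concat (map unmark BS) = concat (b # bs)" using BS by simp
    have "filt_chain (twist A) U (concat (map unmark BS)) l" unfolding cBS by (rule Cons.prems(1))
    from apply_realize_blocks_level[OF this]
    have "filt_chain B X (p @ apply_blocks G (fst U) (realize_blocks U BS)) (l' + (l + int (block_weight BS)))"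
      using Cons.prems(3) by (intro filt_chain_append[OF Cons.prems(2)]) simp
    from cod.mu.op_filt_chain[OF this] show ?thesis
      using Cons.prems(3) cBS by (simp add: deg_out_red_deg add_ac)
  qed
  have null: "null_family ?E ?f ?J"
  proof (rule null_family_weight[where w = block_weight])
    have "{i \<in> ?J. block_weight i \<le> N} \<subseteq> {BS. concat (map unmark BS) = concat (b # bs) \<and> block_weight BS \<le> N}" for N
      by auto
    then show "finite {i \<in> ?J. block_weight i \<le> N}" for N
      by (rule finite_subset) (rule finite_block_weight)
    show "?f i \<in> ?E (l' + l + int (block_weight i))" if "i \<in> ?J" for i by (rule level[OF that])
  qed (rule c.F_antimono)
  let ?y = "\<lambda>m. (deg_out 1 b, fmor G (fst U) (realize U m), fobj G (fst ?V))"
  show ?case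
  proof (rule c.filt_has_sum_fibres_eq[OF null, where p = hd and I = "{m. unmark m = b}"
        and g = "\<lambda>m. mu B X (p @ ?y m # apply_blocks twistG ?V bs)"])
    show "?f BS \<in> ?M" if "BS \<in> ?J" for BS using level[OF that] c.F_sub_M by blast
    show "hd BS \<in> {m. unmark m = b}" if "BS \<in> ?J" for BS using that by (cases BS) simp_all
  next
    fix m assume m: "m \<in> {m. unmark m = b}"
    have bij: "bij_betw (\<lambda>BS. m # BS) {BS. map unmark BS = bs} {j \<in> ?J. hd j = m}"
    proof (rule bij_betw_imageI)
      show "(#) m ` {BS. map unmark BS = bs} = {j \<in> ?J. hd j = m}"
      proof (intro equalityI subsetI)
        fix j assume "j \<in> {j \<in> ?J. hd j = m}"
        then show "j \<in> (#) m ` {BS. map unmark BS = bs}" by (cases j) simp_all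
      qed (use m in force)
    qed simp
    have ml: "fmor G (fst U) (realize U m) \<in> fil B (fobj G (fst U)) (fobj G (fst ?V)) (deg_out 1 b) (l1 + int (nones m))"
      using op.op_realize[of U m l1] l(1) m by simp
    have p': "filt_chain B X (p @ [?y m]) (l' + (l1 + int (nones m)))"
      using ml Cons.prems(3) fobj oA
      by (intro filt_chain_append[OF Cons.prems(2)] filt_chain_single) auto
    have E: "fil B X (fobj G (fst (tgt ?V (concat bs)))) (deg_out 2 ((p @ [?y m]) @ apply_blocks twistG ?V bs)) = ?E"
      by (simp add: deg_out_red_deg)
    have "filt_has_sum ?E (\<lambda>BS. mu B X ((p @ [?y m]) @ apply_blocks G (fst ?V) (realize_blocks ?V BS)))
      {BS. map unmark BS = bs} (mu B X ((p @ [?y m]) @ apply_blocks twistG ?V bs))"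
      using Cons.IH[OF l(2) p'] unfolding E by simp
    then have "filt_has_sum ?E (\<lambda>BS. ?f (m # BS)) {BS. map unmark BS = bs}
      (mu B X (p @ ?y m # apply_blocks twistG ?V bs))"
      using m by (simp add: deg_out_red_deg)
    then show "filt_has_sum ?E ?f {j \<in> ?J. hd j = m} (mu B X (p @ ?y m # apply_blocks twistG ?V bs))"
      using filt_has_sum_reindex[OF bij, of ?E ?f] by simp
  next
    let ?c = "op.twist_op U b"
    have chp: "is_chain (obj B) (mor B) X p" using cod.filt_chain_is_chain[OF Cons.prems(2)] .
    have chr: "is_chain (obj B) (mor B) (fobj G (fst ?V)) (apply_blocks twistG ?V bs)"
      using cod.filt_chain_is_chain[OF filt_chain_twistG[OF l(2)]] .
    have "fobj G (fst ?V) = fobj twistG ?V" by simp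
    then have tg: "tgt (fobj G (fst ?V)) (apply_blocks twistG ?V bs) = fobj G ?W"
      using tgt_apply_blocks[of twistG ?V bs] by simp
    have "filt_has_sum (fil B X (fobj G ?W) (deg_out 2 (p @ (deg_out 1 b, ?c, fobj G (fst ?V)) # apply_blocks twistG ?V bs)))
      (\<lambda>m. mu B X (p @ ?y m # apply_blocks twistG ?V bs)) {m. unmark m = b}
      (mu B X (p @ (deg_out 1 b, ?c, fobj G (fst ?V)) # apply_blocks twistG ?V bs))"
    proof (rule cod.mu.op_slot_sum[OF chp chr, unfolded tg])
      show "fmor G (fst U) (realize U m) \<in> mor B (tgt X p) (fobj G (fst ?V)) (deg_out 1 b)" if "m \<in> {m. unmark m = b}" for m
        using op.op_realize[of U m l1] l(1) that Cons.prems(3) cod.fil_sub_mor[OF fobj[OF oA(1)] fobj[OF oA(2)]] by simp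
      show "?c \<in> mor B (tgt X p) (fobj G (fst ?V)) (deg_out 1 b)"
        using op.twist_op_filt_chain[OF l(1)] Cons.prems(3) cod.fil_sub_mor[OF fobj[OF oA(1)] fobj[OF oA(2)]] by simp
      show "filt_has_sum (fil B (tgt X p) (fobj G (fst ?V)) (deg_out 1 b)) (\<lambda>m. fmor G (fst U) (realize U m)) {m. unmark m = b} ?c"
        using op.twist_op_sum[OF l(1)] Cons.prems(3) by simp
    qed
    then show "filt_has_sum ?E (\<lambda>m. mu B X (p @ ?y m # apply_blocks twistG ?V bs)) {m. unmark m = b}
      (mu B X (p @ apply_blocks twistG U (b # bs)))" by simp
  qed
qed

text \<open>A mark is realised by the second component of the image object, which is the value of
  \<open>twistG\<close> on the empty block.\<close>

lemma realize_mark_blocks: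
  "realize (fobj (bc_functor B G) U) (mark_blocks (bc_functor B G) U bs) = apply_blocks twistG U bs"
proof (induction bs arbitrary: U)
  case (Cons b bs)
  show ?case using Cons[of "tgt U b"]
    by (cases "b = []") (simp_all add: fobj_bc_functor fmor_bc_functor deg_out_red_deg)
qed simp

text \<open>The untwisted functor equations are summed over all insertions. Their left-hand sides
  form one family, indexed by decompositions of marked lists into blocks, whose limit is then
  identified by regrouping.\<close>

lemma bc_functor_ainf:
  assumes cs: "filt_chain (twist A) U cs l"
  shows "(\<Sum>bs\<in>{bs. concat bs = cs \<and> [] \<notin> set bs}.
      mu (bc_all B) (fobj (bc_functor B G) U) (apply_blocks (bc_functor B G) U bs)) =
    (\<Sum>(p, q, r)\<in>{(p, q, r). p @ q @ r = cs}.
      koszul p (fmor (bc_functor B G) U (p @ (deg_out 2 q, mu (bc_all A) (tgt U p) q, tgt (tgt U p) q) # r)))"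
    (is "sum ?L ?S = ?R")
proof -
  let ?X = "fobj G (fst U)" and ?Y = "fobj G (fst (tgt U cs))"
  let ?E = "fil B ?X ?Y (deg_out 2 cs)" and ?M = "mor B ?X ?Y (deg_out 2 cs)"
  have oA: "fst U \<in> obj A" "fst (tgt U cs) \<in> obj A" using filt_chain_source[OF cs] filt_chain_tgt[OF cs] by auto
  interpret c: complete_group ?M ?E by (rule cod.complete_group_fil[OF fobj[OF oA(1)] fobj[OF oA(2)]])
  let ?f = "\<lambda>BS. mu B ?X (apply_blocks G (fst U) (realize_blocks U BS))"
  let ?J = "{BS. concat (map unmark BS) = cs}"
  let ?g = "\<lambda>ms. \<Sum>(p, q, r)\<in>{(p, q, r). p @ q @ r = realize U ms}.
       koszul p (fmor G (fst U) (p @ (deg_out 2 q, mu A (tgt (fst U) p) q, tgt (tgt (fst U) p) q) # r))"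
  have level: "?f BS \<in> ?E (l + int (block_weight BS))" if BS: "BS \<in> ?J" for BS
  proof -
    have "filt_chain (twist A) U (concat (map unmark BS)) l" using BS cs by simp
    from cod.mu.op_filt_chain[OF apply_realize_blocks_level[OF this]] show ?thesis
      using BS by (auto simp add: deg_out_red_deg)
  qed
  have null: "null_family ?E ?f ?J"
  proof (rule null_family_weight[where w = block_weight])
    show "finite {i \<in> ?J. block_weight i \<le> N}" for N using finite_block_weight[of cs N] by simp
    show "?f i \<in> ?E (l + int (block_weight i))" if "i \<in> ?J" for i by (rule level[OF that])
  qed (rule c.F_antimono)
  have M: "?f BS \<in> ?M" if "BS \<in> ?J" for BS using level[OF that] c.F_sub_M by blast
  have R: "?R = (\<Sum>(p, q, r)\<in>{(p, q, r). p @ q @ r = cs}.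
      koszul p (op.twist_op U (p @ (deg_out 2 q, mu (bc_all A) (tgt U p) q, tgt (tgt U p) q) # r)))"
    by (rule sum.cong) (auto simp: fmor_bc_functor)
  \<comment> \<open>Grouped by \<open>concat\<close>: each group is the left-hand side of one
    untwisted functor equation, and the right-hand sides add up to \<open>?R\<close> by
    \<open>twist_op_compose\<close>.\<close>
  have f: "filt_has_sum ?E ?f ?J ?R"
  proof (rule c.filt_has_sum_fibres_eq[OF null M, where p = concat and I = "{ms. unmark ms = cs}" and g = ?g])
    show "filt_has_sum ?E ?g {ms. unmark ms = cs} ?R" unfolding R using op.twist_op_compose[OF cs] by simp
    fix ms assume ms: "ms \<in> {ms. unmark ms = cs}"
    have "{j \<in> ?J. concat j = ms} = {BS. concat BS = ms}" using ms by auto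
    moreover have "is_chain (obj A) (mor A) (fst U) (realize U ms)"
      using dom.filt_chain_is_chain[OF filt_chain_realize[of A U ms l]] ms cs by simp
    from fmor_ainf[OF this] have "filt_has_sum ?E (\<lambda>bs. mu B ?X (apply_blocks G (fst U) bs))
      {bs. concat bs = realize U ms} (?g ms)"
      using ms by (simp add: deg_out_red_deg)
    then have "filt_has_sum ?E ?f {BS. concat BS = ms} (?g ms)"
      using filt_has_sum_reindex[OF bij_betw_realize_blocks[of U ms], of ?E "\<lambda>bs. mu B ?X (apply_blocks G (fst U) bs)" "?g ms"]
      by simp
    ultimately show "filt_has_sum ?E ?f {j \<in> ?J. concat j = ms} (?g ms)" by simp
  qed auto
  let ?h = "\<lambda>bs. mu B ?X (apply_blocks twistG U bs)"
  \<comment> \<open>Grouped by the unmarked blocks: the insertions inside a block add up to the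
    twisted component on that block.\<close>
  have h: "filt_has_sum ?E ?h {bs. concat bs = cs} ?R"
  proof (rule c.filt_has_sum_partition[OF f, where p = "map unmark"])
    fix bs assume bs: "bs \<in> {bs. concat bs = cs}"
    have "{j \<in> ?J. map unmark j = bs} = {BS. map unmark BS = bs}" using bs by auto
    moreover have "deg_out 2 (apply_blocks twistG U bs) = deg_out 2 cs" using bs by (simp add: deg_out_red_deg)
    moreover have "filt_chain (twist A) U (concat bs) l" using cs bs by simp
    from expand_blocks[OF this, of ?X "[]" 0] have "filt_has_sum
      (fil B ?X (fobj G (fst (tgt U (concat bs)))) (deg_out 2 (apply_blocks twistG U bs))) ?f {BS. map unmark BS = bs} (?h bs)"
      using fobj[OF oA(1)] by simp
    ultimately show "filt_has_sum ?E ?f {j \<in> ?J. map unmark j = bs} (?h bs)" using bs by simp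
  qed auto
  \<comment> \<open>Grouped by the nonempty blocks: the empty ones insert the image of the
    deformation parameter, which yields the twisted operation of the target.\<close>
  have "filt_has_sum ?E ?L ?S ?R"
  proof (rule c.filt_has_sum_partition[OF h, where p = "filter (\<lambda>b. b \<noteq> [])"])
    fix bs assume bs: "bs \<in> ?S"
    let ?F = "bc_functor B G"
    have "concat j = cs" if "filter (\<lambda>b. b \<noteq> []) j = bs" for j
    proof -
      have "concat j = concat (filter (\<lambda>b. b \<noteq> []) j)" by simp
      also have "\<dots> = cs" using that bs by simp
      finally show ?thesis .
    qed
    then have "{j \<in> {bs. concat bs = cs}. filter (\<lambda>b. b \<noteq> []) j = bs} = {j. filter (\<lambda>b. b \<noteq> []) j = bs}"
      by blast
    moreover have ch: "filt_chain (twist B) (fobj ?F U) (apply_blocks ?F U bs) l"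
      using bs cs by (intro filt_chain_apply_blocks[of "twist A"] fmor_bc_filt_chain fobj_bc_twist) auto
    have "filt_has_sum ?E (\<lambda>ms. mu B ?X (realize (fobj ?F U) ms)) {ms. unmark ms = apply_blocks ?F U bs} (?L bs)"
      using cod.mu.twist_op_sum[OF ch] bs
      by (simp add: cod.mu_twist deg_out_red_deg) (simp add: fobj_bc_functor)
    then have "filt_has_sum ?E ?h {j. filter (\<lambda>b. b \<noteq> []) j = bs} (?L bs)"
      using filt_has_sum_reindex[OF bij_betw_mark_blocks[of bs ?F U], of ?E "\<lambda>ms. mu B ?X (realize (fobj ?F U) ms)" "?L bs"] bs
      by (simp add: realize_mark_blocks)
    ultimately show "filt_has_sum ?E ?h {j \<in> {bs. concat bs = cs}. filter (\<lambda>b. b \<noteq> []) j = bs} (?L bs)"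
      by simp
  qed auto
  \<comment> \<open>Without empty blocks there are only finitely many decompositions, so the limit
    is an ordinary sum.\<close>
  moreover have "?S \<subseteq> {bs. concat bs = cs \<and> empties bs \<le> 0}" by (auto simp: empties_def filter_empty_conv)
  then have "finite ?S" using finite_blocks[of cs 0] finite_subset by blast
  ultimately show ?thesis using c.filt_has_sum_finite[of ?S ?L] c.filt_has_sum_unique by blast
qed

end

section \<open>Cohomology through representatives\<close>

text \<open>
  The morphism groups of \<open>D\<close> are presented as quotients \<open>P / N\<close>, with \<open>cls\<close> the quotient map. This
  covers both the operations themselves (\<open>N = 0\<close>) and the associated graded (\<open>P = F\<^sub>l\<close>, \<open>N = F\<^sub>l\<^sub>+\<^sub>1\<close>).
  The product \<open>m2\<close> includes the sign by which the product on cohomology differs from \<open>\<mu>\<^sup>2\<close>.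
\<close>

locale presented_ainf =
  fixes D :: "('o, 'g::grading, 'x) graded_ainf"
    and P N :: "'o \<Rightarrow> 'o \<Rightarrow> 'g \<Rightarrow> 'm::ab_group_add set"
    and cls :: "'o \<Rightarrow> 'o \<Rightarrow> 'g \<Rightarrow> 'm \<Rightarrow> 'x"
    and d1 :: "'o \<Rightarrow> 'o \<Rightarrow> 'g \<Rightarrow> 'm \<Rightarrow> 'm"
    and m2 :: "'o \<Rightarrow> 'o \<Rightarrow> 'o \<Rightarrow> 'g \<Rightarrow> 'g \<Rightarrow> 'm \<Rightarrow> 'm \<Rightarrow> 'm"
  assumes P_zero: "X \<in> gobj D \<Longrightarrow> Y \<in> gobj D \<Longrightarrow> 0 \<in> P X Y g"
    and P_diff: "X \<in> gobj D \<Longrightarrow> Y \<in> gobj D \<Longrightarrow> x \<in> P X Y g \<Longrightarrow> y \<in> P X Y g \<Longrightarrow> x - y \<in> P X Y g"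
    and N_zero: "X \<in> gobj D \<Longrightarrow> Y \<in> gobj D \<Longrightarrow> 0 \<in> N X Y g"
    and N_diff: "X \<in> gobj D \<Longrightarrow> Y \<in> gobj D \<Longrightarrow> x \<in> N X Y g \<Longrightarrow> y \<in> N X Y g \<Longrightarrow> x - y \<in> N X Y g"
    and N_P: "X \<in> gobj D \<Longrightarrow> Y \<in> gobj D \<Longrightarrow> x \<in> N X Y g \<Longrightarrow> x \<in> P X Y g"
    and gmor_group: "X \<in> gobj D \<Longrightarrow> Y \<in> gobj D \<Longrightarrow> group (gmor D X Y g)"
    and cls_image: "X \<in> gobj D \<Longrightarrow> Y \<in> gobj D \<Longrightarrow> cls X Y g ` P X Y g = carrier (gmor D X Y g)"
    and cls_add: "X \<in> gobj D \<Longrightarrow> Y \<in> gobj D \<Longrightarrow> x \<in> P X Y g \<Longrightarrow> y \<in> P X Y g \<Longrightarrow>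
      cls X Y g (x + y) = cls X Y g x \<otimes>\<^bsub>gmor D X Y g\<^esub> cls X Y g y"
    and cls_eq: "X \<in> gobj D \<Longrightarrow> Y \<in> gobj D \<Longrightarrow> x \<in> P X Y g \<Longrightarrow> y \<in> P X Y g \<Longrightarrow>
      cls X Y g x = cls X Y g y \<longleftrightarrow> x - y \<in> N X Y g"
    and gmu1: "X \<in> gobj D \<Longrightarrow> Y \<in> gobj D \<Longrightarrow> x \<in> P X Y g \<Longrightarrow>
      gmu D X [(g, cls X Y g x, Y)] = cls X Y (g + deg1) (d1 X Y g x)"
    and gmu2: "X \<in> gobj D \<Longrightarrow> Y \<in> gobj D \<Longrightarrow> Z \<in> gobj D \<Longrightarrow> x \<in> P X Y g \<Longrightarrow> y \<in> P Y Z h \<Longrightarrow>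
      gmu D X [(g, cls X Y g x, Y), (h, cls Y Z h y, Z)] =
      cls X Z (g + h) (if parity g = 0 then m2 X Y Z g h x y else - m2 X Y Z g h x y)"
    and d1_P: "X \<in> gobj D \<Longrightarrow> Y \<in> gobj D \<Longrightarrow> x \<in> P X Y g \<Longrightarrow> d1 X Y g x \<in> P X Y (g + deg1)"
    and d1_N: "X \<in> gobj D \<Longrightarrow> Y \<in> gobj D \<Longrightarrow> x \<in> N X Y g \<Longrightarrow> d1 X Y g x \<in> N X Y (g + deg1)"
    and d1_add: "X \<in> gobj D \<Longrightarrow> Y \<in> gobj D \<Longrightarrow> x \<in> P X Y g \<Longrightarrow> y \<in> P X Y g \<Longrightarrow>
      d1 X Y g (x + y) = d1 X Y g x + d1 X Y g y"
    and d1_d1: "X \<in> gobj D \<Longrightarrow> Y \<in> gobj D \<Longrightarrow> x \<in> P X Y g \<Longrightarrow>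
      d1 X Y (g + deg1) (d1 X Y g x) \<in> N X Y (g + deg1 + deg1)"
    and m2_P: "X \<in> gobj D \<Longrightarrow> Y \<in> gobj D \<Longrightarrow> Z \<in> gobj D \<Longrightarrow> x \<in> P X Y g \<Longrightarrow> y \<in> P Y Z h \<Longrightarrow>
      m2 X Y Z g h x y \<in> P X Z (g + h)"
    and m2_N_left: "X \<in> gobj D \<Longrightarrow> Y \<in> gobj D \<Longrightarrow> Z \<in> gobj D \<Longrightarrow> x \<in> N X Y g \<Longrightarrow> y \<in> P Y Z h \<Longrightarrow>
      m2 X Y Z g h x y \<in> N X Z (g + h)"
    and m2_N_right: "X \<in> gobj D \<Longrightarrow> Y \<in> gobj D \<Longrightarrow> Z \<in> gobj D \<Longrightarrow> x \<in> P X Y g \<Longrightarrow> y \<in> N Y Z h \<Longrightarrow>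
      m2 X Y Z g h x y \<in> N X Z (g + h)"
    and m2_add_left: "X \<in> gobj D \<Longrightarrow> Y \<in> gobj D \<Longrightarrow> Z \<in> gobj D \<Longrightarrow> x \<in> P X Y g \<Longrightarrow> x' \<in> P X Y g \<Longrightarrow> y \<in> P Y Z h \<Longrightarrow>
      m2 X Y Z g h (x + x') y = m2 X Y Z g h x y + m2 X Y Z g h x' y"
    and m2_add_right: "X \<in> gobj D \<Longrightarrow> Y \<in> gobj D \<Longrightarrow> Z \<in> gobj D \<Longrightarrow> x \<in> P X Y g \<Longrightarrow> y \<in> P Y Z h \<Longrightarrow> y' \<in> P Y Z h \<Longrightarrow>
      m2 X Y Z g h x (y + y') = m2 X Y Z g h x y + m2 X Y Z g h x y'"
    and leibniz: "X \<in> gobj D \<Longrightarrow> Y \<in> gobj D \<Longrightarrow> Z \<in> gobj D \<Longrightarrow> x \<in> P X Y g \<Longrightarrow> y \<in> P Y Z h \<Longrightarrow>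
      d1 X Z (g + h) (m2 X Y Z g h x y) - (m2 X Y Z (g + deg1) h (d1 X Y g x) y +
        (if parity g = 0 then m2 X Y Z g (h + deg1) x (d1 Y Z h y) else - m2 X Y Z g (h + deg1) x (d1 Y Z h y)))
      \<in> N X Z (g + h + deg1)"
    and assoc: "X \<in> gobj D \<Longrightarrow> Y \<in> gobj D \<Longrightarrow> Z \<in> gobj D \<Longrightarrow> W \<in> gobj D \<Longrightarrow>
      x \<in> P X Y g \<Longrightarrow> y \<in> P Y Z h \<Longrightarrow> z \<in> P Z W k \<Longrightarrow>
      d1 X Y g x \<in> N X Y (g + deg1) \<Longrightarrow> d1 Y Z h y \<in> N Y Z (h + deg1) \<Longrightarrow> d1 Z W k z \<in> N Z W (k + deg1) \<Longrightarrow>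
      \<exists>w\<in>P X W (g + h + k - deg1). m2 X Z W (g + h) k (m2 X Y Z g h x y) z -
        m2 X Y W g (h + k) x (m2 Y Z W h k y z) - d1 X W (g + h + k - deg1) w \<in> N X W (g + h + k)"
begin

abbreviation ob where "ob X \<equiv> X \<in> gobj D"

text \<open>Working modulo \<open>N\<close> makes \<open>Cyc\<close> and \<open>Bdy\<close> the full
  preimages of cocycles and coboundaries under \<open>cls\<close>, so cohomology classes can be
  compared on representatives.\<close>

definition Cyc :: "'o \<Rightarrow> 'o \<Rightarrow> 'g \<Rightarrow> 'm set" where
  "Cyc X Y g = {x \<in> P X Y g. d1 X Y g x \<in> N X Y (g + deg1)}"

definition Bdy :: "'o \<Rightarrow> 'o \<Rightarrow> 'g \<Rightarrow> 'm set" where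
  "Bdy X Y g = {x \<in> P X Y g. \<exists>z\<in>P X Y (g - deg1). x - d1 X Y (g - deg1) z \<in> N X Y g}"

definition hcls :: "'o \<Rightarrow> 'o \<Rightarrow> 'g \<Rightarrow> 'm \<Rightarrow> 'x set" where
  "hcls X Y g x = coh_class D X Y g (cls X Y g x)"

lemma P_uminus: "ob X \<Longrightarrow> ob Y \<Longrightarrow> x \<in> P X Y g \<Longrightarrow> - x \<in> P X Y g"
  using P_diff[of X Y 0 g x] P_zero by simp

lemma P_add: "ob X \<Longrightarrow> ob Y \<Longrightarrow> x \<in> P X Y g \<Longrightarrow> y \<in> P X Y g \<Longrightarrow> x + y \<in> P X Y g"
  using P_diff[of X Y x g "- y"] P_uminus by simp

lemma N_uminus: "ob X \<Longrightarrow> ob Y \<Longrightarrow> x \<in> N X Y g \<Longrightarrow> - x \<in> N X Y g"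
  using N_diff[of X Y 0 g x] N_zero by simp

lemma N_add: "ob X \<Longrightarrow> ob Y \<Longrightarrow> x \<in> N X Y g \<Longrightarrow> y \<in> N X Y g \<Longrightarrow> x + y \<in> N X Y g"
  using N_diff[of X Y x g "- y"] N_uminus by simp

lemma d1_zero: "ob X \<Longrightarrow> ob Y \<Longrightarrow> d1 X Y g 0 = 0"
  using d1_add[of X Y 0 g 0] P_zero by simp

lemma d1_uminus: "ob X \<Longrightarrow> ob Y \<Longrightarrow> x \<in> P X Y g \<Longrightarrow> d1 X Y g (- x) = - d1 X Y g x"
  using d1_add[of X Y x g "- x"] P_uminus d1_zero by (simp add: minus_unique)

lemma d1_diff: "ob X \<Longrightarrow> ob Y \<Longrightarrow> x \<in> P X Y g \<Longrightarrow> y \<in> P X Y g \<Longrightarrow> d1 X Y g (x - y) = d1 X Y g x - d1 X Y g y"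
  using d1_add[of X Y x g "- y"] P_uminus d1_uminus by simp

lemma m2_diff_left: "ob X \<Longrightarrow> ob Y \<Longrightarrow> ob Z \<Longrightarrow> x \<in> P X Y g \<Longrightarrow> x' \<in> P X Y g \<Longrightarrow> y \<in> P Y Z h \<Longrightarrow>
    m2 X Y Z g h (x - x') y = m2 X Y Z g h x y - m2 X Y Z g h x' y"
  using m2_add_left[of X Y Z "x - x'" g x' y h] P_diff by (simp add: algebra_simps)

lemma m2_diff_right: "ob X \<Longrightarrow> ob Y \<Longrightarrow> ob Z \<Longrightarrow> x \<in> P X Y g \<Longrightarrow> y \<in> P Y Z h \<Longrightarrow> y' \<in> P Y Z h \<Longrightarrow>
    m2 X Y Z g h x (y - y') = m2 X Y Z g h x y - m2 X Y Z g h x y'"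
  using m2_add_right[of X Y Z x g "y - y'" h y'] P_diff by (simp add: algebra_simps)

lemma cls_carrier: "ob X \<Longrightarrow> ob Y \<Longrightarrow> x \<in> P X Y g \<Longrightarrow> cls X Y g x \<in> carrier (gmor D X Y g)"
  using cls_image by blast

lemma cls_zero: assumes "ob X" "ob Y" shows "cls X Y g 0 = \<one>\<^bsub>gmor D X Y g\<^esub>"
proof -
  interpret group "gmor D X Y g" using gmor_group assms .
  have "cls X Y g 0 \<otimes>\<^bsub>gmor D X Y g\<^esub> cls X Y g 0 = cls X Y g 0"
    using cls_add[OF assms, of 0 g 0] P_zero[OF assms] by simp
  then show ?thesis using cls_carrier[OF assms P_zero[OF assms]] l_cancel_one' by metis
qed

lemma cls_uminus:
  assumes "ob X" "ob Y" "x \<in> P X Y g" shows "cls X Y g (- x) = inv\<^bsub>gmor D X Y g\<^esub> cls X Y g x"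
proof -
  interpret group "gmor D X Y g" using gmor_group assms by blast
  have "cls X Y g (- x) \<otimes>\<^bsub>gmor D X Y g\<^esub> cls X Y g x = \<one>\<^bsub>gmor D X Y g\<^esub>"
    using cls_add[OF assms(1,2) P_uminus[OF assms] assms(3)] cls_zero assms by simp
  then show ?thesis using cls_carrier assms P_uminus inv_equality by metis
qed

lemma Cyc_P: "x \<in> Cyc X Y g \<Longrightarrow> x \<in> P X Y g" by (simp add: Cyc_def)
lemma Bdy_P: "x \<in> Bdy X Y g \<Longrightarrow> x \<in> P X Y g" by (simp add: Bdy_def)

lemma Cyc_diff: "ob X \<Longrightarrow> ob Y \<Longrightarrow> x \<in> Cyc X Y g \<Longrightarrow> y \<in> Cyc X Y g \<Longrightarrow> x - y \<in> Cyc X Y g"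
  by (simp add: Cyc_def P_diff d1_diff N_diff)

lemma N_Bdy: assumes "ob X" "ob Y" "x \<in> N X Y g" shows "x \<in> Bdy X Y g"
  using assms N_P by (auto simp: Bdy_def d1_zero intro!: bexI[of _ 0] P_zero)

lemma Bdy_diff:
  assumes "ob X" "ob Y" "x \<in> Bdy X Y g" "y \<in> Bdy X Y g" shows "x - y \<in> Bdy X Y g"
proof -
  obtain z w where z: "z \<in> P X Y (g - deg1)" "x - d1 X Y (g - deg1) z \<in> N X Y g"
    and w: "w \<in> P X Y (g - deg1)" "y - d1 X Y (g - deg1) w \<in> N X Y g"
    using assms by (auto simp: Bdy_def)
  have "x - y - d1 X Y (g - deg1) (z - w) = (x - d1 X Y (g - deg1) z) - (y - d1 X Y (g - deg1) w)"
    using d1_diff[OF assms(1,2) z(1) w(1)] by simp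
  also have "\<dots> \<in> N X Y g" using N_diff assms z w by blast
  finally show ?thesis using assms z w P_diff Bdy_P unfolding Bdy_def by blast
qed

lemma Bdy_zero: "ob X \<Longrightarrow> ob Y \<Longrightarrow> 0 \<in> Bdy X Y g" using N_Bdy N_zero by blast
lemma Bdy_uminus: "ob X \<Longrightarrow> ob Y \<Longrightarrow> x \<in> Bdy X Y g \<Longrightarrow> - x \<in> Bdy X Y g"
  using Bdy_diff[of X Y 0 g x] Bdy_zero by simp
lemma Bdy_add: "ob X \<Longrightarrow> ob Y \<Longrightarrow> x \<in> Bdy X Y g \<Longrightarrow> y \<in> Bdy X Y g \<Longrightarrow> x + y \<in> Bdy X Y g"
  using Bdy_diff[of X Y x g "- y"] Bdy_uminus by simp

lemma d1_P': "ob X \<Longrightarrow> ob Y \<Longrightarrow> z \<in> P X Y (g - deg1) \<Longrightarrow> d1 X Y (g - deg1) z \<in> P X Y g"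
  using d1_P[of X Y z "g - deg1"] by simp

lemma d1_Bdy: "ob X \<Longrightarrow> ob Y \<Longrightarrow> z \<in> P X Y (g - deg1) \<Longrightarrow> d1 X Y (g - deg1) z \<in> Bdy X Y g"
  using d1_P' N_zero unfolding Bdy_def by (auto intro!: bexI[of _ z])

lemma Bdy_Cyc: assumes "ob X" "ob Y" "x \<in> Bdy X Y g" shows "x \<in> Cyc X Y g"
proof -
  obtain z where z: "z \<in> P X Y (g - deg1)" "x - d1 X Y (g - deg1) z \<in> N X Y g"
    using assms by (auto simp: Bdy_def)
  have "d1 X Y g (x - d1 X Y (g - deg1) z) \<in> N X Y (g + deg1)" using d1_N assms z by blast
  moreover have "d1 X Y g (d1 X Y (g - deg1) z) \<in> N X Y (g + deg1)" using d1_d1[OF assms(1,2) z(1)] by simp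
  ultimately have "d1 X Y g x \<in> N X Y (g + deg1)"
    using N_add[OF assms(1,2)] d1_diff[OF assms(1,2) Bdy_P[OF assms(3)] d1_P'[OF assms(1,2) z(1)]] by fastforce
  then show ?thesis using Bdy_P[OF assms(3)] by (simp add: Cyc_def)
qed

lemma hcls_eq_image:
  assumes "ob X" "ob Y" "x \<in> P X Y g"
  shows "hcls X Y g x = (\<lambda>z. cls X Y g (d1 X Y (g - deg1) z + x)) ` P X Y (g - deg1)"
proof -
  have "coboundaries D X Y g = (\<lambda>z. cls X Y g (d1 X Y (g - deg1) z)) ` P X Y (g - deg1)"
    unfolding coboundaries_def cls_image[OF assms(1,2), symmetric] image_image
    by (rule image_cong) (simp_all add: gmu1[OF assms(1,2)])
  then show ?thesis
    unfolding hcls_def coh_class_def r_coset_def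
    using cls_add[OF assms(1,2) d1_P'[OF assms(1,2)] assms(3)] by (auto simp: image_iff)
qed

lemma hcls_eq_iff:
  assumes "ob X" "ob Y" "x \<in> P X Y g" "y \<in> P X Y g"
  shows "hcls X Y g x = hcls X Y g y \<longleftrightarrow> x - y \<in> Bdy X Y g"
proof
  assume eq: "hcls X Y g x = hcls X Y g y"
  have "cls X Y g x \<in> hcls X Y g x"
    unfolding hcls_eq_image[OF assms(1-3)] using P_zero d1_zero assms by (intro image_eqI[of _ _ 0]) auto
  then obtain z where z: "z \<in> P X Y (g - deg1)" "cls X Y g x = cls X Y g (d1 X Y (g - deg1) z + y)"
    unfolding eq hcls_eq_image[OF assms(1,2,4)] by auto
  have "x - (d1 X Y (g - deg1) z + y) \<in> N X Y g"
    using z(2) cls_eq[OF assms(1-3)] P_add[OF assms(1,2) d1_P'[OF assms(1,2) z(1)] assms(4)] by blast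
  then have "x - y - d1 X Y (g - deg1) z \<in> N X Y g" by (simp add: algebra_simps)
  then show "x - y \<in> Bdy X Y g" using P_diff assms z(1) unfolding Bdy_def by auto
next
  have sub: "hcls X Y g x \<subseteq> hcls X Y g y" if xy: "x - y \<in> Bdy X Y g" "x \<in> P X Y g" "y \<in> P X Y g" for x y
  proof
    fix u assume "u \<in> hcls X Y g x"
    then obtain w where w: "w \<in> P X Y (g - deg1)" "u = cls X Y g (d1 X Y (g - deg1) w + x)"
      unfolding hcls_eq_image[OF assms(1,2) xy(2)] by auto
    obtain z where z: "z \<in> P X Y (g - deg1)" "x - y - d1 X Y (g - deg1) z \<in> N X Y g"
      using xy by (auto simp: Bdy_def)
    have "d1 X Y (g - deg1) w + x - (d1 X Y (g - deg1) (w + z) + y) \<in> N X Y g"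
      using z(2) d1_add[OF assms(1,2) w(1) z(1)] by (simp add: algebra_simps)
    then have "u = cls X Y g (d1 X Y (g - deg1) (w + z) + y)"
      using w cls_eq[OF assms(1,2)] P_add[OF assms(1,2)] d1_P'[OF assms(1,2)] w(1) z(1) xy by simp
    then show "u \<in> hcls X Y g y"
      unfolding hcls_eq_image[OF assms(1,2) xy(3)] using P_add[OF assms(1,2) w(1) z(1)] by blast
  qed
  assume "x - y \<in> Bdy X Y g"
  then show "hcls X Y g x = hcls X Y g y"
    using sub[of x y] sub[of y x] assms Bdy_uminus[of X Y "x - y" g] by auto
qed

text \<open>Products and functors on cohomology are evaluated on a chosen element of a class. The
  choice is always the image of a cocycle cohomologous to the given one, which is all that
  well-definedness requires.\<close>

lemma hcls_some:
  assumes "ob X" "ob Y" "x \<in> Cyc X Y g"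
  obtains x' where "x' \<in> Cyc X Y g" "x' - x \<in> Bdy X Y g" "(SOME u. u \<in> hcls X Y g x) = cls X Y g x'"
proof -
  have xP: "x \<in> P X Y g" using assms Cyc_P by blast
  have "hcls X Y g x \<noteq> {}" unfolding hcls_eq_image[OF assms(1,2) xP] using P_zero assms by auto
  then have "(SOME u. u \<in> hcls X Y g x) \<in> hcls X Y g x" by (simp add: some_in_eq)
  then obtain z where z: "z \<in> P X Y (g - deg1)"
    "(SOME u. u \<in> hcls X Y g x) = cls X Y g (d1 X Y (g - deg1) z + x)"
    unfolding hcls_eq_image[OF assms(1,2) xP] by auto
  have b: "d1 X Y (g - deg1) z \<in> Bdy X Y g" using d1_Bdy assms z by blast
  have "d1 X Y (g - deg1) z \<in> Cyc X Y g" using b Bdy_Cyc assms by blast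
  then have "d1 X Y (g - deg1) z + x \<in> Cyc X Y g"
    using assms by (simp add: Cyc_def P_add d1_add N_add)
  with b z(2) show thesis using that[of "d1 X Y (g - deg1) z + x"] by simp
qed

lemma cocycles_image: assumes "ob X" "ob Y" shows "cocycles D X Y g = cls X Y g ` Cyc X Y g"
  unfolding cocycles_def kernel_def cls_image[OF assms, symmetric] Cyc_def
  using gmu1[OF assms] cls_zero[OF assms] cls_eq[OF assms d1_P[OF assms] P_zero[OF assms]]
  by (auto simp: image_iff)

lemma cls_cocycles_iff:
  assumes "ob X" "ob Y" "x \<in> P X Y g" shows "cls X Y g x \<in> cocycles D X Y g \<longleftrightarrow> x \<in> Cyc X Y g"
proof
  assume "cls X Y g x \<in> cocycles D X Y g"
  then obtain y where y: "y \<in> Cyc X Y g" "cls X Y g x = cls X Y g y" unfolding cocycles_image[OF assms(1,2)] by blast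
  then have "x - y \<in> N X Y g" using cls_eq[OF assms Cyc_P[OF y(1)]] by simp
  then have "x - y \<in> Cyc X Y g" using Bdy_Cyc N_Bdy assms by blast
  from Cyc_diff[OF assms(1,2) this Cyc_diff[OF assms(1,2) _ y(1), of 0]] show "x \<in> Cyc X Y g"
    using assms by (simp add: Cyc_def P_zero d1_zero N_zero)
qed (use assms in \<open>simp add: cocycles_image\<close>)

lemma chom_coh: assumes "ob X" "ob Y" shows "chom (coh D) X Y g = hcls X Y g ` Cyc X Y g"
  using cocycles_image[OF assms]
  unfolding coh_def FactGroup_def RCOSETS_def r_coset_def hcls_def coh_class_def by auto

lemma hcls_chom: "ob X \<Longrightarrow> ob Y \<Longrightarrow> x \<in> Cyc X Y g \<Longrightarrow> hcls X Y g x \<in> chom (coh D) X Y g"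
  by (simp add: chom_coh)

lemma cobj_coh [simp]: "cobj (coh D) = gobj D" by (simp add: coh_def)

lemma m2_Cyc:
  assumes "ob X" "ob Y" "ob Z" "x \<in> Cyc X Y g" "y \<in> Cyc Y Z h"
  shows "m2 X Y Z g h x y \<in> Cyc X Z (g + h)"
proof -
  have P: "x \<in> P X Y g" "y \<in> P Y Z h" and N: "d1 X Y g x \<in> N X Y (g + deg1)" "d1 Y Z h y \<in> N Y Z (h + deg1)"
    using assms by (auto simp: Cyc_def)
  let ?t = "m2 X Y Z (g + deg1) h (d1 X Y g x) y + (if parity g = 0 then m2 X Y Z g (h + deg1) x (d1 Y Z h y)
    else - m2 X Y Z g (h + deg1) x (d1 Y Z h y))"
  have "m2 X Y Z (g + deg1) h (d1 X Y g x) y \<in> N X Z (g + h + deg1)"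
    using m2_N_left[OF assms(1-3) N(1) P(2)] by (simp add: add_ac)
  moreover have "m2 X Y Z g (h + deg1) x (d1 Y Z h y) \<in> N X Z (g + h + deg1)"
    using m2_N_right[OF assms(1-3) P(1) N(2)] by (simp add: add_ac)
  ultimately have "?t \<in> N X Z (g + h + deg1)" using assms by (auto intro: N_add N_diff N_uminus)
  from N_add[OF assms(1,3) leibniz[OF assms(1-3) P] this]
  have "d1 X Z (g + h) (m2 X Y Z g h x y) \<in> N X Z (g + h + deg1)" by simp
  then show ?thesis using m2_P[OF assms(1-3) P] by (simp add: Cyc_def)
qed

lemma m2_Bdy_left:
  assumes "ob X" "ob Y" "ob Z" "x \<in> Bdy X Y g" "y \<in> Cyc Y Z h"
  shows "m2 X Y Z g h x y \<in> Bdy X Z (g + h)"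
proof -
  obtain z where z: "z \<in> P X Y (g - deg1)" "x - d1 X Y (g - deg1) z \<in> N X Y g" and xP: "x \<in> P X Y g"
    using assms(4) by (auto simp: Bdy_def)
  have y: "y \<in> P Y Z h" "d1 Y Z h y \<in> N Y Z (h + deg1)" using assms(5) by (auto simp: Cyc_def)
  let ?w = "m2 X Y Z (g - deg1) h z y"
  have w: "?w \<in> P X Z (g + h - deg1)" using m2_P[OF assms(1-3) z(1) y(1)] by (simp add: algebra_simps)
  have e: "g - deg1 + h = g + h - deg1" "g - deg1 + deg1 = g" "g + h - deg1 + deg1 = g + h"
    "g - deg1 + (h + deg1) = g + h" by (simp_all add: algebra_simps)
  let ?b = "m2 X Y Z (g - deg1) (h + deg1) z (d1 Y Z h y)"
  have 1: "d1 X Z (g + h - deg1) ?w - (m2 X Y Z g h (d1 X Y (g - deg1) z) y +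
      (if parity (g - deg1) = 0 then ?b else - ?b)) \<in> N X Z (g + h)"
    using leibniz[OF assms(1-3) z(1) y(1)] unfolding e .
  have "?b \<in> N X Z (g + h)" using m2_N_right[OF assms(1-3) z(1) y(2)] unfolding e .
  then have 2: "(if parity (g - deg1) = 0 then ?b else - ?b) \<in> N X Z (g + h)" using N_uminus assms by simp
  have 3: "m2 X Y Z g h x y - m2 X Y Z g h (d1 X Y (g - deg1) z) y \<in> N X Z (g + h)"
    using m2_N_left[OF assms(1-3) z(2) y(1)] m2_diff_left[OF assms(1-3) xP d1_P'[OF assms(1,2) z(1)] y(1)] by simp
  have "m2 X Y Z g h x y - d1 X Z (g + h - deg1) ?w =
    (m2 X Y Z g h x y - m2 X Y Z g h (d1 X Y (g - deg1) z) y) -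
    (d1 X Z (g + h - deg1) ?w - (m2 X Y Z g h (d1 X Y (g - deg1) z) y +
      (if parity (g - deg1) = 0 then ?b else - ?b))) - (if parity (g - deg1) = 0 then ?b else - ?b)" by simp
  also have "\<dots> \<in> N X Z (g + h)" using N_diff[OF assms(1,3) N_diff[OF assms(1,3) 3 1] 2] .
  finally show ?thesis using w m2_P[OF assms(1-3) xP y(1)] unfolding Bdy_def by blast
qed

lemma m2_Bdy_right:
  assumes "ob X" "ob Y" "ob Z" "x \<in> Cyc X Y g" "y \<in> Bdy Y Z h"
  shows "m2 X Y Z g h x y \<in> Bdy X Z (g + h)"
proof -
  obtain z where z: "z \<in> P Y Z (h - deg1)" "y - d1 Y Z (h - deg1) z \<in> N Y Z h" and yP: "y \<in> P Y Z h"
    using assms(5) by (auto simp: Bdy_def)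
  have x: "x \<in> P X Y g" "d1 X Y g x \<in> N X Y (g + deg1)" using assms(4) by (auto simp: Cyc_def)
  have e: "g + (h - deg1) = g + h - deg1" "h - deg1 + deg1 = h" "g + h - deg1 + deg1 = g + h"
    "g + deg1 + (h - deg1) = g + h" by (simp_all add: algebra_simps)
  let ?m = "m2 X Y Z g (h - deg1) x z"
  have m: "?m \<in> P X Z (g + h - deg1)" using m2_P[OF assms(1-3) x(1) z(1)] unfolding e .
  \<comment> \<open>The Leibniz rule puts the sign of the degree \<open>g\<close> on the derivative
    of the right factor; it is moved onto the primitive \<open>?m\<close>.\<close>
  define s where "s u = (if parity g = 0 then u else - u)" for u :: 'm
  have s: "s (u + v) = s u + s v" "s (u - v) = s u - s v" "s (s u) = u" for u v by (auto simp: s_def)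
  have sN: "s u \<in> N X Z k" if "u \<in> N X Z k" for u k using that N_uminus assms by (simp add: s_def)
  have sP: "s u \<in> P X Z k" if "u \<in> P X Z k" for u k using that P_uminus assms by (simp add: s_def)
  have ds: "d1 X Z (g + h - deg1) (s ?m) = s (d1 X Z (g + h - deg1) ?m)"
    using d1_uminus[OF assms(1,3) m] by (simp add: s_def)
  let ?a = "m2 X Y Z (g + deg1) (h - deg1) (d1 X Y g x) z" and ?b = "m2 X Y Z g h x (d1 Y Z (h - deg1) z)"
  have 1: "d1 X Z (g + h - deg1) ?m - (?a + s ?b) \<in> N X Z (g + h)"
    using leibniz[OF assms(1-3) x(1) z(1)] unfolding e s_def .
  have 2: "?a \<in> N X Z (g + h)" using m2_N_left[OF assms(1-3) x(2) z(1)] unfolding e .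
  have 3: "m2 X Y Z g h x y - ?b \<in> N X Z (g + h)"
    using m2_N_right[OF assms(1-3) x(1) z(2)] m2_diff_right[OF assms(1-3) x(1) yP d1_P'[OF assms(2,3) z(1)]] by simp
  have "d1 X Z (g + h - deg1) ?m - s ?b \<in> N X Z (g + h)" using N_add[OF assms(1,3) 1 2] by simp
  then have "s (d1 X Z (g + h - deg1) ?m) - ?b \<in> N X Z (g + h)" using sN[of "_ - s ?b"] s by metis
  then have "m2 X Y Z g h x y - d1 X Z (g + h - deg1) (s ?m) \<in> N X Z (g + h)"
    unfolding ds using N_diff[OF assms(1,3) 3] by fastforce
  then show ?thesis using sP[OF m] m2_P[OF assms(1-3) x(1) yP] unfolding Bdy_def by blast
qed

lemma m2_cong:
  assumes "ob X" "ob Y" "ob Z" "x \<in> Cyc X Y g" "x' \<in> Cyc X Y g" "x' - x \<in> Bdy X Y g"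
    and "y \<in> Cyc Y Z h" "y' \<in> Cyc Y Z h" "y' - y \<in> Bdy Y Z h"
  shows "m2 X Y Z g h x' y' - m2 X Y Z g h x y \<in> Bdy X Z (g + h)"
proof -
  have "m2 X Y Z g h x' y' - m2 X Y Z g h x y = m2 X Y Z g h (x' - x) y' + m2 X Y Z g h x (y' - y)"
    using m2_diff_left[OF assms(1-3)] m2_diff_right[OF assms(1-3)] Cyc_P assms(4,5,7,8) by simp
  also have "\<dots> \<in> Bdy X Z (g + h)"
    using Bdy_add assms m2_Bdy_left[OF assms(1-3,6,8)] m2_Bdy_right[OF assms(1-4,9)] by blast
  finally show ?thesis .
qed

lemma ccomp_hcls:
  assumes "ob X" "ob Y" "ob Z" "x \<in> Cyc X Y g" "y \<in> Cyc Y Z h"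
  shows "ccomp (coh D) X Y Z g h (hcls X Y g x) (hcls Y Z h y) = hcls X Z (g + h) (m2 X Y Z g h x y)"
proof -
  obtain x' where x': "x' \<in> Cyc X Y g" "x' - x \<in> Bdy X Y g" "(SOME u. u \<in> hcls X Y g x) = cls X Y g x'"
    using hcls_some[OF assms(1,2,4)] .
  obtain y' where y': "y' \<in> Cyc Y Z h" "y' - y \<in> Bdy Y Z h" "(SOME u. u \<in> hcls Y Z h y) = cls Y Z h y'"
    using hcls_some[OF assms(2,3,5)] .
  have P: "m2 X Y Z g h x' y' \<in> P X Z (g + h)" "m2 X Y Z g h x y \<in> P X Z (g + h)"
    using m2_P[OF assms(1-3)] Cyc_P x' y' assms by blast+
  have "ccomp (coh D) X Y Z g h (hcls X Y g x) (hcls Y Z h y) = hcls X Z (g + h) (m2 X Y Z g h x' y')"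
    using gmu2[OF assms(1-3), of x' g y' h] Cyc_P[OF x'(1)] Cyc_P[OF y'(1)] cls_uminus[OF assms(1,3) P_uminus[OF assms(1,3) P(1)]]
    by (simp add: coh_def Let_def x'(3) y'(3) hcls_def[of X Z "g + h" "m2 X Y Z g h x' y'"])
  also have "\<dots> = hcls X Z (g + h) (m2 X Y Z g h x y)"
    using hcls_eq_iff[OF assms(1,3) P] m2_cong[OF assms(1-4) x'(1,2) assms(5) y'(1,2)] by blast
  finally show ?thesis .
qed

lemma assoc_Bdy:
  assumes "ob X" "ob Y" "ob Z" "ob W" "x \<in> Cyc X Y g" "y \<in> Cyc Y Z h" "z \<in> Cyc Z W k"
  shows "m2 X Z W (g + h) k (m2 X Y Z g h x y) z - m2 X Y W g (h + k) x (m2 Y Z W h k y z) \<in> Bdy X W (g + h + k)"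
proof -
  have P: "m2 X Z W (g + h) k (m2 X Y Z g h x y) z \<in> P X W (g + h + k)"
    "m2 X Y W g (h + k) x (m2 Y Z W h k y z) \<in> P X W (g + h + k)"
    using Cyc_P[OF m2_Cyc[OF assms(1,3,4) m2_Cyc[OF assms(1-3,5,6)] assms(7)]]
      Cyc_P[OF m2_Cyc[OF assms(1,2,4,5) m2_Cyc[OF assms(2-4,6,7)]]] by (simp_all add: add.assoc)
  show ?thesis
    using assoc[OF assms(1-4), of x g y h z k] assms(5-7) P_diff[OF assms(1,4) P] unfolding Bdy_def Cyc_def by auto
qed

definition unit_cocycle :: "'o \<Rightarrow> 'm \<Rightarrow> bool" where
  "unit_cocycle X e \<longleftrightarrow> e \<in> Cyc X X 0 \<and>
     (\<forall>Y g x. ob Y \<longrightarrow> x \<in> Cyc X Y g \<longrightarrow> m2 X X Y 0 g e x - x \<in> Bdy X Y g) \<and>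
     (\<forall>Y g x. ob Y \<longrightarrow> x \<in> Cyc Y X g \<longrightarrow> m2 Y X X g 0 x e - x \<in> Bdy Y X g)"

lemma unit_cocycleD:
  assumes "unit_cocycle X e" "ob Y"
  shows "x \<in> Cyc X Y g \<Longrightarrow> m2 X X Y 0 g e x - x \<in> Bdy X Y g"
    and "x \<in> Cyc Y X g \<Longrightarrow> m2 Y X X g 0 x e - x \<in> Bdy Y X g"
  using assms unfolding unit_cocycle_def by blast+

lemma is_unit_at_hcls:
  assumes "ob X" "e \<in> Cyc X X 0"
  shows "is_unit_at (coh D) X (hcls X X 0 e) \<longleftrightarrow> unit_cocycle X e"
proof -
  have "ccomp (coh D) X X Y 0 g (hcls X X 0 e) (hcls X Y g x) = hcls X Y g x \<longleftrightarrow> m2 X X Y 0 g e x - x \<in> Bdy X Y g"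
    if "ob Y" "x \<in> Cyc X Y g" for Y g x
    using that assms ccomp_hcls[OF assms(1,1) that(1) assms(2) that(2)]
      hcls_eq_iff[OF assms(1) that(1), of "m2 X X Y 0 g e x" g x] Cyc_P m2_P[OF assms(1,1) that(1), of e 0 x g] by simp
  moreover have "ccomp (coh D) Y X X g 0 (hcls Y X g x) (hcls X X 0 e) = hcls Y X g x \<longleftrightarrow> m2 Y X X g 0 x e - x \<in> Bdy Y X g"
    if "ob Y" "x \<in> Cyc Y X g" for Y g x
    using that assms ccomp_hcls[OF that(1) assms(1,1) that(2) assms(2)]
      hcls_eq_iff[OF that(1) assms(1), of "m2 Y X X g 0 x e" g x] Cyc_P m2_P[OF that(1) assms(1,1), of x g e 0] by simp
  ultimately show ?thesis
    unfolding is_unit_at_def unit_cocycle_def using assms hcls_chom by (simp add: chom_coh) blast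
qed

lemma is_unit_atE:
  assumes "ob X" "is_unit_at (coh D) X E" obtains e where "E = hcls X X 0 e" "unit_cocycle X e"
proof -
  have "E \<in> chom (coh D) X X 0" using assms(2) unfolding is_unit_at_def by (rule conjunct1)
  then obtain e where e: "E = hcls X X 0 e" "e \<in> Cyc X X 0"
    unfolding chom_coh[OF assms(1,1)] by auto
  from is_unit_at_hcls[OF assms(1) e(2)] assms(2) e(1) have "unit_cocycle X e" by simp
  with e(1) show thesis by (rule that)
qed

lemma unit_cocycle_cong:
  assumes "ob X" "unit_cocycle X e" "e' \<in> Cyc X X 0" "e' - e \<in> Bdy X X 0" shows "unit_cocycle X e'"
proof -
  have e: "e \<in> Cyc X X 0" using assms by (simp add: unit_cocycle_def)
  then have "hcls X X 0 e' = hcls X X 0 e"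
    using hcls_eq_iff[OF assms(1,1) Cyc_P[OF assms(3)] Cyc_P[OF e]] assms(4) by simp
  then show ?thesis using is_unit_at_hcls[OF assms(1,3)] is_unit_at_hcls[OF assms(1) e] assms by simp
qed

section \<open>Cancelling isomorphisms in cohomology\<close>

text \<open>The product of \<open>x\<close> with \<open>f'\<close> is a preimage. Surjectivity rests
  on \<open>f' f\<close> being a unit, injectivity on \<open>f f'\<close>.\<close>

lemma iso_post_surj:
  assumes "ob W" "ob X" "ob Y" "f \<in> Cyc X Y 0" "f' \<in> Cyc Y X 0"
    and "unit_cocycle Y (m2 Y X Y 0 0 f' f)" "x \<in> Cyc W Y g"
  shows "\<exists>x'\<in>Cyc W X g. m2 W X Y g 0 x' f - x \<in> Bdy W Y g"
proof -
  have "m2 W X Y g 0 (m2 W Y X g 0 x f') f - m2 W Y Y g 0 x (m2 Y X Y 0 0 f' f) \<in> Bdy W Y g"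
    using assoc_Bdy[OF assms(1,3,2,3,7,5,4)] by simp
  moreover have "m2 W Y Y g 0 x (m2 Y X Y 0 0 f' f) - x \<in> Bdy W Y g"
    using assms unfolding unit_cocycle_def by blast
  ultimately have "m2 W X Y g 0 (m2 W Y X g 0 x f') f - x \<in> Bdy W Y g"
    using Bdy_add[OF assms(1,3)] by fastforce
  then show ?thesis using m2_Cyc[OF assms(1,3,2,7,5)] by auto
qed

lemma iso_post_inj:
  assumes "ob W" "ob X" "ob Y" "f \<in> Cyc X Y 0" "f' \<in> Cyc Y X 0"
    and "unit_cocycle X (m2 X Y X 0 0 f f')" "x \<in> Cyc W X g" "m2 W X Y g 0 x f \<in> Bdy W Y g"
  shows "x \<in> Bdy W X g"
proof -
  have 1: "m2 W Y X g 0 (m2 W X Y g 0 x f) f' - m2 W X X g 0 x (m2 X Y X 0 0 f f') \<in> Bdy W X g"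
    using assoc_Bdy[OF assms(1,2,3,2,7,4,5)] by simp
  have 2: "m2 W Y X g 0 (m2 W X Y g 0 x f) f' \<in> Bdy W X g"
    using m2_Bdy_left[OF assms(1,3,2,8,5)] by simp
  have 3: "m2 W X X g 0 x (m2 X Y X 0 0 f f') - x \<in> Bdy W X g"
    using assms unfolding unit_cocycle_def by blast
  from Bdy_diff[OF assms(1,2) Bdy_diff[OF assms(1,2) 2 1] 3] show ?thesis by simp
qed

text \<open>Left multiplication, with the roles of \<open>f f'\<close> and \<open>f' f\<close>
  exchanged.\<close>

lemma iso_pre_surj:
  assumes "ob W" "ob X" "ob Y" "f \<in> Cyc X Y 0" "f' \<in> Cyc Y X 0"
    and "unit_cocycle X (m2 X Y X 0 0 f f')" "x \<in> Cyc X W g"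
  shows "\<exists>x'\<in>Cyc Y W g. m2 X Y W 0 g f x' - x \<in> Bdy X W g"
proof -
  have "m2 X X W 0 g (m2 X Y X 0 0 f f') x - m2 X Y W 0 g f (m2 Y X W 0 g f' x) \<in> Bdy X W g"
    using assoc_Bdy[OF assms(2,3,2,1,4,5,7)] by simp
  moreover have "m2 X X W 0 g (m2 X Y X 0 0 f f') x - x \<in> Bdy X W g"
    using assms unfolding unit_cocycle_def by blast
  ultimately have "m2 X Y W 0 g f (m2 Y X W 0 g f' x) - x \<in> Bdy X W g"
    using Bdy_diff[OF assms(2,1)] by fastforce
  then show ?thesis using m2_Cyc[OF assms(3,2,1,5,7)] by auto
qed

lemma iso_pre_inj:
  assumes "ob W" "ob X" "ob Y" "f \<in> Cyc X Y 0" "f' \<in> Cyc Y X 0"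
    and "unit_cocycle Y (m2 Y X Y 0 0 f' f)" "x \<in> Cyc Y W g" "m2 X Y W 0 g f x \<in> Bdy X W g"
  shows "x \<in> Bdy Y W g"
proof -
  have 1: "m2 Y Y W 0 g (m2 Y X Y 0 0 f' f) x - m2 Y X W 0 g f' (m2 X Y W 0 g f x) \<in> Bdy Y W g"
    using assoc_Bdy[OF assms(3,2,3,1,5,4,7)] by simp
  have 2: "m2 Y X W 0 g f' (m2 X Y W 0 g f x) \<in> Bdy Y W g"
    using m2_Bdy_right[OF assms(3,2,1,5,8)] by simp
  have 3: "m2 Y Y W 0 g (m2 Y X Y 0 0 f' f) x - x \<in> Bdy Y W g"
    using assms unfolding unit_cocycle_def by blast
  from Bdy_diff[OF assms(3,1) Bdy_add[OF assms(3,1) 1 2] 3] show ?thesis by simp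
qed

lemma isomorphic_inE:
  assumes "ob X" "ob Y" "isomorphic_in (coh D) X Y"
  obtains f f' where "f \<in> Cyc X Y 0" "f' \<in> Cyc Y X 0"
    "unit_cocycle X (m2 X Y X 0 0 f f')" "unit_cocycle Y (m2 Y X Y 0 0 f' f)"
proof -
  obtain u v where uv: "u \<in> chom (coh D) X Y 0" "v \<in> chom (coh D) Y X 0"
    "is_unit_at (coh D) X (ccomp (coh D) X Y X 0 0 u v)" "is_unit_at (coh D) Y (ccomp (coh D) Y X Y 0 0 v u)"
    using assms(3) unfolding isomorphic_in_def by blast
  obtain f f' where f: "u = hcls X Y 0 f" "v = hcls Y X 0 f'" "f \<in> Cyc X Y 0" "f' \<in> Cyc Y X 0"
    using uv(1,2) chom_coh[OF assms(1,2)] chom_coh[OF assms(2,1)] by auto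
  have "unit_cocycle X (m2 X Y X 0 0 f f')"
    using uv(3) ccomp_hcls[OF assms(1,2,1) f(3,4)] m2_Cyc[OF assms(1,2,1) f(3,4)] is_unit_at_hcls[OF assms(1)] f by simp
  moreover have "unit_cocycle Y (m2 Y X Y 0 0 f' f)"
    using uv(4) ccomp_hcls[OF assms(2,1,2) f(4,3)] m2_Cyc[OF assms(2,1,2) f(4,3)] is_unit_at_hcls[OF assms(2)] f by simp
  ultimately show thesis using that f by blast
qed

lemma isomorphic_inI:
  assumes "ob X" "ob Y" "f \<in> Cyc X Y 0" "f' \<in> Cyc Y X 0"
    "unit_cocycle X (m2 X Y X 0 0 f f')" "unit_cocycle Y (m2 Y X Y 0 0 f' f)"
  shows "isomorphic_in (coh D) X Y"
  unfolding isomorphic_in_def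
  using hcls_chom[OF assms(1-3)] hcls_chom[OF assms(2,1,4)] ccomp_hcls[OF assms(1,2,1,3,4)]
    ccomp_hcls[OF assms(2,1,2,4,3)] is_unit_at_hcls[OF assms(1) m2_Cyc[OF assms(1,2,1,3,4), simplified]]
    is_unit_at_hcls[OF assms(2) m2_Cyc[OF assms(2,1,2,4,3), simplified]] assms
  by (intro bexI[of _ "hcls X Y 0 f"] bexI[of _ "hcls Y X 0 f'"]) auto

end

section \<open>Functors through representatives\<close>

text \<open>Products are respected on cocycles only up to coboundaries rather than modulo
  \<open>N'\<close>, since the second component of a functor is a homotopy.\<close>

locale presented_functor =
  dom: presented_ainf D P N cls d1 m2 + cod: presented_ainf D' P' N' cls' d1' m2'
  for D :: "('o, 'g::grading, 'x) graded_ainf" and P N :: "'o \<Rightarrow> 'o \<Rightarrow> 'g \<Rightarrow> 'm::ab_group_add set"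
    and cls d1 m2
    and D' :: "('p, 'g, 'y) graded_ainf" and P' N' :: "'p \<Rightarrow> 'p \<Rightarrow> 'g \<Rightarrow> 'n::ab_group_add set"
    and cls' d1' m2' +
  fixes F :: "('o, 'g, 'x, 'p, 'y) ainf_functor" and \<phi> :: "'o \<Rightarrow> 'o \<Rightarrow> 'g \<Rightarrow> 'm \<Rightarrow> 'n"
  assumes fobj_ob: "X \<in> gobj D \<Longrightarrow> fobj F X \<in> gobj D'"
    and fmor1: "X \<in> gobj D \<Longrightarrow> Y \<in> gobj D \<Longrightarrow> x \<in> P X Y g \<Longrightarrow>
      fmor F X [(g, cls X Y g x, Y)] = cls' (fobj F X) (fobj F Y) g (\<phi> X Y g x)"
    and \<phi>_P: "X \<in> gobj D \<Longrightarrow> Y \<in> gobj D \<Longrightarrow> x \<in> P X Y g \<Longrightarrow> \<phi> X Y g x \<in> P' (fobj F X) (fobj F Y) g"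
    and \<phi>_N: "X \<in> gobj D \<Longrightarrow> Y \<in> gobj D \<Longrightarrow> x \<in> N X Y g \<Longrightarrow> \<phi> X Y g x \<in> N' (fobj F X) (fobj F Y) g"
    and \<phi>_add: "X \<in> gobj D \<Longrightarrow> Y \<in> gobj D \<Longrightarrow> x \<in> P X Y g \<Longrightarrow> y \<in> P X Y g \<Longrightarrow>
      \<phi> X Y g (x + y) = \<phi> X Y g x + \<phi> X Y g y"
    and \<phi>_d1: "X \<in> gobj D \<Longrightarrow> Y \<in> gobj D \<Longrightarrow> x \<in> P X Y g \<Longrightarrow>
      d1' (fobj F X) (fobj F Y) g (\<phi> X Y g x) - \<phi> X Y (g + deg1) (d1 X Y g x) \<in> N' (fobj F X) (fobj F Y) (g + deg1)"
    and \<phi>_m2: "X \<in> gobj D \<Longrightarrow> Y \<in> gobj D \<Longrightarrow> Z \<in> gobj D \<Longrightarrow> x \<in> dom.Cyc X Y g \<Longrightarrow> y \<in> dom.Cyc Y Z h \<Longrightarrow>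
      \<phi> X Z (g + h) (m2 X Y Z g h x y) - m2' (fobj F X) (fobj F Y) (fobj F Z) g h (\<phi> X Y g x) (\<phi> Y Z h y)
      \<in> cod.Bdy (fobj F X) (fobj F Z) (g + h)"
begin

lemma \<phi>_diff: "dom.ob X \<Longrightarrow> dom.ob Y \<Longrightarrow> x \<in> P X Y g \<Longrightarrow> y \<in> P X Y g \<Longrightarrow> \<phi> X Y g (x - y) = \<phi> X Y g x - \<phi> X Y g y"
  using \<phi>_add[of X Y "x - y" g y] dom.P_diff[of X Y x g y] by (simp add: algebra_simps)

lemma \<phi>_Cyc: assumes "dom.ob X" "dom.ob Y" "x \<in> dom.Cyc X Y g" shows "\<phi> X Y g x \<in> cod.Cyc (fobj F X) (fobj F Y) g"
proof -
  have x: "x \<in> P X Y g" "d1 X Y g x \<in> N X Y (g + deg1)" using assms by (auto simp: dom.Cyc_def)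
  have "d1' (fobj F X) (fobj F Y) g (\<phi> X Y g x) \<in> N' (fobj F X) (fobj F Y) (g + deg1)"
    using cod.N_add[OF fobj_ob[OF assms(1)] fobj_ob[OF assms(2)] \<phi>_d1[OF assms(1,2) x(1)] \<phi>_N[OF assms(1,2) x(2)]] by simp
  then show ?thesis using \<phi>_P[OF assms(1,2) x(1)] by (simp add: cod.Cyc_def)
qed

lemma \<phi>_Bdy: assumes "dom.ob X" "dom.ob Y" "x \<in> dom.Bdy X Y g" shows "\<phi> X Y g x \<in> cod.Bdy (fobj F X) (fobj F Y) g"
proof -
  note o = fobj_ob[OF assms(1)] fobj_ob[OF assms(2)]
  obtain z where z: "z \<in> P X Y (g - deg1)" "x - d1 X Y (g - deg1) z \<in> N X Y g" and x: "x \<in> P X Y g"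
    using assms by (auto simp: dom.Bdy_def)
  have 1: "\<phi> X Y g x - \<phi> X Y g (d1 X Y (g - deg1) z) \<in> N' (fobj F X) (fobj F Y) g"
    using \<phi>_N[OF assms(1,2) z(2)] \<phi>_diff[OF assms(1,2) x dom.d1_P'[OF assms(1,2) z(1)]] by simp
  have 2: "d1' (fobj F X) (fobj F Y) (g - deg1) (\<phi> X Y (g - deg1) z) - \<phi> X Y g (d1 X Y (g - deg1) z)
      \<in> N' (fobj F X) (fobj F Y) g"
    using \<phi>_d1[OF assms(1,2) z(1)] by simp
  have "\<phi> X Y g x - d1' (fobj F X) (fobj F Y) (g - deg1) (\<phi> X Y (g - deg1) z) \<in> N' (fobj F X) (fobj F Y) g"
    using cod.N_diff[OF o 1 2] by simp
  then show ?thesis using \<phi>_P[OF assms(1,2) x] \<phi>_P[OF assms(1,2) z(1)] unfolding cod.Bdy_def by blast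
qed

lemma coh_functor_hcls:
  assumes "dom.ob X" "dom.ob Y" "x \<in> dom.Cyc X Y g"
  shows "coh_functor D' F X Y g (dom.hcls X Y g x) = cod.hcls (fobj F X) (fobj F Y) g (\<phi> X Y g x)"
proof -
  obtain x' where x': "x' \<in> dom.Cyc X Y g" "x' - x \<in> dom.Bdy X Y g" "(SOME u. u \<in> dom.hcls X Y g x) = cls X Y g x'"
    using dom.hcls_some[OF assms] .
  have P: "x \<in> P X Y g" "x' \<in> P X Y g" using assms x' dom.Cyc_P by blast+
  have "coh_functor D' F X Y g (dom.hcls X Y g x) = cod.hcls (fobj F X) (fobj F Y) g (\<phi> X Y g x')"
    unfolding coh_functor_def x'(3) using fmor1[OF assms(1,2) P(2)] by (simp add: cod.hcls_def)
  also have "\<dots> = cod.hcls (fobj F X) (fobj F Y) g (\<phi> X Y g x)"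
    using cod.hcls_eq_iff[OF fobj_ob[OF assms(1)] fobj_ob[OF assms(2)] \<phi>_P[OF assms(1,2) P(2)] \<phi>_P[OF assms(1,2) P(1)]]
      \<phi>_Bdy[OF assms(1,2) x'(2)] \<phi>_diff[OF assms(1,2) P(2,1)] by simp
  finally show ?thesis .
qed

text \<open>Preservation of units is a separate hypothesis because it does not follow from
  multiplicativity: the image of a unit is merely an idempotent.\<close>

lemma graded_functorI:
  assumes unit: "\<And>X e. dom.ob X \<Longrightarrow> dom.unit_cocycle X e \<Longrightarrow> cod.unit_cocycle (fobj F X) (\<phi> X X 0 e)"
  shows "graded_functor (coh D) (coh D') (fobj F) (coh_functor D' F)"
  unfolding graded_functor_def
proof (intro conjI ballI allI impI)
  fix X assume "X \<in> cobj (coh D)" then show "fobj F X \<in> cobj (coh D')" using fobj_ob by simp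
next
  fix X Y g f assume XY: "X \<in> cobj (coh D)" "Y \<in> cobj (coh D)" and f: "f \<in> chom (coh D) X Y g"
  then have o: "dom.ob X" "dom.ob Y" by simp_all
  then obtain x where x: "f = dom.hcls X Y g x" "x \<in> dom.Cyc X Y g" using f by (auto simp: dom.chom_coh)
  show "coh_functor D' F X Y g f \<in> chom (coh D') (fobj F X) (fobj F Y) g"
    unfolding x(1) coh_functor_hcls[OF o x(2)]
    using cod.hcls_chom[OF fobj_ob[OF o(1)] fobj_ob[OF o(2)] \<phi>_Cyc[OF o x(2)]] .
next
  fix X Y Z g h f f' assume "X \<in> cobj (coh D)" "Y \<in> cobj (coh D)" "Z \<in> cobj (coh D)"
    and f: "f \<in> chom (coh D) X Y g" "f' \<in> chom (coh D) Y Z h"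
  then have o: "dom.ob X" "dom.ob Y" "dom.ob Z" by simp_all
  obtain x y where x: "f = dom.hcls X Y g x" "x \<in> dom.Cyc X Y g" and y: "f' = dom.hcls Y Z h y" "y \<in> dom.Cyc Y Z h"
    using f o by (auto simp: dom.chom_coh)
  note o' = fobj_ob[OF o(1)] fobj_ob[OF o(2)] fobj_ob[OF o(3)]
  note Cx = \<phi>_Cyc[OF o(1,2) x(2)] and Cy = \<phi>_Cyc[OF o(2,3) y(2)] and Cm = dom.m2_Cyc[OF o x(2) y(2)]
  show "coh_functor D' F X Z (g + h) (ccomp (coh D) X Y Z g h f f') =
      ccomp (coh D') (fobj F X) (fobj F Y) (fobj F Z) g h (coh_functor D' F X Y g f) (coh_functor D' F Y Z h f')"
    unfolding x(1) y(1) dom.ccomp_hcls[OF o x(2) y(2)] coh_functor_hcls[OF o(1,2) x(2)] coh_functor_hcls[OF o(2,3) y(2)]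
      coh_functor_hcls[OF o(1,3) Cm] cod.ccomp_hcls[OF o' Cx Cy]
    using cod.hcls_eq_iff[OF o'(1,3) cod.Cyc_P[OF \<phi>_Cyc[OF o(1,3) Cm]] cod.Cyc_P[OF cod.m2_Cyc[OF o' Cx Cy]]]
      \<phi>_m2[OF o x(2) y(2)] by simp
next
  fix X E assume X: "X \<in> cobj (coh D)" and E: "is_unit_at (coh D) X E"
  then have o: "dom.ob X" by simp
  obtain e where e: "E = dom.hcls X X 0 e" "dom.unit_cocycle X e" using dom.is_unit_atE[OF o E] .
  have c: "e \<in> dom.Cyc X X 0" using e by (simp add: dom.unit_cocycle_def)
  show "is_unit_at (coh D') (fobj F X) (coh_functor D' F X X 0 E)"
    unfolding e(1) coh_functor_hcls[OF o o c]
    using cod.is_unit_at_hcls[OF fobj_ob[OF o] \<phi>_Cyc[OF o o c]] unit[OF o e(2)] by simp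
qed

lemma bij_coh_functorI:
  assumes o: "dom.ob X" "dom.ob Y"
    and inj: "\<And>x. x \<in> dom.Cyc X Y g \<Longrightarrow> \<phi> X Y g x \<in> cod.Bdy (fobj F X) (fobj F Y) g \<Longrightarrow> x \<in> dom.Bdy X Y g"
    and sur: "\<And>y. y \<in> cod.Cyc (fobj F X) (fobj F Y) g \<Longrightarrow>
      \<exists>x\<in>dom.Cyc X Y g. \<phi> X Y g x - y \<in> cod.Bdy (fobj F X) (fobj F Y) g"
  shows "bij_betw (coh_functor D' F X Y g) (chom (coh D) X Y g) (chom (coh D') (fobj F X) (fobj F Y) g)"
proof (rule bij_betw_imageI)
  note o' = fobj_ob[OF o(1)] fobj_ob[OF o(2)]
  show "inj_on (coh_functor D' F X Y g) (chom (coh D) X Y g)"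
  proof (rule inj_onI)
    fix f f' assume f: "f \<in> chom (coh D) X Y g" "f' \<in> chom (coh D) X Y g"
      and eq: "coh_functor D' F X Y g f = coh_functor D' F X Y g f'"
    obtain x x' where x: "f = dom.hcls X Y g x" "x \<in> dom.Cyc X Y g" "f' = dom.hcls X Y g x'" "x' \<in> dom.Cyc X Y g"
      using f by (auto simp: dom.chom_coh[OF o])
    have "\<phi> X Y g x - \<phi> X Y g x' \<in> cod.Bdy (fobj F X) (fobj F Y) g"
      using eq unfolding x(1,3) coh_functor_hcls[OF o x(2)] coh_functor_hcls[OF o x(4)]
        cod.hcls_eq_iff[OF o' cod.Cyc_P[OF \<phi>_Cyc[OF o x(2)]] cod.Cyc_P[OF \<phi>_Cyc[OF o x(4)]]] .
    then have "x - x' \<in> dom.Bdy X Y g"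
      using inj[OF dom.Cyc_diff[OF o x(2,4)]] \<phi>_diff[OF o dom.Cyc_P[OF x(2)] dom.Cyc_P[OF x(4)]] by simp
    then show "f = f'" unfolding x(1,3) using dom.hcls_eq_iff[OF o dom.Cyc_P[OF x(2)] dom.Cyc_P[OF x(4)]] by simp
  qed
  show "coh_functor D' F X Y g ` chom (coh D) X Y g = chom (coh D') (fobj F X) (fobj F Y) g"
  proof (intro equalityI subsetI)
    fix u assume "u \<in> coh_functor D' F X Y g ` chom (coh D) X Y g"
    then obtain x where x: "x \<in> dom.Cyc X Y g" "u = coh_functor D' F X Y g (dom.hcls X Y g x)"
      by (auto simp: dom.chom_coh[OF o])
    then show "u \<in> chom (coh D') (fobj F X) (fobj F Y) g"
      using cod.hcls_chom[OF o' \<phi>_Cyc[OF o x(1)]] coh_functor_hcls[OF o x(1)] by simp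
  next
    fix u assume "u \<in> chom (coh D') (fobj F X) (fobj F Y) g"
    then obtain y where y: "u = cod.hcls (fobj F X) (fobj F Y) g y" "y \<in> cod.Cyc (fobj F X) (fobj F Y) g"
      by (auto simp: cod.chom_coh[OF o'])
    obtain x where x: "x \<in> dom.Cyc X Y g" "\<phi> X Y g x - y \<in> cod.Bdy (fobj F X) (fobj F Y) g" using sur[OF y(2)] by blast
    have "u = coh_functor D' F X Y g (dom.hcls X Y g x)"
      unfolding y(1) coh_functor_hcls[OF o x(1)]
      using cod.hcls_eq_iff[OF o' cod.Cyc_P[OF \<phi>_Cyc[OF o x(1)]] cod.Cyc_P[OF y(2)]] x(2) by simp
    then show "u \<in> coh_functor D' F X Y g ` chom (coh D) X Y g"
      using dom.hcls_chom[OF o x(1)] by blast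
  qed
qed

text \<open>Unpacks bijectivity on cohomology into a statement about representatives, the form in
  which cone exactness uses it.\<close>

lemma coh_functor_surjD:
  assumes o: "dom.ob X" "dom.ob Y"
    and bij: "bij_betw (coh_functor D' F X Y g) (chom (coh D) X Y g) (chom (coh D') (fobj F X) (fobj F Y) g)"
    and y: "y \<in> cod.Cyc (fobj F X) (fobj F Y) g"
  shows "\<exists>x\<in>dom.Cyc X Y g. \<phi> X Y g x - y \<in> cod.Bdy (fobj F X) (fobj F Y) g"
proof -
  note o' = fobj_ob[OF o(1)] fobj_ob[OF o(2)]
  have "cod.hcls (fobj F X) (fobj F Y) g y \<in> coh_functor D' F X Y g ` chom (coh D) X Y g"
    using bij_betw_imp_surj_on[OF bij] cod.hcls_chom[OF o' y] by simp
  then obtain x where x: "x \<in> dom.Cyc X Y g"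
    "cod.hcls (fobj F X) (fobj F Y) g y = coh_functor D' F X Y g (dom.hcls X Y g x)"
    by (auto simp: dom.chom_coh[OF o])
  then have "\<phi> X Y g x - y \<in> cod.Bdy (fobj F X) (fobj F Y) g"
    using cod.hcls_eq_iff[OF o' cod.Cyc_P[OF \<phi>_Cyc[OF o x(1)]] cod.Cyc_P[OF y]] coh_functor_hcls[OF o x(1)] by simp
  then show ?thesis using x(1) by blast
qed

lemma coh_functor_injD:
  assumes o: "dom.ob X" "dom.ob Y"
    and bij: "bij_betw (coh_functor D' F X Y g) (chom (coh D) X Y g) (chom (coh D') (fobj F X) (fobj F Y) g)"
    and x: "x \<in> dom.Cyc X Y g" "\<phi> X Y g x \<in> cod.Bdy (fobj F X) (fobj F Y) g"
  shows "x \<in> dom.Bdy X Y g"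
proof -
  note o' = fobj_ob[OF o(1)] fobj_ob[OF o(2)]
  have z: "0 \<in> dom.Cyc X Y g" using dom.Cyc_diff[OF o x(1) x(1)] by simp
  have \<phi>z: "\<phi> X Y g 0 = 0" using \<phi>_diff[OF o dom.P_zero[OF o] dom.P_zero[OF o]] by simp
  have "coh_functor D' F X Y g (dom.hcls X Y g x) = coh_functor D' F X Y g (dom.hcls X Y g 0)"
    unfolding coh_functor_hcls[OF o x(1)] coh_functor_hcls[OF o z]
    using cod.hcls_eq_iff[OF o' cod.Cyc_P[OF \<phi>_Cyc[OF o x(1)]] cod.Cyc_P[OF \<phi>_Cyc[OF o z]]] x(2) \<phi>z by simp
  then have "dom.hcls X Y g x = dom.hcls X Y g 0"
    using bij_betw_imp_inj_on[OF bij] dom.hcls_chom[OF o x(1)] dom.hcls_chom[OF o z] by (simp add: inj_on_def)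
  then show ?thesis using dom.hcls_eq_iff[OF o dom.Cyc_P[OF x(1)] dom.Cyc_P[OF z]] by simp
qed

end

section \<open>Low order \<open>A\<^sub>\<infinity>\<close> relations\<close>

lemma sum_splits2_Nil: "(\<Sum>(q, r)\<in>{(q, r). q @ r = []}. f q r) = f [] []"
proof -
  have "{(q, r). q @ r = []} = {([], [])}" by auto
  then show ?thesis by simp
qed

lemma finite_splits2: "finite {(q, r). q @ r = cs}"
proof -
  have "{(q, r). q @ r = cs} \<subseteq> (\<lambda>i. (take i cs, drop i cs)) ` {..length cs}"
  proof safe
    fix q r :: "'a list"
    show "(q, r) \<in> (\<lambda>i. (take i (q @ r), drop i (q @ r))) ` {..length (q @ r)}"
      by (intro image_eqI[of _ _ "length q"]) auto
  qed
  then show ?thesis by (rule finite_subset) simp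
qed

lemma sum_splits2_Cons:
  fixes f :: "'a list \<Rightarrow> 'a list \<Rightarrow> 'b::ab_group_add"
  shows "(\<Sum>(q, r)\<in>{(q, r). q @ r = c # cs}. f q r) = f [] (c # cs) + (\<Sum>(q, r)\<in>{(q, r). q @ r = cs}. f (c # q) r)"
proof -
  have eq: "{(q, r). q @ r = c # cs} = insert ([], c # cs) ((\<lambda>(q, r). (c # q, r)) ` {(q, r). q @ r = cs})"
    by (auto simp: append_eq_Cons_conv image_iff)
  have "inj_on (\<lambda>(q, r). (c # q, r)) {(q, r). q @ r = cs}" by (auto simp: inj_on_def)
  moreover have "([], c # cs) \<notin> (\<lambda>(q, r). (c # q, r)) ` {(q, r). q @ r = cs}" by auto
  ultimately show ?thesis unfolding eq using finite_splits2
    by (subst sum.insert) (auto simp: sum.reindex case_prod_unfold intro!: sum.cong)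
qed

lemma sum_splits_Nil: "(\<Sum>(p, q, r)\<in>{(p, q, r). p @ q @ r = []}. f p q r) = f [] [] []"
proof -
  have "{(p, q, r). p @ q @ r = []} = {([], [], [])}" by auto
  then show ?thesis by simp
qed

text \<open>Peeling off the first entry enumerates the splittings of a chain of known length, so
  that the simplifier can write out the low order equations.\<close>

lemma sum_splits_Cons:
  fixes f :: "'a list \<Rightarrow> 'a list \<Rightarrow> 'a list \<Rightarrow> 'b::ab_group_add"
  shows "(\<Sum>(p, q, r)\<in>{(p, q, r). p @ q @ r = c # cs}. f p q r) =
    (\<Sum>(q, r)\<in>{(q, r). q @ r = c # cs}. f [] q r) + (\<Sum>(p, q, r)\<in>{(p, q, r). p @ q @ r = cs}. f (c # p) q r)"
proof -
  let ?A = "(\<lambda>(q, r). ([]::'a list, q, r)) ` {(q, r). q @ r = c # cs}"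
  let ?B = "(\<lambda>(p, q, r). (c # p, q, r)) ` {(p, q, r). p @ q @ r = cs}"
  have eq: "{(p, q, r). p @ q @ r = c # cs} = ?A \<union> ?B"
    by (auto simp: append_eq_Cons_conv[of _ "_ @ _"] image_iff)
  have "inj_on (\<lambda>(q, r). ([]::'a list, q, r)) {(q, r). q @ r = c # cs}"
    "inj_on (\<lambda>(p, q, r). (c # p, q, r)) {(p, q, r). p @ q @ r = cs}" by (auto simp: inj_on_def)
  moreover have "?A \<inter> ?B = {}" by auto
  ultimately show ?thesis unfolding eq using finite_splits2[of "c # cs"] finite_splits[of cs]
    by (subst sum.union_disjoint) (auto simp: sum.reindex case_prod_unfold intro!: sum.cong)
qed

lemmas sum_splits_simps = sum_splits_Nil sum_splits_Cons sum_splits2_Nil sum_splits2_Cons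

text \<open>The Koszul sign as a function of a degree alone. Signs then combine by adding degrees,
  and the simplifier can cancel them.\<close>

definition sgn_bit :: "bit \<Rightarrow> 'a::ab_group_add \<Rightarrow> 'a" where
  "sgn_bit d x = (if d = 0 then x else - x)"

lemma koszul_sgn_bit: "koszul cs x = sgn_bit (red_deg cs) x"
  by (simp add: koszul_red_deg sgn_bit_def)

lemma sgn_bit_simps [simp]:
  "sgn_bit 0 x = x" "sgn_bit 1 x = - x" "sgn_bit d 0 = 0" "sgn_bit d (- x) = - sgn_bit d x"
  "sgn_bit d (x + y) = sgn_bit d x + sgn_bit d y" "sgn_bit d (x - y) = sgn_bit d x - sgn_bit d y"
  "sgn_bit d (sgn_bit e x) = sgn_bit (d + e) x"
  by (cases d; cases e; simp add: sgn_bit_def)+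

lemma sgn_bit_plus_1 [simp]: "sgn_bit (d + 1) x = - sgn_bit d x" "sgn_bit (1 + d) x = - sgn_bit d x"
  by (cases d; simp add: sgn_bit_def)+

definition del :: "('o, 'm::ab_group_add, 'z) ainf_scheme \<Rightarrow> 'o \<Rightarrow> 'o \<Rightarrow> bit \<Rightarrow> 'm \<Rightarrow> 'm" where
  "del A X Y d x = mu A X [(d, x, Y)]"

text \<open>With this sign the Leibniz rule and associativity take their differential graded form,
  up to curvature and homotopy. It is the product that \<open>coh\<close> uses.\<close>

definition prd :: "('o, 'm::ab_group_add, 'z) ainf_scheme \<Rightarrow> 'o \<Rightarrow> 'o \<Rightarrow> 'o \<Rightarrow> bit \<Rightarrow> bit \<Rightarrow> 'm \<Rightarrow> 'm \<Rightarrow> 'm" where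
  "prd A X Y Z d e x y = sgn_bit d (mu A X [(d, x, Y), (e, y, Z)])"

context curved_ainf_category
begin

lemma mor_zero: "X \<in> obj A \<Longrightarrow> Y \<in> obj A \<Longrightarrow> 0 \<in> mor A X Y d"
  using subspace_0[OF mor_submodule] .
lemma mor_diff: "X \<in> obj A \<Longrightarrow> Y \<in> obj A \<Longrightarrow> x \<in> mor A X Y d \<Longrightarrow> y \<in> mor A X Y d \<Longrightarrow> x - y \<in> mor A X Y d"
  using subspace_diff[OF mor_submodule] .
lemma mor_uminus: "X \<in> obj A \<Longrightarrow> Y \<in> obj A \<Longrightarrow> x \<in> mor A X Y d \<Longrightarrow> - x \<in> mor A X Y d"
  using subspace_neg[OF mor_submodule] .
lemma mor_sgn_bit: "X \<in> obj A \<Longrightarrow> Y \<in> obj A \<Longrightarrow> x \<in> mor A X Y d \<Longrightarrow> sgn_bit e x \<in> mor A X Y d"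
  by (simp add: sgn_bit_def mor_uminus)

lemma mu_add:
  "is_chain (obj A) (mor A) X (p @ (d, c, Y) # r) \<Longrightarrow> is_chain (obj A) (mor A) X (p @ (d, c', Y) # r) \<Longrightarrow>
    mu A X (p @ (d, c + c', Y) # r) = mu A X (p @ (d, c, Y) # r) + mu A X (p @ (d, c', Y) # r)"
  using mu_multilinear unfolding multilinear_def by (elim allE conjE) blast

lemma mu_zero:
  assumes "is_chain (obj A) (mor A) X (p @ (d, 0, Y) # r)" shows "mu A X (p @ (d, 0, Y) # r) = 0"
  using mu_add[OF assms assms] by simp

lemma mu_uminus:
  assumes "is_chain (obj A) (mor A) X (p @ (d, c, Y) # r)"
  shows "mu A X (p @ (d, - c, Y) # r) = - mu A X (p @ (d, c, Y) # r)"
proof -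
  have "is_chain (obj A) (mor A) X (p @ (d, - c, Y) # r)"
    using assms mor_uminus by (auto simp: is_chain_append dest: is_chain_tgt is_chain_source)
  moreover have "is_chain (obj A) (mor A) X (p @ (d, 0, Y) # r)"
    using assms mor_zero by (auto simp: is_chain_append dest: is_chain_tgt is_chain_source)
  ultimately show ?thesis using mu_add[OF assms, of "- c"] mu_zero by (simp add: minus_unique)
qed

lemma mu_sgn_bit:
  "is_chain (obj A) (mor A) X (p @ (d, c, Y) # r) \<Longrightarrow>
    mu A X (p @ (d, sgn_bit e c, Y) # r) = sgn_bit e (mu A X (p @ (d, c, Y) # r))"
  by (simp add: sgn_bit_def mu_uminus)

text \<open>The Bianchi identity. For a twisted object it says that the Maurer-Cartan defect is
  closed.\<close>

lemma relation0: "X \<in> obj A \<Longrightarrow> mu A X [(0, mu A X [], X)] = 0"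
  using mu_ainf[of X "[]"] by (simp add: sum_splits_simps koszul_red_deg deg_out_red_deg)

text \<open>The curvature terms are kept throughout: each inserts a curvature as an additional
  argument, so it vanishes in an uncurved category and raises the level by one in a filtered
  one.\<close>

lemma relation1:
  assumes "X \<in> obj A" "Y \<in> obj A" "x \<in> mor A X Y d"
  shows "mu A X [(d + 1, mu A X [(d, x, Y)], Y)] + mu A X [(0, mu A X [], X), (d, x, Y)] -
    sgn_bit d (mu A X [(d, x, Y), (0, mu A Y [], Y)]) = 0"
  using mu_ainf[of X "[(d, x, Y)]"] assms
  by (simp add: sum_splits_simps koszul_sgn_bit deg_out_red_deg algebra_simps)

lemma relation2:
  assumes "X \<in> obj A" "Y \<in> obj A" "Z \<in> obj A" "x \<in> mor A X Y d" "y \<in> mor A Y Z e"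
  shows "mu A X [(d + e, mu A X [(d, x, Y), (e, y, Z)], Z)] + mu A X [(d + 1, mu A X [(d, x, Y)], Y), (e, y, Z)] -
    sgn_bit d (mu A X [(d, x, Y), (e + 1, mu A Y [(e, y, Z)], Z)]) +
    (mu A X [(0, mu A X [], X), (d, x, Y), (e, y, Z)] - sgn_bit d (mu A X [(d, x, Y), (0, mu A Y [], Y), (e, y, Z)]) +
      sgn_bit (d + e) (mu A X [(d, x, Y), (e, y, Z), (0, mu A Z [], Z)])) = 0"
  using mu_ainf[of X "[(d, x, Y), (e, y, Z)]"] assms
  by (simp add: sum_splits_simps koszul_sgn_bit deg_out_red_deg algebra_simps)

lemma relation3:
  assumes "X \<in> obj A" "Y \<in> obj A" "Z \<in> obj A" "W \<in> obj A" "x \<in> mor A X Y d" "y \<in> mor A Y Z e" "z \<in> mor A Z W f"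
  shows "mu A X [(d + e + f + 1, mu A X [(d, x, Y), (e, y, Z), (f, z, W)], W)] +
    mu A X [(d + e, mu A X [(d, x, Y), (e, y, Z)], Z), (f, z, W)] -
    sgn_bit d (mu A X [(d, x, Y), (e + f, mu A Y [(e, y, Z), (f, z, W)], W)]) +
    mu A X [(d + 1, mu A X [(d, x, Y)], Y), (e, y, Z), (f, z, W)] -
    sgn_bit d (mu A X [(d, x, Y), (e + 1, mu A Y [(e, y, Z)], Z), (f, z, W)]) +
    sgn_bit (d + e) (mu A X [(d, x, Y), (e, y, Z), (f + 1, mu A Z [(f, z, W)], W)]) +
    (mu A X [(0, mu A X [], X), (d, x, Y), (e, y, Z), (f, z, W)] -
      sgn_bit d (mu A X [(d, x, Y), (0, mu A Y [], Y), (e, y, Z), (f, z, W)]) +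
      sgn_bit (d + e) (mu A X [(d, x, Y), (e, y, Z), (0, mu A Z [], Z), (f, z, W)]) -
      sgn_bit (d + e + f) (mu A X [(d, x, Y), (e, y, Z), (f, z, W), (0, mu A W [], W)])) = 0"
  using mu_ainf[of X "[(d, x, Y), (e, y, Z), (f, z, W)]"] assms
  by (simp add: sum_splits_simps koszul_sgn_bit deg_out_red_deg algebra_simps)

end

section \<open>Cohomology of linear categories and of associated gradeds\<close>

context curved_ainf_category
begin

lemma del_mor: "X \<in> obj A \<Longrightarrow> Y \<in> obj A \<Longrightarrow> x \<in> mor A X Y d \<Longrightarrow> del A X Y d x \<in> mor A X Y (d + 1)"
  using mu_degree[of X "[(d, x, Y)]"] by (simp add: del_def deg_out_red_deg add.commute)

lemma prd_mor: "X \<in> obj A \<Longrightarrow> Y \<in> obj A \<Longrightarrow> Z \<in> obj A \<Longrightarrow> x \<in> mor A X Y d \<Longrightarrow> y \<in> mor A Y Z e \<Longrightarrow>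
    prd A X Y Z d e x y \<in> mor A X Z (d + e)"
  using mu_degree[of X "[(d, x, Y), (e, y, Z)]"] by (simp add: prd_def deg_out_red_deg mor_sgn_bit add_ac)

lemma del_add: "X \<in> obj A \<Longrightarrow> Y \<in> obj A \<Longrightarrow> x \<in> mor A X Y d \<Longrightarrow> x' \<in> mor A X Y d \<Longrightarrow>
    del A X Y d (x + x') = del A X Y d x + del A X Y d x'"
  using mu_add[of X "[]" d x Y "[]" x'] by (simp add: del_def)

lemma prd_add_left: "X \<in> obj A \<Longrightarrow> Y \<in> obj A \<Longrightarrow> Z \<in> obj A \<Longrightarrow> x \<in> mor A X Y d \<Longrightarrow> x' \<in> mor A X Y d \<Longrightarrow>
    y \<in> mor A Y Z e \<Longrightarrow> prd A X Y Z d e (x + x') y = prd A X Y Z d e x y + prd A X Y Z d e x' y"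
  using mu_add[of X "[]" d x Y "[(e, y, Z)]" x'] by (simp add: prd_def)

lemma prd_add_right: "X \<in> obj A \<Longrightarrow> Y \<in> obj A \<Longrightarrow> Z \<in> obj A \<Longrightarrow> x \<in> mor A X Y d \<Longrightarrow> y \<in> mor A Y Z e \<Longrightarrow>
    y' \<in> mor A Y Z e \<Longrightarrow> prd A X Y Z d e x (y + y') = prd A X Y Z d e x y + prd A X Y Z d e x y'"
  using mu_add[of X "[(d, x, Y)]" e y Z "[]" y'] by (simp add: prd_def)

lemma del_zero: "X \<in> obj A \<Longrightarrow> Y \<in> obj A \<Longrightarrow> del A X Y d 0 = 0"
  using del_add[of X Y 0 d 0] mor_zero by simp
lemma prd_zero_left: "X \<in> obj A \<Longrightarrow> Y \<in> obj A \<Longrightarrow> Z \<in> obj A \<Longrightarrow> y \<in> mor A Y Z e \<Longrightarrow> prd A X Y Z d e 0 y = 0"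
  using prd_add_left[of X Y Z 0 d 0 y e] mor_zero by simp
lemma prd_zero_right: "X \<in> obj A \<Longrightarrow> Y \<in> obj A \<Longrightarrow> Z \<in> obj A \<Longrightarrow> x \<in> mor A X Y d \<Longrightarrow> prd A X Y Z d e x 0 = 0"
  using prd_add_right[of X Y Z x d 0 e 0] mor_zero by simp

lemma del_diff: "X \<in> obj A \<Longrightarrow> Y \<in> obj A \<Longrightarrow> x \<in> mor A X Y d \<Longrightarrow> x' \<in> mor A X Y d \<Longrightarrow>
    del A X Y d (x - x') = del A X Y d x - del A X Y d x'"
  using del_add[of X Y "x - x'" d x'] mor_diff by (simp add: algebra_simps)
lemma prd_diff_left: "X \<in> obj A \<Longrightarrow> Y \<in> obj A \<Longrightarrow> Z \<in> obj A \<Longrightarrow> x \<in> mor A X Y d \<Longrightarrow> x' \<in> mor A X Y d \<Longrightarrow>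
    y \<in> mor A Y Z e \<Longrightarrow> prd A X Y Z d e (x - x') y = prd A X Y Z d e x y - prd A X Y Z d e x' y"
  using prd_add_left[of X Y Z "x - x'" d x' y e] mor_diff by (simp add: algebra_simps)
lemma prd_diff_right: "X \<in> obj A \<Longrightarrow> Y \<in> obj A \<Longrightarrow> Z \<in> obj A \<Longrightarrow> x \<in> mor A X Y d \<Longrightarrow> y \<in> mor A Y Z e \<Longrightarrow>
    y' \<in> mor A Y Z e \<Longrightarrow> prd A X Y Z d e x (y - y') = prd A X Y Z d e x y - prd A X Y Z d e x y'"
  using prd_add_right[of X Y Z x d "y - y'" e y'] mor_diff by (simp add: algebra_simps)

lemma del_del:
  assumes "X \<in> obj A" "Y \<in> obj A" "x \<in> mor A X Y d"
  shows "del A X Y (d + 1) (del A X Y d x) =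
    - (mu A X [(0, mu A X [], X), (d, x, Y)] - sgn_bit d (mu A X [(d, x, Y), (0, mu A Y [], Y)]))"
  using relation1[OF assms] by (simp add: del_def algebra_simps eq_neg_iff_add_eq_0)

lemma del_prd:
  assumes "X \<in> obj A" "Y \<in> obj A" "Z \<in> obj A" "x \<in> mor A X Y d" "y \<in> mor A Y Z e"
  shows "del A X Z (d + e) (prd A X Y Z d e x y) -
      (prd A X Y Z (d + 1) e (del A X Y d x) y + sgn_bit d (prd A X Y Z d (e + 1) x (del A Y Z e y))) =
    - sgn_bit d (mu A X [(0, mu A X [], X), (d, x, Y), (e, y, Z)] -
        sgn_bit d (mu A X [(d, x, Y), (0, mu A Y [], Y), (e, y, Z)]) +
        sgn_bit (d + e) (mu A X [(d, x, Y), (e, y, Z), (0, mu A Z [], Z)]))"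
proof -
  have m: "mu A X [(d, x, Y), (e, y, Z)] \<in> mor A X Z (d + e)"
    using mu_degree[of X "[(d, x, Y), (e, y, Z)]"] assms by (simp add: deg_out_red_deg add_ac)
  have "del A X Z (d + e) (prd A X Y Z d e x y) = sgn_bit d (mu A X [(d + e, mu A X [(d, x, Y), (e, y, Z)], Z)])"
    using mu_sgn_bit[of X "[]" "d + e" "mu A X [(d, x, Y), (e, y, Z)]" Z "[]" d] m assms
    by (simp add: del_def prd_def)
  with arg_cong[OF relation2[OF assms], of "sgn_bit d"] show ?thesis
    by (simp add: del_def prd_def algebra_simps)
qed

text \<open>The homotopy carries the sign of the degree \<open>e\<close> of \<open>y\<close>, as
  both nested products do relative to the A-infinity equation: in the left one the signs of
  \<open>d + e\<close> and \<open>d\<close> combine to that of \<open>e\<close>.\<close>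

lemma prd_assoc:
  assumes "X \<in> obj A" "Y \<in> obj A" "Z \<in> obj A" "W \<in> obj A" "x \<in> mor A X Y d" "y \<in> mor A Y Z e" "z \<in> mor A Z W f"
  shows "prd A X Z W (d + e) f (prd A X Y Z d e x y) z - prd A X Y W d (e + f) x (prd A Y Z W e f y z) +
      del A X W (d + e + f + 1) (sgn_bit e (mu A X [(d, x, Y), (e, y, Z), (f, z, W)])) =
    - sgn_bit e (mu A X [(d + 1, del A X Y d x, Y), (e, y, Z), (f, z, W)] -
      sgn_bit d (mu A X [(d, x, Y), (e + 1, del A Y Z e y, Z), (f, z, W)]) +
      sgn_bit (d + e) (mu A X [(d, x, Y), (e, y, Z), (f + 1, del A Z W f z, W)]) +
      (mu A X [(0, mu A X [], X), (d, x, Y), (e, y, Z), (f, z, W)] -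
        sgn_bit d (mu A X [(d, x, Y), (0, mu A Y [], Y), (e, y, Z), (f, z, W)]) +
        sgn_bit (d + e) (mu A X [(d, x, Y), (e, y, Z), (0, mu A Z [], Z), (f, z, W)]) -
        sgn_bit (d + e + f) (mu A X [(d, x, Y), (e, y, Z), (f, z, W), (0, mu A W [], W)])))"
proof -
  have xy: "mu A X [(d, x, Y), (e, y, Z)] \<in> mor A X Z (d + e)"
    using mu_degree[of X "[(d, x, Y), (e, y, Z)]"] assms by (simp add: deg_out_red_deg add_ac)
  have yz: "mu A Y [(e, y, Z), (f, z, W)] \<in> mor A Y W (e + f)"
    using mu_degree[of Y "[(e, y, Z), (f, z, W)]"] assms by (simp add: deg_out_red_deg add_ac)
  have xyz: "mu A X [(d, x, Y), (e, y, Z), (f, z, W)] \<in> mor A X W (d + e + f + 1)"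
    using mu_degree[of X "[(d, x, Y), (e, y, Z), (f, z, W)]"] assms by (simp add: deg_out_red_deg add_ac)
  have "prd A X Z W (d + e) f (prd A X Y Z d e x y) z = sgn_bit e (mu A X [(d + e, mu A X [(d, x, Y), (e, y, Z)], Z), (f, z, W)])"
    using mu_sgn_bit[of X "[]" "d + e" "mu A X [(d, x, Y), (e, y, Z)]" Z "[(f, z, W)]" d] xy assms
    by (simp add: prd_def add_ac)
  moreover have "prd A X Y W d (e + f) x (prd A Y Z W e f y z) =
      sgn_bit (d + e) (mu A X [(d, x, Y), (e + f, mu A Y [(e, y, Z), (f, z, W)], W)])"
    using mu_sgn_bit[of X "[(d, x, Y)]" "e + f" "mu A Y [(e, y, Z), (f, z, W)]" W "[]" e] yz assms
    by (simp add: prd_def add_ac)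
  moreover have "del A X W (d + e + f + 1) (sgn_bit e (mu A X [(d, x, Y), (e, y, Z), (f, z, W)])) =
      sgn_bit e (mu A X [(d + e + f + 1, mu A X [(d, x, Y), (e, y, Z), (f, z, W)], W)])"
    using mu_sgn_bit[of X "[]" "d + e + f + 1" "mu A X [(d, x, Y), (e, y, Z), (f, z, W)]" W "[]" e] xyz assms
    by (simp add: del_def)
  ultimately show ?thesis
    using arg_cong[OF relation3[OF assms], of "sgn_bit e"] by (simp add: del_def algebra_simps)
qed

end

lemma comm_group_additive:
  assumes "0 \<in> S" "\<And>x y. x \<in> S \<Longrightarrow> y \<in> S \<Longrightarrow> x - y \<in> S"
  shows "comm_group (additive (S :: 'a::ab_group_add set))"
proof -
  have neg: "- x \<in> S" if "x \<in> S" for x using assms(2)[OF assms(1) that] by simp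
  have add: "x + y \<in> S" if "x \<in> S" "y \<in> S" for x y using assms(2)[OF that(1) neg[OF that(2)]] by simp
  show ?thesis
    by (rule comm_groupI) (auto simp: additive_def assms add add_ac intro: neg bexI[of _ "- _"] exI[of _ "- _"])
qed

context uncurved_ainf_category
begin

text \<open>With \<open>N = 0\<close> the curvature errors of \<open>del_del\<close>,
  \<open>del_prd\<close> and \<open>prd_assoc\<close> have to vanish exactly, which holds because a
  zero curvature is inserted.\<close>

lemma presented_graded:
  "presented_ainf (graded A) (mor A) (\<lambda>X Y d. {0}) (\<lambda>X Y d x. x) (del A) (prd A)"
proof (rule presented_ainf.intro, unfold graded_def graded_ainf.simps, goal_cases)
  case (6 X Y g)
  then show ?case
    using comm_group.axioms(2)[OF comm_group_additive[of "mor A X Y g"]] mor_zero mor_diff by blast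
next
  case (22 X Y Z W x g y h z k)
  note o = 22(1-4) and m = 22(5-7)
  have d: "del A X Y g x = 0" "del A Y Z h y = 0" "del A Z W k z = 0" using 22(8-10) by (simp_all add: deg1_bit_def)
  have z: "mu A X [(g + 1, 0, Y), (h, y, Z), (k, z, W)] = 0" "mu A X [(g, x, Y), (h + 1, 0, Z), (k, z, W)] = 0"
    "mu A X [(g, x, Y), (h, y, Z), (k + 1, 0, W)] = 0" "mu A X [(0, 0, X), (g, x, Y), (h, y, Z), (k, z, W)] = 0"
    "mu A X [(g, x, Y), (0, 0, Y), (h, y, Z), (k, z, W)] = 0" "mu A X [(g, x, Y), (h, y, Z), (0, 0, Z), (k, z, W)] = 0"
    "mu A X [(g, x, Y), (h, y, Z), (k, z, W), (0, 0, W)] = 0"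
    using mu_zero[of X "[]" "g + 1" Y "[(h, y, Z), (k, z, W)]"] mu_zero[of X "[(g, x, Y)]" "h + 1" Z "[(k, z, W)]"]
      mu_zero[of X "[(g, x, Y), (h, y, Z)]" "k + 1" W "[]"] mu_zero[of X "[]" 0 X "[(g, x, Y), (h, y, Z), (k, z, W)]"]
      mu_zero[of X "[(g, x, Y)]" 0 Y "[(h, y, Z), (k, z, W)]"] mu_zero[of X "[(g, x, Y), (h, y, Z)]" 0 Z "[(k, z, W)]"]
      mu_zero[of X "[(g, x, Y), (h, y, Z), (k, z, W)]" 0 W "[]"] o m mor_zero by simp_all
  have M: "mu A X [(g, x, Y), (h, y, Z), (k, z, W)] \<in> mor A X W (g + h + k + 1)"
    using mu_degree[of X "[(g, x, Y), (h, y, Z), (k, z, W)]"] o m by (simp add: deg_out_red_deg add_ac)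
  let ?w = "sgn_bit h (mu A X [(g, x, Y), (h, y, Z), (k, z, W)])"
  have w: "?w \<in> mor A X W (g + h + k + 1)" using M mor_sgn_bit o by blast
  have "del A X W (g + h + k + 1) (- ?w) = - del A X W (g + h + k + 1) ?w"
    using del_diff[OF o(1,4) mor_zero[OF o(1,4)] w] del_zero[OF o(1,4)] by simp
  moreover have "prd A X Z W (g + h) k (prd A X Y Z g h x y) z - prd A X Y W g (h + k) x (prd A Y Z W h k y z) +
      del A X W (g + h + k + 1) ?w = 0"
    using prd_assoc[OF o m] unfolding d mu_uncurved[OF o(1)] mu_uncurved[OF o(2)] mu_uncurved[OF o(3)]
      mu_uncurved[OF o(4)] z by simp
  ultimately show ?case using mor_uminus[OF o(1,4) w] by (intro bexI[of _ "- ?w"]) (auto simp: deg1_bit_def)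
next
  case (21 X Y Z x g y h)
  note o = 21(1-3) and m = 21(4-5)
  have z: "mu A X [(0, 0, X), (g, x, Y), (h, y, Z)] = 0" "mu A X [(g, x, Y), (0, 0, Y), (h, y, Z)] = 0"
    "mu A X [(g, x, Y), (h, y, Z), (0, 0, Z)] = 0"
    using mu_zero[of X "[]" 0 X "[(g, x, Y), (h, y, Z)]"] mu_zero[of X "[(g, x, Y)]" 0 Y "[(h, y, Z)]"]
      mu_zero[of X "[(g, x, Y), (h, y, Z)]" 0 Z "[]"] o m mor_zero by simp_all
  have "del A X Z (g + h) (prd A X Y Z g h x y) -
      (prd A X Y Z (g + 1) h (del A X Y g x) y + sgn_bit g (prd A X Y Z g (h + 1) x (del A Y Z h y))) = 0"
    unfolding del_prd[OF o m] mu_uncurved[OF o(1)] mu_uncurved[OF o(2)] mu_uncurved[OF o(3)] z by simp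
  then show ?case by (cases g) (simp_all add: deg1_bit_def parity_bit_def)
next
  case (15 X Y x g)
  note o = 15(1-2) and m = 15(3)
  have z: "mu A X [(0, 0, X), (g, x, Y)] = 0" "mu A X [(g, x, Y), (0, 0, Y)] = 0"
    using mu_zero[of X "[]" 0 X "[(g, x, Y)]"] mu_zero[of X "[(g, x, Y)]" 0 Y "[]"] o m mor_zero by simp_all
  then show ?case using del_del[OF o m] by (simp add: mu_uncurved o deg1_bit_def)
next
  case 1 then show ?case by (simp add: mor_zero)
next
  case 2 then show ?case by (simp add: mor_diff)
next
  case 5 then show ?case by (simp add: mor_zero)
next
  case 7 then show ?case by (simp add: additive_def)
next
  case 8 then show ?case by (simp add: additive_def)
next
  case 10 then show ?case by (simp add: del_def)
next
  case (11 X Y Z x g y h) then show ?case by (cases g) (simp_all add: prd_def parity_bit_def)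
next
  case 12 then show ?case by (simp add: del_mor deg1_bit_def)
next
  case 13 then show ?case by (simp add: del_zero)
next
  case 14 then show ?case by (simp add: del_add)
next
  case 16 then show ?case by (simp add: prd_mor)
next
  case 17 then show ?case by (simp add: prd_zero_left)
next
  case 18 then show ?case by (simp add: prd_zero_right)
next
  case 19 then show ?case by (simp add: prd_add_left)
next
  case 20 then show ?case by (simp add: prd_add_right)
qed simp_all

end

section \<open>The associated graded through representatives\<close>

lemma filt_chain_Cons:
  "X \<in> obj A \<Longrightarrow> x \<in> fil A X Y d l \<Longrightarrow> filt_chain A Y cs l' \<Longrightarrow> filt_chain A X ((d, x, Y) # cs) (l + l')"
  by (auto intro!: exI[of _ l])

context complete_group
begin

lemma comm_group_additive_F: "comm_group (additive (F l))"
  by (rule comm_group_additive) (auto intro: diff_F)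

lemma normal_additive_F: assumes "l \<le> l'" shows "F l' \<lhd> additive (F l)"
proof -
  interpret comm_group "additive (F l)" by (rule comm_group_additive_F)
  have inv: "inv\<^bsub>additive (F l)\<^esub> x = - x" if "x \<in> F l" for x
    using that by (intro inv_equality) (auto simp: additive_def)
  have "subgroup (F l') (additive (F l))"
    using F_antimono[OF assms] inv by unfold_locales (auto simp: additive_def intro: add_F)
  then show ?thesis by (simp add: normal_iff_subgroup)
qed

lemma coset_additive_eq: "(\<lambda>h. h + x) ` F l = (\<lambda>h. h + y) ` F l \<longleftrightarrow> x - y \<in> F l"
proof
  assume eq: "(\<lambda>h. h + x) ` F l = (\<lambda>h. h + y) ` F l"
  have "x \<in> (\<lambda>h. h + x) ` F l" by (intro image_eqI[of _ _ 0]) auto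
  then show "x - y \<in> F l" unfolding eq by auto
next
  assume xy: "x - y \<in> F l"
  show "(\<lambda>h. h + x) ` F l = (\<lambda>h. h + y) ` F l"
  proof (intro equalityI subsetI)
    fix u assume "u \<in> (\<lambda>h. h + x) ` F l"
    then obtain h where "h \<in> F l" "u = h + x" by auto
    then show "u \<in> (\<lambda>h. h + y) ` F l" using add_F[OF _ xy] by (intro image_eqI[of _ _ "h + (x - y)"]) auto
  next
    fix u assume "u \<in> (\<lambda>h. h + y) ` F l"
    then obtain h where "h \<in> F l" "u = h + y" by auto
    then show "u \<in> (\<lambda>h. h + x) ` F l" using diff_F[OF _ xy] by (intro image_eqI[of _ _ "h - (x - y)"]) auto
  qed
qed

lemma coset_additive_some:
  obtains x' where "x' - x \<in> F l" "(SOME u. u \<in> (\<lambda>h. h + x) ` F l) = x'"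
proof -
  have "(SOME u. u \<in> (\<lambda>h. h + x) ` F l) \<in> (\<lambda>h. h + x) ` F l"
    using zero_F by (intro some_in_eq[THEN iffD2]) blast
  then show thesis using that by fastforce
qed

end

context curved_filtered_ainf_category
begin

lemma fil_add: "X \<in> obj A \<Longrightarrow> Y \<in> obj A \<Longrightarrow> x \<in> fil A X Y d l \<Longrightarrow> y \<in> fil A X Y d l \<Longrightarrow> x + y \<in> fil A X Y d l"
  using complete_group.add_F[OF complete_group_fil] .
lemma fil_diff: "X \<in> obj A \<Longrightarrow> Y \<in> obj A \<Longrightarrow> x \<in> fil A X Y d l \<Longrightarrow> y \<in> fil A X Y d l \<Longrightarrow> x - y \<in> fil A X Y d l"
  using complete_group.diff_F[OF complete_group_fil] .
lemma fil_zero: "X \<in> obj A \<Longrightarrow> Y \<in> obj A \<Longrightarrow> 0 \<in> fil A X Y d l"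
  using complete_group.zero_F[OF complete_group_fil] .
lemma fil_uminus: "X \<in> obj A \<Longrightarrow> Y \<in> obj A \<Longrightarrow> x \<in> fil A X Y d l \<Longrightarrow> - x \<in> fil A X Y d l"
  using complete_group.uminus_F[OF complete_group_fil] .
lemma fil_sgn_bit: "X \<in> obj A \<Longrightarrow> Y \<in> obj A \<Longrightarrow> x \<in> fil A X Y d l \<Longrightarrow> sgn_bit e x \<in> fil A X Y d l"
  by (simp add: sgn_bit_def fil_uminus)
lemma fil_mono: "X \<in> obj A \<Longrightarrow> Y \<in> obj A \<Longrightarrow> x \<in> fil A X Y d l' \<Longrightarrow> l \<le> l' \<Longrightarrow> x \<in> fil A X Y d l"
  using complete_group.F_mono[OF complete_group_fil] .

lemma curvature_fil: "X \<in> obj A \<Longrightarrow> mu A X [] \<in> fil A X X 0 1"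
  by (rule curvature_filtered)

lemma mu_fil: "filt_chain A X cs l \<Longrightarrow> tgt X cs = Y \<Longrightarrow> red_deg cs = d \<Longrightarrow> l' \<le> l \<Longrightarrow> mu A X cs \<in> fil A X Y d l'"
  using mu.op_filt_chain[OF filt_chain_mono] by (auto simp: deg_out_red_deg)

lemma mu1_fil: "X \<in> obj A \<Longrightarrow> Y \<in> obj A \<Longrightarrow> x \<in> fil A X Y d l \<Longrightarrow> mu A X [(d, x, Y)] \<in> fil A X Y (d + 1) l"
  by (rule mu_fil[of _ _ "l + 0"], intro filt_chain_Cons) (simp_all add: add_ac)

lemma mu2_fil: "X \<in> obj A \<Longrightarrow> Y \<in> obj A \<Longrightarrow> Z \<in> obj A \<Longrightarrow> x \<in> fil A X Y d l \<Longrightarrow> y \<in> fil A Y Z e l' \<Longrightarrow>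
    mu A X [(d, x, Y), (e, y, Z)] \<in> fil A X Z (d + e) (l + l')"
  by (rule mu_fil[of _ _ "l + (l' + 0)"], intro filt_chain_Cons) (simp_all add: add_ac)

lemma mu3_fil: "X \<in> obj A \<Longrightarrow> Y \<in> obj A \<Longrightarrow> Z \<in> obj A \<Longrightarrow> W \<in> obj A \<Longrightarrow>
    x \<in> fil A X Y d l \<Longrightarrow> y \<in> fil A Y Z e l' \<Longrightarrow> z \<in> fil A Z W f l'' \<Longrightarrow> n \<le> l + (l' + l'') \<Longrightarrow>
    mu A X [(d, x, Y), (e, y, Z), (f, z, W)] \<in> fil A X W (d + e + f + 1) n"
  by (rule mu_fil[of _ _ "l + (l' + (l'' + 0))"], intro filt_chain_Cons) (simp_all add: add_ac)

lemma mu4_fil: "X \<in> obj A \<Longrightarrow> Y \<in> obj A \<Longrightarrow> Z \<in> obj A \<Longrightarrow> W \<in> obj A \<Longrightarrow> V \<in> obj A \<Longrightarrow>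
    x \<in> fil A X Y d l \<Longrightarrow> y \<in> fil A Y Z e l' \<Longrightarrow> z \<in> fil A Z W f l'' \<Longrightarrow> w \<in> fil A W V g l''' \<Longrightarrow> n \<le> l + (l' + (l'' + l''')) \<Longrightarrow>
    mu A X [(d, x, Y), (e, y, Z), (f, z, W), (g, w, V)] \<in> fil A X V (d + e + f + g) n"
  by (rule mu_fil[of _ _ "l + (l' + (l'' + (l''' + 0)))"], intro filt_chain_Cons) (simp_all add: add_ac)

lemma del_fil: "X \<in> obj A \<Longrightarrow> Y \<in> obj A \<Longrightarrow> x \<in> fil A X Y d l \<Longrightarrow> del A X Y d x \<in> fil A X Y (d + 1) l"
  unfolding del_def by (rule mu1_fil)

lemma prd_fil: "X \<in> obj A \<Longrightarrow> Y \<in> obj A \<Longrightarrow> Z \<in> obj A \<Longrightarrow> x \<in> fil A X Y d l \<Longrightarrow> y \<in> fil A Y Z e l' \<Longrightarrow>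
    n \<le> l + l' \<Longrightarrow> prd A X Y Z d e x y \<in> fil A X Z (d + e) n"
  unfolding prd_def by (rule fil_sgn_bit, assumption+, rule fil_mono[OF _ _ mu2_fil])

text \<open>The error is an operation with a curvature among its arguments, and curvatures lie in
  level 1. Hence \<open>del\<close> is a differential on the associated graded.\<close>

lemma del_del_fil:
  assumes "X \<in> obj A" "Y \<in> obj A" "x \<in> fil A X Y d l"
  shows "del A X Y (d + 1) (del A X Y d x) \<in> fil A X Y d (l + 1)"
proof -
  have "mu A X [(0, mu A X [], X), (d, x, Y)] \<in> fil A X Y d (l + 1)"
    "mu A X [(d, x, Y), (0, mu A Y [], Y)] \<in> fil A X Y d (l + 1)"
    using mu2_fil[OF assms(1,1,2) curvature_fil[OF assms(1)] assms(3)]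
      mu2_fil[OF assms(1,2,2,3) curvature_fil[OF assms(2)]] by (simp_all add: add.commute)
  then show ?thesis
    unfolding del_del[OF assms(1,2) fil_sub_mor[OF assms]] using assms by (intro fil_uminus fil_diff fil_sgn_bit)
qed

lemma del_prd_fil:
  assumes "X \<in> obj A" "Y \<in> obj A" "Z \<in> obj A" "x \<in> fil A X Y d l" "y \<in> fil A Y Z e l'"
  shows "del A X Z (d + e) (prd A X Y Z d e x y) -
      (prd A X Y Z (d + 1) e (del A X Y d x) y + sgn_bit d (prd A X Y Z d (e + 1) x (del A Y Z e y)))
    \<in> fil A X Z (d + e + 1) (l + l' + 1)"
proof -
  note o = assms(1-3)
  have "mu A X [(0, mu A X [], X), (d, x, Y), (e, y, Z)] \<in> fil A X Z (d + e + 1) (l + l' + 1)"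
    "mu A X [(d, x, Y), (0, mu A Y [], Y), (e, y, Z)] \<in> fil A X Z (d + e + 1) (l + l' + 1)"
    "mu A X [(d, x, Y), (e, y, Z), (0, mu A Z [], Z)] \<in> fil A X Z (d + e + 1) (l + l' + 1)"
    using mu3_fil[OF o(1,1-3) curvature_fil[OF o(1)] assms(4,5), of "l + l' + 1"]
      mu3_fil[OF o(1,2,2,3) assms(4) curvature_fil[OF o(2)] assms(5), of "l + l' + 1"]
      mu3_fil[OF o(1,2,3,3) assms(4,5) curvature_fil[OF o(3)], of "l + l' + 1"] by simp_all
  then show ?thesis
    unfolding del_prd[OF o fil_sub_mor[OF o(1,2) assms(4)] fil_sub_mor[OF o(2,3) assms(5)]]
    using o by (intro fil_uminus fil_sgn_bit fil_add fil_diff)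
qed

text \<open>Two kinds of error gain a level: a differential of an argument, by the closedness
  hypotheses, and an inserted curvature.\<close>

lemma prd_assoc_fil:
  assumes o: "X \<in> obj A" "Y \<in> obj A" "Z \<in> obj A" "W \<in> obj A"
    and m: "x \<in> fil A X Y d l" "y \<in> fil A Y Z e l'" "z \<in> fil A Z W f l''"
    and c: "del A X Y d x \<in> fil A X Y (d + 1) (l + 1)" "del A Y Z e y \<in> fil A Y Z (e + 1) (l' + 1)"
      "del A Z W f z \<in> fil A Z W (f + 1) (l'' + 1)"
  shows "prd A X Z W (d + e) f (prd A X Y Z d e x y) z - prd A X Y W d (e + f) x (prd A Y Z W e f y z) +
      del A X W (d + e + f + 1) (sgn_bit e (mu A X [(d, x, Y), (e, y, Z), (f, z, W)]))
    \<in> fil A X W (d + e + f) (l + l' + l'' + 1)"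
proof -
  let ?n = "l + l' + l'' + 1"
  have 3: "mu A X [(d + 1, del A X Y d x, Y), (e, y, Z), (f, z, W)] \<in> fil A X W (d + e + f) ?n"
    "mu A X [(d, x, Y), (e + 1, del A Y Z e y, Z), (f, z, W)] \<in> fil A X W (d + e + f) ?n"
    "mu A X [(d, x, Y), (e, y, Z), (f + 1, del A Z W f z, W)] \<in> fil A X W (d + e + f) ?n"
    using mu3_fil[OF o c(1) m(2,3), of ?n] mu3_fil[OF o m(1) c(2) m(3), of ?n] mu3_fil[OF o m(1,2) c(3), of ?n]
    by (simp_all add: add_ac)
  have 4: "mu A X [(0, mu A X [], X), (d, x, Y), (e, y, Z), (f, z, W)] \<in> fil A X W (d + e + f) ?n"
    "mu A X [(d, x, Y), (0, mu A Y [], Y), (e, y, Z), (f, z, W)] \<in> fil A X W (d + e + f) ?n"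
    "mu A X [(d, x, Y), (e, y, Z), (0, mu A Z [], Z), (f, z, W)] \<in> fil A X W (d + e + f) ?n"
    "mu A X [(d, x, Y), (e, y, Z), (f, z, W), (0, mu A W [], W)] \<in> fil A X W (d + e + f) ?n"
    using mu4_fil[OF o(1,1-4) curvature_fil[OF o(1)] m, of ?n] mu4_fil[OF o(1,2,2-4) m(1) curvature_fil[OF o(2)] m(2,3), of ?n]
      mu4_fil[OF o(1,2,3,3,4) m(1,2) curvature_fil[OF o(3)] m(3), of ?n] mu4_fil[OF o(1-4,4) m curvature_fil[OF o(4)], of ?n]
    by (simp_all add: add_ac)
  show ?thesis
    unfolding prd_assoc[OF o fil_sub_mor[OF o(1,2) m(1)] fil_sub_mor[OF o(2,3) m(2)] fil_sub_mor[OF o(3,4) m(3)]]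
    using 3 4 o by (intro fil_uminus fil_sgn_bit fil_add fil_diff)
qed

lemma gr_class_image: "gr_class A X Y d l x = (\<lambda>h. h + x) ` fil A X Y d (l + 1)"
  by (auto simp: gr_class_def r_coset_def additive_def)

lemma gr_class_eq: "X \<in> obj A \<Longrightarrow> Y \<in> obj A \<Longrightarrow> gr_class A X Y d l x = gr_class A X Y d l y \<longleftrightarrow> x - y \<in> fil A X Y d (l + 1)"
  unfolding gr_class_image by (rule complete_group.coset_additive_eq[OF complete_group_fil])

lemma gr_class_some:
  assumes "X \<in> obj A" "Y \<in> obj A" "x \<in> fil A X Y d l"
  obtains x' where "x' \<in> fil A X Y d l" "x' - x \<in> fil A X Y d (l + 1)" "(SOME u. u \<in> gr_class A X Y d l x) = x'"
proof -
  obtain x' where x': "x' - x \<in> fil A X Y d (l + 1)" "(SOME u. u \<in> gr_class A X Y d l x) = x'"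
    using complete_group.coset_additive_some[OF complete_group_fil[OF assms(1,2)]] unfolding gr_class_image by metis
  have "x' - x + x \<in> fil A X Y d l"
    using fil_add[OF assms(1,2) fil_mono[OF assms(1,2) x'(1)] assms(3)] by simp
  then show thesis using that x' by simp
qed

text \<open>\<open>Gr\<close> evaluates on a chosen representative. As \<open>del\<close> preserves
  levels, another choice changes the value by an element of the next level only.\<close>

lemma gmu_Gr1:
  assumes "X \<in> obj A" "Y \<in> obj A" "x \<in> fil A X Y d l"
  shows "gmu (Gr A) X [((d, l), gr_class A X Y d l x, Y)] = gr_class A X Y (d + 1) l (del A X Y d x)"
proof -
  obtain x' where x': "x' \<in> fil A X Y d l" "x' - x \<in> fil A X Y d (l + 1)" "(SOME u. u \<in> gr_class A X Y d l x) = x'"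
    using gr_class_some[OF assms] .
  have "gmu (Gr A) X [((d, l), gr_class A X Y d l x, Y)] = gr_class A X Y (d + 1) l (del A X Y d x')"
    by (simp add: Gr_def Let_def representatives_def forget_level_def level_def x'(3) del_def deg_out_red_deg add.commute)
  also have "\<dots> = gr_class A X Y (d + 1) l (del A X Y d x)"
    using del_fil[OF assms(1,2) x'(2)] del_diff[OF assms(1,2) fil_sub_mor[OF assms(1,2) x'(1)] fil_sub_mor[OF assms]]
    by (simp add: gr_class_eq assms)
  finally show ?thesis .
qed

lemma gmu_Gr2:
  assumes o: "X \<in> obj A" "Y \<in> obj A" "Z \<in> obj A" and x: "x \<in> fil A X Y d l" and y: "y \<in> fil A Y Z e l'"
  shows "gmu (Gr A) X [((d, l), gr_class A X Y d l x, Y), ((e, l'), gr_class A Y Z e l' y, Z)] =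
    gr_class A X Z (d + e) (l + l') (sgn_bit d (prd A X Y Z d e x y))"
proof -
  obtain x' where x': "x' \<in> fil A X Y d l" "x' - x \<in> fil A X Y d (l + 1)" "(SOME u. u \<in> gr_class A X Y d l x) = x'"
    using gr_class_some[OF o(1,2) x] .
  obtain y' where y': "y' \<in> fil A Y Z e l'" "y' - y \<in> fil A Y Z e (l' + 1)" "(SOME u. u \<in> gr_class A Y Z e l' y) = y'"
    using gr_class_some[OF o(2,3) y] .
  have "gmu (Gr A) X [((d, l), gr_class A X Y d l x, Y), ((e, l'), gr_class A Y Z e l' y, Z)] =
      gr_class A X Z (d + e) (l + l') (sgn_bit d (prd A X Y Z d e x' y'))"
    by (simp add: Gr_def Let_def representatives_def forget_level_def level_def x'(3) y'(3) prd_def deg_out_red_deg add_ac)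
  also have "\<dots> = gr_class A X Z (d + e) (l + l') (sgn_bit d (prd A X Y Z d e x y))"
  proof -
    have "prd A X Y Z d e x' y' - prd A X Y Z d e x y = prd A X Y Z d e (x' - x) y' + prd A X Y Z d e x (y' - y)"
      using prd_diff_left[OF o fil_sub_mor[OF o(1,2) x'(1)] fil_sub_mor[OF o(1,2) x] fil_sub_mor[OF o(2,3) y'(1)]]
        prd_diff_right[OF o fil_sub_mor[OF o(1,2) x] fil_sub_mor[OF o(2,3) y'(1)] fil_sub_mor[OF o(2,3) y]] by simp
    also have "\<dots> \<in> fil A X Z (d + e) (l + l' + 1)"
      using prd_fil[OF o x'(2) y'(1), of "l + l' + 1"] prd_fil[OF o x y'(2), of "l + l' + 1"] fil_add[OF o(1,3)] by simp
    finally show ?thesis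
      using fil_sgn_bit[OF o(1,3), of _ "d + e" "l + l' + 1" d] by (simp add: gr_class_eq o flip: sgn_bit_simps(6))
  qed
  finally show ?thesis .
qed

lemma presented_Gr:
  "presented_ainf (Gr A) (\<lambda>X Y g. fil A X Y (fst g) (snd g)) (\<lambda>X Y g. fil A X Y (fst g) (snd g + 1))
    (\<lambda>X Y g. gr_class A X Y (fst g) (snd g)) (\<lambda>X Y g. del A X Y (fst g)) (\<lambda>X Y Z g h. prd A X Y Z (fst g) (fst h))"
proof (rule presented_ainf.intro, goal_cases)
  note G = Gr_def deg1_prod_def deg1_bit_def
  {
    case 1 then show ?case by (simp add: G fil_zero)
  next
    case 2 then show ?case by (simp add: G fil_diff)
  next
    case 3 then show ?case by (simp add: G fil_zero)
  next
    case 4 then show ?case by (simp add: G fil_diff)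
  next
    case (5 X Y x g) then show ?case using fil_mono[of X Y x "fst g" "snd g + 1" "snd g"] by (simp add: G)
  next
    case (6 X Y g)
    then interpret c: complete_group "mor A X Y (fst g)" "fil A X Y (fst g)"
      using complete_group_fil by (simp add: G)
    show ?case using normal.factorgroup_is_group[OF c.normal_additive_F[of "snd g" "snd g + 1"]]
      by (simp add: G case_prod_unfold)
  next
    case (7 X Y g)
    show ?case by (auto simp: G case_prod_unfold gr_class_def FactGroup_def RCOSETS_def additive_def)
  next
    case (8 X Y x g y)
    then interpret c: complete_group "mor A X Y (fst g)" "fil A X Y (fst g)"
      using complete_group_fil by (simp add: G)
    show ?case using normal.rcos_sum[OF c.normal_additive_F[of "snd g" "snd g + 1"], of x y] 8
      by (simp add: G case_prod_unfold gr_class_def FactGroup_def) (simp add: additive_def)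
  next
    case 9 then show ?case by (simp add: G gr_class_eq)
  next
    case (10 X Y x g) then show ?case using gmu_Gr1[of X Y x "fst g" "snd g"]
      by (cases g) (simp add: G plus_prod_def)
  next
    case (11 X Y Z x g y h) then show ?case using gmu_Gr2[of X Y Z x "fst g" "snd g" y "fst h" "snd h"]
      by (cases g; cases h) (simp add: G plus_prod_def parity_prod_def parity_bit_def sgn_bit_def)
  next
    case 12 then show ?case by (simp add: G del_fil)
  next
    case 13 then show ?case by (simp add: G del_fil)
  next
    case 14 then show ?case using fil_sub_mor del_add by (simp add: G)
  next
    case (15 X Y x g) then show ?case using del_del_fil[of X Y x "fst g" "snd g"] by (simp add: G)
  next
    case 16 then show ?case by (simp add: G prd_fil)
  next
    case 17 then show ?case by (simp add: G prd_fil)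
  next
    case 18 then show ?case by (simp add: G prd_fil)
  next
    case 19 then show ?case using fil_sub_mor prd_add_left by (simp add: G)
  next
    case 20 then show ?case using fil_sub_mor prd_add_right by (simp add: G)
  next
    case (21 X Y Z x g y h)
    then show ?case using del_prd_fil[of X Y Z x "fst g" "snd g" y "fst h" "snd h"]
      by (cases "fst g") (simp_all add: G parity_prod_def parity_bit_def)
  next
    case (22 X Y Z W x g y h z k)
    let ?v = "sgn_bit (fst h) (mu A X [(fst g, x, Y), (fst h, y, Z), (fst k, z, W)])"
    have o: "X \<in> obj A" "Y \<in> obj A" "Z \<in> obj A" "W \<in> obj A" using 22 by (simp_all add: G)
    have v: "?v \<in> fil A X W (fst g + fst h + fst k + 1) (snd g + snd h + snd k)"
      using 22(5-7) o by (intro fil_sgn_bit mu3_fil[where l = "snd g" and l' = "snd h" and l'' = "snd k"]) simp_all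
    have dv: "del A X W (fst g + fst h + fst k + 1) (- ?v) = - del A X W (fst g + fst h + fst k + 1) ?v"
      using del_diff[OF o(1,4) mor_zero[OF o(1,4)] fil_sub_mor[OF o(1,4) v]] del_zero[OF o(1,4)] by simp
    have "prd A X Z W (fst g + fst h) (fst k) (prd A X Y Z (fst g) (fst h) x y) z -
        prd A X Y W (fst g) (fst h + fst k) x (prd A Y Z W (fst h) (fst k) y z) +
        del A X W (fst g + fst h + fst k + 1) ?v \<in> fil A X W (fst g + fst h + fst k) (snd g + snd h + snd k + 1)"
      using 22(5-10) by (intro prd_assoc_fil[OF o]) (simp_all add: G)
    then show ?case using fil_uminus[OF o(1,4) v] dv by (intro bexI[of _ "- ?v"]) (simp_all add: G)
  }
qed

end

section \<open>Functors of uncurved categories\<close>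

lemma blocks_single: "{bs. concat bs = [x] \<and> [] \<notin> set bs} = {[[x]]}"
proof -
  have "bs = [[x]]" if bs: "concat bs = [x]" "[] \<notin> set bs" for bs
  proof -
    obtain b bs' where b: "bs = b # bs'" using bs by (cases bs) auto
    then have "b = [x]" "concat bs' = []" using bs by (cases b; auto)+
    moreover have "bs' = []" using bs(2) b calculation(2) by (cases bs') auto
    ultimately show ?thesis using b by simp
  qed
  then show ?thesis by auto
qed

lemma blocks_pair: "{bs. concat bs = [x, y] \<and> [] \<notin> set bs} = {[[x, y]], [[x], [y]]}"
proof -
  have "bs = [[x, y]] \<or> bs = [[x], [y]]" if bs: "concat bs = [x, y]" "[] \<notin> set bs" for bs
  proof -
    obtain b bs' where b: "bs = b # bs'" "b \<noteq> []" using bs by (cases bs) auto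
    then consider "b = [x]" "concat bs' = [y]" | "b = [x, y]" "concat bs' = []"
      using bs by (cases b; cases "tl b") auto
    then show ?thesis
    proof cases
      case 1
      then have "bs' \<in> {bs. concat bs = [y] \<and> [] \<notin> set bs}" using bs(2) b by auto
      then show ?thesis using 1 b(1) unfolding blocks_single by simp
    next
      case 2
      moreover have "bs' = []" using bs(2) b 2(2) by (cases bs') auto
      ultimately show ?thesis using b by simp
    qed
  qed
  then show ?thesis by auto
qed

context uncurved_ainf_functor
begin

abbreviation F1 where "F1 X Y d x \<equiv> fmor F X [(d, x, Y)]"

lemma F1_mor: "X \<in> obj A \<Longrightarrow> Y \<in> obj A \<Longrightarrow> x \<in> mor A X Y d \<Longrightarrow> F1 X Y d x \<in> mor B (fobj F X) (fobj F Y) d"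
  using fmor_degree[of X "[(d, x, Y)]"] by (simp add: deg_out_red_deg)

lemma fmor_add:
  "is_chain (obj A) (mor A) X (p @ (d, c, Y) # r) \<Longrightarrow> is_chain (obj A) (mor A) X (p @ (d, c', Y) # r) \<Longrightarrow>
    fmor F X (p @ (d, c + c', Y) # r) = fmor F X (p @ (d, c, Y) # r) + fmor F X (p @ (d, c', Y) # r)"
  using fmor_multilinear unfolding multilinear_def by (elim allE conjE) blast

lemma fmor_zero:
  assumes "is_chain (obj A) (mor A) X (p @ (d, 0, Y) # r)" shows "fmor F X (p @ (d, 0, Y) # r) = 0"
  using fmor_add[OF assms assms] by simp

lemma F1_add: "X \<in> obj A \<Longrightarrow> Y \<in> obj A \<Longrightarrow> x \<in> mor A X Y d \<Longrightarrow> y \<in> mor A X Y d \<Longrightarrow> F1 X Y d (x + y) = F1 X Y d x + F1 X Y d y"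
  using fmor_add[of X "[]" d x Y "[]" y] by simp

lemma F1_zero: "X \<in> obj A \<Longrightarrow> Y \<in> obj A \<Longrightarrow> F1 X Y d 0 = 0"
  using fmor_zero[of X "[]" d Y "[]"] dom.mor_zero by simp

lemma F1_sgn_bit: "X \<in> obj A \<Longrightarrow> Y \<in> obj A \<Longrightarrow> x \<in> mor A X Y d \<Longrightarrow> F1 X Y d (sgn_bit e x) = sgn_bit e (F1 X Y d x)"
  using F1_add[of X Y x d "- x"] dom.mor_uminus[of X Y x d] F1_zero[of X Y d] by (cases e) (simp_all add: minus_unique)

lemma F1_del:
  assumes "X \<in> obj A" "Y \<in> obj A" "x \<in> mor A X Y d"
  shows "del B (fobj F X) (fobj F Y) d (F1 X Y d x) = F1 X Y (d + 1) (del A X Y d x)"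
proof -
  have "fmor F X [(0, 0, X), (d, x, Y)] = 0" "fmor F X [(d, x, Y), (0, 0, Y)] = 0"
    using fmor_zero[of X "[]" 0 X "[(d, x, Y)]"] fmor_zero[of X "[(d, x, Y)]" 0 Y "[]"] assms dom.mor_zero by simp_all
  then show ?thesis using fmor_ainf[of X "[(d, x, Y)]"] assms
    by (simp add: blocks_single sum_splits_simps koszul_sgn_bit deg_out_red_deg dom.mu_uncurved del_def add.commute)
qed

text \<open>The second component, with the sign of \<open>prd\<close>, is the homotopy between the
  image of a product and the product of the images.\<close>

lemma F1_prd:
  assumes o: "X \<in> obj A" "Y \<in> obj A" "Z \<in> obj A" and m: "x \<in> mor A X Y d" "y \<in> mor A Y Z e"
    and c: "del A X Y d x = 0" "del A Y Z e y = 0"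
  shows "F1 X Z (d + e) (prd A X Y Z d e x y) -
      prd B (fobj F X) (fobj F Y) (fobj F Z) d e (F1 X Y d x) (F1 Y Z e y) =
    del B (fobj F X) (fobj F Z) (d + e + 1) (sgn_bit d (fmor F X [(d, x, Y), (e, y, Z)]))"
proof -
  let ?F2 = "fmor F X [(d, x, Y), (e, y, Z)]"
  have z: "fmor F X [(d + 1, 0, Y), (e, y, Z)] = 0" "fmor F X [(d, x, Y), (e + 1, 0, Z)] = 0"
    "fmor F X [(0, 0, X), (d, x, Y), (e, y, Z)] = 0" "fmor F X [(d, x, Y), (0, 0, Y), (e, y, Z)] = 0"
    "fmor F X [(d, x, Y), (e, y, Z), (0, 0, Z)] = 0"
    using fmor_zero[of X "[]" "d + 1" Y "[(e, y, Z)]"] fmor_zero[of X "[(d, x, Y)]" "e + 1" Z "[]"]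
      fmor_zero[of X "[]" 0 X "[(d, x, Y), (e, y, Z)]"] fmor_zero[of X "[(d, x, Y)]" 0 Y "[(e, y, Z)]"]
      fmor_zero[of X "[(d, x, Y), (e, y, Z)]" 0 Z "[]"] o m dom.mor_zero by simp_all
  have F2: "?F2 \<in> mor B (fobj F X) (fobj F Z) (d + e + 1)"
    using fmor_degree[of X "[(d, x, Y), (e, y, Z)]"] o m by (simp add: deg_out_red_deg add_ac)
  have 1: "del B (fobj F X) (fobj F Z) (d + e + 1) (sgn_bit d ?F2) = sgn_bit d (mu B (fobj F X) [(d + e + 1, ?F2, fobj F Z)])"
    using cod.mu_sgn_bit[of "fobj F X" "[]" "d + e + 1" ?F2 "fobj F Z" "[]" d] F2 fobj o by (simp add: del_def)
  have "mu A X [(d, x, Y), (e, y, Z)] \<in> mor A X Z (d + e)"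
    using dom.mu_degree[of X "[(d, x, Y), (e, y, Z)]"] o m by (simp add: deg_out_red_deg add_ac)
  then have 2: "F1 X Z (d + e) (prd A X Y Z d e x y) = sgn_bit d (F1 X Z (d + e) (mu A X [(d, x, Y), (e, y, Z)]))"
    using F1_sgn_bit o by (simp add: prd_def)
  have 3: "mu B (fobj F X) [(d + e + 1, ?F2, fobj F Z)] + mu B (fobj F X) [(d, F1 X Y d x, fobj F Y), (e, F1 Y Z e y, fobj F Z)] =
      F1 X Z (d + e) (mu A X [(d, x, Y), (e, y, Z)])"
    using fmor_ainf[of X "[(d, x, Y), (e, y, Z)]"] o m z c
    by (simp add: blocks_pair sum_splits_simps koszul_sgn_bit deg_out_red_deg dom.mu_uncurved del_def add_ac)
  show ?thesis unfolding 1 2 3[symmetric] prd_def[of B] by simp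
qed

lemma presented_functor_graded:
  "presented_functor (graded A) (mor A) (\<lambda>X Y d. {0}) (\<lambda>X Y d x. x) (del A) (prd A)
    (graded B) (mor B) (\<lambda>X Y d. {0}) (\<lambda>X Y d x. x) (del B) (prd B) F F1"
proof -
  interpret d: presented_ainf "graded A" "mor A" "\<lambda>X Y d. {0}" "\<lambda>X Y d x. x" "del A" "prd A"
    by (rule dom.presented_graded)
  interpret c: presented_ainf "graded B" "mor B" "\<lambda>X Y d. {0}" "\<lambda>X Y d x. x" "del B" "prd B"
    by (rule cod.presented_graded)
  show ?thesis
  proof (intro presented_functor.intro d.presented_ainf_axioms c.presented_ainf_axioms presented_functor_axioms.intro, goal_cases)
    case 1 then show ?case by (simp add: graded_def fobj)
  next
    case 2 then show ?case by simp
  next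
    case 3 then show ?case by (simp add: graded_def F1_mor)
  next
    case 4 then show ?case by (simp add: graded_def F1_zero)
  next
    case 5 then show ?case by (simp add: graded_def F1_add)
  next
    case 6 then show ?case by (simp add: graded_def F1_del deg1_bit_def)
  next
    case (7 X Y Z x g y h)
    then have o: "X \<in> obj A" "Y \<in> obj A" "Z \<in> obj A" and m: "x \<in> mor A X Y g" "y \<in> mor A Y Z h"
      and cc: "del A X Y g x = 0" "del A Y Z h y = 0"
      by (simp_all add: graded_def d.Cyc_def)
    have F2: "fmor F X [(g, x, Y), (h, y, Z)] \<in> mor B (fobj F X) (fobj F Z) (g + h + 1)"
      using fmor_degree[of X "[(g, x, Y), (h, y, Z)]"] o m by (simp add: deg_out_red_deg add_ac)
    then have s: "sgn_bit g (fmor F X [(g, x, Y), (h, y, Z)]) \<in> mor B (fobj F X) (fobj F Z) (g + h + 1)"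
      using cod.mor_sgn_bit fobj o by blast
    show ?case unfolding F1_prd[OF o m cc]
      using c.d1_Bdy[of "fobj F X" "fobj F Z" _ "g + h"] s fobj o by (simp add: graded_def deg1_bit_def)
  qed
qed

end

section \<open>Lifting along complete filtrations\<close>

lemma complete_group_prod:
  assumes "complete_group M F" "complete_group M' F'"
  shows "complete_group (M \<times> M') (\<lambda>l. F l \<times> F' l)"
proof -
  interpret a: complete_group M F by fact
  interpret b: complete_group M' F' by fact
  have "\<exists>y\<in>M \<times> M'. \<forall>l. y - x l \<in> F l \<times> F' l"
    if x: "\<forall>l. x l \<in> M \<times> M' \<and> x (l + 1) - x l \<in> F l \<times> F' l" for x
  proof -
    have 1: "fst (x l) \<in> M" "fst (x (l + 1)) - fst (x l) \<in> F l"
      and 2: "snd (x l) \<in> M'" "snd (x (l + 1)) - snd (x l) \<in> F' l" for l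
      using x[rule_format, of l] by (auto simp: mem_Times_iff)
    obtain y where y: "y \<in> M" "\<forall>l. y - fst (x l) \<in> F l" using a.F_limit[of "\<lambda>l. fst (x l)"] 1 by blast
    obtain z where z: "z \<in> M'" "\<forall>l. z - snd (x l) \<in> F' l" using b.F_limit[of "\<lambda>l. snd (x l)"] 2 by blast
    show ?thesis using y z by (intro bexI[of _ "(y, z)"]) (auto simp: mem_Times_iff)
  qed
  moreover have "(\<Union>l. F l \<times> F' l) = M \<times> M'"
  proof (intro equalityI subsetI)
    fix u assume "u \<in> M \<times> M'"
    then obtain l l' where "fst u \<in> F l" "snd u \<in> F' l'" using a.F_exhaust b.F_exhaust by (metis mem_Times_iff)
    then have "u \<in> F (min l l') \<times> F' (min l l')" by (auto simp: mem_Times_iff intro: a.F_mono b.F_mono)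
    then show "u \<in> (\<Union>l. F l \<times> F' l)" by blast
  qed (auto intro: a.F_sub_M b.F_sub_M)
  moreover have "(\<Inter>l. F l \<times> F' l) = {0}"
  proof (intro equalityI subsetI)
    fix u assume "u \<in> (\<Inter>l. F l \<times> F' l)"
    then have "fst u = 0" "snd u = 0" by (auto simp: mem_Times_iff intro!: a.F_separated b.F_separated)
    then show "u \<in> {0}" by (simp add: prod_eq_iff)
  qed (auto simp: zero_prod_def)
  moreover have "F l' \<times> F' l' \<subseteq> F l \<times> F' l" if "l \<le> l'" for l l'
    using a.F_antimono[OF that] b.F_antimono[OF that] by blast
  moreover have "0 \<in> F l \<times> F' l" "\<forall>u\<in>F l \<times> F' l. \<forall>v\<in>F l \<times> F' l. u - v \<in> F l \<times> F' l" for l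
    by (auto simp: zero_prod_def intro: a.diff_F b.diff_F)
  ultimately show ?thesis unfolding complete_group_def complete_filtration_def by simp
qed

text \<open>A defect of level \<open>n\<close> is corrected by an element of the same level and
  becomes one of level \<open>n + 1\<close>. The corrections tend to zero, so completeness gives a
  limit, and \<open>cont\<close> puts its defect into every level. \<open>cont\<close> stands in for
  linearity, which the Maurer-Cartan equation does not have.\<close>

lemma successive_approximation:
  assumes "complete_group M F" "complete_group M' F'" and m0: "m0 \<in> M" "\<Theta> m0 \<in> F' n0"
    and step: "\<And>n m. n0 \<le> n \<Longrightarrow> m - m0 \<in> F n0 \<Longrightarrow> \<Theta> m \<in> F' n \<Longrightarrow> \<exists>m'\<in>F n. \<Theta> (m + m') \<in> F' (n + 1)"
    and cont: "\<And>n m m'. n0 \<le> n \<Longrightarrow> m - m0 \<in> F n0 \<Longrightarrow> m' \<in> F n \<Longrightarrow> \<Theta> (m + m') - \<Theta> m \<in> F' n"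
  shows "\<exists>m. m - m0 \<in> F n0 \<and> \<Theta> m = 0"
proof -
  interpret a: complete_group M F by fact
  interpret b: complete_group M' F' by fact
  let ?P = "\<lambda>k m. m - m0 \<in> F n0 \<and> \<Theta> m \<in> F' (n0 + int k)"
  have "\<exists>s. \<forall>k. ?P k (s k) \<and> s (Suc k) - s k \<in> F (n0 + int k)"
  proof (rule dependent_nat_choice)
    show "\<exists>m. ?P 0 m" using m0 by (intro exI[of _ m0]) simp
  next
    fix m k assume P: "?P k m"
    obtain m' where m': "m' \<in> F (n0 + int k)" "\<Theta> (m + m') \<in> F' (n0 + int k + 1)"
      using step[of "n0 + int k" m] P by auto
    have "m' \<in> F n0" using a.F_mono[OF m'(1)] by simp
    then have "m + m' - m0 \<in> F n0" using P a.add_F[of "m - m0" n0 m'] by (simp add: algebra_simps)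
    then show "\<exists>y. ?P (Suc k) y \<and> y - m \<in> F (n0 + int k)"
      using m' by (intro exI[of _ "m + m'"]) (simp add: algebra_simps)
  qed
  then obtain s where s: "\<And>k. ?P k (s k)" "\<And>k. s (Suc k) - s k \<in> F (n0 + int k)" by blast
  \<comment> \<open>Limits are taken of sequences indexed by all integers, so the iteration is
    continued as a constant below \<open>n0\<close>.\<close>
  define x where "x l = (if l < n0 then s 0 else s (nat (l - n0)))" for l
  have sM: "s k \<in> M" for k
    using a.add_M[OF a.F_sub_M[of "s k - m0" n0] m0(1)] s(1)[of k] by simp
  have "x (l + 1) - x l \<in> F l" for l
  proof (cases "l < n0")
    case True
    then have "x (l + 1) = x l" by (cases "l + 1 = n0") (auto simp: x_def)
    then show ?thesis by simp
  next
    case False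
    then have "nat (l + 1 - n0) = Suc (nat (l - n0))" "n0 + int (nat (l - n0)) = l" by auto
    then show ?thesis using s(2)[of "nat (l - n0)"] False by (simp add: x_def)
  qed
  moreover have "x l \<in> M" for l using sM by (simp add: x_def)
  ultimately obtain y where y: "\<And>l. y - x l \<in> F l" using a.F_limit[of x] by blast
  have "y - m0 = (y - x n0) + (s 0 - m0)" by (simp add: x_def)
  also have "\<dots> \<in> F n0" using y[of n0] s(1)[of 0] a.add_F by blast
  finally have y0: "y - m0 \<in> F n0" .
  \<comment> \<open>\<open>y\<close> differs from the approximation \<open>x l\<close> by an element
    of \<open>F l\<close>, and the defect of \<open>x l\<close> already lies in
    \<open>F' l\<close>.\<close>
  have ge: "\<Theta> y \<in> F' l" if "n0 \<le> l" for l
  proof -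
    have l: "x l = s (nat (l - n0))" "n0 + int (nat (l - n0)) = l" using that by (auto simp: x_def)
    have "\<Theta> (x l) \<in> F' l" "x l - m0 \<in> F n0" using s(1)[of "nat (l - n0)"] l by auto
    moreover have "\<Theta> (x l + (y - x l)) - \<Theta> (x l) \<in> F' l" using cont[OF that calculation(2) y[of l]] .
    ultimately show ?thesis using b.add_F by fastforce
  qed
  have "\<Theta> y \<in> F' l" for l using b.F_mono[OF ge[of "max n0 l"], of l] by simp
  from b.F_separated[OF this] y0 show ?thesis by blast
qed

section \<open>Mapping cones of filtered maps\<close>

text \<open>The squares of the differentials and compatibility with \<open>\<phi>\<close> are left
  to the individual lemmas, because for untwisted operations they are zero, respectively hold, only
  modulo the next level.\<close>

locale filtered_map =
  fixes C :: "bit \<Rightarrow> 'a::ab_group_add set" and FC :: "bit \<Rightarrow> int \<Rightarrow> 'a set" and dC :: "bit \<Rightarrow> 'a \<Rightarrow> 'a"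
    and D :: "bit \<Rightarrow> 'b::ab_group_add set" and FD :: "bit \<Rightarrow> int \<Rightarrow> 'b set" and dD :: "bit \<Rightarrow> 'b \<Rightarrow> 'b"
    and \<phi> :: "bit \<Rightarrow> 'a \<Rightarrow> 'b"
  assumes C_complete: "complete_group (C d) (FC d)" and D_complete: "complete_group (D d) (FD d)"
    and dC_add: "x \<in> C d \<Longrightarrow> y \<in> C d \<Longrightarrow> dC d (x + y) = dC d x + dC d y"
    and dD_add: "u \<in> D d \<Longrightarrow> v \<in> D d \<Longrightarrow> dD d (u + v) = dD d u + dD d v"
    and \<phi>_add: "x \<in> C d \<Longrightarrow> y \<in> C d \<Longrightarrow> \<phi> d (x + y) = \<phi> d x + \<phi> d y"
    and dC_F: "x \<in> FC d l \<Longrightarrow> dC d x \<in> FC (d + 1) l"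
    and dD_F: "u \<in> FD d l \<Longrightarrow> dD d u \<in> FD (d + 1) l"
    and \<phi>_F: "x \<in> FC d l \<Longrightarrow> \<phi> d x \<in> FD d l"
begin

sublocale C: complete_group "C d" "FC d" for d by (rule C_complete)
sublocale D: complete_group "D d" "FD d" for d by (rule D_complete)

lemma dC_M: "x \<in> C d \<Longrightarrow> dC d x \<in> C (d + 1)" using C.F_exhaust dC_F C.F_sub_M by metis
lemma dD_M: "u \<in> D d \<Longrightarrow> dD d u \<in> D (d + 1)" using D.F_exhaust dD_F D.F_sub_M by metis
lemma \<phi>_M: "x \<in> C d \<Longrightarrow> \<phi> d x \<in> D d" using C.F_exhaust \<phi>_F D.F_sub_M by metis

lemma dC_diff: "x \<in> C d \<Longrightarrow> y \<in> C d \<Longrightarrow> dC d (x - y) = dC d x - dC d y"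
  using dC_add[of "x - y" d y] C.diff_M[of x d y] by (simp add: algebra_simps)
lemma dD_diff: "u \<in> D d \<Longrightarrow> v \<in> D d \<Longrightarrow> dD d (u - v) = dD d u - dD d v"
  using dD_add[of "u - v" d v] D.diff_M[of u d v] by (simp add: algebra_simps)
lemma \<phi>_diff: "x \<in> C d \<Longrightarrow> y \<in> C d \<Longrightarrow> \<phi> d (x - y) = \<phi> d x - \<phi> d y"
  using \<phi>_add[of "x - y" d y] C.diff_M[of x d y] by (simp add: algebra_simps)

lemma dD_uminus: "u \<in> D d \<Longrightarrow> dD d (- u) = - dD d u"
  using dD_diff[of 0 d u] dD_diff[of u d u] D.zero_M by simp

text \<open>Exactness of the associated graded of the mapping cone of \<open>\<phi>\<close>.\<close>

definition cone_exact :: bool where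
  "cone_exact \<longleftrightarrow> (\<forall>d n r s. r \<in> FC (d + 1) n \<longrightarrow> s \<in> FD d n \<longrightarrow> dC (d + 1) r \<in> FC d (n + 1) \<longrightarrow>
     \<phi> (d + 1) r + dD d s \<in> FD (d + 1) (n + 1) \<longrightarrow>
     (\<exists>x\<in>FC d n. \<exists>y\<in>FD (d + 1) n. dC d x - r \<in> FC (d + 1) (n + 1) \<and> dD (d + 1) y - \<phi> d x - s \<in> FD d (n + 1)))"

text \<open>The long exact sequence of the cone in terms of representatives: injectivity and
  surjectivity on graded cohomology give exactness.\<close>

lemma cone_exactI:
  assumes inj: "\<And>d n x z. x \<in> FC (d + 1) n \<Longrightarrow> dC (d + 1) x \<in> FC d (n + 1) \<Longrightarrow> z \<in> FD d n \<Longrightarrow>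
      \<phi> (d + 1) x - dD d z \<in> FD (d + 1) (n + 1) \<Longrightarrow> \<exists>w\<in>FC d n. x - dC d w \<in> FC (d + 1) (n + 1)"
    and sur: "\<And>d n y. y \<in> FD d n \<Longrightarrow> dD d y \<in> FD (d + 1) (n + 1) \<Longrightarrow>
      \<exists>x\<in>FC d n. \<exists>z\<in>FD (d + 1) n. dC d x \<in> FC (d + 1) (n + 1) \<and> \<phi> d x - y - dD (d + 1) z \<in> FD d (n + 1)"
    and chain: "\<And>d n x. x \<in> FC d n \<Longrightarrow> dD d (\<phi> d x) - \<phi> (d + 1) (dC d x) \<in> FD (d + 1) (n + 1)"
  shows cone_exact
  unfolding cone_exact_def
proof (intro allI impI)
  fix d n r s
  assume r: "r \<in> FC (d + 1) n" "dC (d + 1) r \<in> FC d (n + 1)" and s: "s \<in> FD d n"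
    and rs: "\<phi> (d + 1) r + dD d s \<in> FD (d + 1) (n + 1)"
  have sD: "s \<in> D d" using s D.F_sub_M by blast
  have rC: "r \<in> C (d + 1)" using r C.F_sub_M by blast
  have "\<phi> (d + 1) r - dD d (- s) \<in> FD (d + 1) (n + 1)" using rs dD_uminus[OF sD] by simp
  then obtain x0 where x0: "x0 \<in> FC d n" "r - dC d x0 \<in> FC (d + 1) (n + 1)" using inj r s D.uminus_F by blast
  have x0C: "x0 \<in> C d" using x0 C.F_sub_M by blast
  \<comment> \<open>Once \<open>x0\<close> has bounded \<open>r\<close>, adding
    \<open>\<phi> x0\<close> to \<open>s\<close> gives a cocycle modulo the next level, to which
    surjectivity applies.\<close>
  define t where "t = s + \<phi> d x0"
  have t: "t \<in> FD d n" unfolding t_def using s \<phi>_F[OF x0(1)] D.add_F by blast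
  have "dD d t = (\<phi> (d + 1) r + dD d s) + (dD d (\<phi> d x0) - \<phi> (d + 1) (dC d x0)) - \<phi> (d + 1) (r - dC d x0)"
    unfolding t_def using dD_add[OF sD \<phi>_M[OF x0C]] \<phi>_diff[OF rC dC_M[OF x0C]] by simp
  also have "\<dots> \<in> FD (d + 1) (n + 1)" using D.diff_F[OF D.add_F[OF rs chain[OF x0(1)]] \<phi>_F[OF x0(2)]] .
  finally have "dD d t \<in> FD (d + 1) (n + 1)" .
  from sur[OF t this] obtain x1 z where x1: "x1 \<in> FC d n" "dC d x1 \<in> FC (d + 1) (n + 1)"
    and z: "z \<in> FD (d + 1) n" "\<phi> d x1 - t - dD (d + 1) z \<in> FD d (n + 1)" by blast
  have x1C: "x1 \<in> C d" using x1 C.F_sub_M by blast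
  have "dC d (x0 - x1) - r = - (r - dC d x0) - dC d x1" using dC_diff[OF x0C x1C] by simp
  also have "\<dots> \<in> FC (d + 1) (n + 1)" using C.diff_F[OF C.uminus_F[OF x0(2)] x1(2)] .
  finally have 1: "dC d (x0 - x1) - r \<in> FC (d + 1) (n + 1)" .
  have "dD (d + 1) (- z) - \<phi> d (x0 - x1) - s = \<phi> d x1 - t - dD (d + 1) z"
    using dD_uminus[OF D.F_sub_M[OF z(1)]] \<phi>_diff[OF x0C x1C] by (simp add: t_def)
  with z(2) have "dD (d + 1) (- z) - \<phi> d (x0 - x1) - s \<in> FD d (n + 1)" by simp
  with 1 show "\<exists>x\<in>FC d n. \<exists>y\<in>FD (d + 1) n. dC d x - r \<in> FC (d + 1) (n + 1) \<and> dD (d + 1) y - \<phi> d x - s \<in> FD d (n + 1)"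
    using C.diff_F[OF x0(1) x1(1)] D.uminus_F[OF z(1)] by blast
qed

text \<open>Exactness of the graded cone sees only leading terms, and the perturbation changes none
  of them. This is the passage from untwisted to twisted maps.\<close>

lemma cone_exact_perturb:
  assumes "filtered_map C FC dC' D FD dD' \<phi>'" and ex: "filtered_map.cone_exact FC dC' FD dD' \<phi>'"
    and C: "\<And>d n x. x \<in> FC d n \<Longrightarrow> dC d x - dC' d x \<in> FC (d + 1) (n + 1)"
    and D: "\<And>d n y. y \<in> FD d n \<Longrightarrow> dD d y - dD' d y \<in> FD (d + 1) (n + 1)"
    and \<phi>: "\<And>d n x. x \<in> FC d n \<Longrightarrow> \<phi> d x - \<phi>' d x \<in> FD d (n + 1)"
  shows cone_exact
  unfolding cone_exact_def
proof (intro allI impI)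
  interpret o: filtered_map C FC dC' D FD dD' \<phi>' by fact
  fix d n r s
  assume r: "r \<in> FC (d + 1) n" "dC (d + 1) r \<in> FC d (n + 1)" and s: "s \<in> FD d n"
    and rs: "\<phi> (d + 1) r + dD d s \<in> FD (d + 1) (n + 1)"
  have d2: "d + 1 + 1 = d" by (cases d) simp_all
  have "dC' (d + 1) r = dC (d + 1) r - (dC (d + 1) r - dC' (d + 1) r)" by simp
  also have "\<dots> \<in> FC d (n + 1)" using C.diff_F[OF r(2)] C[OF r(1)] unfolding d2 by blast
  finally have 1: "dC' (d + 1) r \<in> FC d (n + 1)" .
  have "\<phi>' (d + 1) r + dD' d s = \<phi> (d + 1) r + dD d s - (\<phi> (d + 1) r - \<phi>' (d + 1) r) - (dD d s - dD' d s)" by simp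
  also have "\<dots> \<in> FD (d + 1) (n + 1)" using D.diff_F[OF D.diff_F[OF rs \<phi>[OF r(1)]] D[OF s]] .
  finally have 2: "\<phi>' (d + 1) r + dD' d s \<in> FD (d + 1) (n + 1)" .
  obtain x y where xy: "x \<in> FC d n" "y \<in> FD (d + 1) n" "dC' d x - r \<in> FC (d + 1) (n + 1)"
    "dD' (d + 1) y - \<phi>' d x - s \<in> FD d (n + 1)"
    using ex r(1) s 1 2 unfolding o.cone_exact_def by blast
  have "dC d x - r = dC d x - dC' d x + (dC' d x - r)" by simp
  also have "\<dots> \<in> FC (d + 1) (n + 1)" using C.add_F[OF C[OF xy(1)] xy(3)] .
  finally have 3: "dC d x - r \<in> FC (d + 1) (n + 1)" .
  have "dD (d + 1) y - \<phi> d x - s = (dD (d + 1) y - dD' (d + 1) y) - (\<phi> d x - \<phi>' d x) + (dD' (d + 1) y - \<phi>' d x - s)" by simp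
  also have "\<dots> \<in> FD d (n + 1)" using D.add_F[OF D.diff_F[OF _ \<phi>[OF xy(1)]] xy(4)] D[OF xy(2)] unfolding d2 by blast
  finally show "\<exists>x\<in>FC d n. \<exists>y\<in>FD (d + 1) n. dC d x - r \<in> FC (d + 1) (n + 1) \<and> dD (d + 1) y - \<phi> d x - s \<in> FD d (n + 1)"
    using 3 xy(1,2) by blast
qed

text \<open>For genuine complexes the residue of an approximate solution is again a cocycle of the
  cone, so graded exactness applies to it anew at the next level. The solution stays in the level
  \<open>n\<close> of the data.\<close>

lemma cone_lift:
  assumes ex: cone_exact
    and dCdC: "\<And>d x. x \<in> C d \<Longrightarrow> dC (d + 1) (dC d x) = 0" and dDdD: "\<And>d y. y \<in> D d \<Longrightarrow> dD (d + 1) (dD d y) = 0"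
    and chain: "\<And>d x. x \<in> C d \<Longrightarrow> dD d (\<phi> d x) = \<phi> (d + 1) (dC d x)"
    and r: "r \<in> FC (d + 1) n" "dC (d + 1) r = 0" and s: "s \<in> FD d n" "\<phi> (d + 1) r + dD d s = 0"
  shows "\<exists>x\<in>FC d n. \<exists>y\<in>FD (d + 1) n. dC d x = r \<and> dD (d + 1) y - \<phi> d x = s"
proof -
  let ?\<Theta> = "\<lambda>(x, y). (dC d x - r, dD (d + 1) y - \<phi> d x - s)"
  have d2: "d + 1 + 1 = d" by (cases d) simp_all
  note rC = C.F_sub_M[OF r(1)] and sD = D.F_sub_M[OF s(1)]
  have add: "?\<Theta> (m + m') = ?\<Theta> m + (dC d (fst m'), dD (d + 1) (snd m') - \<phi> d (fst m'))"
    if "m \<in> C d \<times> D (d + 1)" "m' \<in> C d \<times> D (d + 1)" for m m'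
    using that by (auto simp: dC_add dD_add \<phi>_add)
  have "\<exists>m. m - 0 \<in> FC d n \<times> FD (d + 1) n \<and> ?\<Theta> m = 0"
  proof (rule successive_approximation[OF complete_group_prod[OF C_complete[of d] D_complete[of "d + 1"]]
        complete_group_prod[OF C_complete[of "d + 1"] D_complete[of d]]])
    show "0 \<in> C d \<times> D (d + 1)" by (simp add: zero_prod_def C.zero_M D.zero_M)
    have "dC d 0 = 0" "dD (d + 1) 0 = 0" "\<phi> d 0 = 0"
      using dC_add[of 0 d 0] dD_add[of 0 "d + 1" 0] \<phi>_add[of 0 d 0] C.zero_M D.zero_M by simp_all
    then show "?\<Theta> 0 \<in> FC (d + 1) n \<times> FD d n" using r(1) s(1) by (simp add: zero_prod_def C.uminus_F D.uminus_F)
  next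
    fix k m assume k: "n \<le> k" and m: "m - 0 \<in> FC d n \<times> FD (d + 1) n" and \<Theta>: "?\<Theta> m \<in> FC (d + 1) k \<times> FD d k"
    obtain x y where xy: "m = (x, y)" by (cases m)
    have xC: "x \<in> C d" and yD: "y \<in> D (d + 1)" using m xy C.F_sub_M D.F_sub_M by auto
    \<comment> \<open>The residues. That they form a cocycle uses the vanishing squares and the
      chain map property.\<close>
    define r1 s1 where "r1 = r - dC d x" and "s1 = s - (dD (d + 1) y - \<phi> d x)"
    have e: "?\<Theta> m = (- r1, - s1)" by (simp add: xy r1_def s1_def)
    have r1: "r1 \<in> FC (d + 1) k" and s1: "s1 \<in> FD d k" using \<Theta> unfolding e by auto
    have dr1: "dC (d + 1) r1 = 0" using dC_diff[OF rC dC_M[OF xC]] dCdC[OF xC] r(2) by (simp add: r1_def)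
    have dy: "dD (d + 1) y \<in> D d" using dD_M[OF yD] unfolding d2 .
    have ddy: "dD d (dD (d + 1) y) = 0" using dDdD[OF yD] unfolding d2 .
    have "\<phi> (d + 1) r1 + dD d s1 = (\<phi> (d + 1) r - \<phi> (d + 1) (dC d x)) + (dD d s - (dD d (dD (d + 1) y) - dD d (\<phi> d x)))"
      using \<phi>_diff[OF rC dC_M[OF xC]] dD_diff[OF sD D.diff_M[OF dy \<phi>_M[OF xC]]] dD_diff[OF dy \<phi>_M[OF xC]]
      by (simp add: r1_def s1_def)
    also have "\<dots> = \<phi> (d + 1) r + dD d s" using chain[OF xC] ddy by simp
    finally have "\<phi> (d + 1) r1 + dD d s1 = 0" using s(2) by simp
    then obtain x' y' where x': "x' \<in> FC d k" "y' \<in> FD (d + 1) k" "dC d x' - r1 \<in> FC (d + 1) (k + 1)"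
      "dD (d + 1) y' - \<phi> d x' - s1 \<in> FD d (k + 1)"
      using ex r1 s1 dr1 unfolding cone_exact_def by (metis C.zero_F D.zero_F)
    have "?\<Theta> (m + (x', y')) = (dC d x' - r1, dD (d + 1) y' - \<phi> d x' - s1)"
      using add[of m "(x', y')"] xC yD C.F_sub_M[OF x'(1)] D.F_sub_M[OF x'(2)] e by (simp add: xy)
    then show "\<exists>m'\<in>FC d k \<times> FD (d + 1) k. ?\<Theta> (m + m') \<in> FC (d + 1) (k + 1) \<times> FD d (k + 1)"
      using x' by (intro bexI[of _ "(x', y')"]) simp_all
  next
    fix k m m' assume m: "m - 0 \<in> FC d n \<times> FD (d + 1) n" and m': "m' \<in> FC d k \<times> FD (d + 1) k"
    have "m \<in> C d \<times> D (d + 1)" "m' \<in> C d \<times> D (d + 1)" using m m' C.F_sub_M D.F_sub_M by (auto simp: mem_Times_iff)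
    from add[OF this] have "?\<Theta> (m + m') - ?\<Theta> m = (dC d (fst m'), dD (d + 1) (snd m') - \<phi> d (fst m'))" by simp
    also have "\<dots> \<in> FC (d + 1) k \<times> FD d k"
      using dC_F[of "fst m'" d k] dD_F[of "snd m'" "d + 1" k] \<phi>_F[of "fst m'" d k] m' D.diff_F[of _ d k]
      unfolding d2 by (auto simp: mem_Times_iff)
    finally show "?\<Theta> (m + m') - ?\<Theta> m \<in> FC (d + 1) k \<times> FD d k" .
  qed
  then obtain x y where "x \<in> FC d n" "y \<in> FD (d + 1) n" "?\<Theta> (x, y) = 0" by (auto simp: mem_Times_iff)
  then show ?thesis by (intro bexI[of _ x] bexI[of _ y]) (auto simp: zero_prod_def)
qed

text \<open>The cocycle \<open>(0, - y)\<close> of the cone.\<close>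

lemma lift_surj:
  assumes "cone_exact" "\<And>d x. x \<in> C d \<Longrightarrow> dC (d + 1) (dC d x) = 0" "\<And>d y. y \<in> D d \<Longrightarrow> dD (d + 1) (dD d y) = 0"
    "\<And>d x. x \<in> C d \<Longrightarrow> dD d (\<phi> d x) = \<phi> (d + 1) (dC d x)"
    and y: "y \<in> FD d n" "dD d y = 0"
  shows "\<exists>x\<in>FC d n. \<exists>z\<in>FD (d + 1) n. dC d x = 0 \<and> \<phi> d x - y = dD (d + 1) z"
proof -
  have "dC (d + 1) 0 = 0" "\<phi> (d + 1) 0 = 0"
    using dC_add[of 0 "d + 1" 0] \<phi>_add[of 0 "d + 1" 0] C.zero_M by simp_all
  then obtain x z where x: "x \<in> FC d n" "z \<in> FD (d + 1) n" "dC d x = 0" "dD (d + 1) z - \<phi> d x = - y"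
    using cone_lift[OF assms(1-4), of 0 d n "- y"] y dD_uminus[OF D.F_sub_M[OF y(1)]] C.zero_F D.uminus_F by auto
  from x(4) have "\<phi> d x - y = dD (d + 1) z" by (simp add: algebra_simps)
  then show ?thesis using x by blast
qed

text \<open>The cocycle \<open>(x, - z)\<close> of the cone, with degrees read modulo 2.\<close>

lemma lift_inj:
  assumes "cone_exact" "\<And>d x. x \<in> C d \<Longrightarrow> dC (d + 1) (dC d x) = 0" "\<And>d y. y \<in> D d \<Longrightarrow> dD (d + 1) (dD d y) = 0"
    "\<And>d x. x \<in> C d \<Longrightarrow> dD d (\<phi> d x) = \<phi> (d + 1) (dC d x)"
    and x: "x \<in> FC d n" "dC d x = 0" "z \<in> FD (d + 1) n" "\<phi> d x = dD (d + 1) z"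
  shows "\<exists>w\<in>FC (d + 1) n. x = dC (d + 1) w"
proof -
  have d2: "d + 1 + 1 = d" by (cases d) simp_all
  have "\<phi> d x + dD (d + 1) (- z) = 0" using x(4) dD_uminus[OF D.F_sub_M[OF x(3)]] by simp
  then show ?thesis
    using cone_lift[OF assms(1-4), of x "d + 1" n "- z"] x D.uminus_F[OF x(3)] unfolding d2 by metis
qed

end

section \<open>Bounding cochains and their images\<close>

lemma unmark_Nil_realize: "unmark P = [] \<Longrightarrow> realize U P = replicate (length P) (1, snd U, fst U)"
  by (induction P rule: unmark.induct) auto

lemma filt_chain_replicate:
  "X \<in> obj A \<Longrightarrow> a \<in> fil A X X 1 1 \<Longrightarrow> filt_chain A X (replicate j (1, a, X)) (int j)"
  by (induction j) (auto intro!: exI[of _ 1])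

lemma tgt_replicate [simp]: "tgt X (replicate j (d, a, X)) = X"
  by (induction j) auto

lemma red_deg_replicate [simp]: "red_deg (replicate j (1, a, X)) = 0"
  by (induction j) auto

context filtered_op
begin

text \<open>Telescoping: each term has one \<open>a'\<close> and \<open>j - 1\<close> entries of level \<open>1\<close>.\<close>

lemma op_replicate_diff:
  assumes X: "Y \<in> obj A" and a: "a \<in> fil A Y Y 1 1" and a': "a' \<in> fil A Y Y 1 k" "1 \<le> k"
    and p: "filt_chain A X p lp" "tgt X p = Y" and r: "filt_chain A Y r lr"
  shows "op X (p @ replicate j (1, a + a', Y) @ r) - op X (p @ replicate j (1, a, Y) @ r)
    \<in> T X (tgt Y r) (deg_out n (p @ r)) (lp + (k + int j - 1) + lr)"
  using p
proof (induction j arbitrary: p lp)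
  case 0
  have "complete_group (TM X (tgt Y r) (deg_out n (p @ r))) (T X (tgt Y r) (deg_out n (p @ r)))"
    using T_complete filt_chain_source[OF 0(1)] filt_chain_tgt[OF r] by blast
  then show ?case using complete_group.zero_F by simp blast
next
  case (Suc j)
  let ?E = "T X (tgt Y r) (deg_out n (p @ r))"
  interpret c: complete_group "TM X (tgt Y r) (deg_out n (p @ r))" ?E
    using T_complete filt_chain_source[OF Suc.prems(1)] filt_chain_tgt[OF r] by blast
  have a1: "a' \<in> fil A Y Y 1 1" using src.fil_mono[OF X X a'] by simp
  have aa: "a + a' \<in> fil A Y Y 1 1" using src.fil_add[OF X X a a1] .
  let ?t = "replicate j (1, a + a', Y) @ r"
  have t: "filt_chain A Y ?t (int j + lr)"
    using filt_chain_append[OF filt_chain_replicate[OF X aa]] r by simp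
  have ch: "filt_chain A X (p @ (1, c, Y) # ?t) (lp + (k' + (int j + lr)))" if "c \<in> fil A Y Y 1 k'" for c k'
    using filt_chain_append[OF Suc.prems(1)] filt_chain_Cons[OF X that t] Suc.prems(2) by simp
  have split: "op X (p @ (1, a + a', Y) # ?t) = op X (p @ (1, a, Y) # ?t) + op X (p @ (1, a', Y) # ?t)"
    using op_add src.filt_chain_is_chain[OF ch[OF a]] src.filt_chain_is_chain[OF ch[OF a1]] by blast
  have tg: "tgt X (p @ (1, a', Y) # ?t) = tgt Y r" by simp
  have "op X (p @ (1, a', Y) # ?t) \<in> ?E (lp + (k + (int j + lr)))"
    using op_filt_chain[OF ch[OF a'(1)]] unfolding tg by (simp add: deg_out_red_deg)
  moreover have "filt_chain A X (p @ [(1, a, Y)]) (lp + 1)"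
    using filt_chain_append[OF Suc.prems(1), of "[(1, a, Y)]" 1] filt_chain_single[OF X X a] unfolding Suc.prems(2) .
  then have "op X ((p @ [(1, a, Y)]) @ ?t) - op X ((p @ [(1, a, Y)]) @ replicate j (1, a, Y) @ r)
      \<in> T X (tgt Y r) (deg_out n ((p @ [(1, a, Y)]) @ r)) (lp + 1 + (k + int j - 1) + lr)"
    by (rule Suc.IH) simp
  then have "op X (p @ (1, a, Y) # ?t) - op X (p @ (1, a, Y) # replicate j (1, a, Y) @ r) \<in> ?E (lp + (k + (int j + lr)))"
    by (simp add: deg_out_red_deg algebra_simps)
  ultimately have "op X (p @ (1, a', Y) # ?t) + (op X (p @ (1, a, Y) # ?t) - op X (p @ (1, a, Y) # replicate j (1, a, Y) @ r))
      \<in> ?E (lp + (k + (int j + lr)))" by (rule c.add_F)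
  then show ?case using split by (simp add: algebra_simps)
qed

text \<open>The list with one mark gives the linear term exactly, the list without marks does not
  involve \<open>a\<close>, and a list of \<open>j\<close> marks gains \<open>j - 1\<close> beyond
  the level of \<open>a'\<close> by telescoping, which suffices from \<open>j = 2\<close>
  on.\<close>

lemma twist_op_curvature_variation:
  assumes X: "X \<in> obj A" and a: "a \<in> fil A X X 1 1" and a': "a' \<in> fil A X X 1 k" "1 \<le> k"
  shows "twist_op (X, a + a') [] - twist_op (X, a) [] - op X [(1, a', X)] \<in> T X X (of_int n) (k + 1)"
proof -
  let ?E = "T X X (of_int n)"
  interpret c: complete_group "TM X X (of_int n)" ?E using T_complete[OF X X] .
  have a1: "a' \<in> fil A X X 1 1" using src.fil_mono[OF X X a'] by simp
  have aa: "a + a' \<in> fil A X X 1 1" using src.fil_add[OF X X a a1] .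
  have U: "filt_chain (twist A) (X, a) [] 0" "filt_chain (twist A) (X, a + a') [] 0" using X a aa by auto
  let ?f = "\<lambda>ms. op X (realize (X, a + a') ms) - op X (realize (X, a) ms)"
  have hs: "filt_has_sum ?E ?f {ms. unmark ms = []} (twist_op (X, a + a') [] - twist_op (X, a) [])"
    using c.filt_has_sum_diff[of _ "{ms. unmark ms = []}"] twist_op_sum[OF U(1)] twist_op_sum[OF U(2)]
    by (simp add: deg_out_red_deg)
  have small: "?f ms \<in> ?E (k + 1)" if ms: "ms \<in> {ms. unmark ms = []} - {[None]}" for ms
  proof (cases "length ms \<le> 1")
    case True
    then have "ms = []" using ms by (cases ms rule: unmark.cases) auto
    then show ?thesis by simp
  next
    case False
    have "?f ms \<in> ?E (k + int (length ms) - 1)"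
      using op_replicate_diff[OF X a a', of X "[]" 0 "[]" 0 "length ms"] X ms
      by (simp add: unmark_Nil_realize deg_out_red_deg)
    then show ?thesis using False c.F_mono[of _ "k + int (length ms) - 1" "k + 1"] by simp
  qed
  have ch: "is_chain (obj A) (mor A) X [(1, a, X)]" "is_chain (obj A) (mor A) X [(1, a', X)]"
    using X a a1 src.fil_sub_mor[OF X X] by auto
  have "?f [None] = op X [(1, a', X)]" using op_add[of X "[]" 1 a X "[]" a'] ch by simp
  with c.filt_has_sum_approx[OF hs, of "{[None]}" "k + 1", OF _ _ small] show ?thesis by simp
qed

text \<open>Without insertions before \<open>f\<close> the two terms cancel. Otherwise only a single
  insertion before \<open>f\<close>, with none after it, contributes to leading order: each
  additional one raises the level.\<close>

lemma twist_op_variation: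
  assumes X: "X \<in> obj A" and a: "a \<in> fil A X X 1 1" and a': "a' \<in> fil A X X 1 k" "1 \<le> k"
    and V: "V \<in> obj (twist A)" and f: "f \<in> fil A X (fst V) d l"
  shows "twist_op (X, a + a') [(d, f, V)] - twist_op (X, a) [(d, f, V)] - op X [(1, a', X), (d, f, fst V)]
    \<in> T X (fst V) (of_int n + d + 1) (k + l + 1)"
proof -
  let ?E = "T X (fst V) (of_int n + d + 1)"
  have Y: "fst V \<in> obj A" "snd V \<in> fil A (fst V) (fst V) 1 1" using V by auto
  interpret c: complete_group "TM X (fst V) (of_int n + d + 1)" ?E using T_complete[OF X Y(1)] .
  have a1: "a' \<in> fil A X X 1 1" using src.fil_mono[OF X X a'] by simp
  have aa: "a + a' \<in> fil A X X 1 1" using src.fil_add[OF X X a a1] .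
  have U: "filt_chain (twist A) (X, a) [(d, f, V)] l" "filt_chain (twist A) (X, a + a') [(d, f, V)] l"
    using filt_chain_single[of "(X, a)" "twist A" V f d l] filt_chain_single[of "(X, a + a')" "twist A" V f d l] X a aa V f
    by simp_all
  let ?I = "{P. unmark P = []} \<times> {R. unmark R = []}"
  let ?g = "\<lambda>a (P, R). op X (realize (X, a) P @ (d, f, fst V) # realize V R)"
  let ?f = "\<lambda>j. ?g (a + a') j - ?g a j"
  have hs: "filt_has_sum ?E ?f ?I (twist_op (X, a + a') [(d, f, V)] - twist_op (X, a) [(d, f, V)])"
    using c.filt_has_sum_diff[of _ ?I] twist_op_slot_sum[of "(X, a)" "[]" d f V "[]" l]
      twist_op_slot_sum[of "(X, a + a')" "[]" d f V "[]" l] U by (simp add: deg_out_red_deg add_ac)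
  have small: "?f j \<in> ?E (k + l + 1)" if j: "j \<in> ?I - {([None], [])}" for j
  proof -
    obtain P R where PR: "j = (P, R)" "unmark P = []" "unmark R = []" using j by (cases j) auto
    show ?thesis
    proof (cases "P = []")
      case True then show ?thesis using PR by simp
    next
      case False
      have "2 \<le> length P + length R"
        using j PR False by (cases P rule: unmark.cases; cases "tl P"; cases R) auto
      moreover have "filt_chain A X ((d, f, fst V) # replicate (length R) (1, snd V, fst V)) (l + int (length R))"
        using filt_chain_Cons[OF X f filt_chain_replicate[OF Y]] .
      from op_replicate_diff[OF X a a' _ _ this, of X "[]" 0 "length P"]
      have "?f j \<in> ?E (k + int (length P) - 1 + (l + int (length R)))"
        using PR X by (simp add: unmark_Nil_realize deg_out_red_deg add_ac)
      ultimately show ?thesis using c.F_mono[of "?f j" "k + int (length P) - 1 + (l + int (length R))" "k + l + 1"] by simp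
    qed
  qed
  have ch: "is_chain (obj A) (mor A) X [(1, a, X), (d, f, fst V)]" "is_chain (obj A) (mor A) X [(1, a', X), (d, f, fst V)]"
    using X a a1 f Y src.fil_sub_mor[OF X X] src.fil_sub_mor[OF X Y(1)] by auto
  have "?f ([None], []) = op X [(1, a', X), (d, f, fst V)]"
    using op_add[of X "[]" 1 a X "[(d, f, fst V)]" a'] ch by simp
  with c.filt_has_sum_approx[OF hs, of "{([None], [])}" "k + l + 1", OF _ _ small] show ?thesis by simp
qed

end

text \<open>Lists of marks only are determined by their length, which identifies the Maurer-Cartan
  sum with the twisted curvature.\<close>

lemma (in curved_filtered_ainf_category) maurer_cartan_iff:
  "maurer_cartan A X a \<longleftrightarrow> (X, a) \<in> obj (twist A) \<and> mu (bc_all A) (X, a) [] = 0"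
proof (cases "(X, a) \<in> obj (twist A)")
  case True
  then have U: "filt_chain (twist A) (X, a) [] 0" by simp
  interpret c: complete_group "mor A X X 0" "fil A X X 0" using complete_group_fil True by simp
  have bij: "bij_betw (\<lambda>k. replicate k None) UNIV {ms :: (bit \<times> 'm \<times> 'o \<times> 'm) option list. unmark ms = []}"
  proof (rule bij_betw_imageI)
    show "inj (\<lambda>k. replicate k (None :: (bit \<times> 'm \<times> 'o \<times> 'm) option))" by (rule injI) simp
    show "range (\<lambda>k. replicate k None) = {ms :: (bit \<times> 'm \<times> 'o \<times> 'm) option list. unmark ms = []}"
    proof (intro equalityI subsetI)
      fix ms :: "(bit \<times> 'm \<times> 'o \<times> 'm) option list" assume "ms \<in> {ms. unmark ms = []}"
      then have "ms = replicate (length ms) None" using unmark_Nil_iff[of ms] by blast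
      then show "ms \<in> range (\<lambda>k. replicate k None)" by (rule range_eqI)
    qed auto
  qed
  have "filt_has_sum (fil A X X 0) (\<lambda>ms. mu A X (realize (X, a) ms)) {ms. unmark ms = []} (mu (bc_all A) (X, a) [])"
    using mu.twist_op_sum[OF U] by (simp add: mu_twist deg_out_red_deg)
  then have "filt_has_sum (fil A X X 0) (\<lambda>k. mu A X (replicate k (1, a, X))) UNIV (mu (bc_all A) (X, a) [])"
    using filt_has_sum_reindex[OF bij, of _ "\<lambda>ms. mu A X (realize (X, a) ms)"] by (simp add: unmark_Nil_realize)
  then show ?thesis using True c.filt_has_sum_unique unfolding maurer_cartan_def by auto
qed (auto simp: maurer_cartan_def)

lemma restrict_obj_simps:
  "obj (A\<lparr>obj := S\<rparr>) = S" "mor (A\<lparr>obj := S\<rparr>) = mor A" "mu (A\<lparr>obj := S\<rparr>) = mu A"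
  for A :: "('o, 'm, 'z) ainf_scheme"
  by simp_all

text \<open>The set of objects is arbitrary so that the lemma covers all bounding cochains, the
  c-unital ones and the one-object algebras \<open>deformed\<close>.\<close>

lemma (in curved_filtered_ainf_category) uncurved_restrict:
  assumes S: "S \<subseteq> {(X, a). maurer_cartan A X a}"
  shows "uncurved_ainf_category scale ((bc_all A)\<lparr>obj := S\<rparr>)"
proof -
  interpret t: curved_filtered_ainf_category FK scale "twist A" by (rule twist_category)
  have sub: "S \<subseteq> obj (twist A)" using S maurer_cartan_iff by auto
  have m: "mor (bc_all A) = mor (twist A)" by (simp add: bc_all_def)
  have ch: "is_chain (obj (twist A)) (mor (twist A)) U cs" if "is_chain S (mor (bc_all A)) U cs" for U cs
    using is_chain_mono[OF that sub] unfolding m .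
  show ?thesis
  proof (unfold_locales, unfold restrict_obj_simps, goal_cases)
    case (1 U V d) then show ?case using t.mor_submodule[of U V d] sub unfolding m by blast
  next
    case (2 U cs) then show ?case using t.mu_degree[OF ch[OF 2]] unfolding m by simp
  next
    case 3
    then show ?case using t.mu_multilinear ch unfolding multilinear_def by (simp only: twist_simps(3)) blast
  next
    case (4 U cs) then show ?case using t.mu_ainf[OF ch[OF 4]] by simp
  next
    case (5 U) then show ?case using S maurer_cartan_iff by (cases U) auto
  qed
qed

section \<open>Images of bounding cochains\<close>

context curved_filtered_ainf_functor
begin

text \<open>The functor equation on the empty chain, whose only decomposition without empty blocks
  is the empty one. It computes the curvature of the image also for objects that are not bounding
  cochains.\<close>

lemma bc_curvature:
  assumes "U \<in> obj (twist A)"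
  shows "mu (bc_all B) (fobj (bc_functor B G) U) [] = op.twist_op U [(0, mu (bc_all A) U [], U)]"
proof -
  have U: "filt_chain (twist A) U [] 0" using assms by auto
  have "bs = []" if "concat bs = [] \<and> [] \<notin> set bs" for bs :: "('o \<times> 'm, bit, 'm) chain list"
    using that by (cases bs) auto
  then have "{bs :: ('o \<times> 'm, bit, 'm) chain list. concat bs = [] \<and> [] \<notin> set bs} = {[]}" by auto
  from bc_functor_ainf[OF U, unfolded this] show ?thesis
    by (simp add: sum_splits_simps koszul_sgn_bit deg_out_red_deg fmor_bc_functor)
qed

lemma bc_maurer_cartan:
  assumes "maurer_cartan A X a" shows "maurer_cartan B (fobj G X) (push_mc B G X a)"
proof -
  have U: "(X, a) \<in> obj (twist A)" "mu (bc_all A) (X, a) [] = 0" using assms dom.maurer_cartan_iff by auto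
  interpret t: curved_filtered_ainf_category FK scale "twist A" by (rule dom.twist_category)
  have ch: "is_chain (obj (twist A)) (mor (twist A)) (X, a) ([] @ (0, 0, (X, a)) # [])"
    using U t.mor_zero[OF U(1) U(1)] by simp
  have "op.twist_op (X, a) [(0, 0, (X, a))] = 0" using op.twist_op_add[OF ch ch] by simp
  then have "mu (bc_all B) (fobj (bc_functor B G) (X, a)) [] = 0" using bc_curvature[OF U(1)] U(2) by simp
  then show ?thesis using fobj_bc_twist[OF U(1)] cod.maurer_cartan_iff
    by (simp add: fobj_bc_functor push_mc_twist)
qed

text \<open>The sets of objects are left free: all bounding cochains serve to study units, the
  c-unital ones enter the final statement.\<close>

lemma uncurved_functor_restrict:
  assumes S: "S \<subseteq> {(X, a). maurer_cartan A X a}" and S': "S' \<subseteq> {(X, a). maurer_cartan B X a}"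
    and map: "\<And>U. U \<in> S \<Longrightarrow> fobj (bc_functor B G) U \<in> S'"
  shows "uncurved_ainf_functor scale ((bc_all A)\<lparr>obj := S\<rparr>) scale' ((bc_all B)\<lparr>obj := S'\<rparr>) (bc_functor B G)"
proof -
  interpret s: uncurved_ainf_category scale "(bc_all A)\<lparr>obj := S\<rparr>" by (rule dom.uncurved_restrict[OF S])
  interpret s': uncurved_ainf_category scale' "(bc_all B)\<lparr>obj := S'\<rparr>" by (rule cod.uncurved_restrict[OF S'])
  have sub: "S \<subseteq> obj (twist A)" using S dom.maurer_cartan_iff by auto
  have m: "mor (bc_all A) = mor (twist A)" by (simp add: bc_all_def)
  have m': "mor (bc_all B) = mor (twist B)" by (simp add: bc_all_def)
  have ch: "is_chain (obj (twist A)) (mor (twist A)) U cs" if "is_chain S (mor (bc_all A)) U cs" for U cs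
    using is_chain_mono[OF that sub] unfolding m .
  interpret t': curved_filtered_ainf_category FK scale' "twist B" by (rule cod.twist_category)
  show ?thesis
  proof (intro uncurved_ainf_functor.intro s.uncurved_ainf_category_axioms s'.uncurved_ainf_category_axioms
      uncurved_ainf_functor_axioms.intro, unfold restrict_obj_simps, goal_cases)
    case 1 then show ?case using map by simp
  next
    case (2 U cs)
    obtain l where l: "filt_chain (twist A) U cs l" using ch[OF 2] unfolding dom.twist_chain by blast
    show ?case using fmor_bc_filt_chain[OF l] t'.fil_sub_mor fobj_bc_twist
        filt_chain_source[OF l] filt_chain_tgt[OF l] unfolding m' by blast
  next
    case 3
    show ?case
    proof (rule multilinearI)
      fix U p d c c' V r
      assume "is_chain S (mor (bc_all A)) U (p @ (d, c, V) # r)" "is_chain S (mor (bc_all A)) U (p @ (d, c', V) # r)"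
      then show "fmor (bc_functor B G) U (p @ (d, c + c', V) # r) =
          fmor (bc_functor B G) U (p @ (d, c, V) # r) + fmor (bc_functor B G) U (p @ (d, c', V) # r)"
        using op.twist_op_add ch by (simp add: fmor_bc_functor)
    next
      fix U p d c V r k
      assume "is_chain S (mor (bc_all A)) U (p @ (d, c, V) # r)"
      then show "fmor (bc_functor B G) U (p @ (d, scale k c, V) # r) = scale' k (fmor (bc_functor B G) U (p @ (d, c, V) # r))"
        using op.twist_op_scale ch by (simp add: fmor_bc_functor)
    qed
  next
    case 4 then show ?case by (simp add: fmor_bc_functor)
  next
    case (5 U cs)
    obtain l where l: "filt_chain (twist A) U cs l" using ch[OF 5] unfolding dom.twist_chain by blast
    show ?case using bc_functor_ainf[OF l] by simp
  qed
qed

section \<open>Leading terms of the functor\<close>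

lemma apply_blocks_level:
  "filt_chain A X (concat bs) l \<Longrightarrow> filt_chain B (fobj G X) (apply_blocks G X bs) (l + int (empties bs))"
proof (induction bs arbitrary: X l)
  case Nil then show ?case using fobj by auto
next
  case (Cons b bs)
  then obtain l1 l2 where l: "filt_chain A X b l1" "filt_chain A (tgt X b) (concat bs) l2" "l = l1 + l2"
    by (auto elim: filt_chain_appendE)
  have o: "X \<in> obj A" "tgt X b \<in> obj A" using filt_chain_source[OF l(1)] filt_chain_source[OF l(2)] .
  let ?w = "if b = [] then 1 else 0 :: int"
  have "fmor G X b \<in> fil B (fobj G X) (fobj G (tgt X b)) (deg_out 1 b) (l1 + ?w)"
  proof (cases "b = []")
    case True
    then have "l1 \<le> 0" using l(1) by simp
    then show ?thesis
      using True complete_group.F_mono[OF op.T_complete[OF o(1,1)] curvature_filtered[OF o(1)], of "l1 + 1"]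
      by (simp add: deg_out_red_deg)
  next
    case False then show ?thesis using op.op_filt_chain[OF l(1)] by simp
  qed
  from filt_chain_Cons[OF fobj[OF o(1)] this Cons.IH[OF l(2)]] show ?case using l(3) by (auto simp: algebra_simps)
qed

text \<open>Terms with an empty block contain the curvature of \<open>G\<close>, which has level \<open>1\<close>, and drop out of the
  associated graded.\<close>

lemma fmor_ainf_approx:
  assumes cs: "filt_chain A X cs l"
  shows "(\<Sum>(p, q, r)\<in>{(p, q, r). p @ q @ r = cs}.
           koszul p (fmor G X (p @ (deg_out 2 q, mu A (tgt X p) q, tgt (tgt X p) q) # r))) -
      (\<Sum>bs\<in>{bs. concat bs = cs \<and> [] \<notin> set bs}. mu B (fobj G X) (apply_blocks G X bs))
    \<in> fil B (fobj G X) (fobj G (tgt X cs)) (deg_out 2 cs) (l + 1)"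
proof -
  interpret c: complete_group "mor B (fobj G X) (fobj G (tgt X cs)) (deg_out 2 cs)"
    "fil B (fobj G X) (fobj G (tgt X cs)) (deg_out 2 cs)"
    by (rule cod.complete_group_fil[OF fobj[OF filt_chain_source[OF cs]] fobj[OF filt_chain_tgt[OF cs]]])
  have e0: "{bs. concat bs = cs \<and> [] \<notin> set bs} \<subseteq> {bs. concat bs = cs \<and> empties bs \<le> 0}"
    by (auto simp: empties_def filter_empty_conv)
  show ?thesis
  proof (rule c.filt_has_sum_approx[OF fmor_ainf[OF dom.filt_chain_is_chain[OF cs]]])
    show "finite {bs. concat bs = cs \<and> [] \<notin> set bs}" using finite_subset[OF e0 finite_blocks] .
    fix bs assume bs: "bs \<in> {bs. concat bs = cs} - {bs. concat bs = cs \<and> [] \<notin> set bs}"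
    then have "1 \<le> empties bs" "concat bs = cs"
      by (auto simp: empties_def Suc_le_eq filter_empty_conv)
    then show "mu B (fobj G X) (apply_blocks G X bs) \<in> fil B (fobj G X) (fobj G (tgt X cs)) (deg_out 2 cs) (l + 1)"
      using cod.mu.op_filt_chain[OF apply_blocks_level[of X bs l]] cs c.F_mono[of _ "l + int (empties bs)" "l + 1"]
      by (simp add: deg_out_red_deg)
  qed auto
qed

definition G1 where "G1 X Y d x = fmor G X [(d, x, Y)]"

lemma fmor_fil: "filt_chain A X cs l \<Longrightarrow> tgt X cs = Y \<Longrightarrow> red_deg cs + 1 = d \<Longrightarrow> l' \<le> l \<Longrightarrow>
    fmor G X cs \<in> fil B (fobj G X) (fobj G Y) d l'"
  using op.op_filt_chain[OF filt_chain_mono] by (auto simp: deg_out_red_deg add.commute)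

lemma fmor2_fil: "X \<in> obj A \<Longrightarrow> Y \<in> obj A \<Longrightarrow> Z \<in> obj A \<Longrightarrow> x \<in> fil A X Y d l \<Longrightarrow> y \<in> fil A Y Z e l' \<Longrightarrow> n \<le> l + l' \<Longrightarrow>
    fmor G X [(d, x, Y), (e, y, Z)] \<in> fil B (fobj G X) (fobj G Z) (d + e + 1) n"
  by (rule fmor_fil[of _ _ "l + (l' + 0)"], intro filt_chain_Cons) (simp_all add: add_ac)

lemma fmor3_fil: "X \<in> obj A \<Longrightarrow> Y \<in> obj A \<Longrightarrow> Z \<in> obj A \<Longrightarrow> W \<in> obj A \<Longrightarrow>
    x \<in> fil A X Y d l \<Longrightarrow> y \<in> fil A Y Z e l' \<Longrightarrow> z \<in> fil A Z W f l'' \<Longrightarrow> n \<le> l + (l' + l'') \<Longrightarrow>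
    fmor G X [(d, x, Y), (e, y, Z), (f, z, W)] \<in> fil B (fobj G X) (fobj G W) (d + e + f) n"
  by (rule fmor_fil[of _ _ "l + (l' + (l'' + 0))"], intro filt_chain_Cons) (simp_all add: add_ac)

lemma G1_fil: "X \<in> obj A \<Longrightarrow> Y \<in> obj A \<Longrightarrow> x \<in> fil A X Y d l \<Longrightarrow> G1 X Y d x \<in> fil B (fobj G X) (fobj G Y) d l"
  unfolding G1_def by (rule fmor_fil[of _ _ "l + 0"], intro filt_chain_Cons) (simp_all add: add_ac)

lemma G1_add: "X \<in> obj A \<Longrightarrow> Y \<in> obj A \<Longrightarrow> x \<in> mor A X Y d \<Longrightarrow> y \<in> mor A X Y d \<Longrightarrow> G1 X Y d (x + y) = G1 X Y d x + G1 X Y d y"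
  using op.op_add[of X "[]" d x Y "[]" y] by (simp add: G1_def)

lemma G1_diff: "X \<in> obj A \<Longrightarrow> Y \<in> obj A \<Longrightarrow> x \<in> mor A X Y d \<Longrightarrow> y \<in> mor A X Y d \<Longrightarrow> G1 X Y d (x - y) = G1 X Y d x - G1 X Y d y"
  using G1_add[of X Y "x - y" d y] dom.mor_diff by (simp add: algebra_simps)

lemma G1_del:
  assumes o: "X \<in> obj A" "Y \<in> obj A" and x: "x \<in> fil A X Y d l"
  shows "del B (fobj G X) (fobj G Y) d (G1 X Y d x) - G1 X Y (d + 1) (del A X Y d x) \<in> fil B (fobj G X) (fobj G Y) (d + 1) (l + 1)"
proof -
  note o' = fobj[OF o(1)] fobj[OF o(2)]
  let ?E = "fil B (fobj G X) (fobj G Y) (d + 1) (l + 1)"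
  have ch: "filt_chain A X [(d, x, Y)] l" using filt_chain_single[OF o x] .
  let ?u = "fmor G X [(0, mu A X [], X), (d, x, Y)]" and ?v = "fmor G X [(d, x, Y), (0, mu A Y [], Y)]"
  have "?u \<in> ?E" "?v \<in> ?E"
    using fmor2_fil[OF o(1,1,2) dom.curvature_fil[OF o(1)] x, of "l + 1"]
      fmor2_fil[OF o(1,2,2) x dom.curvature_fil[OF o(2)], of "l + 1"] by simp_all
  then have uv: "?u - sgn_bit d ?v \<in> ?E" using cod.fil_diff[OF o'] cod.fil_sgn_bit[OF o'] by blast
  have "G1 X Y (d + 1) (del A X Y d x) + (?u - sgn_bit d ?v) - del B (fobj G X) (fobj G Y) d (G1 X Y d x) \<in> ?E"
    using fmor_ainf_approx[OF ch] by (simp add: blocks_single sum_splits_simps koszul_sgn_bit deg_out_red_deg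
      del_def G1_def algebra_simps)
  from cod.fil_diff[OF o' uv this] show ?thesis by (simp add: algebra_simps)
qed

text \<open>Modulo the next level only the two decompositions without empty blocks remain on the
  target side, while curvatures and differentials of the arguments drop out on the source side. The
  second component remains as a homotopy.\<close>

lemma G1_prd:
  assumes o: "X \<in> obj A" "Y \<in> obj A" "Z \<in> obj A" and x: "x \<in> fil A X Y d l" "del A X Y d x \<in> fil A X Y (d + 1) (l + 1)"
    and y: "y \<in> fil A Y Z e l'" "del A Y Z e y \<in> fil A Y Z (e + 1) (l' + 1)"
  shows "G1 X Z (d + e) (prd A X Y Z d e x y) -
      prd B (fobj G X) (fobj G Y) (fobj G Z) d e (G1 X Y d x) (G1 Y Z e y) -
      del B (fobj G X) (fobj G Z) (d + e + 1) (sgn_bit d (fmor G X [(d, x, Y), (e, y, Z)]))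
    \<in> fil B (fobj G X) (fobj G Z) (d + e) (l + l' + 1)"
proof -
  note o' = fobj[OF o(1)] fobj[OF o(2)] fobj[OF o(3)]
  let ?E = "fil B (fobj G X) (fobj G Z) (d + e) (l + l' + 1)"
  let ?F2 = "fmor G X [(d, x, Y), (e, y, Z)]"
  have ch: "filt_chain A X [(d, x, Y), (e, y, Z)] (l + l')"
    using filt_chain_Cons[OF o(1) x(1) filt_chain_single[OF o(2,3) y(1)]] .
  have F2: "?F2 \<in> fil B (fobj G X) (fobj G Z) (d + e + 1) (l + l')" using fmor2_fil[OF o x(1) y(1)] by simp
  have 1: "del B (fobj G X) (fobj G Z) (d + e + 1) (sgn_bit d ?F2) = sgn_bit d (mu B (fobj G X) [(d + e + 1, ?F2, fobj G Z)])"
    using cod.mu_sgn_bit[of "fobj G X" "[]" "d + e + 1" ?F2 "fobj G Z" "[]" d] cod.fil_sub_mor[OF o'(1,3) F2] o'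
    by (simp add: del_def)
  have xy: "mu A X [(d, x, Y), (e, y, Z)] \<in> mor A X Z (d + e)"
    using dom.mu2_fil[OF o x(1) y(1)] dom.fil_sub_mor[OF o(1,3)] by blast
  have 2: "G1 X Z (d + e) (prd A X Y Z d e x y) = sgn_bit d (G1 X Z (d + e) (mu A X [(d, x, Y), (e, y, Z)]))"
    using G1_diff[OF o(1,3) dom.mor_zero[OF o(1,3)] xy] G1_diff[OF o(1,3) xy xy] by (cases d) (simp_all add: prd_def)
  let ?w = "fmor G X [(d + 1, del A X Y d x, Y), (e, y, Z)] - sgn_bit d (fmor G X [(d, x, Y), (e + 1, del A Y Z e y, Z)]) +
    (fmor G X [(0, mu A X [], X), (d, x, Y), (e, y, Z)] - sgn_bit d (fmor G X [(d, x, Y), (0, mu A Y [], Y), (e, y, Z)]) +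
      sgn_bit (d + e) (fmor G X [(d, x, Y), (e, y, Z), (0, mu A Z [], Z)]))"
  have "fmor G X [(d + 1, del A X Y d x, Y), (e, y, Z)] \<in> ?E" "fmor G X [(d, x, Y), (e + 1, del A Y Z e y, Z)] \<in> ?E"
    "fmor G X [(0, mu A X [], X), (d, x, Y), (e, y, Z)] \<in> ?E" "fmor G X [(d, x, Y), (0, mu A Y [], Y), (e, y, Z)] \<in> ?E"
    "fmor G X [(d, x, Y), (e, y, Z), (0, mu A Z [], Z)] \<in> ?E"
    using fmor2_fil[OF o x(2) y(1), of "l + l' + 1"] fmor2_fil[OF o x(1) y(2), of "l + l' + 1"]
      fmor3_fil[OF o(1,1-3) dom.curvature_fil[OF o(1)] x(1) y(1), of "l + l' + 1"]
      fmor3_fil[OF o(1,2,2,3) x(1) dom.curvature_fil[OF o(2)] y(1), of "l + l' + 1"]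
      fmor3_fil[OF o(1,2,3,3) x(1) y(1) dom.curvature_fil[OF o(3)], of "l + l' + 1"] by (simp_all add: add_ac)
  then have w: "?w \<in> ?E" using o' by (intro cod.fil_add cod.fil_diff cod.fil_sgn_bit)
  have 3: "G1 X Z (d + e) (mu A X [(d, x, Y), (e, y, Z)]) + ?w -
      (mu B (fobj G X) [(d + e + 1, ?F2, fobj G Z)] + mu B (fobj G X) [(d, G1 X Y d x, fobj G Y), (e, G1 Y Z e y, fobj G Z)]) \<in> ?E"
    using fmor_ainf_approx[OF ch] by (simp add: blocks_pair sum_splits_simps koszul_sgn_bit deg_out_red_deg
      del_def G1_def algebra_simps)
  from cod.fil_sgn_bit[OF o'(1,3) cod.fil_diff[OF o'(1,3) 3 w], of d] show ?thesis
    unfolding 1 2 prd_def[of B] by (simp add: algebra_simps)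
qed

lemma presented_functor_Gr:
  "presented_functor (Gr A) (\<lambda>X Y g. fil A X Y (fst g) (snd g)) (\<lambda>X Y g. fil A X Y (fst g) (snd g + 1))
    (\<lambda>X Y g. gr_class A X Y (fst g) (snd g)) (\<lambda>X Y g. del A X Y (fst g)) (\<lambda>X Y Z g h. prd A X Y Z (fst g) (fst h))
    (Gr B) (\<lambda>X Y g. fil B X Y (fst g) (snd g)) (\<lambda>X Y g. fil B X Y (fst g) (snd g + 1))
    (\<lambda>X Y g. gr_class B X Y (fst g) (snd g)) (\<lambda>X Y g. del B X Y (fst g)) (\<lambda>X Y Z g h. prd B X Y Z (fst g) (fst h))
    (Gr_functor B G) (\<lambda>X Y g. G1 X Y (fst g))"
proof -
  interpret d: presented_ainf "Gr A" "\<lambda>X Y g. fil A X Y (fst g) (snd g)" "\<lambda>X Y g. fil A X Y (fst g) (snd g + 1)"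
    "\<lambda>X Y g. gr_class A X Y (fst g) (snd g)" "\<lambda>X Y g. del A X Y (fst g)" "\<lambda>X Y Z g h. prd A X Y Z (fst g) (fst h)"
    by (rule dom.presented_Gr)
  interpret c: presented_ainf "Gr B" "\<lambda>X Y g. fil B X Y (fst g) (snd g)" "\<lambda>X Y g. fil B X Y (fst g) (snd g + 1)"
    "\<lambda>X Y g. gr_class B X Y (fst g) (snd g)" "\<lambda>X Y g. del B X Y (fst g)" "\<lambda>X Y Z g h. prd B X Y Z (fst g) (fst h)"
    by (rule cod.presented_Gr)
  have obA: "gobj (Gr A) = obj A" and obB: "gobj (Gr B) = obj B" and fo: "fobj (Gr_functor B G) = fobj G"
    by (simp_all add: Gr_def Gr_functor_def)
  have dg: "deg1 = (1 :: bit, 0 :: int)" by (simp add: deg1_prod_def deg1_bit_def)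
  show ?thesis
  proof (intro presented_functor.intro d.presented_ainf_axioms c.presented_ainf_axioms presented_functor_axioms.intro,
      unfold obA obB fo, goal_cases)
    case 1 then show ?case by (rule fobj)
  next
    case (2 X Y x g)
    obtain dd l where g: "g = (dd, l)" by (cases g)
    have x: "x \<in> fil A X Y dd l" using 2 g by simp
    obtain x' where x': "x' \<in> fil A X Y dd l" "x' - x \<in> fil A X Y dd (l + 1)" "(SOME u. u \<in> gr_class A X Y dd l x) = x'"
      using dom.gr_class_some[OF 2(1,2) x] .
    have "G1 X Y dd x' - G1 X Y dd x \<in> fil B (fobj G X) (fobj G Y) dd (l + 1)"
      using G1_fil[OF 2(1,2) x'(2)] G1_diff[OF 2(1,2) dom.fil_sub_mor[OF 2(1,2) x'(1)] dom.fil_sub_mor[OF 2(1,2) x]] by simp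
    then have "gr_class B (fobj G X) (fobj G Y) dd l (G1 X Y dd x') = gr_class B (fobj G X) (fobj G Y) dd l (G1 X Y dd x)"
      using cod.gr_class_eq fobj 2 by simp
    then show ?case
      by (simp add: g Gr_functor_def Let_def representatives_def forget_level_def level_def x'(3) G1_def deg_out_red_deg)
  next
    case 3 then show ?case by (simp add: G1_fil)
  next
    case 4 then show ?case by (simp add: G1_fil)
  next
    case 5 then show ?case using dom.fil_sub_mor G1_add by simp
  next
    case (6 X Y x g) then show ?case using G1_del[of X Y x "fst g" "snd g"] by (simp add: dg)
  next
    case (7 X Y Z x g y h)
    then have x: "x \<in> fil A X Y (fst g) (snd g)" "del A X Y (fst g) x \<in> fil A X Y (fst g + 1) (snd g + 1)"
      and y: "y \<in> fil A Y Z (fst h) (snd h)" "del A Y Z (fst h) y \<in> fil A Y Z (fst h + 1) (snd h + 1)"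
      by (simp_all add: d.Cyc_def dg)
    note o = 7(1-3)
    note o' = fobj[OF o(1)] fobj[OF o(2)] fobj[OF o(3)]
    let ?z = "sgn_bit (fst g) (fmor G X [(fst g, x, Y), (fst h, y, Z)])"
    have z: "?z \<in> fil B (fobj G X) (fobj G Z) (fst g + fst h + 1) (snd g + snd h)"
      using cod.fil_sgn_bit[OF o'(1,3) fmor2_fil[OF o x(1) y(1)]] by simp
    have "G1 X Z (fst g + fst h) (prd A X Y Z (fst g) (fst h) x y) -
        prd B (fobj G X) (fobj G Y) (fobj G Z) (fst g) (fst h) (G1 X Y (fst g) x) (G1 Y Z (fst h) y)
      \<in> fil B (fobj G X) (fobj G Z) (fst g + fst h) (snd g + snd h)"
      using cod.fil_diff[OF o'(1,3) G1_fil[OF o(1,3) dom.prd_fil[OF o x(1) y(1) order.refl]]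
        cod.prd_fil[OF o' G1_fil[OF o(1,2) x(1)] G1_fil[OF o(2,3) y(1)] order.refl]] .
    then show ?case using G1_prd[OF o x y] z by (auto simp: c.Bdy_def dg intro!: bexI[of _ ?z])
  qed
qed

end

section \<open>Composition with isomorphisms of the associated graded\<close>

lemma filtered_mapI_F:
  assumes "\<And>d. complete_group (C d) (FC d)" "\<And>d. complete_group (D d) (FD d)"
    and "\<And>d x y. x \<in> C d \<Longrightarrow> y \<in> C d \<Longrightarrow> dC d (x + y) = dC d x + dC d y"
    and "\<And>d u v. u \<in> D d \<Longrightarrow> v \<in> D d \<Longrightarrow> dD d (u + v) = dD d u + dD d v"
    and "\<And>d x y. x \<in> C d \<Longrightarrow> y \<in> C d \<Longrightarrow> \<phi> d (x + y) = \<phi> d x + \<phi> d y"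
    and "\<And>d l x. x \<in> FC d l \<Longrightarrow> dC d x \<in> FC (d + 1) l"
    and "\<And>d l u. u \<in> FD d l \<Longrightarrow> dD d u \<in> FD (d + 1) l"
    and "\<And>d l x. x \<in> FC d l \<Longrightarrow> \<phi> d x \<in> FD d l"
  shows "filtered_map C FC dC D FD dD \<phi>"
  using assms by unfold_locales (auto simp: complete_group_def)

context curved_filtered_ainf_category
begin

sublocale gr: presented_ainf "Gr A" "\<lambda>X Y g. fil A X Y (fst g) (snd g)" "\<lambda>X Y g. fil A X Y (fst g) (snd g + 1)"
    "\<lambda>X Y g. gr_class A X Y (fst g) (snd g)" "\<lambda>X Y g. del A X Y (fst g)" "\<lambda>X Y Z g h. prd A X Y Z (fst g) (fst h)"
  by (rule presented_Gr)

lemma gobj_Gr [simp]: "gobj (Gr A) = obj A" by (simp add: Gr_def)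

lemma gr_Cyc_iff: "x \<in> gr.Cyc X Y g \<longleftrightarrow> x \<in> fil A X Y (fst g) (snd g) \<and>
    del A X Y (fst g) x \<in> fil A X Y (fst g + 1) (snd g + 1)"
  by (simp add: gr.Cyc_def deg1_prod_def deg1_bit_def)

lemma gr_Bdy_iff: "x \<in> gr.Bdy X Y g \<longleftrightarrow> x \<in> fil A X Y (fst g) (snd g) \<and>
    (\<exists>z\<in>fil A X Y (fst g + 1) (snd g). x - del A X Y (fst g + 1) z \<in> fil A X Y (fst g) (snd g + 1))"
  by (simp add: gr.Bdy_def deg1_prod_def deg1_bit_def)

text \<open>A representative of an isomorphism of degree \<open>(0, 0)\<close> in the cohomology of
  \<open>Gr A\<close>.\<close>

definition gr_iso :: "'o \<Rightarrow> 'o \<Rightarrow> 'm \<Rightarrow> bool" where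
  "gr_iso X Y f \<longleftrightarrow> f \<in> gr.Cyc X Y 0 \<and>
     (\<exists>f'\<in>gr.Cyc Y X 0. gr.unit_cocycle X (prd A X Y X 0 0 f f') \<and> gr.unit_cocycle Y (prd A Y X Y 0 0 f' f))"

lemma gr_iso_fil: "gr_iso X Y f \<Longrightarrow> f \<in> fil A X Y 0 0"
  by (simp add: gr_iso_def gr_Cyc_iff)

lemma gr_unit_unique:
  assumes "X \<in> obj A" "gr.unit_cocycle X e" "gr.unit_cocycle X e'" shows "e - e' \<in> gr.Bdy X X 0"
proof -
  have C: "e \<in> gr.Cyc X X 0" "e' \<in> gr.Cyc X X 0" using assms by (simp_all add: gr.unit_cocycle_def)
  have "prd A X X X 0 0 e e' - e' \<in> gr.Bdy X X 0" "prd A X X X 0 0 e e' - e \<in> gr.Bdy X X 0"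
    using gr.unit_cocycleD(1)[OF assms(2), of X e' 0] gr.unit_cocycleD(2)[OF assms(3), of X e 0] assms(1) C by simp_all
  then show ?thesis using gr.Bdy_diff[of X X "prd A X X X 0 0 e e' - e'" 0 "prd A X X X 0 0 e e' - e"] assms(1) by simp
qed

lemma gr_unit_iso: assumes "X \<in> obj A" "gr.unit_cocycle X e" shows "gr_iso X X e"
proof -
  have C: "e \<in> gr.Cyc X X 0" using assms by (simp add: gr.unit_cocycle_def)
  have "prd A X X X 0 0 e e - e \<in> gr.Bdy X X 0"
    using gr.unit_cocycleD(1)[OF assms(2), of X e 0] assms(1) C by simp
  moreover have "prd A X X X 0 0 e e \<in> gr.Cyc X X 0" using gr.m2_Cyc[of X X X e 0 e 0] C assms(1) by simp
  ultimately have "gr.unit_cocycle X (prd A X X X 0 0 e e)" using gr.unit_cocycle_cong[of X e] assms by simp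
  then show ?thesis using C unfolding gr_iso_def by blast
qed

text \<open>Differences of level 1 vanish in the graded piece of level 0. This carries invertibility
  from an approximate solution to the exact one.\<close>

lemma gr_iso_cong:
  assumes o: "X \<in> obj A" "Y \<in> obj A" and f: "gr_iso X Y f" and g: "g \<in> fil A X Y 0 0" "g - f \<in> fil A X Y 0 1"
  shows "gr_iso X Y g"
proof -
  obtain f' where f': "f' \<in> gr.Cyc Y X 0" "gr.unit_cocycle X (prd A X Y X 0 0 f f')"
    "gr.unit_cocycle Y (prd A Y X Y 0 0 f' f)" and fC: "f \<in> gr.Cyc X Y 0" using f unfolding gr_iso_def by blast
  have gf: "g - f \<in> gr.Bdy X Y 0" using gr.N_Bdy[of X Y "g - f" 0] o g by simp
  have "g - f \<in> gr.Cyc X Y 0" using gr.Bdy_Cyc[of X Y "g - f" 0] o gf by simp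
  then have gC: "g \<in> gr.Cyc X Y 0"
    using gr.Cyc_diff[of X Y "g - f" 0 "0 - f"] gr.Cyc_diff[of X Y 0 0 f] gr.Cyc_diff[of X Y f 0 f] fC o by simp
  have z: "f' - f' \<in> gr.Bdy Y X 0" using gr.Bdy_zero[of Y X 0] o by simp
  have "gr.unit_cocycle X (prd A X Y X 0 0 g f')"
    using gr.unit_cocycle_cong[of X "prd A X Y X 0 0 f f'" "prd A X Y X 0 0 g f'"] f'(2)
      gr.m2_Cyc[of X Y X g 0 f' 0] gr.m2_cong[of X Y X f 0 g f' 0 f'] o gC fC gf f'(1) z by simp
  moreover have "gr.unit_cocycle Y (prd A Y X Y 0 0 f' g)"
    using gr.unit_cocycle_cong[of Y "prd A Y X Y 0 0 f' f" "prd A Y X Y 0 0 f' g"] f'(3)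
      gr.m2_Cyc[of Y X Y f' 0 g 0] gr.m2_cong[of Y X Y f' 0 f' f 0 g] o gC fC gf f'(1) z by simp
  ultimately show ?thesis using gC f'(1) unfolding gr_iso_def by blast
qed

lemma filtered_map_post:
  assumes o: "X \<in> obj A" "Y \<in> obj A" "Z \<in> obj A" and f: "f \<in> fil A Y Z 0 0"
  shows "filtered_map (mor A X Y) (fil A X Y) (del A X Y) (mor A X Z) (fil A X Z) (del A X Z) (\<lambda>d x. prd A X Y Z d 0 x f)"
proof (rule filtered_mapI_F)
  show "prd A X Y Z d 0 x f \<in> fil A X Z d l" if "x \<in> fil A X Y d l" for d l x
    using prd_fil[OF o that f, of l] by simp
qed (use o f fil_sub_mor[OF o(2,3) f] in \<open>simp_all add: complete_group_fil del_add prd_add_left del_fil\<close>)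

lemma filtered_map_pre:
  assumes o: "X \<in> obj A" "Y \<in> obj A" "Z \<in> obj A" and f: "f \<in> fil A X Y 0 0"
  shows "filtered_map (mor A Y Z) (fil A Y Z) (del A Y Z) (mor A X Z) (fil A X Z) (del A X Z) (\<lambda>d x. prd A X Y Z 0 d f x)"
proof (rule filtered_mapI_F)
  show "prd A X Y Z 0 d f x \<in> fil A X Z d l" if "x \<in> fil A Y Z d l" for d l x
    using prd_fil[OF o f that, of l] by simp
qed (use o f fil_sub_mor[OF o(1,2) f] in \<open>simp_all add: complete_group_fil del_add prd_add_right del_fil\<close>)

lemma del_prd_post:
  assumes o: "X \<in> obj A" "Y \<in> obj A" "Z \<in> obj A" and f: "f \<in> gr.Cyc Y Z 0" and x: "x \<in> fil A X Y d n"
  shows "del A X Z d (prd A X Y Z d 0 x f) - prd A X Y Z (d + 1) 0 (del A X Y d x) f \<in> fil A X Z (d + 1) (n + 1)"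
proof -
  have f0: "f \<in> fil A Y Z 0 0" and df: "del A Y Z 0 f \<in> fil A Y Z 1 1" using f by (simp_all add: gr_Cyc_iff)
  have p: "prd A X Y Z d 1 x (del A Y Z 0 f) \<in> fil A X Z (d + 1) (n + 1)"
    using prd_fil[OF o x df, of "n + 1"] by simp
  have "del A X Z d (prd A X Y Z d 0 x f) - (prd A X Y Z (d + 1) 0 (del A X Y d x) f +
      sgn_bit d (prd A X Y Z d 1 x (del A Y Z 0 f))) \<in> fil A X Z (d + 1) (n + 1)"
    using del_prd_fil[OF o x f0] by simp
  from fil_add[OF o(1,3) this fil_sgn_bit[OF o(1,3) p, of d]] show ?thesis by simp
qed

text \<open>Cancellation of \<open>f\<close> in the cohomology of the associated graded, applied in
  every degree and level.\<close>

lemma cone_exact_post: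
  assumes o: "X \<in> obj A" "Y \<in> obj A" "Z \<in> obj A" and f: "gr_iso Y Z f"
  shows "filtered_map.cone_exact (fil A X Y) (del A X Y) (fil A X Z) (del A X Z) (\<lambda>d x. prd A X Y Z d 0 x f)"
proof -
  interpret fm: filtered_map "mor A X Y" "fil A X Y" "del A X Y" "mor A X Z" "fil A X Z" "del A X Z" "\<lambda>d x. prd A X Y Z d 0 x f"
    by (rule filtered_map_post[OF o gr_iso_fil[OF f]])
  obtain f' where f': "f \<in> gr.Cyc Y Z 0" "f' \<in> gr.Cyc Z Y 0" "gr.unit_cocycle Y (prd A Y Z Y 0 0 f f')"
    "gr.unit_cocycle Z (prd A Z Y Z 0 0 f' f)" using f unfolding gr_iso_def by blast
  note g = gr_iso_fil[OF f]
  show ?thesis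
  proof (rule fm.cone_exactI)
    fix d n x z assume x: "x \<in> fil A X Y (d + 1) n" "del A X Y (d + 1) x \<in> fil A X Y d (n + 1)"
      and z: "z \<in> fil A X Z d n" "prd A X Y Z (d + 1) 0 x f - del A X Z d z \<in> fil A X Z (d + 1) (n + 1)"
    have "prd A X Y Z (d + 1) 0 x f \<in> fil A X Z (d + 1) n" using prd_fil[OF o x(1) g, of n] by simp
    then have "prd A X Y Z (d + 1) 0 x f \<in> gr.Bdy X Z (d + 1, n)" using z by (auto simp: gr_Bdy_iff add.assoc)
    moreover have "x \<in> gr.Cyc X Y (d + 1, n)" using x by (simp add: gr_Cyc_iff add.assoc)
    ultimately have "x \<in> gr.Bdy X Y (d + 1, n)"
      using gr.iso_post_inj[of X Y Z f f' x "(d + 1, n)"] f' o by simp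
    then show "\<exists>w\<in>fil A X Y d n. x - del A X Y d w \<in> fil A X Y (d + 1) (n + 1)" by (simp add: gr_Bdy_iff add.assoc)
  next
    fix d n y assume "y \<in> fil A X Z d n" "del A X Z d y \<in> fil A X Z (d + 1) (n + 1)"
    then have "y \<in> gr.Cyc X Z (d, n)" by (simp add: gr_Cyc_iff)
    then obtain x where "x \<in> gr.Cyc X Y (d, n)" "prd A X Y Z d 0 x f - y \<in> gr.Bdy X Z (d, n)"
      using gr.iso_post_surj[of X Y Z f f' y "(d, n)"] f' o by auto
    then show "\<exists>x\<in>fil A X Y d n. \<exists>z\<in>fil A X Z (d + 1) n. del A X Y d x \<in> fil A X Y (d + 1) (n + 1) \<and>
        prd A X Y Z d 0 x f - y - del A X Z (d + 1) z \<in> fil A X Z d (n + 1)"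
      by (auto simp: gr_Cyc_iff gr_Bdy_iff)
  next
    fix d n x assume "x \<in> fil A X Y d n"
    then show "del A X Z d (prd A X Y Z d 0 x f) - prd A X Y Z (d + 1) 0 (del A X Y d x) f \<in> fil A X Z (d + 1) (n + 1)"
      by (rule del_prd_post[OF o f'(1)])
  qed
qed

lemma cone_exact_pre:
  assumes o: "X \<in> obj A" "Y \<in> obj A" "Z \<in> obj A" and f: "gr_iso X Y f"
  shows "filtered_map.cone_exact (fil A Y Z) (del A Y Z) (fil A X Z) (del A X Z) (\<lambda>d x. prd A X Y Z 0 d f x)"
proof -
  interpret fm: filtered_map "mor A Y Z" "fil A Y Z" "del A Y Z" "mor A X Z" "fil A X Z" "del A X Z" "\<lambda>d x. prd A X Y Z 0 d f x"
    by (rule filtered_map_pre[OF o gr_iso_fil[OF f]])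
  obtain f' where f': "f \<in> gr.Cyc X Y 0" "f' \<in> gr.Cyc Y X 0" "gr.unit_cocycle X (prd A X Y X 0 0 f f')"
    "gr.unit_cocycle Y (prd A Y X Y 0 0 f' f)" using f unfolding gr_iso_def by blast
  note g = gr_iso_fil[OF f]
  show ?thesis
  proof (rule fm.cone_exactI)
    fix d n x z assume x: "x \<in> fil A Y Z (d + 1) n" "del A Y Z (d + 1) x \<in> fil A Y Z d (n + 1)"
      and z: "z \<in> fil A X Z d n" "prd A X Y Z 0 (d + 1) f x - del A X Z d z \<in> fil A X Z (d + 1) (n + 1)"
    have "prd A X Y Z 0 (d + 1) f x \<in> fil A X Z (d + 1) n" using prd_fil[OF o g x(1), of n] by simp
    then have "prd A X Y Z 0 (d + 1) f x \<in> gr.Bdy X Z (d + 1, n)" using z by (auto simp: gr_Bdy_iff add.assoc)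
    moreover have "x \<in> gr.Cyc Y Z (d + 1, n)" using x by (simp add: gr_Cyc_iff add.assoc)
    ultimately have "x \<in> gr.Bdy Y Z (d + 1, n)"
      using gr.iso_pre_inj[of Z X Y f f' x "(d + 1, n)"] f' o by simp
    then show "\<exists>w\<in>fil A Y Z d n. x - del A Y Z d w \<in> fil A Y Z (d + 1) (n + 1)" by (simp add: gr_Bdy_iff add.assoc)
  next
    fix d n y assume "y \<in> fil A X Z d n" "del A X Z d y \<in> fil A X Z (d + 1) (n + 1)"
    then have "y \<in> gr.Cyc X Z (d, n)" by (simp add: gr_Cyc_iff)
    then obtain x where "x \<in> gr.Cyc Y Z (d, n)" "prd A X Y Z 0 d f x - y \<in> gr.Bdy X Z (d, n)"
      using gr.iso_pre_surj[of Z X Y f f' y "(d, n)"] f' o by auto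
    then show "\<exists>x\<in>fil A Y Z d n. \<exists>z\<in>fil A X Z (d + 1) n. del A Y Z d x \<in> fil A Y Z (d + 1) (n + 1) \<and>
        prd A X Y Z 0 d f x - y - del A X Z (d + 1) z \<in> fil A X Z d (n + 1)"
      by (auto simp: gr_Cyc_iff gr_Bdy_iff)
  next
    fix d n x assume x: "x \<in> fil A Y Z d n"
    have df: "del A X Y 0 f \<in> fil A X Y 1 1" using f'(1) by (simp add: gr_Cyc_iff)
    have p: "prd A X Y Z 1 d (del A X Y 0 f) x \<in> fil A X Z (d + 1) (n + 1)"
      using prd_fil[OF o df x, of "n + 1"] by (simp add: add.commute)
    have "del A X Z d (prd A X Y Z 0 d f x) - (prd A X Y Z 1 d (del A X Y 0 f) x +
        prd A X Y Z 0 (d + 1) f (del A Y Z d x)) \<in> fil A X Z (d + 1) (n + 1)"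
      using del_prd_fil[OF o g x] by simp
    from fil_add[OF o(1,3) this p]
    show "del A X Z d (prd A X Y Z 0 d f x) - prd A X Y Z 0 (d + 1) f (del A Y Z d x) \<in> fil A X Z (d + 1) (n + 1)"
      by (simp add: algebra_simps)
  qed
qed

lemma twist_del_approx:
  assumes "U \<in> obj (twist A)" "V \<in> obj (twist A)" "x \<in> fil A (fst U) (fst V) d n"
  shows "del (twist A) U V d x - del A (fst U) (fst V) d x \<in> fil A (fst U) (fst V) (d + 1) (n + 1)"
proof -
  have "filt_chain (twist A) U [(d, x, V)] n" using filt_chain_single[of U "twist A" V x d n] assms by simp
  from mu.twist_op_approx[OF this] show ?thesis by (simp add: del_def mu_twist deg_out_red_deg)
qed

lemma twist_prd_approx:
  assumes "U \<in> obj (twist A)" "V \<in> obj (twist A)" "W \<in> obj (twist A)" "x \<in> fil A (fst U) (fst V) d n" "y \<in> fil A (fst V) (fst W) e k"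
  shows "prd (twist A) U V W d e x y - prd A (fst U) (fst V) (fst W) d e x y \<in> fil A (fst U) (fst W) (d + e) (n + k + 1)"
proof -
  have "filt_chain (twist A) U [(d, x, V), (e, y, W)] (n + k)"
    using filt_chain_Cons[of U "twist A" x V d n "[(e, y, W)]" k] filt_chain_single[of V "twist A" W y e k] assms by simp
  from mu.twist_op_approx[OF this]
  have "mu (bc_all A) U [(d, x, V), (e, y, W)] - mu A (fst U) [(d, x, fst V), (e, y, fst W)] \<in> fil A (fst U) (fst W) (d + e) (n + k + 1)"
    by (simp add: mu_twist deg_out_red_deg add_ac)
  from fil_sgn_bit[OF _ _ this, of d] show ?thesis using assms(1,3) by (auto simp: prd_def)
qed

section \<open>Cohomology of bounding cochains\<close>

abbreviation MC where "MC \<equiv> {(X, a). maurer_cartan A X a}"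

lemma MC_twist: "U \<in> MC \<Longrightarrow> U \<in> obj (twist A)" using maurer_cartan_iff by auto

lemma MC_fst: "U \<in> MC \<Longrightarrow> fst U \<in> obj A" using MC_twist by auto

text \<open>The sets \<open>Cyc\<close> and \<open>Bdy\<close> depend on the morphism groups and
  differentials but not on \<open>S\<close>. The presentations for different sets of objects
  therefore share \<open>mc.Cyc\<close> and \<open>mc.Bdy\<close>.\<close>

lemma presented_restrict:
  assumes S: "S \<subseteq> MC"
  shows "presented_ainf (graded ((bc_all A)\<lparr>obj := S\<rparr>)) (\<lambda>U V. mor A (fst U) (fst V)) (\<lambda>U V d. {0}) (\<lambda>U V d x. x)
    (del (twist A)) (prd (twist A))"
proof -
  interpret u: uncurved_ainf_category scale "(bc_all A)\<lparr>obj := S\<rparr>" by (rule uncurved_restrict[OF S])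
  have 1: "mor ((bc_all A)\<lparr>obj := S\<rparr>) = (\<lambda>U V. mor A (fst U) (fst V))" by (simp add: bc_all_def)
  have 2: "del ((bc_all A)\<lparr>obj := S\<rparr>) = del (twist A)" by (intro ext) (simp add: del_def)
  have 3: "prd ((bc_all A)\<lparr>obj := S\<rparr>) = prd (twist A)" by (intro ext) (simp add: prd_def)
  show ?thesis using u.presented_graded unfolding 1 2 3 .
qed

sublocale mc: presented_ainf "graded ((bc_all A)\<lparr>obj := MC\<rparr>)" "\<lambda>U V. mor A (fst U) (fst V)" "\<lambda>U V d. {0}"
    "\<lambda>U V d x. x" "del (twist A)" "prd (twist A)"
  by (rule presented_restrict) simp

lemma gobj_restrict [simp]: "gobj (graded ((bc_all A)\<lparr>obj := S\<rparr>)) = S"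
  by (simp add: graded_def)

lemma mc_Cyc_iff: "x \<in> mc.Cyc U V d \<longleftrightarrow> x \<in> mor A (fst U) (fst V) d \<and> del (twist A) U V d x = 0"
  by (simp add: mc.Cyc_def)

lemma mc_Bdy_iff:
  assumes "U \<in> MC" "V \<in> MC"
  shows "x \<in> mc.Bdy U V d \<longleftrightarrow> (\<exists>z\<in>mor A (fst U) (fst V) (d + 1). x = del (twist A) U V (d + 1) z)"
  using mc.d1_P'[of U V _ d] assms by (auto simp: mc.Bdy_def deg1_bit_def)

lemma mc_Bdy_fil: "U \<in> MC \<Longrightarrow> V \<in> MC \<Longrightarrow> z \<in> fil A (fst U) (fst V) (d + 1) n \<Longrightarrow> x = del (twist A) U V (d + 1) z \<Longrightarrow> x \<in> mc.Bdy U V d"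
  using fil_sub_mor[OF MC_fst MC_fst] mc_Bdy_iff by blast

lemma mc_Bdy_level:
  assumes UV: "U \<in> MC" "V \<in> MC" and x: "x \<in> mc.Bdy U V d"
  obtains z n where "z \<in> fil A (fst U) (fst V) (d + 1) n" "x = del (twist A) U V (d + 1) z"
  using x complete_group.F_exhaust[OF complete_group_fil[OF MC_fst[OF UV(1)] MC_fst[OF UV(2)]]]
  unfolding mc_Bdy_iff[OF UV] by metis

lemma del_del_MC: "U \<in> MC \<Longrightarrow> V \<in> MC \<Longrightarrow> x \<in> mor A (fst U) (fst V) d \<Longrightarrow> del (twist A) U V (d + 1) (del (twist A) U V d x) = 0"
  using mc.d1_d1[of U V x d] by (simp add: deg1_bit_def)

lemma post_chain:
  assumes "U \<in> MC" "V \<in> MC" "W \<in> MC" and f: "f \<in> mc.Cyc V W 0" and x: "x \<in> mor A (fst U) (fst V) d"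
  shows "del (twist A) U W d (prd (twist A) U V W d 0 x f) = prd (twist A) U V W (d + 1) 0 (del (twist A) U V d x) f"
proof -
  have "prd (twist A) U V W d 1 x 0 = 0"
    using mc.m2_diff_right[of U V W x d 0 1 0] assms mor_zero MC_fst by simp
  then show ?thesis using mc.leibniz[of U V W x d f 0] assms f by (simp add: mc_Cyc_iff deg1_bit_def split: if_splits)
qed

lemma pre_chain:
  assumes "U \<in> MC" "V \<in> MC" "W \<in> MC" and f: "f \<in> mc.Cyc U V 0" and x: "x \<in> mor A (fst V) (fst W) d"
  shows "del (twist A) U W d (prd (twist A) U V W 0 d f x) = prd (twist A) U V W 0 (d + 1) f (del (twist A) V W d x)"
proof -
  have "prd (twist A) U V W 1 d 0 x = 0"
    using mc.m2_diff_left[of U V W 0 1 0 x d] assms mor_zero MC_fst by simp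
  then show ?thesis using mc.leibniz[of U V W f 0 x d] assms f
    by (simp add: mc_Cyc_iff deg1_bit_def parity_bit_def)
qed

text \<open>Graded exactness of right multiplication by \<open>f\<close> is transferred to the
  twisted operations, for which \<open>f\<close> is closed and the cone is a complex. The level in
  the surjective part is kept because units have to be found in level 0.\<close>

lemma twist_post:
  assumes o: "U \<in> MC" "V \<in> MC" "W \<in> MC" and f: "gr_iso (fst V) (fst W) f" "f \<in> mc.Cyc V W 0"
  shows twist_post_surj: "y \<in> fil A (fst U) (fst W) d n \<Longrightarrow> del (twist A) U W d y = 0 \<Longrightarrow>
      \<exists>x\<in>fil A (fst U) (fst V) d n. \<exists>z\<in>fil A (fst U) (fst W) (d + 1) n. del (twist A) U V d x = 0 \<and>
        prd (twist A) U V W d 0 x f - y = del (twist A) U W (d + 1) z"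
    and twist_post_inj: "x \<in> mc.Cyc U V d \<Longrightarrow> prd (twist A) U V W d 0 x f \<in> mc.Bdy U W d \<Longrightarrow> x \<in> mc.Bdy U V d"
proof -
  interpret t: curved_filtered_ainf_category FK scale "twist A" by (rule twist_category)
  note ot = MC_twist[OF o(1)] MC_twist[OF o(2)] MC_twist[OF o(3)]
  note oA = MC_fst[OF o(1)] MC_fst[OF o(2)] MC_fst[OF o(3)]
  have f0: "f \<in> fil A (fst V) (fst W) 0 0" using gr_iso_fil[OF f(1)] .
  have "f \<in> fil (twist A) V W 0 0" using f0 by simp
  from t.filtered_map_post[OF ot this]
  interpret fm: filtered_map "mor A (fst U) (fst V)" "fil A (fst U) (fst V)" "del (twist A) U V" "mor A (fst U) (fst W)"
    "fil A (fst U) (fst W)" "del (twist A) U W" "\<lambda>d x. prd (twist A) U V W d 0 x f" by simp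
  have ex: fm.cone_exact
    by (rule fm.cone_exact_perturb[OF filtered_map_post[OF oA f0] cone_exact_post[OF oA f(1)]
          twist_del_approx[OF ot(1,2)] twist_del_approx[OF ot(1,3)]])
      (use twist_prd_approx[OF ot _ f0] in simp_all)
  note lift = fm.lift_surj[OF ex del_del_MC[OF o(1,2)] del_del_MC[OF o(1,3)] post_chain[OF o f(2)]]
    fm.lift_inj[OF ex del_del_MC[OF o(1,2)] del_del_MC[OF o(1,3)] post_chain[OF o f(2)]]
  show "y \<in> fil A (fst U) (fst W) d n \<Longrightarrow> del (twist A) U W d y = 0 \<Longrightarrow>
      \<exists>x\<in>fil A (fst U) (fst V) d n. \<exists>z\<in>fil A (fst U) (fst W) (d + 1) n. del (twist A) U V d x = 0 \<and>
        prd (twist A) U V W d 0 x f - y = del (twist A) U W (d + 1) z"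
    by (rule lift(1))
  show "x \<in> mc.Bdy U V d" if x: "x \<in> mc.Cyc U V d" "prd (twist A) U V W d 0 x f \<in> mc.Bdy U W d"
  proof -
    obtain z k where z: "z \<in> fil A (fst U) (fst W) (d + 1) k" "prd (twist A) U V W d 0 x f = del (twist A) U W (d + 1) z"
      using mc_Bdy_level[OF o(1,3) x(2)] .
    obtain l where l: "x \<in> fil A (fst U) (fst V) d l" using fm.C.F_exhaust x(1) unfolding mc_Cyc_iff by blast
    \<comment> \<open>The minimum puts \<open>x\<close> and the element bounding its image into a
      common level.\<close>
    have "\<exists>w\<in>fil A (fst U) (fst V) (d + 1) (min k l). x = del (twist A) U V (d + 1) w"
      using x(1) z(2) fm.C.F_mono[OF l] fm.D.F_mono[OF z(1)]
      by (intro lift(2)) (auto simp: mc_Cyc_iff)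
    then show ?thesis using mc_Bdy_fil[OF o(1,2)] by blast
  qed
qed

lemma twist_pre:
  assumes o: "U \<in> MC" "V \<in> MC" "W \<in> MC" and f: "gr_iso (fst U) (fst V) f" "f \<in> mc.Cyc U V 0"
  shows "x \<in> mc.Cyc V W d \<Longrightarrow> prd (twist A) U V W 0 d f x \<in> mc.Bdy U W d \<Longrightarrow> x \<in> mc.Bdy V W d"
proof -
  interpret t: curved_filtered_ainf_category FK scale "twist A" by (rule twist_category)
  note ot = MC_twist[OF o(1)] MC_twist[OF o(2)] MC_twist[OF o(3)]
  note oA = MC_fst[OF o(1)] MC_fst[OF o(2)] MC_fst[OF o(3)]
  have f0: "f \<in> fil A (fst U) (fst V) 0 0" using gr_iso_fil[OF f(1)] .
  have "f \<in> fil (twist A) U V 0 0" using f0 by simp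
  from t.filtered_map_pre[OF ot this]
  interpret fm: filtered_map "mor A (fst V) (fst W)" "fil A (fst V) (fst W)" "del (twist A) V W" "mor A (fst U) (fst W)"
    "fil A (fst U) (fst W)" "del (twist A) U W" "\<lambda>d x. prd (twist A) U V W 0 d f x" by simp
  have ex: fm.cone_exact
    by (rule fm.cone_exact_perturb[OF filtered_map_pre[OF oA f0] cone_exact_pre[OF oA f(1)]
          twist_del_approx[OF ot(2,3)] twist_del_approx[OF ot(1,3)]])
      (use twist_prd_approx[OF ot f0] in simp_all)
  show "x \<in> mc.Bdy V W d" if x: "x \<in> mc.Cyc V W d" "prd (twist A) U V W 0 d f x \<in> mc.Bdy U W d"
  proof -
    obtain z k where z: "z \<in> fil A (fst U) (fst W) (d + 1) k" "prd (twist A) U V W 0 d f x = del (twist A) U W (d + 1) z"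
      using mc_Bdy_level[OF o(1,3) x(2)] .
    obtain l where l: "x \<in> fil A (fst V) (fst W) d l" using fm.C.F_exhaust x(1) unfolding mc_Cyc_iff by blast
    have "\<exists>w\<in>fil A (fst V) (fst W) (d + 1) (min k l). x = del (twist A) V W (d + 1) w"
      using x(1) z(2) fm.C.F_mono[OF l] fm.D.F_mono[OF z(1)]
      by (intro fm.lift_inj[OF ex del_del_MC[OF o(2,3)] del_del_MC[OF o(1,3)] pre_chain[OF o f(2)]])
        (auto simp: mc_Cyc_iff)
    then show ?thesis using mc_Bdy_fil[OF o(2,3)] by blast
  qed
qed

section \<open>Units of bounding cochains\<close>

text \<open>A closed idempotent \<open>e\<close> acts by homotopy idempotents. If its leading term is a unit of the
  associated graded, then these are injective on cohomology and hence the identity.\<close>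

definition mc_unit :: "'o \<times> 'm \<Rightarrow> 'm \<Rightarrow> bool" where
  "mc_unit U e \<longleftrightarrow> e \<in> fil A (fst U) (fst U) 0 0 \<and> del (twist A) U U 0 e = 0 \<and>
     prd (twist A) U U U 0 0 e e - e \<in> mc.Bdy U U 0 \<and> gr.unit_cocycle (fst U) e"

lemma mc_unit_Cyc: "U \<in> MC \<Longrightarrow> mc_unit U e \<Longrightarrow> e \<in> mc.Cyc U U 0"
  using fil_sub_mor[OF MC_fst MC_fst] by (auto simp: mc_unit_def mc_Cyc_iff)

lemma mc_unit_unit_cocycle:
  assumes U: "U \<in> MC" and e: "mc_unit U e" shows "mc.unit_cocycle U e"
proof -
  note eC = mc_unit_Cyc[OF U e]
  have iso: "gr_iso (fst U) (fst U) e" using gr_unit_iso[OF MC_fst[OF U]] e by (simp add: mc_unit_def)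
  have ee: "prd (twist A) U U U 0 0 e e - e \<in> mc.Bdy U U 0" "prd (twist A) U U U 0 0 e e \<in> mc.Cyc U U 0"
    using e mc.m2_Cyc[of U U U e 0 e 0] eC U by (simp_all add: mc_unit_def)
  have left: "prd (twist A) U U V 0 g e x - x \<in> mc.Bdy U V g" if V: "V \<in> MC" and x: "x \<in> mc.Cyc U V g" for V g x
  \<comment> \<open>Up to coboundaries \<open>e (e x - x)\<close> equals
    \<open>(e e) x - e x\<close>, which is zero; cancelling \<open>e\<close> on the left leaves
    \<open>e x = x\<close>.\<close>
  proof (rule twist_pre[OF U U V iso eC])
    have ex: "prd (twist A) U U V 0 g e x \<in> mc.Cyc U V g" using mc.m2_Cyc[of U U V e 0 x g] U V x eC by simp
    show "prd (twist A) U U V 0 g e x - x \<in> mc.Cyc U V g" using mc.Cyc_diff[of U V] U V ex x by simp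
    have "prd (twist A) U U V 0 g (prd (twist A) U U U 0 0 e e) x - prd (twist A) U U V 0 g e (prd (twist A) U U V 0 g e x) \<in> mc.Bdy U V g"
      using mc.assoc_Bdy[of U U U V e 0 e 0 x g] U V x eC by simp
    moreover have "prd (twist A) U U V 0 g (prd (twist A) U U U 0 0 e e) x - prd (twist A) U U V 0 g e x \<in> mc.Bdy U V g"
      using mc.m2_cong[of U U V e 0 "prd (twist A) U U U 0 0 e e" x g x] U V x eC ee mc.Bdy_zero by simp
    ultimately have "prd (twist A) U U V 0 g e (prd (twist A) U U V 0 g e x) - prd (twist A) U U V 0 g e x \<in> mc.Bdy U V g"
      using mc.Bdy_diff[of U V "prd (twist A) U U V 0 g (prd (twist A) U U U 0 0 e e) x - prd (twist A) U U V 0 g e x" g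
          "prd (twist A) U U V 0 g (prd (twist A) U U U 0 0 e e) x - prd (twist A) U U V 0 g e (prd (twist A) U U V 0 g e x)"] U V by simp
    then show "prd (twist A) U U V 0 g e (prd (twist A) U U V 0 g e x - x) \<in> mc.Bdy U V g"
      using mc.m2_diff_right[of U U V e 0 "prd (twist A) U U V 0 g e x" g x] U V ex x eC by (simp add: mc_Cyc_iff)
  qed
  have right: "prd (twist A) V U U g 0 x e - x \<in> mc.Bdy V U g" if V: "V \<in> MC" and x: "x \<in> mc.Cyc V U g" for V g x
  proof (rule twist_post_inj[OF V U U iso eC])
    have ex: "prd (twist A) V U U g 0 x e \<in> mc.Cyc V U g" using mc.m2_Cyc[of V U U x g e 0] U V x eC by simp
    show "prd (twist A) V U U g 0 x e - x \<in> mc.Cyc V U g" using mc.Cyc_diff[of V U] U V ex x by simp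
    have "prd (twist A) V U U g 0 (prd (twist A) V U U g 0 x e) e - prd (twist A) V U U g 0 x (prd (twist A) U U U 0 0 e e) \<in> mc.Bdy V U g"
      using mc.assoc_Bdy[of V U U U x g e 0 e 0] U V x eC by simp
    moreover have "prd (twist A) V U U g 0 x (prd (twist A) U U U 0 0 e e) - prd (twist A) V U U g 0 x e \<in> mc.Bdy V U g"
      using mc.m2_cong[of V U U x g x e 0 "prd (twist A) U U U 0 0 e e"] U V x eC ee mc.Bdy_zero by simp
    ultimately have "prd (twist A) V U U g 0 (prd (twist A) V U U g 0 x e) e - prd (twist A) V U U g 0 x e \<in> mc.Bdy V U g"
      using mc.Bdy_add[of V U "prd (twist A) V U U g 0 (prd (twist A) V U U g 0 x e) e - prd (twist A) V U U g 0 x (prd (twist A) U U U 0 0 e e)" g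
        "prd (twist A) V U U g 0 x (prd (twist A) U U U 0 0 e e) - prd (twist A) V U U g 0 x e"] U V by simp
    then show "prd (twist A) V U U g 0 (prd (twist A) V U U g 0 x e - x) e \<in> mc.Bdy V U g"
      using mc.m2_diff_left[of V U U "prd (twist A) V U U g 0 x e" g x e 0] U V ex x eC by (simp add: mc_Cyc_iff)
  qed
  show ?thesis unfolding mc.unit_cocycle_def using eC left right by simp
qed

lemma endo_category:
  assumes "X \<in> obj A" shows "curved_filtered_ainf_category FK scale (endo A X)"
proof -
  have sub: "{X} \<subseteq> obj A" using assms by simp
  have s: "obj (endo A X) = {X}" "mor (endo A X) = mor A" "mu (endo A X) = mu A" "fil (endo A X) = fil A"
    by (simp_all add: endo_def)
  show ?thesis
  proof (unfold_locales, unfold s, goal_cases)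
    case 1 then show ?case using mor_submodule assms by blast
  next
    case 2 then show ?case using mu_degree is_chain_mono[OF _ sub] by blast
  next
    case 3 then show ?case using mu_multilinear is_chain_mono[OF _ sub] unfolding multilinear_def by blast
  next
    case 4 then show ?case using mu_ainf is_chain_mono[OF _ sub] by blast
  next
    case 5 then show ?case using fil_complete assms by blast
  next
    case 6 then show ?case using fil_scale assms by blast
  next
    case 7 then show ?case using mu_filtered is_chain_mono[OF _ sub] by blast
  next
    case 8 then show ?case using curvature_filtered assms by blast
  qed
qed

lemma presented_endo:
  assumes "X \<in> obj A"
  shows "presented_ainf (Gr (endo A X)) (\<lambda>X Y g. fil A X Y (fst g) (snd g)) (\<lambda>X Y g. fil A X Y (fst g) (snd g + 1))
    (\<lambda>X Y g. gr_class A X Y (fst g) (snd g)) (\<lambda>X Y g. del A X Y (fst g)) (\<lambda>X Y Z g h. prd A X Y Z (fst g) (fst h))"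
proof -
  interpret e: curved_filtered_ainf_category FK scale "endo A X" by (rule endo_category[OF assms])
  have 1: "fil (endo A X) = fil A" by (simp add: endo_def)
  have 2: "gr_class (endo A X) = gr_class A" by (intro ext) (simp add: gr_class_def 1)
  have 3: "del (endo A X) = del A" by (intro ext) (simp add: del_def endo_def)
  have 4: "prd (endo A X) = prd A" by (intro ext) (simp add: prd_def endo_def)
  show ?thesis using e.presented_Gr unfolding 1 2 3 4 .
qed

text \<open>The definition tests units inside one-object algebras, whereas \<open>mc_unit\<close>
  asks for a unit of the whole associated graded. The gap is closed by a unit \<open>e'\<close> of
  \<open>Gr A\<close>, as \<open>e e'\<close> is cohomologous to both \<open>e\<close> and
  \<open>e'\<close>. Conversely, \<open>mc_unit\<close> yields a unit against all bounding cochains,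
  in particular within the deformed algebra.\<close>

lemma c_unital_maurer_cartan_iff:
  assumes unital: "c_unital (Gr A)"
  shows "c_unital_maurer_cartan A X a \<longleftrightarrow> maurer_cartan A X a \<and> (\<exists>e. mc_unit (X, a) e)"
proof (cases "maurer_cartan A X a")
  case True
  let ?U = "(X, a)"
  have U: "?U \<in> MC" using True by simp
  have X: "X \<in> obj A" using MC_fst[OF U] by simp
  have d: "deformed A X a = (bc_all A)\<lparr>obj := {?U}\<rparr>" by (simp add: deformed_def)
  interpret df: presented_ainf "graded (deformed A X a)" "\<lambda>U V. mor A (fst U) (fst V)" "\<lambda>U V d. {0}"
    "\<lambda>U V d x. x" "del (twist A)" "prd (twist A)"
    unfolding d by (rule presented_restrict) (use U in blast)
  interpret en: presented_ainf "Gr (endo A X)" "\<lambda>X Y g. fil A X Y (fst g) (snd g)" "\<lambda>X Y g. fil A X Y (fst g) (snd g + 1)"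
    "\<lambda>X Y g. gr_class A X Y (fst g) (snd g)" "\<lambda>X Y g. del A X Y (fst g)" "\<lambda>X Y Z g h. prd A X Y Z (fst g) (fst h)"
    by (rule presented_endo[OF X])
  have obd: "gobj (graded (deformed A X a)) = {?U}" unfolding d by simp
  have obe: "gobj (Gr (endo A X)) = {X}" by (simp add: Gr_def endo_def)
  have oe: "X \<in> gobj (Gr (endo A X))" using obe by simp
  have od: "?U \<in> gobj (graded (deformed A X a))" using obd by simp
  have cls: "coh_class (Gr (endo A X)) X X (0, 0) (gr_class A X X 0 0 e) = en.hcls X X 0 e" for e
    by (simp add: en.hcls_def zero_prod_def)
  have cls_d: "coh_class (graded (deformed A X a)) ?U ?U 0 e = df.hcls ?U ?U 0 e" for e
    by (simp add: df.hcls_def)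
  have cocycle_e: "gr_class A X X 0 0 e \<in> cocycles (Gr (endo A X)) X X (0, 0) \<longleftrightarrow> e \<in> gr.Cyc X X 0"
    if "e \<in> fil A X X 0 0" for e
    using en.cls_cocycles_iff[OF oe oe, of e 0] that by (simp add: zero_prod_def)
  have cocycle_d: "e \<in> cocycles (graded (deformed A X a)) ?U ?U 0 \<longleftrightarrow> e \<in> mc.Cyc ?U ?U 0"
    if "e \<in> fil A X X 0 0" for e
    using df.cls_cocycles_iff[OF od od, of e 0] fil_sub_mor[OF X X that] by simp
  obtain E' where "is_unit_at (coh (Gr A)) X E'" using unital X unfolding c_unital_def by auto
  then obtain e' where e': "gr.unit_cocycle X e'" using gr.is_unit_atE[of X E'] X by auto
  have e'C: "e' \<in> gr.Cyc X X 0" using e' by (simp add: gr.unit_cocycle_def)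
  show ?thesis
  proof
    assume "c_unital_maurer_cartan A X a"
    then obtain e where e: "e \<in> fil A X X 0 0" "e \<in> mc.Cyc ?U ?U 0" "is_unit_at (coh (graded (deformed A X a))) ?U (df.hcls ?U ?U 0 e)"
      "e \<in> gr.Cyc X X 0" "is_unit_at (coh (Gr (endo A X))) X (en.hcls X X 0 e)"
      unfolding c_unital_maurer_cartan_def cls cls_d using cocycle_e cocycle_d by blast
    have "df.unit_cocycle ?U e" using df.is_unit_at_hcls[OF od e(2)] e(3) by simp
    then have 1: "prd (twist A) ?U ?U ?U 0 0 e e - e \<in> mc.Bdy ?U ?U 0"
      using df.unit_cocycleD(1)[OF _ od e(2)] by blast
    have "en.unit_cocycle X e" using en.is_unit_at_hcls[OF oe e(4)] e(5) by simp
    from en.unit_cocycleD(1)[OF this oe e'C] have "prd A X X X 0 0 e e' - e' \<in> gr.Bdy X X 0" by simp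
    moreover have "prd A X X X 0 0 e e' - e \<in> gr.Bdy X X 0" using gr.unit_cocycleD(2)[OF e' _ e(4)] X by simp
    ultimately have "e - e' \<in> gr.Bdy X X 0"
      using gr.Bdy_diff[of X X "prd A X X X 0 0 e e' - e'" 0 "prd A X X X 0 0 e e' - e"] X by simp
    then have "gr.unit_cocycle X e" using gr.unit_cocycle_cong[of X e' e] X e' e(4) by simp
    then have "mc_unit ?U e" using e(1,2) 1 by (simp add: mc_unit_def mc_Cyc_iff)
    then show "maurer_cartan A X a \<and> (\<exists>e. mc_unit ?U e)" using True by blast
  next
    assume "maurer_cartan A X a \<and> (\<exists>e. mc_unit ?U e)"
    then obtain e where e: "mc_unit ?U e" by blast
    have e0: "e \<in> fil A X X 0 0" and eg: "gr.unit_cocycle X e" using e by (simp_all add: mc_unit_def)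
    note eC = mc_unit_Cyc[OF U e]
    have egC: "e \<in> gr.Cyc X X 0" using eg by (simp add: gr.unit_cocycle_def)
    have "df.unit_cocycle ?U e"
      using mc_unit_unit_cocycle[OF U e] U unfolding df.unit_cocycle_def mc.unit_cocycle_def obd by simp
    then have 1: "is_unit_at (coh (graded (deformed A X a))) ?U (df.hcls ?U ?U 0 e)"
      using df.is_unit_at_hcls[OF od eC] by simp
    have "en.unit_cocycle X e"
      using eg X unfolding en.unit_cocycle_def gr.unit_cocycle_def obe by simp
    then have 2: "is_unit_at (coh (Gr (endo A X))) X (en.hcls X X 0 e)"
      using en.is_unit_at_hcls[OF oe egC] by simp
    have 3: "c_unital (graded (deformed A X a))" unfolding c_unital_def obd using 1 by blast
    show "c_unital_maurer_cartan A X a"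
      unfolding c_unital_maurer_cartan_def cls cls_d using True 1 2 3 e0 cocycle_e[OF e0] cocycle_d[OF e0] eC egC by blast
  qed
qed (simp add: c_unital_maurer_cartan_def)

text \<open>A closed morphism whose leading term is invertible induces a unit on its source, because it can be
  divided by itself.\<close>

lemma mc_unit_source:
  assumes unital: "c_unital (Gr A)" and UV: "U \<in> MC" "V \<in> MC"
    and f: "gr_iso (fst U) (fst V) f" "f \<in> mc.Cyc U V 0"
  shows "\<exists>e. mc_unit U e"
proof -
  note o = MC_fst[OF UV(1)] MC_fst[OF UV(2)] and ot = MC_twist[OF UV(1)] MC_twist[OF UV(2)]
  have f0: "f \<in> fil A (fst U) (fst V) 0 0" using gr_iso_fil[OF f(1)] .
  have df: "del (twist A) U V 0 f = 0" using f(2) by (simp add: mc_Cyc_iff)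
  \<comment> \<open>Here \<open>e f = f\<close> up to a coboundary. Then
    \<open>(e e) f = e (e f) = e f\<close>, so cancelling \<open>f\<close> makes \<open>e\<close>
    idempotent in cohomology.\<close>
  obtain e z where e: "e \<in> fil A (fst U) (fst U) 0 0" "del (twist A) U U 0 e = 0"
    and z: "z \<in> fil A (fst U) (fst V) 1 0" "prd (twist A) U U V 0 0 e f - f = del (twist A) U V 1 z"
    using twist_post_surj[OF UV(1,1,2) f f0 df] by auto
  have eC: "e \<in> mc.Cyc U U 0" using e fil_sub_mor[OF o(1,1)] by (simp add: mc_Cyc_iff)
  have ef: "prd (twist A) U U V 0 0 e f \<in> mc.Cyc U V 0" using mc.m2_Cyc[of U U V e 0 f 0] UV eC f(2) by simp
  have efB: "prd (twist A) U U V 0 0 e f - f \<in> mc.Bdy U V 0"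
    using mc_Bdy_fil[OF UV, of z 0 0] z by simp
  have ee: "prd (twist A) U U U 0 0 e e \<in> mc.Cyc U U 0" using mc.m2_Cyc[of U U U e 0 e 0] UV eC by simp
  have "prd (twist A) U U U 0 0 e e - e \<in> mc.Bdy U U 0"
  proof (rule twist_post_inj[OF UV(1,1,2) f])
    show "prd (twist A) U U U 0 0 e e - e \<in> mc.Cyc U U 0" using mc.Cyc_diff[of U U] UV(1) ee eC by simp
    have "prd (twist A) U U V 0 0 (prd (twist A) U U U 0 0 e e) f - prd (twist A) U U V 0 0 e (prd (twist A) U U V 0 0 e f) \<in> mc.Bdy U V 0"
      using mc.assoc_Bdy[of U U U V e 0 e 0 f 0] UV eC f(2) by simp
    moreover have "prd (twist A) U U V 0 0 e (prd (twist A) U U V 0 0 e f) - prd (twist A) U U V 0 0 e f \<in> mc.Bdy U V 0"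
      using mc.m2_cong[of U U V e 0 e f 0 "prd (twist A) U U V 0 0 e f"] UV eC f(2) ef efB mc.Bdy_zero by simp
    ultimately have "prd (twist A) U U V 0 0 (prd (twist A) U U U 0 0 e e) f - prd (twist A) U U V 0 0 e f \<in> mc.Bdy U V 0"
      using mc.Bdy_add[of U V "prd (twist A) U U V 0 0 (prd (twist A) U U U 0 0 e e) f - prd (twist A) U U V 0 0 e (prd (twist A) U U V 0 0 e f)" 0
        "prd (twist A) U U V 0 0 e (prd (twist A) U U V 0 0 e f) - prd (twist A) U U V 0 0 e f"] UV by simp
    then show "prd (twist A) U U V 0 0 (prd (twist A) U U U 0 0 e e - e) f \<in> mc.Bdy U V 0"
      using mc.m2_diff_left[of U U V "prd (twist A) U U U 0 0 e e" 0 e f 0] UV ee eC f(2) by (simp add: mc_Cyc_iff)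
  qed
  \<comment> \<open>A unit \<open>u\<close> of the associated graded also satisfies
    \<open>u f = f\<close> there, so cancelling the leading term of \<open>f\<close> identifies
    \<open>e\<close> with \<open>u\<close>.\<close>
  moreover have "gr.unit_cocycle (fst U) e"
  proof -
    let ?X = "fst U" and ?Y = "fst V"
    obtain f' where f': "f \<in> gr.Cyc ?X ?Y 0" "f' \<in> gr.Cyc ?Y ?X 0" "gr.unit_cocycle ?X (prd A ?X ?Y ?X 0 0 f f')"
      using f(1) unfolding gr_iso_def by blast
    obtain E where "is_unit_at (coh (Gr A)) ?X E" using unital o(1) unfolding c_unital_def by auto
    then obtain u where u: "gr.unit_cocycle ?X u" using gr.is_unit_atE[of ?X E] o(1) by auto
    have uC: "u \<in> gr.Cyc ?X ?X 0" using u by (simp add: gr.unit_cocycle_def)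
    have u0: "u \<in> fil A ?X ?X 0 0" using uC by (simp add: gr_Cyc_iff)
    have "del A ?X ?X 0 e \<in> fil A ?X ?X 1 1"
      using fil_uminus[OF o(1,1) twist_del_approx[OF ot(1,1) e(1)]] e(2) by simp
    then have egC: "e \<in> gr.Cyc ?X ?X 0" using e(1) by (simp add: gr_Cyc_iff)
    have euC: "e - u \<in> gr.Cyc ?X ?X 0" using gr.Cyc_diff[of ?X ?X] o(1) egC uC by simp
    have "prd A ?X ?X ?Y 0 0 e f - f - del A ?X ?Y 1 z =
        (del (twist A) U V 1 z - del A ?X ?Y 1 z) - (prd (twist A) U U V 0 0 e f - prd A ?X ?X ?Y 0 0 e f)"
      using z(2) by (simp add: algebra_simps)
    also have "\<dots> \<in> fil A ?X ?Y 0 1"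
      using fil_diff[OF o] twist_del_approx[OF ot z(1)] twist_prd_approx[OF ot(1,1,2) e(1) f0] by simp
    finally have "prd A ?X ?X ?Y 0 0 e f - f - del A ?X ?Y 1 z \<in> fil A ?X ?Y 0 1" .
    moreover have "prd A ?X ?X ?Y 0 0 e f - f \<in> fil A ?X ?Y 0 0"
      using fil_diff[OF o _ f0, of "prd A ?X ?X ?Y 0 0 e f"] prd_fil[OF o(1,1,2) e(1) f0, of 0] by simp
    ultimately have 1: "prd A ?X ?X ?Y 0 0 e f - f \<in> gr.Bdy ?X ?Y 0" using z(1) by (auto simp: gr_Bdy_iff)
    have 2: "prd A ?X ?X ?Y 0 0 u f - f \<in> gr.Bdy ?X ?Y 0" using gr.unit_cocycleD(1)[OF u, of ?Y f 0] o(2) f'(1) by simp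
    have "prd A ?X ?X ?Y 0 0 (e - u) f = (prd A ?X ?X ?Y 0 0 e f - f) - (prd A ?X ?X ?Y 0 0 u f - f)"
      using prd_diff_left[OF o(1,1,2) fil_sub_mor[OF o(1,1) e(1)] fil_sub_mor[OF o(1,1) u0] fil_sub_mor[OF o f0]] by simp
    then have "prd A ?X ?X ?Y 0 0 (e - u) f \<in> gr.Bdy ?X ?Y 0" using gr.Bdy_diff[OF _ _ 1 2] o by simp
    then have "e - u \<in> gr.Bdy ?X ?X 0" using gr.iso_post_inj[of ?X ?X ?Y f f' "e - u" 0] o f' euC by simp
    then show ?thesis using gr.unit_cocycle_cong[of ?X u e] o(1) u egC by simp
  qed
  ultimately show ?thesis using e by (auto simp: mc_unit_def)
qed

text \<open>\<open>f'\<close> solves \<open>f' f = e'\<close>. The other relation follows by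
  cancelling \<open>f\<close> on the right in \<open>(f f') f = f (f' f) = f e' = f = e f\<close>,
  all up to coboundaries.\<close>

lemma mc_iso:
  assumes UV: "U \<in> MC" "V \<in> MC" and e: "mc_unit U e" "mc_unit V e'"
    and f: "gr_iso (fst U) (fst V) f" "f \<in> mc.Cyc U V 0"
  shows "\<exists>f'\<in>mc.Cyc V U 0. mc.unit_cocycle U (prd (twist A) U V U 0 0 f f') \<and> mc.unit_cocycle V (prd (twist A) V U V 0 0 f' f)"
proof -
  note o = MC_fst[OF UV(1)] MC_fst[OF UV(2)]
  note eC = mc_unit_Cyc[OF UV(1) e(1)] and e'C = mc_unit_Cyc[OF UV(2) e(2)]
  note eu = mc_unit_unit_cocycle[OF UV(1) e(1)] and e'u = mc_unit_unit_cocycle[OF UV(2) e(2)]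
  have e'0: "e' \<in> fil A (fst V) (fst V) 0 0" "del (twist A) V V 0 e' = 0" using e(2) by (simp_all add: mc_unit_def)
  obtain f' z where f'0: "f' \<in> fil A (fst V) (fst U) 0 0" "del (twist A) V U 0 f' = 0"
    and z: "z \<in> fil A (fst V) (fst V) 1 0" "prd (twist A) V U V 0 0 f' f - e' = del (twist A) V V 1 z"
    using twist_post_surj[OF UV(2,1,2) f e'0] by auto
  have f'C: "f' \<in> mc.Cyc V U 0" using f'0 fil_sub_mor[OF o(2,1)] by (simp add: mc_Cyc_iff)
  have f'f: "prd (twist A) V U V 0 0 f' f - e' \<in> mc.Bdy V V 0" using mc_Bdy_fil[OF UV(2,2), of z 0 0] z by simp
  have f'fC: "prd (twist A) V U V 0 0 f' f \<in> mc.Cyc V V 0" using mc.m2_Cyc[of V U V f' 0 f 0] UV f'C f(2) by simp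
  have ff'C: "prd (twist A) U V U 0 0 f f' \<in> mc.Cyc U U 0" using mc.m2_Cyc[of U V U f 0 f' 0] UV f'C f(2) by simp
  have "prd (twist A) U V U 0 0 f f' - e \<in> mc.Bdy U U 0"
  proof (rule twist_post_inj[OF UV(1,1,2) f])
    show "prd (twist A) U V U 0 0 f f' - e \<in> mc.Cyc U U 0" using mc.Cyc_diff[of U U] UV(1) ff'C eC by simp
    have 1: "prd (twist A) U U V 0 0 (prd (twist A) U V U 0 0 f f') f - prd (twist A) U V V 0 0 f (prd (twist A) V U V 0 0 f' f) \<in> mc.Bdy U V 0"
      using mc.assoc_Bdy[of U V U V f 0 f' 0 f 0] UV f'C f(2) by simp
    have 2: "prd (twist A) U V V 0 0 f (prd (twist A) V U V 0 0 f' f) - prd (twist A) U V V 0 0 f e' \<in> mc.Bdy U V 0"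
      using mc.m2_cong[of U V V f 0 f e' 0 "prd (twist A) V U V 0 0 f' f"] UV f(2) e'C f'fC f'f mc.Bdy_zero by simp
    have 3: "prd (twist A) U V V 0 0 f e' - f \<in> mc.Bdy U V 0" using mc.unit_cocycleD(2)[OF e'u, of U f 0] UV(1) f(2) by simp
    have 4: "prd (twist A) U U V 0 0 e f - f \<in> mc.Bdy U V 0" using mc.unit_cocycleD(1)[OF eu, of V f 0] UV(2) f(2) by simp
    have ob: "U \<in> gobj (graded ((bc_all A)\<lparr>obj := MC\<rparr>))" "V \<in> gobj (graded ((bc_all A)\<lparr>obj := MC\<rparr>))" using UV by simp_all
    have "prd (twist A) U U V 0 0 (prd (twist A) U V U 0 0 f f') f - prd (twist A) U U V 0 0 e f \<in> mc.Bdy U V 0"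
      using mc.Bdy_diff[OF ob mc.Bdy_add[OF ob mc.Bdy_add[OF ob 1 2] 3] 4] by simp
    then show "prd (twist A) U U V 0 0 (prd (twist A) U V U 0 0 f f' - e) f \<in> mc.Bdy U V 0"
      using mc.m2_diff_left[of U U V "prd (twist A) U V U 0 0 f f'" 0 e f 0] UV ff'C eC f(2) by (simp add: mc_Cyc_iff)
  qed
  then have "mc.unit_cocycle U (prd (twist A) U V U 0 0 f f')"
    using mc.unit_cocycle_cong[of U e] UV(1) eu ff'C by simp
  moreover have "mc.unit_cocycle V (prd (twist A) V U V 0 0 f' f)"
    using mc.unit_cocycle_cong[of V e'] UV(2) e'u f'fC f'f by simp
  ultimately show ?thesis using f'C by blast
qed

end

section \<open>The functor on bounding cochains\<close>

context curved_filtered_ainf_functor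
begin

abbreviation F where "F \<equiv> bc_functor B G"

definition F1 where "F1 U V d x = fmor F U [(d, x, V)]"

lemma presented_functor_restrict:
  assumes S: "S \<subseteq> dom.MC" and S': "S' \<subseteq> cod.MC" and map: "\<And>U. U \<in> S \<Longrightarrow> fobj F U \<in> S'"
  shows "presented_functor (graded ((bc_all A)\<lparr>obj := S\<rparr>)) (\<lambda>U V. mor A (fst U) (fst V)) (\<lambda>U V d. {0}) (\<lambda>U V d x. x)
      (del (twist A)) (prd (twist A))
    (graded ((bc_all B)\<lparr>obj := S'\<rparr>)) (\<lambda>U V. mor B (fst U) (fst V)) (\<lambda>U V d. {0}) (\<lambda>U V d x. x)
      (del (twist B)) (prd (twist B)) F F1"
proof -
  interpret u: uncurved_ainf_functor scale "(bc_all A)\<lparr>obj := S\<rparr>" scale' "(bc_all B)\<lparr>obj := S'\<rparr>" F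
    by (rule uncurved_functor_restrict[OF S S' map])
  have 1: "mor ((bc_all A)\<lparr>obj := S\<rparr>) = (\<lambda>U V. mor A (fst U) (fst V))" "mor ((bc_all B)\<lparr>obj := S'\<rparr>) = (\<lambda>U V. mor B (fst U) (fst V))"
    by (simp_all add: bc_all_def)
  have 2: "del ((bc_all A)\<lparr>obj := S\<rparr>) = del (twist A)" "del ((bc_all B)\<lparr>obj := S'\<rparr>) = del (twist B)" by (intro ext; simp add: del_def)+
  have 3: "prd ((bc_all A)\<lparr>obj := S\<rparr>) = prd (twist A)" "prd ((bc_all B)\<lparr>obj := S'\<rparr>) = prd (twist B)" by (intro ext; simp add: prd_def)+
  have 4: "(\<lambda>X Y d x. fmor F X [(d, x, Y)]) = F1" by (intro ext) (simp add: F1_def)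
  show ?thesis using u.presented_functor_graded unfolding 1 2 3 4 .
qed

lemma fobj_MC: "U \<in> dom.MC \<Longrightarrow> fobj F U \<in> cod.MC"
  using bc_maurer_cartan by (auto simp: bc_functor_def)

sublocale mcF: presented_functor "graded ((bc_all A)\<lparr>obj := dom.MC\<rparr>)" "\<lambda>U V. mor A (fst U) (fst V)" "\<lambda>U V d. {0}" "\<lambda>U V d x. x"
      "del (twist A)" "prd (twist A)"
    "graded ((bc_all B)\<lparr>obj := cod.MC\<rparr>)" "\<lambda>U V. mor B (fst U) (fst V)" "\<lambda>U V d. {0}" "\<lambda>U V d x. x"
      "del (twist B)" "prd (twist B)" F F1
  by (rule presented_functor_restrict) (use fobj_MC in auto)

sublocale grF: presented_functor "Gr A" "\<lambda>X Y g. fil A X Y (fst g) (snd g)" "\<lambda>X Y g. fil A X Y (fst g) (snd g + 1)"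
    "\<lambda>X Y g. gr_class A X Y (fst g) (snd g)" "\<lambda>X Y g. del A X Y (fst g)" "\<lambda>X Y Z g h. prd A X Y Z (fst g) (fst h)"
    "Gr B" "\<lambda>X Y g. fil B X Y (fst g) (snd g)" "\<lambda>X Y g. fil B X Y (fst g) (snd g + 1)"
    "\<lambda>X Y g. gr_class B X Y (fst g) (snd g)" "\<lambda>X Y g. del B X Y (fst g)" "\<lambda>X Y Z g h. prd B X Y Z (fst g) (fst h)"
    "Gr_functor B G" "\<lambda>X Y g. G1 X Y (fst g)"
  by (rule presented_functor_Gr)

lemma fobj_Gr [simp]: "fobj (Gr_functor B G) = fobj G" by (simp add: Gr_functor_def)

lemma fst_fobj [simp]: "fst (fobj F U) = fobj G (fst U)" by (simp add: fobj_bc_functor)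

lemma F1_fil:
  assumes "U \<in> obj (twist A)" "V \<in> obj (twist A)" "x \<in> fil A (fst U) (fst V) d n"
  shows "F1 U V d x \<in> fil B (fobj G (fst U)) (fobj G (fst V)) d n"
proof -
  have "filt_chain (twist A) U [(d, x, V)] n" using filt_chain_single[of U "twist A" V x d n] assms by simp
  from fmor_bc_filt_chain[OF this] show ?thesis by (simp add: F1_def deg_out_red_deg)
qed

lemma F1_approx:
  assumes "U \<in> obj (twist A)" "V \<in> obj (twist A)" "x \<in> fil A (fst U) (fst V) d n"
  shows "F1 U V d x - G1 (fst U) (fst V) d x \<in> fil B (fobj G (fst U)) (fobj G (fst V)) d (n + 1)"
proof -
  have "filt_chain (twist A) U [(d, x, V)] n" using filt_chain_single[of U "twist A" V x d n] assms by simp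
  from op.twist_op_approx[OF this] show ?thesis by (simp add: F1_def G1_def fmor_bc_functor deg_out_red_deg)
qed

lemma F1_add:
  assumes "U \<in> obj (twist A)" "V \<in> obj (twist A)" "x \<in> mor A (fst U) (fst V) d" "y \<in> mor A (fst U) (fst V) d"
  shows "F1 U V d (x + y) = F1 U V d x + F1 U V d y"
  using op.twist_op_add[of U "[]" d x V "[]" y] assms by (simp add: F1_def fmor_bc_functor)

lemma filtered_map_G1:
  assumes "X \<in> obj A" "Y \<in> obj A"
  shows "filtered_map (mor A X Y) (fil A X Y) (del A X Y) (mor B (fobj G X) (fobj G Y)) (fil B (fobj G X) (fobj G Y))
    (del B (fobj G X) (fobj G Y)) (G1 X Y)"
  by (rule filtered_mapI_F)
    (use assms fobj in \<open>simp_all add: dom.complete_group_fil cod.complete_group_fil dom.del_add cod.del_add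
      dom.del_fil cod.del_fil G1_add G1_fil\<close>)

lemma filtered_map_F1:
  assumes "U \<in> obj (twist A)" "V \<in> obj (twist A)"
  shows "filtered_map (mor A (fst U) (fst V)) (fil A (fst U) (fst V)) (del (twist A) U V)
    (mor B (fobj G (fst U)) (fobj G (fst V))) (fil B (fobj G (fst U)) (fobj G (fst V))) (del (twist B) (fobj F U) (fobj F V)) (F1 U V)"
proof -
  interpret t: curved_filtered_ainf_category FK scale "twist A" by (rule dom.twist_category)
  interpret t': curved_filtered_ainf_category FK scale' "twist B" by (rule cod.twist_category)
  have o: "fst U \<in> obj A" "fst V \<in> obj A" using assms by auto
  note ot = fobj_bc_twist[OF assms(1)] fobj_bc_twist[OF assms(2)]
  show ?thesis
  proof (rule filtered_mapI_F, goal_cases)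
    case 1 show ?case using dom.complete_group_fil[OF o] .
  next
    case 2 show ?case using cod.complete_group_fil fobj o by blast
  next
    case 3 then show ?case using t.del_add[OF assms] by simp
  next
    case 4 then show ?case using t'.del_add[OF ot] by simp
  next
    case 5 then show ?case using F1_add[OF assms] by simp
  next
    case 6 then show ?case using t.del_fil[OF assms] by simp
  next
    case 7 then show ?case using t'.del_fil[OF ot] by simp
  next
    case 8 then show ?case using F1_fil[OF assms] by simp
  qed
qed

text \<open>To first order the pair of a Maurer--Cartan defect and a closedness defect changes by the
  differential of a mapping cone.\<close>

lemma curvature_variation:
  assumes X: "X \<in> obj A" and a: "a \<in> fil A X X 1 1" and a': "a' \<in> fil A X X 1 n" "1 \<le> n"
  shows "mu (bc_all A) (X, a + a') [] - mu (bc_all A) (X, a) [] - del A X X 1 a' \<in> fil A X X 0 (n + 1)"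
  using dom.mu.twist_op_curvature_variation[OF X a a'] by (simp add: dom.mu_twist del_def)

lemma closedness_variation:
  assumes X: "X \<in> obj A" and V: "V \<in> obj (twist B)"
    and a: "a \<in> fil A X X 1 1" and a': "a' \<in> fil A X X 1 n" "1 \<le> n"
    and f: "f0 \<in> fil B (fobj G X) (fst V) 0 0" "f - f0 \<in> fil B (fobj G X) (fst V) 0 1" and f': "f' \<in> fil B (fobj G X) (fst V) 0 n"
  shows "del (twist B) (fobj F (X, a + a')) V 0 (f + f') - del (twist B) (fobj F (X, a)) V 0 f -
      (del B (fobj G X) (fst V) 0 f' - prd B (fobj G X) (fobj G X) (fst V) 1 0 (G1 X X 1 a') f0)
    \<in> fil B (fobj G X) (fst V) 1 (n + 1)"
proof -
  let ?Z = "fobj G X" and ?Y = "fst V"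
  interpret t': curved_filtered_ainf_category FK scale' "twist B" by (rule cod.twist_category)
  note Z = fobj[OF X]
  have Y: "?Y \<in> obj B" using V by auto
  have a1: "a' \<in> fil A X X 1 1" using dom.fil_mono[OF X X a'] by simp
  have aa: "a + a' \<in> fil A X X 1 1" using dom.fil_add[OF X X a a1] .
  have U: "(X, a) \<in> obj (twist A)" "(X, a + a') \<in> obj (twist A)" using X a aa by simp_all
  \<comment> \<open>\<open>b\<close> is the image of \<open>a\<close>, and \<open>b'\<close> its
    increment, which agrees with \<open>G1\<close> of \<open>a'\<close> modulo the next
    level.\<close>
  define b b' where "b = op.twist_op (X, a) []" and "b' = op.twist_op (X, a + a') [] - b"
  have FU: "fobj F (X, a) = (?Z, b)" "fobj F (X, a + a') = (?Z, b + b')" by (simp_all add: fobj_bc_functor b_def b'_def)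
  have FUt: "(?Z, b) \<in> obj (twist B)" "(?Z, b + b') \<in> obj (twist B)" using fobj_bc_twist[OF U(1)] fobj_bc_twist[OF U(2)] FU by simp_all
  have b1: "b \<in> fil B ?Z ?Z 1 1" using FUt(1) by simp
  have b'G: "b' - G1 X X 1 a' \<in> fil B ?Z ?Z 1 (n + 1)"
    using op.twist_op_curvature_variation[OF X a a'] by (simp add: b'_def b_def G1_def)
  have Ga: "G1 X X 1 a' \<in> fil B ?Z ?Z 1 n" using G1_fil[OF X X a'(1)] .
  have b'n: "b' \<in> fil B ?Z ?Z 1 n"
    using cod.fil_add[OF Z Z cod.fil_mono[OF Z Z b'G, of n] Ga] by simp
  have f_0: "f \<in> fil B ?Z ?Y 0 0" using cod.fil_add[OF Z Y cod.fil_mono[OF Z Y f(2), of 0] f(1)] by simp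
  let ?E = "fil B ?Z ?Y 1 (n + 1)"
  have 1: "del (twist B) (?Z, b + b') V 0 (f + f') = del (twist B) (?Z, b + b') V 0 f + del (twist B) (?Z, b + b') V 0 f'"
    using t'.del_add[OF FUt(2) V, of f 0 f'] cod.fil_sub_mor[OF Z Y f_0] cod.fil_sub_mor[OF Z Y f'] by simp
  have 2: "del (twist B) (?Z, b + b') V 0 f' - del B ?Z ?Y 0 f' \<in> ?E"
    using cod.twist_del_approx[OF FUt(2) V, of f' 0 n] f' by simp
  \<comment> \<open>Inserting \<open>b'\<close> before \<open>f\<close> is minus the product,
    because \<open>prd\<close> has a minus sign when its first factor has degree 1.\<close>
  have 3: "del (twist B) (?Z, b + b') V 0 f - del (twist B) (?Z, b) V 0 f + prd B ?Z ?Z ?Y 1 0 b' f \<in> ?E"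
    using cod.mu.twist_op_variation[OF Z b1 b'n a'(2) V f_0] by (simp add: cod.mu_twist del_def prd_def)
  have 4: "prd B ?Z ?Z ?Y 1 0 b' f - prd B ?Z ?Z ?Y 1 0 (G1 X X 1 a') f0 \<in> ?E"
  proof -
    have "prd B ?Z ?Z ?Y 1 0 b' f - prd B ?Z ?Z ?Y 1 0 (G1 X X 1 a') f0 =
        prd B ?Z ?Z ?Y 1 0 (b' - G1 X X 1 a') f + prd B ?Z ?Z ?Y 1 0 (G1 X X 1 a') (f - f0)"
      using cod.prd_diff_left[OF Z Z Y cod.fil_sub_mor[OF Z Z b'n] cod.fil_sub_mor[OF Z Z Ga] cod.fil_sub_mor[OF Z Y f_0]]
        cod.prd_diff_right[OF Z Z Y cod.fil_sub_mor[OF Z Z Ga] cod.fil_sub_mor[OF Z Y f_0] cod.fil_sub_mor[OF Z Y f(1)]] by simp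
    also have "\<dots> \<in> ?E"
      using cod.fil_add[OF Z Y] cod.prd_fil[OF Z Z Y b'G f_0, of "n + 1"] cod.prd_fil[OF Z Z Y Ga f(2), of "n + 1"] by simp
    finally show ?thesis .
  qed
  from cod.fil_diff[OF Z Y cod.fil_add[OF Z Y 2 3] 4] show ?thesis unfolding FU 1 by (simp add: algebra_simps)
qed

end

section \<open>Lifting along the quasi-equivalence\<close>

context curved_filtered_quasi_equivalence
begin

lemma unital: "c_unital (Gr A)" "c_unital (Gr B)"
  using Gr_quasi_equivalence by (simp_all add: quasi_equivalence_def)

lemma Gr_equivalence: "graded_equivalence (coh (Gr A)) (coh (Gr B)) (fobj G) (coh_functor (Gr B) (Gr_functor B G))"
  using Gr_quasi_equivalence by (simp add: quasi_equivalence_def)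

lemma G1_unit:
  assumes X: "X \<in> obj A" and e: "dom.gr.unit_cocycle X e" shows "cod.gr.unit_cocycle (fobj G X) (G1 X X 0 e)"
proof -
  have eC: "e \<in> dom.gr.Cyc X X 0" using e by (simp add: dom.gr.unit_cocycle_def)
  have "is_unit_at (coh (Gr A)) X (dom.gr.hcls X X 0 e)" using dom.gr.is_unit_at_hcls[of X e] X eC e by simp
  then have "is_unit_at (coh (Gr B)) (fobj G X) (coh_functor (Gr B) (Gr_functor B G) X X 0 (dom.gr.hcls X X 0 e))"
    using Gr_equivalence X unfolding graded_equivalence_def graded_functor_def by simp
  then have "is_unit_at (coh (Gr B)) (fobj G X) (cod.gr.hcls (fobj G X) (fobj G X) 0 (G1 X X 0 e))"
    using grF.coh_functor_hcls[of X X e 0] X eC by simp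
  then show ?thesis using cod.gr.is_unit_at_hcls[of "fobj G X" "G1 X X 0 e"] fobj[OF X] grF.\<phi>_Cyc[of X X e 0] X eC by simp
qed

lemma bij_Gr:
  "X \<in> obj A \<Longrightarrow> Y \<in> obj A \<Longrightarrow>
    bij_betw (coh_functor (Gr B) (Gr_functor B G) X Y g) (chom (coh (Gr A)) X Y g) (chom (coh (Gr B)) (fobj G X) (fobj G Y) g)"
  using Gr_equivalence unfolding graded_equivalence_def by (cases g) simp

lemma G1_inj: "X \<in> obj A \<Longrightarrow> Y \<in> obj A \<Longrightarrow> x \<in> dom.gr.Cyc X Y g \<Longrightarrow>
    G1 X Y (fst g) x \<in> cod.gr.Bdy (fobj G X) (fobj G Y) g \<Longrightarrow> x \<in> dom.gr.Bdy X Y g"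
  using grF.coh_functor_injD[of X Y g x] bij_Gr by simp

lemma G1_surj: "X \<in> obj A \<Longrightarrow> Y \<in> obj A \<Longrightarrow> y \<in> cod.gr.Cyc (fobj G X) (fobj G Y) g \<Longrightarrow>
    \<exists>x\<in>dom.gr.Cyc X Y g. G1 X Y (fst g) x - y \<in> cod.gr.Bdy (fobj G X) (fobj G Y) g"
  using grF.coh_functor_surjD[of X Y g y] bij_Gr by simp

lemma Gr_essentially_surjective:
  assumes Y: "Y \<in> obj B" shows "\<exists>X\<in>obj A. \<exists>f. cod.gr_iso (fobj G X) Y f"
proof -
  obtain X where X: "X \<in> obj A" "isomorphic_in (coh (Gr B)) (fobj G X) Y"
    using Gr_equivalence Y unfolding graded_equivalence_def by auto
  have ob: "fobj G X \<in> gobj (Gr B)" "Y \<in> gobj (Gr B)" using fobj[OF X(1)] Y by simp_all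
  obtain f f' where "f \<in> cod.gr.Cyc (fobj G X) Y 0" "f' \<in> cod.gr.Cyc Y (fobj G X) 0"
    "cod.gr.unit_cocycle (fobj G X) (prd B (fobj G X) Y (fobj G X) (fst (0 :: bit \<times> int)) (fst (0 :: bit \<times> int)) f f')"
    "cod.gr.unit_cocycle Y (prd B Y (fobj G X) Y (fst (0 :: bit \<times> int)) (fst (0 :: bit \<times> int)) f' f)"
    using cod.gr.isomorphic_inE[OF ob X(2)] .
  then have "cod.gr_iso (fobj G X) Y f" unfolding cod.gr_iso_def by auto
  then show ?thesis using X(1) by blast
qed

text \<open>Full faithfulness on the associated graded, used in every degree and level.\<close>

lemma cone_exact_G1:
  assumes o: "X \<in> obj A" "Y \<in> obj A"
  shows "filtered_map.cone_exact (fil A X Y) (del A X Y) (fil B (fobj G X) (fobj G Y)) (del B (fobj G X) (fobj G Y)) (G1 X Y)"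
proof -
  interpret fm: filtered_map "mor A X Y" "fil A X Y" "del A X Y" "mor B (fobj G X) (fobj G Y)" "fil B (fobj G X) (fobj G Y)"
    "del B (fobj G X) (fobj G Y)" "G1 X Y" by (rule filtered_map_G1[OF o])
  show ?thesis
  proof (rule fm.cone_exactI)
    fix d n x z assume x: "x \<in> fil A X Y (d + 1) n" "del A X Y (d + 1) x \<in> fil A X Y d (n + 1)"
      and z: "z \<in> fil B (fobj G X) (fobj G Y) d n"
        "G1 X Y (d + 1) x - del B (fobj G X) (fobj G Y) d z \<in> fil B (fobj G X) (fobj G Y) (d + 1) (n + 1)"
    have "G1 X Y (d + 1) x \<in> cod.gr.Bdy (fobj G X) (fobj G Y) (d + 1, n)"
      using z G1_fil[OF o x(1)] by (auto simp: cod.gr_Bdy_iff add.assoc)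
    moreover have "x \<in> dom.gr.Cyc X Y (d + 1, n)" using x by (simp add: dom.gr_Cyc_iff add.assoc)
    ultimately have "x \<in> dom.gr.Bdy X Y (d + 1, n)" using G1_inj[OF o, of x "(d + 1, n)"] by simp
    then show "\<exists>w\<in>fil A X Y d n. x - del A X Y d w \<in> fil A X Y (d + 1) (n + 1)" by (simp add: dom.gr_Bdy_iff add.assoc)
  next
    fix d n y assume "y \<in> fil B (fobj G X) (fobj G Y) d n" "del B (fobj G X) (fobj G Y) d y \<in> fil B (fobj G X) (fobj G Y) (d + 1) (n + 1)"
    then have "y \<in> cod.gr.Cyc (fobj G X) (fobj G Y) (d, n)" by (simp add: cod.gr_Cyc_iff)
    from G1_surj[OF o this] show "\<exists>x\<in>fil A X Y d n. \<exists>z\<in>fil B (fobj G X) (fobj G Y) (d + 1) n.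
        del A X Y d x \<in> fil A X Y (d + 1) (n + 1) \<and> G1 X Y d x - y - del B (fobj G X) (fobj G Y) (d + 1) z \<in> fil B (fobj G X) (fobj G Y) d (n + 1)"
      by (auto simp: dom.gr_Cyc_iff cod.gr_Bdy_iff)
  qed (rule G1_del[OF o])
qed

text \<open>A composite of two isomorphisms on graded cohomology, \<open>G1\<close> and right
  multiplication by \<open>f\<close>. Its cone governs the linearised equations in
  \<open>lift_iso\<close>.\<close>

lemma cone_exact_G1_post:
  assumes o: "X \<in> obj A" "Y \<in> obj A" "Z \<in> obj B" and f: "cod.gr_iso (fobj G Y) Z f"
  shows "filtered_map.cone_exact (fil A X Y) (del A X Y) (fil B (fobj G X) Z) (del B (fobj G X) Z)
    (\<lambda>d x. prd B (fobj G X) (fobj G Y) Z d 0 (G1 X Y d x) f)"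
proof -
  let ?X = "fobj G X" and ?Y = "fobj G Y"
  let ?\<phi> = "\<lambda>d x. prd B ?X ?Y Z d 0 (G1 X Y d x) f"
  note o' = fobj[OF o(1)] fobj[OF o(2)] o(3)
  note f0 = cod.gr_iso_fil[OF f]
  obtain f' where f': "f \<in> cod.gr.Cyc ?Y Z 0" "f' \<in> cod.gr.Cyc Z ?Y 0" "cod.gr.unit_cocycle ?Y (prd B ?Y Z ?Y 0 0 f f')"
    "cod.gr.unit_cocycle Z (prd B Z ?Y Z 0 0 f' f)" using f unfolding cod.gr_iso_def by blast
  interpret g: filtered_map "mor A X Y" "fil A X Y" "del A X Y" "mor B ?X ?Y" "fil B ?X ?Y" "del B ?X ?Y" "G1 X Y"
    by (rule filtered_map_G1[OF o(1,2)])
  interpret p: filtered_map "mor B ?X ?Y" "fil B ?X ?Y" "del B ?X ?Y" "mor B ?X Z" "fil B ?X Z" "del B ?X Z" "\<lambda>d x. prd B ?X ?Y Z d 0 x f"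
    by (rule cod.filtered_map_post[OF o' f0])
  interpret fm: filtered_map "mor A X Y" "fil A X Y" "del A X Y" "mor B ?X Z" "fil B ?X Z" "del B ?X Z" ?\<phi>
    by (rule filtered_mapI_F)
      (simp_all add: g.C_complete p.D_complete g.dC_add p.dD_add g.\<phi>_add p.\<phi>_add g.\<phi>_M g.dC_F p.dD_F g.\<phi>_F p.\<phi>_F)
  show ?thesis
  proof (rule fm.cone_exactI)
    fix d n x z assume x: "x \<in> fil A X Y (d + 1) n" "del A X Y (d + 1) x \<in> fil A X Y d (n + 1)"
      and z: "z \<in> fil B ?X Z d n" "?\<phi> (d + 1) x - del B ?X Z d z \<in> fil B ?X Z (d + 1) (n + 1)"
    have xC: "x \<in> dom.gr.Cyc X Y (d + 1, n)" using x by (simp add: dom.gr_Cyc_iff add.assoc)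
    have GxC: "G1 X Y (d + 1) x \<in> cod.gr.Cyc ?X ?Y (d + 1, n)" using grF.\<phi>_Cyc[of X Y x "(d + 1, n)"] xC o by simp
    have "?\<phi> (d + 1) x \<in> cod.gr.Bdy ?X Z (d + 1, n)"
      using z fm.\<phi>_F[OF x(1)] by (auto simp: cod.gr_Bdy_iff add.assoc)
    then have "G1 X Y (d + 1) x \<in> cod.gr.Bdy ?X ?Y (d + 1, n)"
      using cod.gr.iso_post_inj[of ?X ?Y Z f f' "G1 X Y (d + 1) x" "(d + 1, n)"] f' o' GxC by simp
    then have "x \<in> dom.gr.Bdy X Y (d + 1, n)" using G1_inj[OF o(1,2), of x "(d + 1, n)"] xC by simp
    then show "\<exists>w\<in>fil A X Y d n. x - del A X Y d w \<in> fil A X Y (d + 1) (n + 1)" by (simp add: dom.gr_Bdy_iff add.assoc)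
  next
    fix d n y assume "y \<in> fil B ?X Z d n" "del B ?X Z d y \<in> fil B ?X Z (d + 1) (n + 1)"
    then have "y \<in> cod.gr.Cyc ?X Z (d, n)" by (simp add: cod.gr_Cyc_iff)
    then obtain x' where x': "x' \<in> cod.gr.Cyc ?X ?Y (d, n)" "prd B ?X ?Y Z d 0 x' f - y \<in> cod.gr.Bdy ?X Z (d, n)"
      using cod.gr.iso_post_surj[of ?X ?Y Z f f' y "(d, n)"] f' o' by auto
    obtain x where x: "x \<in> dom.gr.Cyc X Y (d, n)" "G1 X Y d x - x' \<in> cod.gr.Bdy ?X ?Y (d, n)"
      using G1_surj[OF o(1,2) x'(1)] by auto
    have GxC: "G1 X Y d x \<in> cod.gr.Cyc ?X ?Y (d, n)" using grF.\<phi>_Cyc[of X Y x "(d, n)"] x o by simp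
    have "?\<phi> d x - prd B ?X ?Y Z d 0 x' f \<in> cod.gr.Bdy ?X Z (d, n)"
      using cod.gr.m2_cong[of ?X ?Y Z x' "(d, n)" "G1 X Y d x" f 0 f] o' x' x GxC f'(1) cod.gr.Bdy_zero by simp
    then have "?\<phi> d x - y \<in> cod.gr.Bdy ?X Z (d, n)"
      using cod.gr.Bdy_add[of ?X Z "?\<phi> d x - prd B ?X ?Y Z d 0 x' f" "(d, n)" "prd B ?X ?Y Z d 0 x' f - y"] x'(2) o' by simp
    then show "\<exists>x\<in>fil A X Y d n. \<exists>z\<in>fil B ?X Z (d + 1) n. del A X Y d x \<in> fil A X Y (d + 1) (n + 1) \<and>
        ?\<phi> d x - y - del B ?X Z (d + 1) z \<in> fil B ?X Z d (n + 1)"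
      using x(1) by (auto simp: dom.gr_Cyc_iff cod.gr_Bdy_iff)
  next
    fix d n x assume x: "x \<in> fil A X Y d n"
    have xm: "x \<in> mor A X Y d" using x g.C.F_sub_M by blast
    have 1: "del B ?X Z d (?\<phi> d x) - prd B ?X ?Y Z (d + 1) 0 (del B ?X ?Y d (G1 X Y d x)) f \<in> fil B ?X Z (d + 1) (n + 1)"
      by (rule cod.del_prd_post[OF o' f'(1) G1_fil[OF o(1,2) x]])
    have 2: "prd B ?X ?Y Z (d + 1) 0 (del B ?X ?Y d (G1 X Y d x)) f - ?\<phi> (d + 1) (del A X Y d x) \<in> fil B ?X Z (d + 1) (n + 1)"
      using p.\<phi>_F[OF G1_del[OF o(1,2) x]] p.\<phi>_diff[OF g.dD_M[OF g.\<phi>_M[OF xm]] g.\<phi>_M[OF g.dC_M[OF xm]]] by simp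
    from cod.fil_add[OF o'(1,3) 1 2] show "del B ?X Z d (?\<phi> d x) - ?\<phi> (d + 1) (del A X Y d x) \<in> fil B ?X Z (d + 1) (n + 1)" by simp
  qed
qed

text \<open>Insertions do not change leading terms, so exactness of the cone passes from
  \<open>G1\<close> to \<open>F1\<close>, which is a chain map between genuine complexes and can be
  lifted.\<close>

lemma F1_lift:
  assumes UV: "U \<in> dom.MC" "V \<in> dom.MC"
  shows F1_surj: "y \<in> fil B (fobj G (fst U)) (fobj G (fst V)) d n \<Longrightarrow> del (twist B) (fobj F U) (fobj F V) d y = 0 \<Longrightarrow>
      \<exists>x\<in>fil A (fst U) (fst V) d n. \<exists>z\<in>fil B (fobj G (fst U)) (fobj G (fst V)) (d + 1) n.
        del (twist A) U V d x = 0 \<and> F1 U V d x - y = del (twist B) (fobj F U) (fobj F V) (d + 1) z"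
    and F1_inj: "x \<in> dom.mc.Cyc U V d \<Longrightarrow> F1 U V d x \<in> cod.mc.Bdy (fobj F U) (fobj F V) d \<Longrightarrow> x \<in> dom.mc.Bdy U V d"
proof -
  note ot = dom.MC_twist[OF UV(1)] dom.MC_twist[OF UV(2)] and o = dom.MC_fst[OF UV(1)] dom.MC_fst[OF UV(2)]
  note UV' = fobj_MC[OF UV(1)] fobj_MC[OF UV(2)]
  note ot' = cod.MC_twist[OF UV'(1)] cod.MC_twist[OF UV'(2)]
  interpret fm: filtered_map "mor A (fst U) (fst V)" "fil A (fst U) (fst V)" "del (twist A) U V"
    "mor B (fobj G (fst U)) (fobj G (fst V))" "fil B (fobj G (fst U)) (fobj G (fst V))" "del (twist B) (fobj F U) (fobj F V)" "F1 U V"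
    by (rule filtered_map_F1[OF ot])
  have ex: fm.cone_exact
    by (rule fm.cone_exact_perturb[OF filtered_map_G1[OF o] cone_exact_G1[OF o] dom.twist_del_approx[OF ot] _ F1_approx[OF ot]])
      (use cod.twist_del_approx[OF ot'] in simp_all)
  have dd: "del (twist B) (fobj F U) (fobj F V) (d + 1) (del (twist B) (fobj F U) (fobj F V) d y) = 0"
    if "y \<in> mor B (fobj G (fst U)) (fobj G (fst V)) d" for d y
    using cod.del_del_MC[OF UV'] that by simp
  have ch: "del (twist B) (fobj F U) (fobj F V) d (F1 U V d x) = F1 U V (d + 1) (del (twist A) U V d x)"
    if "x \<in> mor A (fst U) (fst V) d" for d x
    using mcF.\<phi>_d1[of U V x d] UV that by (simp add: deg1_bit_def)
  show "y \<in> fil B (fobj G (fst U)) (fobj G (fst V)) d n \<Longrightarrow> del (twist B) (fobj F U) (fobj F V) d y = 0 \<Longrightarrow>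
      \<exists>x\<in>fil A (fst U) (fst V) d n. \<exists>z\<in>fil B (fobj G (fst U)) (fobj G (fst V)) (d + 1) n.
        del (twist A) U V d x = 0 \<and> F1 U V d x - y = del (twist B) (fobj F U) (fobj F V) (d + 1) z"
    by (rule fm.lift_surj[OF ex dom.del_del_MC[OF UV] dd ch])
  show "x \<in> dom.mc.Bdy U V d" if x: "x \<in> dom.mc.Cyc U V d" "F1 U V d x \<in> cod.mc.Bdy (fobj F U) (fobj F V) d"
  proof -
    obtain z k where z: "z \<in> fil B (fobj G (fst U)) (fobj G (fst V)) (d + 1) k" "F1 U V d x = del (twist B) (fobj F U) (fobj F V) (d + 1) z"
      using cod.mc_Bdy_level[OF UV' x(2)] by auto
    obtain l where l: "x \<in> fil A (fst U) (fst V) d l" using fm.C.F_exhaust x(1) unfolding dom.mc_Cyc_iff by blast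
    have "\<exists>w\<in>fil A (fst U) (fst V) (d + 1) (min k l). x = del (twist A) U V (d + 1) w"
      using x(1) z(2) fm.C.F_mono[OF l] fm.D.F_mono[OF z(1)]
      by (intro fm.lift_inj[OF ex dom.del_del_MC[OF UV] dd ch]) (auto simp: dom.mc_Cyc_iff)
    then show ?thesis using dom.mc_Bdy_fil[OF UV] by blast
  qed
qed

lemma F1_Cyc: "U \<in> dom.MC \<Longrightarrow> V \<in> dom.MC \<Longrightarrow> x \<in> dom.mc.Cyc U V d \<Longrightarrow> F1 U V d x \<in> cod.mc.Cyc (fobj F U) (fobj F V) d"
  using mcF.\<phi>_Cyc[of U V x d] by simp

lemma F1_Bdy: "U \<in> dom.MC \<Longrightarrow> V \<in> dom.MC \<Longrightarrow> x \<in> dom.mc.Bdy U V d \<Longrightarrow> F1 U V d x \<in> cod.mc.Bdy (fobj F U) (fobj F V) d"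
  using mcF.\<phi>_Bdy[of U V x d] by simp

text \<open>\<open>F1\<close> is multiplicative on cocycles up to coboundaries, so idempotency can
  be moved through the functor in either direction.\<close>

lemma F1_square:
  assumes U: "U \<in> dom.MC" and e: "e \<in> dom.mc.Cyc U U 0"
  shows "(F1 U U 0 (prd (twist A) U U U 0 0 e e - e)) -
      (prd (twist B) (fobj F U) (fobj F U) (fobj F U) 0 0 (F1 U U 0 e) (F1 U U 0 e) - F1 U U 0 e)
    \<in> cod.mc.Bdy (fobj F U) (fobj F U) 0"
proof -
  have "prd (twist A) U U U 0 0 e e \<in> dom.mc.Cyc U U 0" using dom.mc.m2_Cyc[of U U U e 0 e 0] U e by simp
  then show ?thesis using mcF.\<phi>_m2[of U U U e 0 e 0] mcF.\<phi>_diff[of U U "prd (twist A) U U U 0 0 e e" 0 e] U e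
    by (simp add: dom.mc_Cyc_iff)
qed

text \<open>On the twisted side \<open>mc_unit\<close> asks for closedness and idempotency, which
  pass through \<open>F1\<close>. The leading term of \<open>F1 e\<close> is that of
  \<open>G1 e\<close>, a unit because the graded functor preserves units.\<close>

lemma mc_unit_image:
  assumes U: "U \<in> dom.MC" and e: "dom.mc_unit U e" shows "cod.mc_unit (fobj F U) (F1 U U 0 e)"
proof -
  note ot = dom.MC_twist[OF U] and o = dom.MC_fst[OF U] and U' = fobj_MC[OF U]
  have e0: "e \<in> fil A (fst U) (fst U) 0 0" and eg: "dom.gr.unit_cocycle (fst U) e" using e by (simp_all add: dom.mc_unit_def)
  note eC = dom.mc_unit_Cyc[OF U e]
  let ?Z = "fobj G (fst U)"
  have Z: "?Z \<in> obj B" using fobj[OF o] .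
  have C: "F1 U U 0 e \<in> cod.mc.Cyc (fobj F U) (fobj F U) 0" using F1_Cyc[OF U U eC] .
  have ob: "fobj F U \<in> gobj (graded ((bc_all B)\<lparr>obj := cod.MC\<rparr>))" using U' by simp
  have b: "F1 U U 0 (prd (twist A) U U U 0 0 e e - e) \<in> cod.mc.Bdy (fobj F U) (fobj F U) 0"
    using F1_Bdy[OF U U] e by (simp add: dom.mc_unit_def)
  have 1: "prd (twist B) (fobj F U) (fobj F U) (fobj F U) 0 0 (F1 U U 0 e) (F1 U U 0 e) - F1 U U 0 e \<in> cod.mc.Bdy (fobj F U) (fobj F U) 0"
    using cod.mc.Bdy_diff[OF ob ob b F1_square[OF U eC]] by simp
  have F0: "F1 U U 0 e \<in> fil B ?Z ?Z 0 0" using F1_fil[OF ot ot e0] .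
  have Gu: "cod.gr.unit_cocycle ?Z (G1 (fst U) (fst U) 0 e)" using G1_unit[OF o eg] .
  have N: "F1 U U 0 e - G1 (fst U) (fst U) 0 e \<in> fil B ?Z ?Z 0 1" using F1_approx[OF ot ot e0] by simp
  have "cod.gr_iso ?Z ?Z (F1 U U 0 e)" using cod.gr_iso_cong[OF Z Z cod.gr_unit_iso[OF Z Gu] F0 N] .
  then have "F1 U U 0 e \<in> cod.gr.Cyc ?Z ?Z 0" by (simp add: cod.gr_iso_def)
  moreover have "F1 U U 0 e - G1 (fst U) (fst U) 0 e \<in> cod.gr.Bdy ?Z ?Z 0" using cod.gr.N_Bdy[of ?Z ?Z _ 0] N Z by simp
  ultimately have "cod.gr.unit_cocycle ?Z (F1 U U 0 e)" using cod.gr.unit_cocycle_cong[of ?Z "G1 (fst U) (fst U) 0 e"] Z Gu by simp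
  then show ?thesis using F0 C 1 by (simp add: cod.mc_unit_def cod.mc_Cyc_iff)
qed

text \<open>Surjectivity provides a closed \<open>e\<close> in level 0 whose image is cohomologous
  to \<open>e'\<close>, and injectivity reflects its idempotency.\<close>

lemma mc_unit_reflect:
  assumes U: "U \<in> dom.MC" and e': "cod.mc_unit (fobj F U) e'" shows "\<exists>e. dom.mc_unit U e"
proof -
  note ot = dom.MC_twist[OF U] and o = dom.MC_fst[OF U] and U' = fobj_MC[OF U]
  note ot' = cod.MC_twist[OF U']
  let ?X = "fst U" and ?Z = "fobj G (fst U)"
  have Z: "?Z \<in> obj B" using fobj[OF o] .
  note e'C = cod.mc_unit_Cyc[OF U' e']
  have e'0: "e' \<in> fil B ?Z ?Z 0 0" "del (twist B) (fobj F U) (fobj F U) 0 e' = 0"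
    and e'g: "cod.gr.unit_cocycle ?Z e'" using e' by (simp_all add: cod.mc_unit_def)
  obtain e z where e: "e \<in> fil A ?X ?X 0 0" "del (twist A) U U 0 e = 0"
    and z: "z \<in> fil B ?Z ?Z 1 0" "F1 U U 0 e - e' = del (twist B) (fobj F U) (fobj F U) 1 z"
    using F1_surj[OF U U e'0] by auto
  have eC: "e \<in> dom.mc.Cyc U U 0" using e dom.fil_sub_mor[OF o o] by (simp add: dom.mc_Cyc_iff)
  have FC: "F1 U U 0 e \<in> cod.mc.Cyc (fobj F U) (fobj F U) 0" using F1_Cyc[OF U U eC] .
  have ob: "fobj F U \<in> gobj (graded ((bc_all B)\<lparr>obj := cod.MC\<rparr>))" using U' by simp
  have B: "F1 U U 0 e - e' \<in> cod.mc.Bdy (fobj F U) (fobj F U) 0" using cod.mc_Bdy_fil[OF U' U', of z 0 0] z by simp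
  let ?p = "prd (twist B) (fobj F U) (fobj F U) (fobj F U) 0 0"
  have 1: "?p (F1 U U 0 e) (F1 U U 0 e) - ?p e' e' \<in> cod.mc.Bdy (fobj F U) (fobj F U) 0"
    using cod.mc.m2_cong[OF ob ob ob e'C FC B e'C FC B] by simp
  have 2: "?p e' e' - e' \<in> cod.mc.Bdy (fobj F U) (fobj F U) 0" using e' by (simp add: cod.mc_unit_def)
  have "?p (F1 U U 0 e) (F1 U U 0 e) - F1 U U 0 e \<in> cod.mc.Bdy (fobj F U) (fobj F U) 0"
    using cod.mc.Bdy_diff[OF ob ob cod.mc.Bdy_add[OF ob ob 1 2] B] by simp
  from cod.mc.Bdy_add[OF ob ob F1_square[OF U eC] this]
  have "F1 U U 0 (prd (twist A) U U U 0 0 e e - e) \<in> cod.mc.Bdy (fobj F U) (fobj F U) 0" by simp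
  moreover have "prd (twist A) U U U 0 0 e e - e \<in> dom.mc.Cyc U U 0"
    using dom.mc.Cyc_diff[of U U] dom.mc.m2_Cyc[of U U U e 0 e 0] U eC by simp
  ultimately have idem: "prd (twist A) U U U 0 0 e e - e \<in> dom.mc.Bdy U U 0" using F1_inj[OF U U] by blast
  obtain E where "is_unit_at (coh (Gr A)) ?X E" using unital(1) o unfolding c_unital_def by auto
  then obtain u where u: "dom.gr.unit_cocycle ?X u" using dom.gr.is_unit_atE[of ?X E] o by auto
  have uC: "u \<in> dom.gr.Cyc ?X ?X 0" using u by (simp add: dom.gr.unit_cocycle_def)
  have u0: "u \<in> fil A ?X ?X 0 0" using uC by (simp add: dom.gr_Cyc_iff)
  have "del A ?X ?X 0 e \<in> fil A ?X ?X 1 1"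
    using dom.fil_uminus[OF o o dom.twist_del_approx[OF ot ot e(1)]] e(2) by simp
  then have egC: "e \<in> dom.gr.Cyc ?X ?X 0" using e(1) by (simp add: dom.gr_Cyc_iff)
  have euC: "e - u \<in> dom.gr.Cyc ?X ?X 0" using dom.gr.Cyc_diff[of ?X ?X] o egC uC by simp
  have obg: "?Z \<in> gobj (Gr B)" using Z by simp
  \<comment> \<open>In graded cohomology \<open>G1 e\<close> agrees with \<open>e'\<close> and, by
    uniqueness of units, with \<open>G1 u\<close> for a unit \<open>u\<close>. Injectivity of
    \<open>G1\<close> then identifies \<open>e\<close> with \<open>u\<close>.\<close>
  have "G1 ?X ?X 0 e - e' - del B ?Z ?Z 1 z =
      (del (twist B) (fobj F U) (fobj F U) 1 z - del B ?Z ?Z 1 z) - (F1 U U 0 e - G1 ?X ?X 0 e)" using z(2) by (simp add: algebra_simps)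
  also have "\<dots> \<in> fil B ?Z ?Z 0 1"
    using cod.fil_diff[OF Z Z] cod.twist_del_approx[OF ot' ot', of z 1 0] z(1) F1_approx[OF ot ot e(1)] by simp
  finally have "G1 ?X ?X 0 e - e' \<in> cod.gr.Bdy ?Z ?Z 0"
    using z(1) cod.fil_diff[OF Z Z G1_fil[OF o o e(1)] e'0(1)] by (auto simp: cod.gr_Bdy_iff)
  then have "G1 ?X ?X 0 e - G1 ?X ?X 0 u \<in> cod.gr.Bdy ?Z ?Z 0"
    using cod.gr.Bdy_add[OF obg obg _ cod.gr_unit_unique[OF Z e'g G1_unit[OF o u]]] by fastforce
  then have "G1 ?X ?X 0 (e - u) \<in> cod.gr.Bdy ?Z ?Z 0"
    using G1_diff[OF o o dom.fil_sub_mor[OF o o e(1)] dom.fil_sub_mor[OF o o u0]] by simp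
  then have "e - u \<in> dom.gr.Bdy ?X ?X 0" using G1_inj[OF o o euC] by simp
  then have "dom.gr.unit_cocycle ?X e" using dom.gr.unit_cocycle_cong[of ?X u e] o u egC by simp
  then show ?thesis using e idem by (auto simp: dom.mc_unit_def)
qed

text \<open>The Maurer--Cartan equation for \<open>a\<close> and closedness of \<open>f\<close> are solved simultaneously by successive
  approximation: at each level the two defects form a cocycle in the mapping cone of
  \<open>x \<mapsto> G\<^sup>1(x) f0\<close>, which is acyclic on the associated graded.\<close>

lemma lift_iso:
  assumes X: "X \<in> obj A" and V: "V \<in> cod.MC" and f0: "cod.gr_iso (fobj G X) (fst V) f0"
  shows "\<exists>a f. (X, a) \<in> dom.MC \<and> f \<in> cod.mc.Cyc (fobj F (X, a)) V 0 \<and> cod.gr_iso (fobj G X) (fst V) f"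
proof -
  let ?Z = "fobj G X" and ?Y = "fst V"
  interpret t: curved_filtered_ainf_category FK scale "twist A" by (rule dom.twist_category)
  interpret t': curved_filtered_ainf_category FK scale' "twist B" by (rule cod.twist_category)
  note Z = fobj[OF X] and Y = cod.MC_fst[OF V] and Vt = cod.MC_twist[OF V]
  note f00 = cod.gr_iso_fil[OF f0]
  have f0C: "f0 \<in> cod.gr.Cyc ?Z ?Y 0" using f0 by (simp add: cod.gr_iso_def)
  note ex = cone_exact_G1_post[OF X X Y f0]
  let ?\<phi> = "\<lambda>d x. prd B ?Z ?Z ?Y d 0 (G1 X X d x) f0"
  interpret g: filtered_map "mor A X X" "fil A X X" "del A X X" "mor B ?Z ?Z" "fil B ?Z ?Z" "del B ?Z ?Z" "G1 X X"
    by (rule filtered_map_G1[OF X X])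
  interpret p: filtered_map "mor B ?Z ?Z" "fil B ?Z ?Z" "del B ?Z ?Z" "mor B ?Z ?Y" "fil B ?Z ?Y" "del B ?Z ?Y" "\<lambda>d x. prd B ?Z ?Z ?Y d 0 x f0"
    by (rule cod.filtered_map_post[OF Z Z Y f00])
  interpret fm: filtered_map "mor A X X" "fil A X X" "del A X X" "mor B ?Z ?Y" "fil B ?Z ?Y" "del B ?Z ?Y" ?\<phi>
    by (rule filtered_mapI_F)
      (simp_all add: g.C_complete p.D_complete g.dC_add p.dD_add g.\<phi>_add p.\<phi>_add g.\<phi>_M g.dC_F p.dD_F g.\<phi>_F p.\<phi>_F)
  let ?F = "\<lambda>l. fil A X X 1 l \<times> fil B ?Z ?Y 0 l" and ?F' = "\<lambda>l. fil A X X 0 l \<times> fil B ?Z ?Y 1 l"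
  \<comment> \<open>The two defects: the curvature of \<open>(X, a)\<close>, and the failure of
    \<open>f\<close> to be closed as a morphism from the image of \<open>(X, a)\<close> to
    \<open>V\<close>.\<close>
  define \<Theta> where "\<Theta> = (\<lambda>(a, f). (mu (bc_all A) (X, a) [], del (twist B) (fobj F (X, a)) V 0 f))"
  have prod: "complete_group (mor A X X 1 \<times> mor B ?Z ?Y 0) ?F" "complete_group (mor A X X 0 \<times> mor B ?Z ?Y 1) ?F'"
    by (intro complete_group_prod dom.complete_group_fil cod.complete_group_fil X Y Z)+
  interpret P: complete_group "mor A X X 0 \<times> mor B ?Z ?Y 1" ?F' by (rule prod(2))
  have near: "a \<in> fil A X X 1 1" "f - f0 \<in> fil B ?Z ?Y 0 1" "f \<in> fil B ?Z ?Y 0 0"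
    if "(a, f) - (0, f0) \<in> ?F 1" for a f
  proof -
    show "a \<in> fil A X X 1 1" and 1: "f - f0 \<in> fil B ?Z ?Y 0 1" using that by simp_all
    show "f \<in> fil B ?Z ?Y 0 0" using cod.fil_add[OF Z Y cod.fil_mono[OF Z Y 1, of 0] f00] by simp
  qed
  have obt: "(X, a) \<in> obj (twist A)" "fobj F (X, a) \<in> obj (twist B)" if "a \<in> fil A X X 1 1" for a
    using X that fobj_bc_twist[of "(X, a)"] by simp_all
  have var: "\<Theta> ((a, f) + (a', f')) - \<Theta> (a, f) - (del A X X 1 a', del B ?Z ?Y 0 f' - ?\<phi> 1 a') \<in> ?F' (n + 1)"
    if "1 \<le> n" "(a, f) - (0, f0) \<in> ?F 1" "(a', f') \<in> ?F n" for n a f a' f'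
  proof -
    note nr = near[OF that(2)]
    have a': "a' \<in> fil A X X 1 n" and f': "f' \<in> fil B ?Z ?Y 0 n" using that(3) by simp_all
    show ?thesis
      using curvature_variation[OF X nr(1) a' that(1)] closedness_variation[OF X Vt nr(1) a' that(1) f00 nr(2) f']
      by (simp add: \<Theta>_def)
  qed
  have "\<exists>m. m - (0, f0) \<in> ?F 1 \<and> \<Theta> m = 0"
  proof (rule successive_approximation[OF prod])
    \<comment> \<open>The start \<open>(0, f0)\<close> has defects of level 1, since curvatures lie
      there and \<open>f0\<close> is closed on the associated graded. Starting at level 1 also keeps
      \<open>a\<close> in level 1.\<close>
    show "(0, f0) \<in> mor A X X 1 \<times> mor B ?Z ?Y 0"
      using dom.mor_zero[OF X X] cod.fil_sub_mor[OF Z Y f00] by simp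
    have 0: "0 \<in> fil A X X 1 1" using dom.fil_zero[OF X X] .
    have "mu (bc_all A) (X, 0) [] \<in> fil A X X 0 1" using t.curvature_fil[OF obt(1)[OF 0]] by simp
    moreover have "del (twist B) (fobj F (X, 0)) V 0 f0 - del B ?Z ?Y 0 f0 \<in> fil B ?Z ?Y 1 1"
      using cod.twist_del_approx[OF obt(2)[OF 0] Vt, of f0 0 0] f00 by simp
    then have "del (twist B) (fobj F (X, 0)) V 0 f0 \<in> fil B ?Z ?Y 1 1"
      using cod.fil_add[OF Z Y, of _ 1 1 "del B ?Z ?Y 0 f0"] f0C by (fastforce simp: cod.gr_Cyc_iff)
    ultimately show "\<Theta> (0, f0) \<in> ?F' 1" by (simp add: \<Theta>_def)
  next
    fix n m assume n: "1 \<le> (n::int)" and m: "m - (0, f0) \<in> ?F 1" and \<Theta>m: "\<Theta> m \<in> ?F' n"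
    obtain a f where af: "m = (a, f)" by (cases m)
    note nr = near[OF m[unfolded af]]
    let ?U = "(X, a)"
    note U = obt[OF nr(1)]
    define r where "r = mu (bc_all A) ?U []"
    define s where "s = del (twist B) (fobj F ?U) V 0 f"
    have rs: "\<Theta> m = (r, s)" by (simp add: \<Theta>_def af r_def s_def)
    have r: "r \<in> fil A X X 0 n" and s: "s \<in> fil B ?Z ?Y 1 n" using \<Theta>m unfolding rs by simp_all
    \<comment> \<open>By the Bianchi identity the first defect is closed for the twisted
      differential, hence closed modulo the next level for the untwisted one.\<close>
    have "del (twist A) ?U ?U 0 r = 0" using t.relation0[OF U(1)] by (simp add: del_def r_def)
    then have dr: "del A X X 0 r \<in> fil A X X 1 (n + 1)"
      using dom.twist_del_approx[OF U(1,1), of r 0 n] r dom.fil_uminus[OF X X] by fastforce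
    have f_mor: "f \<in> mor (twist B) (fobj F ?U) V 0" using cod.fil_sub_mor[OF Z Y nr(3)] by simp
    \<comment> \<open>The square of the differential on morphisms to \<open>V\<close> is given by
      the two curvatures. That of \<open>V\<close> vanishes and that of the source is
      \<open>F1\<close> of \<open>r\<close>, so the differential of \<open>s\<close> is minus the
      product of \<open>F1 r\<close> with \<open>f\<close>. To leading order this makes
      \<open>(r, s)\<close> a cocycle of the cone.\<close>
    have "mu (bc_all B) V [] = 0" using V cod.maurer_cartan_iff by (cases V) simp
    moreover have "mu (bc_all B) (fobj F ?U) [(0, f, V), (0, 0, V)] = 0"
      using t'.prd_zero_right[OF U(2) Vt Vt f_mor, of 0] by (simp add: prd_def)
    moreover have "mu (bc_all B) (fobj F ?U) [] = F1 ?U ?U 0 r"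
      using bc_curvature[OF U(1)] by (simp add: r_def F1_def fmor_bc_functor)
    ultimately have ds: "del (twist B) (fobj F ?U) V 1 s = - prd (twist B) (fobj F ?U) (fobj F ?U) V 0 0 (F1 ?U ?U 0 r) f"
      using t'.del_del[OF U(2) Vt f_mor] by (simp add: s_def prd_def)
    have Fr: "F1 ?U ?U 0 r \<in> fil B ?Z ?Z 0 n" using F1_fil[OF U(1,1), of r 0 n] r by simp
    have Gr: "G1 X X 0 r \<in> fil B ?Z ?Z 0 n" using G1_fil[OF X X r] .
    let ?E = "fil B ?Z ?Y 0 (n + 1)"
    have 1: "del (twist B) (fobj F ?U) V 1 s - del B ?Z ?Y 1 s \<in> ?E"
      using cod.twist_del_approx[OF U(2) Vt, of s 1 n] s by simp
    have 2: "prd (twist B) (fobj F ?U) (fobj F ?U) V 0 0 (F1 ?U ?U 0 r) f - prd B ?Z ?Z ?Y 0 0 (F1 ?U ?U 0 r) f \<in> ?E"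
      using cod.twist_prd_approx[OF U(2,2) Vt, of "F1 ?U ?U 0 r" 0 n f 0 0] Fr nr(3) by simp
    have "prd B ?Z ?Z ?Y 0 0 (F1 ?U ?U 0 r) f - prd B ?Z ?Z ?Y 0 0 (G1 X X 0 r) f0 =
        prd B ?Z ?Z ?Y 0 0 (F1 ?U ?U 0 r - G1 X X 0 r) f + prd B ?Z ?Z ?Y 0 0 (G1 X X 0 r) (f - f0)"
      using cod.prd_diff_left[OF Z Z Y cod.fil_sub_mor[OF Z Z Fr] cod.fil_sub_mor[OF Z Z Gr] cod.fil_sub_mor[OF Z Y nr(3)]]
        cod.prd_diff_right[OF Z Z Y cod.fil_sub_mor[OF Z Z Gr] cod.fil_sub_mor[OF Z Y nr(3)] cod.fil_sub_mor[OF Z Y f00]] by simp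
    also have "\<dots> \<in> ?E"
      using cod.fil_add[OF Z Y] cod.prd_fil[OF Z Z Y _ nr(3), of "F1 ?U ?U 0 r - G1 X X 0 r" 0 "n + 1" "n + 1"]
        F1_approx[OF U(1,1), of r 0 n] r cod.prd_fil[OF Z Z Y Gr nr(2), of "n + 1"] by simp
    finally have 3: "prd B ?Z ?Z ?Y 0 0 (F1 ?U ?U 0 r) f - ?\<phi> 0 r \<in> ?E" .
    have "?\<phi> 0 r + del B ?Z ?Y 1 s = - (del (twist B) (fobj F ?U) V 1 s - del B ?Z ?Y 1 s) -
        (prd (twist B) (fobj F ?U) (fobj F ?U) V 0 0 (F1 ?U ?U 0 r) f - prd B ?Z ?Z ?Y 0 0 (F1 ?U ?U 0 r) f) -
        (prd B ?Z ?Z ?Y 0 0 (F1 ?U ?U 0 r) f - ?\<phi> 0 r)" using ds by simp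
    also have "\<dots> \<in> ?E" using cod.fil_diff[OF Z Y cod.fil_diff[OF Z Y cod.fil_uminus[OF Z Y 1] 2] 3] .
    finally have "?\<phi> 0 r + del B ?Z ?Y 1 s \<in> ?E" .
    then obtain x y where xy: "x \<in> fil A X X 1 n" "y \<in> fil B ?Z ?Y 0 n" "del A X X 1 x - r \<in> fil A X X 0 (n + 1)"
      "del B ?Z ?Y 0 y - ?\<phi> 1 x - s \<in> fil B ?Z ?Y 1 (n + 1)"
      using ex[unfolded fm.cone_exact_def, rule_format, of r 1 n s] r s dr by auto
    \<comment> \<open>The correction is minus the primitive \<open>(x, y)\<close>, since the defect
      \<open>(r, s)\<close> has to be cancelled.\<close>
    let ?D = "(del A X X 1 (- x), del B ?Z ?Y 0 (- y) - ?\<phi> 1 (- x))"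
    have m': "(- x, - y) \<in> ?F n" using dom.fil_uminus[OF X X xy(1)] cod.fil_uminus[OF Z Y xy(2)] by simp
    have "del A X X 1 (- x) = - del A X X 1 x" "del B ?Z ?Y 0 (- y) = - del B ?Z ?Y 0 y" "?\<phi> 1 (- x) = - ?\<phi> 1 x"
      using fm.dC_diff[of 0 1 x] fm.dC_diff[of x 1 x] fm.dD_uminus[of y 0] fm.\<phi>_diff[of 0 1 x] fm.\<phi>_diff[of x 1 x]
        dom.fil_sub_mor[OF X X xy(1)] cod.fil_sub_mor[OF Z Y xy(2)] dom.mor_zero[OF X X] by simp_all
    then have "?D + \<Theta> m = (- (del A X X 1 x - r), - (del B ?Z ?Y 0 y - ?\<phi> 1 x - s))" unfolding rs by simp
    also have "\<dots> \<in> ?F' (n + 1)" using xy(3,4) dom.fil_uminus[OF X X] cod.fil_uminus[OF Z Y] by blast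
    finally have D: "?D + \<Theta> m \<in> ?F' (n + 1)" .
    have "\<Theta> (m + (- x, - y)) - \<Theta> m - ?D \<in> ?F' (n + 1)" using var[OF n m[unfolded af] m'] unfolding af .
    from P.add_F[OF this D] have "\<Theta> (m + (- x, - y)) \<in> ?F' (n + 1)" by (simp only: diff_add_cancel diff_diff_eq add.commute[of ?D])
    then show "\<exists>m'\<in>?F n. \<Theta> (m + m') \<in> ?F' (n + 1)" using m' by (rule bexI)
  next
    fix n m m' assume n: "1 \<le> (n::int)" and m: "m - (0, f0) \<in> ?F 1" and m': "m' \<in> ?F n"
    obtain a f a' f' where af: "m = (a, f)" "m' = (a', f')" by (cases m; cases m')
    have a': "a' \<in> fil A X X 1 n" and f': "f' \<in> fil B ?Z ?Y 0 n" using m' af by simp_all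
    have D: "(del A X X 1 a', del B ?Z ?Y 0 f' - ?\<phi> 1 a') \<in> ?F' n"
      using fm.dC_F[OF a'] fm.dD_F[OF f'] fm.\<phi>_F[OF a'] cod.fil_diff[OF Z Y] by simp
    have "\<Theta> (m + m') - \<Theta> m - (del A X X 1 a', del B ?Z ?Y 0 f' - ?\<phi> 1 a') \<in> ?F' n"
      using P.F_mono[OF var[OF n m[unfolded af] m'[unfolded af]], of n] unfolding af by simp
    from P.add_F[OF this D] show "\<Theta> (m + m') - \<Theta> m \<in> ?F' n" by (simp only: diff_add_cancel)
  qed
  then obtain a f where m: "(a, f) - (0, f0) \<in> ?F 1" "\<Theta> (a, f) = 0" by auto
  note nr = near[OF m(1)]
  have "(X, a) \<in> dom.MC" using m(2) obt(1)[OF nr(1)] dom.maurer_cartan_iff by (simp add: \<Theta>_def zero_prod_def)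
  moreover have "f \<in> cod.mc.Cyc (fobj F (X, a)) V 0"
    using m(2) cod.fil_sub_mor[OF Z Y nr(3)] by (simp add: \<Theta>_def zero_prod_def cod.mc_Cyc_iff)
  moreover have "cod.gr_iso ?Z ?Y f" using cod.gr_iso_cong[OF Z Y f0 nr(3,2)] .
  ultimately show ?thesis by blast
qed

section \<open>The categories of c-unital bounding cochains\<close>

definition bcA where "bcA = {(X, a). c_unital_maurer_cartan A X a}"
definition bcB where "bcB = {(X, a). c_unital_maurer_cartan B X a}"

lemma bc_eq: "bc A = (bc_all A)\<lparr>obj := bcA\<rparr>" "bc B = (bc_all B)\<lparr>obj := bcB\<rparr>"
  by (simp_all add: bc_def bcA_def bcB_def)

lemma bcA_iff: "U \<in> bcA \<longleftrightarrow> U \<in> dom.MC \<and> (\<exists>e. dom.mc_unit U e)"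
  using dom.c_unital_maurer_cartan_iff[OF unital(1)] by (cases U) (simp add: bcA_def)

lemma bcB_iff: "U \<in> bcB \<longleftrightarrow> U \<in> cod.MC \<and> (\<exists>e. cod.mc_unit U e)"
  using cod.c_unital_maurer_cartan_iff[OF unital(2)] by (cases U) (simp add: bcB_def)

lemma bc_MC: "bcA \<subseteq> dom.MC" "bcB \<subseteq> cod.MC"
  using bcA_iff bcB_iff by blast+

lemma fobj_bc:
  assumes "U \<in> bcA" shows "fobj F U \<in> bcB"
proof -
  obtain e where e: "U \<in> dom.MC" "dom.mc_unit U e" using assms bcA_iff by blast
  show ?thesis unfolding bcB_iff using fobj_MC[OF e(1)] mc_unit_image[OF e] by (intro conjI exI)
qed

sublocale bcF: presented_functor "graded ((bc_all A)\<lparr>obj := bcA\<rparr>)" "\<lambda>U V. mor A (fst U) (fst V)" "\<lambda>U V d. {0}" "\<lambda>U V d x. x"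
      "del (twist A)" "prd (twist A)"
    "graded ((bc_all B)\<lparr>obj := bcB\<rparr>)" "\<lambda>U V. mor B (fst U) (fst V)" "\<lambda>U V d. {0}" "\<lambda>U V d x. x"
      "del (twist B)" "prd (twist B)" F F1
  by (rule presented_functor_restrict[OF bc_MC]) (rule fobj_bc)

lemma bc_unitA:
  assumes "U \<in> bcA" obtains e where "dom.mc_unit U e" "bcF.dom.unit_cocycle U e"
proof -
  obtain e where e: "U \<in> dom.MC" "dom.mc_unit U e" using assms bcA_iff by blast
  have "bcF.dom.unit_cocycle U e"
    using dom.mc_unit_unit_cocycle[OF e] bc_MC(1) unfolding bcF.dom.unit_cocycle_def dom.mc.unit_cocycle_def
    by (simp add: subset_iff)
  with e(2) show thesis by (rule that)
qed

lemma mc_unit_cocycle_bc: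
  assumes "cod.mc.unit_cocycle U e" shows "bcF.cod.unit_cocycle U e"
  using assms bc_MC(2) unfolding bcF.cod.unit_cocycle_def cod.mc.unit_cocycle_def by (simp add: subset_iff)

lemma bc_unitB:
  assumes "U \<in> bcB" obtains e where "cod.mc_unit U e" "bcF.cod.unit_cocycle U e"
proof -
  obtain e where e: "U \<in> cod.MC" "cod.mc_unit U e" using assms bcB_iff by blast
  show thesis using that[OF e(2) mc_unit_cocycle_bc[OF cod.mc_unit_unit_cocycle[OF e]]] .
qed

text \<open>Any two units of an object are cohomologous, so \<open>e\<close> may be replaced by one
  that satisfies \<open>mc_unit\<close>, whose image is known to be a unit.\<close>

lemma F1_unit:
  assumes U: "U \<in> bcA" and e: "bcF.dom.unit_cocycle U e" shows "bcF.cod.unit_cocycle (fobj F U) (F1 U U 0 e)"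
proof -
  obtain u where u: "dom.mc_unit U u" "bcF.dom.unit_cocycle U u" using bc_unitA[OF U] .
  have U': "U \<in> dom.MC" using U bc_MC by blast
  have C: "e \<in> dom.mc.Cyc U U 0" "u \<in> dom.mc.Cyc U U 0" using e u(2) by (simp_all add: bcF.dom.unit_cocycle_def)
  have oU: "U \<in> gobj (graded ((bc_all A)\<lparr>obj := bcA\<rparr>))" using U by simp
  have "prd (twist A) U U U 0 0 e u - u \<in> dom.mc.Bdy U U 0" "prd (twist A) U U U 0 0 e u - e \<in> dom.mc.Bdy U U 0"
    using bcF.dom.unit_cocycleD(1)[OF e oU C(2)] bcF.dom.unit_cocycleD(2)[OF u(2) oU C(1)] by simp_all
  from bcF.dom.Bdy_diff[OF oU oU this] have eu: "e - u \<in> dom.mc.Bdy U U 0" by simp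
  have Fu: "bcF.cod.unit_cocycle (fobj F U) (F1 U U 0 u)"
    using mc_unit_cocycle_bc[OF cod.mc_unit_unit_cocycle[OF fobj_MC[OF U'] mc_unit_image[OF U' u(1)]]] .
  show ?thesis
  proof (rule bcF.cod.unit_cocycle_cong[OF _ Fu])
    show "fobj F U \<in> gobj (graded ((bc_all B)\<lparr>obj := bcB\<rparr>))" using fobj_bc[OF U] by simp
    show "F1 U U 0 e \<in> cod.mc.Cyc (fobj F U) (fobj F U) 0" using F1_Cyc[OF U' U' C(1)] .
    show "F1 U U 0 e - F1 U U 0 u \<in> cod.mc.Bdy (fobj F U) (fobj F U) 0"
      using bcF.\<phi>_Bdy[OF oU oU eu] bcF.\<phi>_diff[OF oU oU bcF.dom.Cyc_P[OF C(1)] bcF.dom.Cyc_P[OF C(2)]] by simp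
  qed
qed

text \<open>The unit of the image object comes from dividing \<open>f\<close> by itself and is
  reflected to \<open>(X, a)\<close>, which thereby becomes an object of \<open>bc A\<close>. With
  units at both ends \<open>f\<close> is invertible in cohomology.\<close>

lemma bc_essentially_surjective:
  assumes V: "V \<in> bcB" shows "\<exists>U\<in>bcA. isomorphic_in (coh (graded ((bc_all B)\<lparr>obj := bcB\<rparr>))) (fobj F U) V"
proof -
  have V': "V \<in> cod.MC" using V bc_MC by blast
  obtain e' where e': "cod.mc_unit V e'" using V bcB_iff by blast
  obtain X f0 where X: "X \<in> obj A" "cod.gr_iso (fobj G X) (fst V) f0"
    using Gr_essentially_surjective[OF cod.MC_fst[OF V']] by blast
  obtain a f where U: "(X, a) \<in> dom.MC" and f: "f \<in> cod.mc.Cyc (fobj F (X, a)) V 0" "cod.gr_iso (fobj G X) (fst V) f"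
    using lift_iso[OF X(1) V' X(2)] by blast
  let ?U = "(X, a)" and ?W = "fobj F (X, a)"
  have W: "?W \<in> cod.MC" using fobj_MC[OF U] .
  have iso: "cod.gr_iso (fst ?W) (fst V) f" using f(2) by simp
  obtain e where e: "cod.mc_unit ?W e" using cod.mc_unit_source[OF unital(2) W V' iso f(1)] by blast
  have UbcA: "?U \<in> bcA" using mc_unit_reflect[OF U e] U bcA_iff by blast
  obtain f' where f': "f' \<in> cod.mc.Cyc V ?W 0" "cod.mc.unit_cocycle ?W (prd (twist B) ?W V ?W 0 0 f f')"
    "cod.mc.unit_cocycle V (prd (twist B) V ?W V 0 0 f' f)"
    using cod.mc_iso[OF W V' e e' iso f(1)] by blast
  have "isomorphic_in (coh (graded ((bc_all B)\<lparr>obj := bcB\<rparr>))) ?W V"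
    using fobj_bc[OF UbcA] V f(1) f'(1) mc_unit_cocycle_bc[OF f'(2)] mc_unit_cocycle_bc[OF f'(3)]
    by (intro bcF.cod.isomorphic_inI[of ?W V f f']) simp_all
  then show ?thesis using UbcA by blast
qed

lemma bc_ainf_functor: "uncurved_ainf_functor scale (bc A) scale' (bc B) F"
  unfolding bc_eq using uncurved_functor_restrict[OF bc_MC fobj_bc] .

lemma bc_quasi_equivalence: "quasi_equivalence (graded (bc A)) (graded (bc B)) F"
proof -
  have c1: "c_unital (graded ((bc_all A)\<lparr>obj := bcA\<rparr>))"
    unfolding c_unital_def
  proof
    fix U assume "U \<in> gobj (graded ((bc_all A)\<lparr>obj := bcA\<rparr>))"
    then have U: "U \<in> bcA" by simp
    obtain e where e: "bcF.dom.unit_cocycle U e" using bc_unitA[OF U] .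
    have "is_unit_at (coh (graded ((bc_all A)\<lparr>obj := bcA\<rparr>))) U (bcF.dom.hcls U U 0 e)"
      using bcF.dom.is_unit_at_hcls[of U e] e U unfolding bcF.dom.unit_cocycle_def by simp
    then show "\<exists>E. is_unit_at (coh (graded ((bc_all A)\<lparr>obj := bcA\<rparr>))) U E" by blast
  qed
  have c2: "c_unital (graded ((bc_all B)\<lparr>obj := bcB\<rparr>))"
    unfolding c_unital_def
  proof
    fix U assume "U \<in> gobj (graded ((bc_all B)\<lparr>obj := bcB\<rparr>))"
    then have U: "U \<in> bcB" by simp
    obtain e where e: "bcF.cod.unit_cocycle U e" using bc_unitB[OF U] .
    have "is_unit_at (coh (graded ((bc_all B)\<lparr>obj := bcB\<rparr>))) U (bcF.cod.hcls U U 0 e)"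
      using bcF.cod.is_unit_at_hcls[of U e] e U unfolding bcF.cod.unit_cocycle_def by simp
    then show "\<exists>E. is_unit_at (coh (graded ((bc_all B)\<lparr>obj := bcB\<rparr>))) U E" by blast
  qed
  have f: "graded_functor (coh (graded ((bc_all A)\<lparr>obj := bcA\<rparr>))) (coh (graded ((bc_all B)\<lparr>obj := bcB\<rparr>))) (fobj F)
      (coh_functor (graded ((bc_all B)\<lparr>obj := bcB\<rparr>)) F)"
    by (rule bcF.graded_functorI) (simp add: F1_unit)
  have bij: "bij_betw (coh_functor (graded ((bc_all B)\<lparr>obj := bcB\<rparr>)) F U V d)
      (chom (coh (graded ((bc_all A)\<lparr>obj := bcA\<rparr>))) U V d) (chom (coh (graded ((bc_all B)\<lparr>obj := bcB\<rparr>))) (fobj F U) (fobj F V) d)"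
    if UV: "U \<in> bcA" "V \<in> bcA" for U V d
  proof (rule bcF.bij_coh_functorI)
    have MC: "U \<in> dom.MC" "V \<in> dom.MC" using UV bc_MC by blast+
    note o = dom.MC_fst[OF MC(1)] dom.MC_fst[OF MC(2)]
    note o' = fobj[OF o(1)] fobj[OF o(2)]
    show "U \<in> gobj (graded ((bc_all A)\<lparr>obj := bcA\<rparr>))" "V \<in> gobj (graded ((bc_all A)\<lparr>obj := bcA\<rparr>))" using UV by simp_all
    show "x \<in> dom.mc.Bdy U V d" if "x \<in> dom.mc.Cyc U V d" "F1 U V d x \<in> cod.mc.Bdy (fobj F U) (fobj F V) d" for x
      using F1_inj[OF MC that] .
    show "\<exists>x\<in>dom.mc.Cyc U V d. F1 U V d x - y \<in> cod.mc.Bdy (fobj F U) (fobj F V) d"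
      if y: "y \<in> cod.mc.Cyc (fobj F U) (fobj F V) d" for y
    proof -
      have "y \<in> mor B (fobj G (fst U)) (fobj G (fst V)) d" and dy: "del (twist B) (fobj F U) (fobj F V) d y = 0"
        using y by (simp_all add: cod.mc_Cyc_iff)
      \<comment> \<open>\<open>F1_surj\<close> works at a fixed level, which exhaustiveness
        provides.\<close>
      then obtain n where n: "y \<in> fil B (fobj G (fst U)) (fobj G (fst V)) d n"
        using complete_group.F_exhaust[OF cod.complete_group_fil[OF o']] by blast
      from F1_surj[OF MC n dy] obtain x z where x: "x \<in> fil A (fst U) (fst V) d n" "del (twist A) U V d x = 0"
        and z: "z \<in> fil B (fobj G (fst U)) (fobj G (fst V)) (d + 1) n"
          "F1 U V d x - y = del (twist B) (fobj F U) (fobj F V) (d + 1) z" by blast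
      have "x \<in> dom.mc.Cyc U V d" using x dom.fil_sub_mor[OF o] by (simp add: dom.mc_Cyc_iff)
      moreover have "F1 U V d x - y \<in> cod.mc.Bdy (fobj F U) (fobj F V) d"
        using cod.mc_Bdy_fil[OF fobj_MC[OF MC(1)] fobj_MC[OF MC(2)] _ z(2)] z(1) by simp
      ultimately show ?thesis by blast
    qed
  qed
  show ?thesis
    unfolding quasi_equivalence_def graded_equivalence_def bc_eq
    using c1 c2 f bij bc_essentially_surjective by simp
qed

end

theorem theorem2p12:
  fixes FK :: "int \<Rightarrow> 'k::comm_ring_1 set"
    and scale\<^sub>A :: "'k \<Rightarrow> 'm::ab_group_add \<Rightarrow> 'm" and A :: "('o, 'm) filt_ainf"
    and scale\<^sub>B :: "'k \<Rightarrow> 'n::ab_group_add \<Rightarrow> 'n" and B :: "('p, 'n) filt_ainf"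
    and G :: "('o, bit, 'm, 'p, 'n) ainf_functor"
  assumes "filtered_ring FK"
    and "curved_filtered_ainf_category FK scale\<^sub>A A" and "c_unital (Gr A)"
    and "curved_filtered_ainf_category FK scale\<^sub>B B" and "c_unital (Gr B)"
    and "curved_filtered_quasi_equivalence FK scale\<^sub>A A scale\<^sub>B B G"
  shows "uncurved_ainf_functor scale\<^sub>A (bc A) scale\<^sub>B (bc B) (bc_functor B G) \<and>
         quasi_equivalence (graded (bc A)) (graded (bc B)) (bc_functor B G)"
  using curved_filtered_quasi_equivalence.bc_ainf_functor[OF assms(6)]
    curved_filtered_quasi_equivalence.bc_quasi_equivalence[OF assms(6)] ..

end
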